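(* Let $\Lambda$ be a set and let $\{Y_\alpha\}_{\alpha\in\Lambda}$ be a family of time-dependent vector fields $Y_\alpha(t,x)=\sum_{i=1}^n Y^i_\alpha(t,x)\,\partial/\partial x^i$ on $\mathbb{R}^n$, with associated family of non-autonomous systems $$\frac{dx^i}{dt}=Y^i_\alpha(t,x),\qquad i=1,\ldots,n,\quad \alpha\in\Lambda. \qquad ( * )$$ The family of systems $( * )$ admits a common time-dependent superposition rule if and only if the autonomizations $\{\bar Y_\alpha\}_{\alpha\in\Lambda}$ can be written in the form $$\bar Y_\alpha(t,x)=\sum_{j=1}^r b_{\alpha j}(t)\,\bar X_j(t,x),\qquad \alpha\in\Lambda,$$ where $r$ is a (finite) positive integer, the $b_{\alpha j}$ are functions of the time only with $\sum_{j=1}^r b_{\alpha j}=1$ for every $\alpha\in\Lambda$, and $X_1,\ldots,X_r$ are time-dependent vector fields on $\mathbb{R}^n$ such that $$[\bar X_j,\bar X_k](t,x)=\sum_{l=1}^r f_{jkl}(t)\,\bar X_l(t,x),\qquad j,k=1,\ldots,r,$$ for some functions $f_{jkl}:\mathbb{R}\rightarrow\mathbb{R}$, $j,k,l=1,\ldots,r$.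
   Context: A time-dependent vector field on $\mathbb{R}^n$ is $Y(t,x)=\sum_{i=1}^n Y^i(t,x)\,\partial/\partial x^i$. Its autonomization is the vector field $\bar Y=\partial/\partial t+\sum_{i=1}^n Y^i(t,x)\,\partial/\partial x^i$ on $\mathbb{R}\times\mathbb{R}^n$. A family of systems $dx^i/dt=Y^i_\alpha(t,x)$, $\alpha\in\Lambda$, admits a common time-dependent superposition rule if, for some $m$, there exists a map $\Phi:\mathbb{R}\times\mathbb{R}^{n(m+1)}\rightarrow\mathbb{R}^n$, $x=\Phi(t,x_{(1)},\ldots,x_{(m)};k_1,\ldots,k_n)$, not depending on $\alpha$, such that the general solution $x(t)$ of any system $Y_\alpha$ of the family can be written, at least for sufficiently small $t$, as $$x(t)=\Phi(t,x_{(1)}(t),\ldots,x_{(m)}(t);k_1,\ldots,k_n),$$ with $x_{(1)}(t),\ldots,x_{(m)}(t)$ a generic set of particular solutions of $Y_\alpha$ and $k_1,\ldots,k_n$ constants associated with each particular solution. Conventions: all objects are smooth. Considerations are local: maps such as $\Phi$ are only required to be defined on open subsets of the indicated spaces, and statements are understood near generic points. For generic $(t,x_{(1)},\ldots,x_{(m)})$ the map $k\mapsto\Phi(t,x_{(1)},\ldots,x_{(m)};k)$ is regular, so that $x_{(0)}=\Phi(t,x_{(1)},\ldots,x_{(m)};k)$ can be (locally) inverted as $k=\Psi(t,x_{(0)},\ldots,x_{(m)})$. The word "generic" is not formalized further (e.g. for linear homogeneous systems, generic particular solutions are linearly independent ones). *)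

theory Defs
  imports "HOL-Analysis.Analysis"
begin

section \<open>Smooth maps and vector fields\<close>

primrec Ck_on :: "nat \<Rightarrow> 'a::real_normed_vector set \<Rightarrow> ('a \<Rightarrow> 'b::real_normed_vector) \<Rightarrow> bool" where
  "Ck_on 0 S f \<longleftrightarrow> continuous_on S f"
| "Ck_on (Suc k) S f \<longleftrightarrow> (\<forall>x\<in>S. f differentiable (at x)) \<and>
     (\<forall>v. Ck_on k S (\<lambda>x. frechet_derivative f (at x) v))"

text \<open>To be used for open \<open>S\<close> only, since the derivatives are not taken within \<open>S\<close>.\<close>

definition smooth_on :: "'a::real_normed_vector set \<Rightarrow> ('a \<Rightarrow> 'b::real_normed_vector) \<Rightarrow> bool" where
  "smooth_on S f \<longleftrightarrow> (\<forall>k. Ck_on k S f)"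

definition lie_bracket :: "('a::real_normed_vector \<Rightarrow> 'a) \<Rightarrow> ('a \<Rightarrow> 'a) \<Rightarrow> 'a \<Rightarrow> 'a" where
  "lie_bracket X Y z = frechet_derivative Y (at z) (X z) - frechet_derivative X (at z) (Y z)"

text \<open>The first component of the value is the coefficient of \<open>\<partial>/\<partial>t\<close>.\<close>

definition autonomization ::
  "(real \<Rightarrow> real ^ 'n \<Rightarrow> real ^ 'n) \<Rightarrow> real \<times> (real ^ 'n) \<Rightarrow> real \<times> (real ^ 'n)" where
  "autonomization Y = (\<lambda>(t, x). (1, Y t x))"

definition is_solution ::
  "(real \<Rightarrow> real ^ 'n \<Rightarrow> real ^ 'n) \<Rightarrow> real set \<Rightarrow> (real \<Rightarrow> real ^ 'n) \<Rightarrow> bool" where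
  "is_solution Y J x \<longleftrightarrow> open J \<and> is_interval J \<and>
     (\<forall>t\<in>J. (x has_vector_derivative Y t (x t)) (at t))"

section \<open>Generic localization\<close>

text \<open>A property of boxes \<open>I \<times> U\<close> holds near generic points if every point of some open dense
  subset of \<open>\<real> \<times> \<real>\<^sup>n\<close> lies in an open box that has the property.\<close>

definition near_generic_points ::
  "(real set \<Rightarrow> (real ^ 'n) set \<Rightarrow> bool) \<Rightarrow> bool" where
  "near_generic_points P \<longleftrightarrow>
     (\<exists>G. open G \<and> closure G = UNIV \<and>
       (\<forall>(t0, x0)\<in>G. \<exists>I U. open I \<and> is_interval I \<and> t0 \<in> I \<and> open U \<and> x0 \<in> U \<and> P I U))"

section \<open>Common superposition rules\<close>

text \<open>The number \<open>m\<close> of particular solutions is existentially quantified, so that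
  \<open>(\<real>\<^sup>n)\<^sup>m\<close> cannot be a type of the form \<open>real ^ 'n ^ 'm\<close>. Instead, \<open>(\<real>\<^sup>n)\<^sup>m\<close> is embedded
  into the normed space of bounded sequences in \<open>\<real>\<^sup>n\<close>, as the subspace of the sequences
  that vanish outside of \<open>{1..m}\<close>. Subsets of \<open>(\<real>\<^sup>n)\<^sup>m\<close> that are open, and maps that are
  smooth on them, are exactly the restrictions of such sets and maps in the ambient space
  (extend them to be independent of the other entries).\<close>

definition tup :: "nat \<Rightarrow> (nat \<Rightarrow> real ^ 'n) \<Rightarrow> (nat \<Rightarrow>\<^sub>C (real ^ 'n))" where
  "tup m x = Bcontfun (\<lambda>a. if a \<in> {1..m} then x a else 0)"

lemma apply_tup: "apply_bcontfun (tup m x) a = (if a \<in> {1..m} then x a else 0)"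
proof -
  have "finite ((\<lambda>a. if a \<in> {1..m} then x a else 0) ` UNIV)"
    by (rule finite_subset[of _ "insert 0 (x ` {1..m})"]) auto
  then have "(\<lambda>a. if a \<in> {1..m} then x a else 0) \<in> bcontfun"
    unfolding bcontfun_def by (auto intro: finite_imp_bounded)
  then show ?thesis
    unfolding tup_def by (simp add: Bcontfun_inverse)
qed

text \<open>\<open>\<Phi>\<close> on the open domain \<open>W\<close> is a common superposition rule for the solutions with
  graph near \<open>I \<times> U\<close>. The last two conditions say that, for particular solutions
  \<open>xs 1, \<dots>, xs m\<close>, the curves \<open>\<Phi> t (xs 1 t, \<dots>, xs m t) k\<close> form the general solution of
  every system of the family: each of them is a solution, and each solution passing through
  \<open>I \<times> U\<close> at time \<open>s\<close> is one of them for times close to \<open>s\<close>, provided that the particular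
  solutions are generic, i.e. their values at time \<open>s\<close> are in a fixed nonempty open set \<open>V\<close>.\<close>

definition superposition_rule_on ::
  "'a set \<Rightarrow> ('a \<Rightarrow> real \<Rightarrow> real ^ 'n \<Rightarrow> real ^ 'n) \<Rightarrow> nat \<Rightarrow> real set \<Rightarrow> (real ^ 'n) set \<Rightarrow>
   (real \<times> (nat \<Rightarrow>\<^sub>C (real ^ 'n)) \<times> (real ^ 'n)) set \<Rightarrow>
   (real \<Rightarrow> (nat \<Rightarrow>\<^sub>C (real ^ 'n)) \<Rightarrow> real ^ 'n \<Rightarrow> real ^ 'n) \<Rightarrow> bool" where
  "superposition_rule_on \<Lambda> Y m I U W \<Phi> \<longleftrightarrow>
     open W \<and> smooth_on W (\<lambda>(t, p, k). \<Phi> t p k) \<and>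
     (\<forall>(t, p, k)\<in>W. bij (frechet_derivative (\<Phi> t p) (at k))) \<and>
     (\<forall>\<alpha>\<in>\<Lambda>. \<forall>J xs k.
        is_interval J \<and> open J \<and>
        (\<forall>a\<in>{1..m}. is_solution (Y \<alpha>) J (xs a)) \<and>
        (\<forall>t\<in>J. (t, tup m (\<lambda>a. xs a t), k) \<in> W) \<longrightarrow>
        is_solution (Y \<alpha>) J (\<lambda>t. \<Phi> t (tup m (\<lambda>a. xs a t)) k)) \<and>
     (\<exists>V. open V \<and> V \<inter> range (tup m) \<noteq> {} \<and>
        (\<forall>\<alpha>\<in>\<Lambda>. \<forall>J x xs s.
           is_solution (Y \<alpha>) J x \<and> (\<forall>a\<in>{1..m}. is_solution (Y \<alpha>) J (xs a)) \<and>
           s \<in> J \<and> s \<in> I \<and> x s \<in> U \<and> tup m (\<lambda>a. xs a s) \<in> V \<longrightarrow>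
           (\<exists>k. \<forall>\<^sub>F t in nhds s.
              (t, tup m (\<lambda>a. xs a t), k) \<in> W \<and> x t = \<Phi> t (tup m (\<lambda>a. xs a t)) k)))"

definition admits_common_superposition_rule ::
  "'a set \<Rightarrow> ('a \<Rightarrow> real \<Rightarrow> real ^ 'n \<Rightarrow> real ^ 'n) \<Rightarrow> bool" where
  "admits_common_superposition_rule \<Lambda> Y \<longleftrightarrow>
     (\<exists>m. near_generic_points (\<lambda>I U. \<exists>W \<Phi>. superposition_rule_on \<Lambda> Y m I U W \<Phi>))"

end

theory Submission
  imports Defs
begin

text \<open>
  \<^bold>\<open>From the rule to the module.\<close> The prolongation of a field moves the time and all points of a
  tuple \<open>p\<close> along the field and leaves the constants \<open>k\<close> fixed. As \<open>\<Phi>\<close> maps solutions to solutions, the map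
  \<open>(t, p, k) \<mapsto> (t, \<Phi> t p k)\<close> sends the prolongation of the autonomization of every \<open>Y \<alpha>\<close> to this
  autonomization (\<open>compatible_autonomization\<close>). Fields with this property are preserved by taking
  brackets, provided that the bracket is added to one of its arguments to keep the coefficient \<open>1\<close> of
  \<open>\<partial>/\<partial>t\<close> (\<open>compatible_bracket\<close>). The derivative of the map at \<open>(t, p, k)\<close> is linear, and the prolongation
  only involves the values of a field at the points of \<open>p\<close>. So, if \<open>p\<close> is a fixed generic tuple, linear
  relations between the values at its points at the time \<open>t\<close> hold at all points \<open>\<Phi> t p k\<close>, which fill
  \<open>U\<close> (\<open>compatible_linear_relation\<close>). At a fixed time all fields generated by the autonomizations are
  therefore combinations of finitely many of them. Near a time where their rank is maximal, the
  coefficients are smooth functions of the time alone (\<open>superposition_rule_imp_module\<close>).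

  \<^bold>\<open>From the module to the rule.\<close> As the structure functions \<open>f\<close> depend on the time only, the flow of a
  field \<open>A i\<close> transports a combination \<open>\<Sum>l. \<beta> l *\<^sub>R A l\<close> to a combination whose coefficients depend on the
  times, but not on the point (\<open>flow_transports\<close>). This remains true for a composition \<open>E\<close> of flows for
  several times \<open>g\<close>, also if \<open>g\<close> varies (\<open>flow_comp_transport\<close>). With \<open>r\<close> points in a tuple \<open>p\<close>, there are
  enough coordinates to choose \<open>g = \<Gamma> (t, p)\<close> such that the transported points of \<open>p\<close> keep some of their
  coordinates, which determine a combination of the fields. Along solutions of one of the systems, all
  points \<open>E (g, t, p k)\<close> and any further point \<open>E (g, t, y)\<close> move by the same combination of the fields.
  The coordinates show that it is \<open>0\<close>. So \<open>E (\<Gamma> (t, p), t, y)\<close> is constant along solutions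
  (\<open>transport_coordinates\<close>). It is invertible in \<open>y\<close>, and the inverse is a superposition rule for \<open>r\<close>
  particular solutions (\<open>superposition_rule_near\<close>).

  Both properties are only claimed near generic points. So it suffices to find, in every nonempty open
  set, one box on which the other property holds (\<open>near_generic_pointsI\<close>). This leaves room to choose a
  time of maximal rank. Since tuples are elements of a space of infinite dimension, the calculus of
  smooth maps and the implicit function theorem are needed on normed spaces, for functions that vary in
  finitely many directions.
\<close>

section \<open>Calculus of smooth maps\<close>

lemma Ck_on_SucD:
  assumes "Ck_on (Suc k) S f"
  shows "x \<in> S \<Longrightarrow> (f has_derivative frechet_derivative f (at x)) (at x)"
    and "Ck_on k S (\<lambda>x. frechet_derivative f (at x) v)"
  using assms frechet_derivative_works by auto

lemma Ck_on_imp_continuous_on: "Ck_on k S f \<Longrightarrow> continuous_on S f"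
  by (cases k)
    (auto intro!: continuous_at_imp_continuous_on differentiable_imp_continuous_within)

lemma Ck_on_Suc_imp: "Ck_on (Suc k) S f \<Longrightarrow> Ck_on k S f"
proof (induction k arbitrary: f)
  case 0
  then show ?case by (metis Ck_on.simps(1) Ck_on_imp_continuous_on)
next
  case (Suc k)
  then show ?case by (metis Ck_on.simps(2))
qed

lemma Ck_on_subset: "Ck_on k S f \<Longrightarrow> T \<subseteq> S \<Longrightarrow> Ck_on k T f"
  by (induction k arbitrary: f) (auto intro: continuous_on_subset)

lemma Ck_on_cong:
  assumes "open S" "Ck_on k S f" "\<And>x. x \<in> S \<Longrightarrow> f x = g x"
  shows "Ck_on k S g"
  using assms(2,3)
proof (induction k arbitrary: f g)
  case 0
  then show ?case by (metis Ck_on.simps(1) continuous_on_cong)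
next
  case (Suc k)
  have d: "(g has_derivative frechet_derivative f (at x)) (at x)" if "x \<in> S" for x
    by (rule has_derivative_transform_within_open[OF Ck_on_SucD(1)[OF Suc.prems(1) that] assms(1) that Suc.prems(2)])
  have "frechet_derivative g (at x) = frechet_derivative f (at x)" if "x \<in> S" for x
    using frechet_derivative_at[OF d[OF that]] by simp
  then have "Ck_on k S (\<lambda>x. frechet_derivative g (at x) v)" for v
    using Suc.IH[of "\<lambda>x. frechet_derivative f (at x) v"] Suc.prems(1) by simp
  then show ?case using d by (auto simp: differentiable_def)
qed

lemma Ck_on_SucI:
  assumes "\<And>x. x \<in> S \<Longrightarrow> (f has_derivative f' x) (at x)"
    and "\<And>v. Ck_on k S (\<lambda>x. f' x v)"
    and "open S"
  shows "Ck_on (Suc k) S f"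
proof -
  have "frechet_derivative f (at x) = f' x" if "x \<in> S" for x
    using frechet_derivative_at[OF assms(1)[OF that]] by simp
  then have "Ck_on k S (\<lambda>x. frechet_derivative f (at x) v)" for v
    by (intro Ck_on_cong[OF assms(3,2)]) simp
  then show ?thesis using assms(1) by (auto simp: differentiable_def)
qed

lemma Ck_on_const: "Ck_on k S (\<lambda>x. c)"
  by (induction k arbitrary: c) auto

lemma Ck_on_bounded_linear:
  assumes "bounded_linear L"
  shows "Ck_on k S L"
proof (cases k)
  case (Suc j)
  have "frechet_derivative L (at x) = L" for x
    using frechet_derivative_at[OF bounded_linear_imp_has_derivative[OF assms]] by simp
  then show ?thesis using Suc bounded_linear_imp_differentiable[OF assms] by (simp add: Ck_on_const)
qed (use assms linear_continuous_on in auto)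

lemma Ck_on_linear_comp:
  assumes "bounded_linear L" "open S" "Ck_on k S f"
  shows "Ck_on k S (\<lambda>x. L (f x))"
  using assms(3)
proof (induction k arbitrary: f)
  case 0
  then show ?case
    using assms(1) by (auto intro: bounded_linear.continuous_on)
next
  case (Suc k)
  show ?case
    by (rule Ck_on_SucI[OF bounded_linear.has_derivative[OF assms(1) Ck_on_SucD(1)[OF Suc.prems]]
          Suc.IH[OF Ck_on_SucD(2)[OF Suc.prems]] assms(2)])
qed

lemma Ck_on_add:
  assumes "open S" "Ck_on k S f" "Ck_on k S g"
  shows "Ck_on k S (\<lambda>x. f x + g x)"
  using assms(2,3)
proof (induction k arbitrary: f g)
  case 0
  then show ?case by (auto intro: continuous_on_add)
next
  case (Suc k)
  show ?case
    by (rule Ck_on_SucI[OF has_derivative_add[OF Ck_on_SucD(1)[OF Suc.prems(1)] Ck_on_SucD(1)[OF Suc.prems(2)]]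
       Suc.IH[OF Ck_on_SucD(2)[OF Suc.prems(1)] Ck_on_SucD(2)[OF Suc.prems(2)]] assms(1)])
qed

lemma (in bounded_bilinear) Ck_on_prod:
  assumes "open S" "Ck_on k S f" "Ck_on k S g"
  shows "Ck_on k S (\<lambda>x. prod (f x) (g x))"
  using assms(2,3)
proof (induction k arbitrary: f g)
  case 0
  then show ?case by (auto intro: continuous_on)
next
  case (Suc k)
  show ?case
  proof (rule Ck_on_SucI[OF FDERIV[OF Ck_on_SucD(1)[OF Suc.prems(1)] Ck_on_SucD(1)[OF Suc.prems(2)]] _ assms(1)])
    fix v
    show "Ck_on k S (\<lambda>x. prod (f x) (frechet_derivative g (at x) v) + prod (frechet_derivative f (at x) v) (g x))"
      by (intro Ck_on_add assms(1) Suc.IH Ck_on_SucD(2) Suc.prems Ck_on_Suc_imp)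
  qed
qed

lemma Ck_on_sum:
  assumes "open S" "\<And>i. i \<in> F \<Longrightarrow> Ck_on k S (f i)"
  shows "Ck_on k S (\<lambda>x. \<Sum>i\<in>F. f i x)"
proof (cases "finite F")
  case True
  then show ?thesis using assms(2)
    by (induction F) (auto simp: Ck_on_const intro: Ck_on_add[OF assms(1)])
qed (simp add: Ck_on_const)

lemmas Ck_on_scaleR = bounded_bilinear.Ck_on_prod[OF bounded_bilinear_scaleR]
lemmas Ck_on_mult = bounded_bilinear.Ck_on_prod[OF bounded_bilinear_mult]

lemma Ck_on_diff:
  assumes "open S" "Ck_on k S f" "Ck_on k S g"
  shows "Ck_on k S (\<lambda>x. f x - g x)"
  using Ck_on_add[OF assms(1,2) Ck_on_linear_comp[OF bounded_linear_minus[OF bounded_linear_ident] assms(1,3)]]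
  by simp

lemma Ck_on_inverse:
  fixes f :: "'a::real_normed_vector \<Rightarrow> real"
  assumes "open S" "Ck_on k S f" "\<And>x. x \<in> S \<Longrightarrow> f x \<noteq> 0"
  shows "Ck_on k S (\<lambda>x. inverse (f x))"
  using assms(2)
proof (induction k)
  case 0
  then show ?case using assms(3) by (auto intro: continuous_on_inverse)
next
  case (Suc k)
  show ?case
  proof (rule Ck_on_SucI[OF _ _ assms(1)])
    show "((\<lambda>x. inverse (f x)) has_derivative
        (\<lambda>v. - (inverse (f x) * frechet_derivative f (at x) v * inverse (f x)))) (at x)" if "x \<in> S" for x
      by (rule Deriv.has_derivative_inverse[OF _ Ck_on_SucD(1)[OF Suc.prems]]) (use that assms(3) in auto)
    show "Ck_on k S (\<lambda>x. - (inverse (f x) * frechet_derivative f (at x) v * inverse (f x)))" for v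
      using Suc Ck_on_Suc_imp[OF Suc.prems]
      by (intro Ck_on_linear_comp[OF bounded_linear_minus[OF bounded_linear_ident]]
          Ck_on_mult assms(1) Ck_on_SucD(2)) auto
  qed
qed

text \<open>The directions in \<^const>\<open>Ck_on\<close> are fixed, but the derivative of \<open>f \<circ> h\<close> is the
  derivative of \<open>f\<close> in a direction that varies with the point. If \<open>h\<close> is the sum of a linear map and
  of a map into a space of finite dimension, this is a finite sum of derivatives of \<open>f\<close> in fixed
  directions. For such inner maps the chain rule holds also on spaces of infinite dimension; a \<open>C\<^sup>k\<close> map
  into a Euclidean space is always of this kind.\<close>

definition Ck_inner :: "nat \<Rightarrow> 'a::real_normed_vector set \<Rightarrow> ('a \<Rightarrow> 'b::real_normed_vector) \<Rightarrow> bool" where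
  "Ck_inner k S h \<longleftrightarrow> (\<exists>A (F::'b set) g. bounded_linear A \<and> finite F \<and> (\<forall>e\<in>F. Ck_on k S (g e)) \<and>
     (\<forall>x\<in>S. h x = A x + (\<Sum>e\<in>F. (g e x :: real) *\<^sub>R e)))"

lemma Ck_inner_Suc_imp: "Ck_inner (Suc k) S h \<Longrightarrow> Ck_inner k S h"
  unfolding Ck_inner_def by (elim exE conjE, intro exI conjI) (auto intro: Ck_on_Suc_imp simp del: Ck_on.simps)

lemma Ck_inner_subset: "Ck_inner k S h \<Longrightarrow> T \<subseteq> S \<Longrightarrow> Ck_inner k T h"
  unfolding Ck_inner_def by (elim exE conjE, intro exI conjI) (auto intro: Ck_on_subset)

lemma Ck_inner_imp_Ck_on:
  assumes "open S" "Ck_inner k S h"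
  shows "Ck_on k S h"
proof -
  obtain A F g where *: "bounded_linear A" "finite F" "\<forall>e\<in>F. Ck_on k S (g e)"
     "\<forall>x\<in>S. h x = A x + (\<Sum>e\<in>F. (g e x :: real) *\<^sub>R e)"
    using assms(2) unfolding Ck_inner_def by blast
  have "Ck_on k S (\<lambda>x. A x + (\<Sum>e\<in>F. (g e x :: real) *\<^sub>R e))"
    using * by (intro Ck_on_add assms(1) Ck_on_bounded_linear[OF *(1)] Ck_on_sum Ck_on_scaleR Ck_on_const) auto
  then show ?thesis by (rule Ck_on_cong[OF assms(1)]) (use * in auto)
qed

lemma Ck_on_compose:
  assumes "open S" "Ck_on k T f" "Ck_inner k S h" "\<And>x. x \<in> S \<Longrightarrow> h x \<in> T"
  shows "Ck_on k S (\<lambda>x. f (h x))"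
  using assms(2,3)
proof (induction k arbitrary: f)
  case 0
  have "continuous_on S h" using Ck_inner_imp_Ck_on[OF assms(1) 0(2)] by simp
  moreover have "continuous_on (h ` S) f" using 0 assms(4) by (auto intro: continuous_on_subset)
  ultimately show ?case using continuous_on_compose[of S h f] by (simp add: o_def)
next
  case (Suc k)
  obtain A F g where A: "bounded_linear A" and F: "finite F" and g: "\<forall>e\<in>F. Ck_on (Suc k) S (g e)"
     and h: "\<forall>x\<in>S. h x = A x + (\<Sum>e\<in>F. (g e x :: real) *\<^sub>R e)"
    using Suc.prems(2) unfolding Ck_inner_def by blast
  note inner = Ck_inner_Suc_imp[OF Suc.prems(2)]
  show ?case
  proof (rule Ck_on_SucI[OF _ _ assms(1)])
    fix x assume x: "x \<in> S"
    have "((\<lambda>x. A x + (\<Sum>e\<in>F. g e x *\<^sub>R e)) has_derivative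
        (\<lambda>v. A v + (\<Sum>e\<in>F. frechet_derivative (g e) (at x) v *\<^sub>R e))) (at x)"
      using g x by (intro has_derivative_add has_derivative_sum has_derivative_scaleR_left
          bounded_linear_imp_has_derivative A Ck_on_SucD(1)) auto
    then have hd: "(h has_derivative (\<lambda>v. A v + (\<Sum>e\<in>F. frechet_derivative (g e) (at x) v *\<^sub>R e))) (at x)"
      by (rule has_derivative_transform_within_open[OF _ assms(1) x]) (use h in auto)
    have fd: "(f has_derivative frechet_derivative f (at (h x))) (at (h x))"
      using Ck_on_SucD(1)[OF Suc.prems(1)] assms(4) x by auto
    interpret l: bounded_linear "frechet_derivative f (at (h x))"
      using fd by (rule has_derivative_bounded_linear)
    show "((\<lambda>x. f (h x)) has_derivative
       (\<lambda>v. frechet_derivative f (at (h x)) (A v) +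
          (\<Sum>e\<in>F. frechet_derivative (g e) (at x) v *\<^sub>R frechet_derivative f (at (h x)) e))) (at x)"
      using diff_chain_at[OF hd fd] by (simp add: o_def l.add l.sum l.scaleR)
  next
    fix v
    show "Ck_on k S (\<lambda>x. frechet_derivative f (at (h x)) (A v) +
          (\<Sum>e\<in>F. frechet_derivative (g e) (at x) v *\<^sub>R frechet_derivative f (at (h x)) e))"
      using Suc.prems g Ck_on_SucD(2)
      by (intro Ck_on_add assms(1) Ck_on_sum Ck_on_scaleR Suc.IH inner
           Ck_on_SucD(2)[OF Suc.prems(1)]) blast+
  qed
qed

lemma Ck_inner_linear: "bounded_linear A \<Longrightarrow> Ck_inner k S A"
  unfolding Ck_inner_def by (rule exI[of _ A], rule exI[of _ "{}"]) auto

lemma Ck_inner_scaleR: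
  assumes "Ck_on k S g"
  shows "Ck_inner k S (\<lambda>x. (g x :: real) *\<^sub>R e)"
  unfolding Ck_inner_def
  by (rule exI[of _ "\<lambda>_. 0"], rule exI[of _ "{e}"], rule exI[of _ "\<lambda>_. g"]) (use assms in auto)

lemma Ck_inner_const: "Ck_inner k S (\<lambda>x. c)"
  using Ck_inner_scaleR[OF Ck_on_const[of k S "1::real"], of c] by simp

lemma Ck_inner_add:
  assumes "open S" "Ck_inner k S h1" "Ck_inner k S h2"
  shows "Ck_inner k S (\<lambda>x. h1 x + h2 x)"
proof -
  obtain A1 F1 g1 where 1: "bounded_linear A1" "finite F1" "\<forall>e\<in>F1. Ck_on k S (g1 e)"
     "\<forall>x\<in>S. h1 x = A1 x + (\<Sum>e\<in>F1. (g1 e x :: real) *\<^sub>R e)"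
    using assms(2) unfolding Ck_inner_def by blast
  obtain A2 F2 g2 where 2: "bounded_linear A2" "finite F2" "\<forall>e\<in>F2. Ck_on k S (g2 e)"
     "\<forall>x\<in>S. h2 x = A2 x + (\<Sum>e\<in>F2. (g2 e x :: real) *\<^sub>R e)"
    using assms(3) unfolding Ck_inner_def by blast
  define g where "g e x = (if e \<in> F1 then g1 e x else 0) + (if e \<in> F2 then g2 e x else 0)" for e x
  have "(\<Sum>e\<in>F1. g1 e x *\<^sub>R e) + (\<Sum>e\<in>F2. g2 e x *\<^sub>R e) = (\<Sum>e\<in>F1 \<union> F2. g e x *\<^sub>R e)" for x
  proof -
    have "(\<Sum>e\<in>F1. g1 e x *\<^sub>R e) = (\<Sum>e\<in>F1 \<union> F2. (if e \<in> F1 then g1 e x else 0) *\<^sub>R e)"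
      using 1 2 by (intro sum.mono_neutral_cong_left) auto
    moreover have "(\<Sum>e\<in>F2. g2 e x *\<^sub>R e) = (\<Sum>e\<in>F1 \<union> F2. (if e \<in> F2 then g2 e x else 0) *\<^sub>R e)"
      using 1 2 by (intro sum.mono_neutral_cong_left) auto
    ultimately show ?thesis by (simp add: g_def scaleR_left_distrib sum.distrib)
  qed
  moreover have "Ck_on k S (g e)" for e
    unfolding g_def using 1 2
    by (cases "e \<in> F1"; cases "e \<in> F2") (auto simp: Ck_on_const intro!: Ck_on_add[OF assms(1)])
  ultimately show ?thesis unfolding Ck_inner_def
    using 1 2 bounded_linear_add[OF 1(1) 2(1)]
    by (intro exI[of _ "\<lambda>x. A1 x + A2 x"] exI[of _ "F1 \<union> F2"] exI[of _ g])
      (auto simp: algebra_simps)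
qed

lemma Ck_inner_sum:
  assumes "open S" "\<And>i. i \<in> F \<Longrightarrow> Ck_inner k S (h i)"
  shows "Ck_inner k S (\<lambda>x. \<Sum>i\<in>F. h i x)"
proof (cases "finite F")
  case True
  then show ?thesis using assms(2)
    by (induction F) (auto simp: Ck_inner_const intro: Ck_inner_add[OF assms(1)])
qed (simp add: Ck_inner_const)

lemma Ck_inner_linear_comp:
  assumes "bounded_linear L" "open S" "Ck_inner k S h"
  shows "Ck_inner k S (\<lambda>x. L (h x))"
proof -
  obtain A F g where *: "bounded_linear A" "finite F" "\<forall>e\<in>F. Ck_on k S (g e)"
     "\<forall>x\<in>S. h x = A x + (\<Sum>e\<in>F. (g e x :: real) *\<^sub>R e)"
    using assms(3) unfolding Ck_inner_def by blast
  interpret L: bounded_linear L by fact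
  have "Ck_inner k S (\<lambda>x. L (A x) + (\<Sum>e\<in>F. (g e x :: real) *\<^sub>R L e))"
    using * by (intro Ck_inner_add assms(2) Ck_inner_linear Ck_inner_sum Ck_inner_scaleR
       bounded_linear_compose[OF assms(1)]) auto
  then obtain A' F' g' where "bounded_linear A'" "finite F'" "\<forall>e\<in>F'. Ck_on k S (g' e)"
     "\<forall>x\<in>S. L (A x) + (\<Sum>e\<in>F. (g e x :: real) *\<^sub>R L e) = A' x + (\<Sum>e\<in>F'. (g' e x :: real) *\<^sub>R e)"
    unfolding Ck_inner_def by blast
  moreover have "L (h x) = L (A x) + (\<Sum>e\<in>F. (g e x :: real) *\<^sub>R L e)" if "x \<in> S" for x
    using * that by (simp add: L.add L.sum L.scaleR)
  ultimately show ?thesis unfolding Ck_inner_def by auto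
qed

lemma Ck_inner_Pair:
  assumes "open S" "Ck_inner k S h1" "Ck_inner k S h2"
  shows "Ck_inner k S (\<lambda>x. (h1 x, h2 x))"
proof -
  have "Ck_inner k S (\<lambda>x. (h1 x, 0) + (0, h2 x))"
    by (intro Ck_inner_add assms(1) Ck_inner_linear_comp[OF _ assms(1) assms(2)]
        Ck_inner_linear_comp[OF _ assms(1) assms(3)] bounded_linear_Pair
        bounded_linear_zero bounded_linear_ident)
  then show ?thesis by simp
qed

lemma Ck_inner_euclidean:
  fixes h :: "'a::real_normed_vector \<Rightarrow> 'b::euclidean_space"
  assumes "open S" "Ck_on k S h"
  shows "Ck_inner k S h"
  unfolding Ck_inner_def
  by (rule exI[of _ "\<lambda>_. 0"], rule exI[of _ Basis], rule exI[of _ "\<lambda>e x. h x \<bullet> e"])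
    (use Ck_on_linear_comp[OF bounded_linear_inner_left assms] in \<open>auto simp: euclidean_representation\<close>)

lemma Ck_inner_compose:
  assumes "open S" "Ck_inner k T f" "Ck_inner k S h" "\<And>x. x \<in> S \<Longrightarrow> h x \<in> T"
  shows "Ck_inner k S (\<lambda>x. f (h x))"
proof -
  obtain A F g where *: "bounded_linear A" "finite F" "\<forall>e\<in>F. Ck_on k T (g e)"
     "\<forall>x\<in>T. f x = A x + (\<Sum>e\<in>F. (g e x :: real) *\<^sub>R e)"
    using assms(2) unfolding Ck_inner_def by blast
  have "Ck_inner k S (\<lambda>x. (g e (h x) :: real) *\<^sub>R e)" if "e \<in> F" for e
    using Ck_inner_scaleR[OF Ck_on_compose[OF assms(1) _ assms(3,4)]] * that by blast
  then have "Ck_inner k S (\<lambda>x. A (h x) + (\<Sum>e\<in>F. (g e (h x) :: real) *\<^sub>R e))"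
    by (rule Ck_inner_add[OF assms(1) Ck_inner_linear_comp[OF *(1) assms(1,3)] Ck_inner_sum[OF assms(1)]])
  then show ?thesis unfolding Ck_inner_def using *(4) assms(4) by auto
qed

definition smooth_inner :: "'a::real_normed_vector set \<Rightarrow> ('a \<Rightarrow> 'b::real_normed_vector) \<Rightarrow> bool" where
  "smooth_inner S h \<longleftrightarrow> (\<forall>k. Ck_inner k S h)"

lemma smooth_on_has_derivative:
  "smooth_on S f \<Longrightarrow> x \<in> S \<Longrightarrow> (f has_derivative frechet_derivative f (at x)) (at x)"
  unfolding smooth_on_def using Ck_on_SucD(1) by blast

lemma smooth_on_frechet_derivative:
  "smooth_on S f \<Longrightarrow> smooth_on S (\<lambda>x. frechet_derivative f (at x) v)"
  unfolding smooth_on_def using Ck_on_SucD(2) by blast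

lemma smooth_on_subset: "smooth_on S f \<Longrightarrow> T \<subseteq> S \<Longrightarrow> smooth_on T f"
  unfolding smooth_on_def using Ck_on_subset by blast

lemma smooth_on_continuous_on: "smooth_on S f \<Longrightarrow> continuous_on S f"
  unfolding smooth_on_def using Ck_on.simps(1) by blast

lemma smooth_on_cong:
  "open S \<Longrightarrow> smooth_on S f \<Longrightarrow> (\<And>x. x \<in> S \<Longrightarrow> f x = g x) \<Longrightarrow> smooth_on S g"
  unfolding smooth_on_def using Ck_on_cong by blast

lemma smooth_on_const: "smooth_on S (\<lambda>x. c)"
  by (simp add: smooth_on_def Ck_on_const)

lemma smooth_on_linear_comp:
  "bounded_linear L \<Longrightarrow> open S \<Longrightarrow> smooth_on S f \<Longrightarrow> smooth_on S (\<lambda>x. L (f x))"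
  by (simp add: smooth_on_def Ck_on_linear_comp)

lemma smooth_on_add: "open S \<Longrightarrow> smooth_on S f \<Longrightarrow> smooth_on S g \<Longrightarrow> smooth_on S (\<lambda>x. f x + g x)"
  by (simp add: smooth_on_def Ck_on_add)

lemma smooth_on_diff: "open S \<Longrightarrow> smooth_on S f \<Longrightarrow> smooth_on S g \<Longrightarrow> smooth_on S (\<lambda>x. f x - g x)"
  by (simp add: smooth_on_def Ck_on_diff)

lemma smooth_on_sum:
  "open S \<Longrightarrow> (\<And>i. i \<in> F \<Longrightarrow> smooth_on S (f i)) \<Longrightarrow> smooth_on S (\<lambda>x. \<Sum>i\<in>F. f i x)"
  by (simp add: smooth_on_def Ck_on_sum)

lemma smooth_on_scaleR:
  "open S \<Longrightarrow> smooth_on S f \<Longrightarrow> smooth_on S g \<Longrightarrow> smooth_on S (\<lambda>x. f x *\<^sub>R g x)"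
  by (simp add: smooth_on_def Ck_on_scaleR)

lemma smooth_on_Pair:
  assumes "open S" "smooth_on S f" "smooth_on S g"
  shows "smooth_on S (\<lambda>x. (f x, g x))"
proof -
  have "smooth_on S (\<lambda>x. (f x, 0) + (0, g x))"
    by (intro smooth_on_add assms(1)
        smooth_on_linear_comp[OF bounded_linear_Pair[OF bounded_linear_ident bounded_linear_zero] assms(1,2)]
        smooth_on_linear_comp[OF bounded_linear_Pair[OF bounded_linear_zero bounded_linear_ident] assms(1,3)])
  then show ?thesis by simp
qed

lemma smooth_on_mult:
  fixes f g :: "'a::real_normed_vector \<Rightarrow> real"
  shows "open S \<Longrightarrow> smooth_on S f \<Longrightarrow> smooth_on S g \<Longrightarrow> smooth_on S (\<lambda>x. f x * g x)"
  by (simp add: smooth_on_def Ck_on_mult)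

lemma smooth_on_compose:
  assumes "open S" "smooth_on T f" "smooth_inner S h" "\<And>x. x \<in> S \<Longrightarrow> h x \<in> T"
  shows "smooth_on S (\<lambda>x. f (h x))"
  unfolding smooth_on_def
proof
  show "Ck_on k S (\<lambda>x. f (h x))" for k
    by (rule Ck_on_compose[OF assms(1) _ _ assms(4)]) (use assms in \<open>auto simp: smooth_on_def smooth_inner_def\<close>)
qed

lemma smooth_inner_subset: "smooth_inner S f \<Longrightarrow> T \<subseteq> S \<Longrightarrow> smooth_inner T f"
  unfolding smooth_inner_def using Ck_inner_subset by blast

lemma smooth_inner_imp_smooth_on: "open S \<Longrightarrow> smooth_inner S h \<Longrightarrow> smooth_on S h"
  by (simp add: smooth_on_def smooth_inner_def Ck_inner_imp_Ck_on)

lemma smooth_inner_linear: "bounded_linear A \<Longrightarrow> smooth_inner S A"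
  by (simp add: smooth_inner_def Ck_inner_linear)

lemma smooth_inner_const: "smooth_inner S (\<lambda>x. c)"
  by (simp add: smooth_inner_def Ck_inner_const)

lemma smooth_inner_scaleR: "smooth_on S g \<Longrightarrow> smooth_inner S (\<lambda>x. (g x :: real) *\<^sub>R e)"
  by (simp add: smooth_inner_def smooth_on_def Ck_inner_scaleR)

lemma smooth_inner_add:
  "open S \<Longrightarrow> smooth_inner S f \<Longrightarrow> smooth_inner S g \<Longrightarrow> smooth_inner S (\<lambda>x. f x + g x)"
  by (simp add: smooth_inner_def Ck_inner_add)

lemma smooth_inner_sum:
  "open S \<Longrightarrow> (\<And>i. i \<in> F \<Longrightarrow> smooth_inner S (f i)) \<Longrightarrow> smooth_inner S (\<lambda>x. \<Sum>i\<in>F. f i x)"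
  by (simp add: smooth_inner_def Ck_inner_sum)

lemma smooth_inner_Pair:
  "open S \<Longrightarrow> smooth_inner S f \<Longrightarrow> smooth_inner S g \<Longrightarrow> smooth_inner S (\<lambda>x. (f x, g x))"
  by (simp add: smooth_inner_def Ck_inner_Pair)

lemma smooth_inner_euclidean:
  fixes h :: "'a::real_normed_vector \<Rightarrow> 'b::euclidean_space"
  shows "open S \<Longrightarrow> smooth_on S h \<Longrightarrow> smooth_inner S h"
  by (simp add: smooth_inner_def smooth_on_def Ck_inner_euclidean)

section \<open>Symmetry of second derivatives\<close>

text \<open>For fixed \<open>v\<close>, the mean value inequality is applied to the first difference along \<open>s *\<^sub>R v\<close>, as a
  function of the multiple of \<open>u\<close>. Only derivatives in the direction \<open>u\<close> are differentiated again.\<close>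

lemma second_difference_bound:
  fixes f :: "'a::real_normed_vector \<Rightarrow> 'b::real_normed_vector"
  assumes S: "open S" "x \<in> S" and f: "\<And>z. z \<in> S \<Longrightarrow> (f has_derivative f' z) (at z)"
    and D: "((\<lambda>z. f' z u) has_derivative D) (at x)" and e: "e > 0"
  shows "\<forall>\<^sub>F s in at_right 0.
    norm (f (x + s *\<^sub>R u + s *\<^sub>R v) - f (x + s *\<^sub>R u) - (f (x + s *\<^sub>R v) - f x) - (s * s) *\<^sub>R D v) \<le> e * (s * s)"
proof -
  define K where "K = norm u + norm v + 1"
  have K: "K > 0" "norm u + norm v \<le> K" "norm u \<le> K"
    using norm_ge_zero[of u] norm_ge_zero[of v] unfolding K_def by linarith+
  interpret D: bounded_linear D using D by (rule has_derivative_bounded_linear)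
  obtain d1 where d1: "d1 > 0" "ball x d1 \<subseteq> S" using S openE by blast
  obtain d2 where d2: "d2 > 0"
    "\<And>y. norm (y - x) < d2 \<Longrightarrow> norm (f' y u - f' x u - D (y - x)) \<le> e / (2 * K) * norm (y - x)"
    using D e K unfolding has_derivative_at_alt by (auto dest!: spec[of _ "e / (2 * K)"])
  have "\<forall>\<^sub>F s in at_right 0. 0 < s \<and> s < min d1 d2 / K"
    using eventually_at_right_real[of 0 "min d1 d2 / K"] d1(1) d2(1) K by simp
  then show ?thesis
  proof eventually_elim
    case (elim s)
    then have s: "s > 0" "s * K < d1" "s * K < d2"
      using K by (auto simp: field_simps min_def split: if_splits)
    have small: "norm ((t *\<^sub>R u + r *\<^sub>R v)) \<le> s * K" if "t \<in> {0..s}" "r \<in> {0, s}" for t r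
    proof -
      have "norm (t *\<^sub>R u + r *\<^sub>R v) \<le> t * norm u + r * norm v"
        using that s by (intro norm_triangle_le) auto
      also have "\<dots> \<le> s * norm u + s * norm v" using that s by (intro add_mono mult_right_mono) auto
      also have "\<dots> \<le> s * K" using K s by (simp add: distrib_left[symmetric] mult_left_mono)
      finally show ?thesis .
    qed
    define g where "g t = f (x + t *\<^sub>R u + s *\<^sub>R v) - f (x + t *\<^sub>R u) - (t * s) *\<^sub>R D v" for t
    define g' where "g' t = (\<lambda>r::real. r *\<^sub>R (f' (x + t *\<^sub>R u + s *\<^sub>R v) u - f' (x + t *\<^sub>R u) u - s *\<^sub>R D v))" for t
    have inS: "x + t *\<^sub>R u + r *\<^sub>R v \<in> S" if "t \<in> {0..s}" "r \<in> {0, s}" for t r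
    proof -
      have "x + t *\<^sub>R u + r *\<^sub>R v \<in> ball x d1"
        using small[OF that] s norm_minus_cancel[of "t *\<^sub>R u + r *\<^sub>R v"]
        by (simp add: dist_norm diff_diff_add[symmetric] add.assoc)
      then show ?thesis using d1 by auto
    qed
    have der: "(g has_derivative g' t) (at t within {0..s})" if t: "t \<in> {0..s}" for t
    proof -
      have 1: "((\<lambda>t. f (x + t *\<^sub>R u + r *\<^sub>R v)) has_derivative (\<lambda>h. f' (x + t *\<^sub>R u + r *\<^sub>R v) (h *\<^sub>R u))) (at t within {0..s})"
        if "r \<in> {0,s}" for r
      proof (rule has_derivative_compose[of "\<lambda>t. x + t *\<^sub>R u + r *\<^sub>R v" "\<lambda>h. h *\<^sub>R u"])
        show "((\<lambda>t. x + t *\<^sub>R u + r *\<^sub>R v) has_derivative (\<lambda>h. h *\<^sub>R u)) (at t within {0..s})"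
          by (auto intro!: derivative_eq_intros)
      qed (use f inS[OF t that] in auto)
      have lin: "f' z (h *\<^sub>R u) = h *\<^sub>R f' z u" if "z \<in> S" for z h
        using f[OF that] has_derivative_bounded_linear bounded_linear.linear linear_scale by blast
      show ?thesis unfolding g_def g'_def
        by (rule derivative_eq_intros 1[of s] 1[of 0, simplified] refl | simp)+
          (use inS[OF t, of s] inS[OF t, of 0] in \<open>auto simp: lin fun_eq_iff algebra_simps\<close>)
    qed
    have bd: "onorm (g' t) \<le> e * s" if t: "t \<in> {0..s}" for t
    proof -
      define a where "a = t *\<^sub>R u + s *\<^sub>R v"
      define b where "b = t *\<^sub>R u"
      have na: "norm a \<le> s * K" "norm b \<le> s * K" using small[OF t, of s] small[OF t, of 0] by (auto simp: a_def b_def)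
      have "norm (f' (x + a) u - f' x u - D a) \<le> e / (2 * K) * norm a"
        "norm (f' (x + b) u - f' x u - D b) \<le> e / (2 * K) * norm b"
        using d2(2)[of "x + a"] d2(2)[of "x + b"] na s by auto
      then have "norm (f' (x + a) u - f' x u - D a) \<le> e / (2 * K) * (s * K)"
        "norm (f' (x + b) u - f' x u - D b) \<le> e / (2 * K) * (s * K)"
        using na e K by (meson divide_nonneg_nonneg less_imp_le mult_left_mono mult_nonneg_nonneg order_trans zero_le_numeral)+
      moreover have "e / (2 * K) * (s * K) = e * s / 2" using K by simp
      ultimately have "norm ((f' (x + a) u - f' x u - D a) - (f' (x + b) u - f' x u - D b)) \<le> e * s"
        using norm_triangle_ineq4[of "f' (x + a) u - f' x u - D a" "f' (x + b) u - f' x u - D b"] by simp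
      moreover have "(f' (x + a) u - f' x u - D a) - (f' (x + b) u - f' x u - D b) =
        f' (x + t *\<^sub>R u + s *\<^sub>R v) u - f' (x + t *\<^sub>R u) u - s *\<^sub>R D v"
        by (simp add: a_def b_def D.add D.scaleR algebra_simps)
      ultimately show ?thesis unfolding g'_def
        by (intro onorm_bound) (use e s in \<open>auto simp: mult.commute mult_left_mono\<close>)
    qed
    have "norm (g s - g 0) \<le> e * s * norm (s - 0)"
      by (rule differentiable_bound[of "{0..s}" g g']) (use der bd s in auto)
    then show ?case using s by (simp add: g_def algebra_simps)
  qed
qed

text \<open>The second difference along two directions is symmetric in them, and its leading term is
  either one of the two mixed second derivatives.\<close>

lemma second_derivative_symmetric:
  fixes f :: "'a::real_normed_vector \<Rightarrow> 'b::real_normed_vector"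
  assumes S: "open S" "x \<in> S" and f: "\<And>z. z \<in> S \<Longrightarrow> (f has_derivative f' z) (at z)"
    and D: "((\<lambda>z. f' z u) has_derivative Du) (at x)"
    and E: "((\<lambda>z. f' z v) has_derivative Dv) (at x)"
  shows "Du v = Dv u"
proof (rule ccontr)
  assume ne: "Du v \<noteq> Dv u"
  define e where "e = norm (Du v - Dv u) / 4"
  have e: "e > 0" using ne by (simp add: e_def)
  have b1: "\<forall>\<^sub>F s in at_right 0.
      norm (f (x + s *\<^sub>R u + s *\<^sub>R v) - f (x + s *\<^sub>R u) - (f (x + s *\<^sub>R v) - f x) - (s * s) *\<^sub>R Du v) \<le> e * (s * s)"
    by (rule second_difference_bound[where f' = f', OF S _ D e]) (rule f)
  have b2: "\<forall>\<^sub>F s in at_right 0.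
      norm (f (x + s *\<^sub>R v + s *\<^sub>R u) - f (x + s *\<^sub>R v) - (f (x + s *\<^sub>R u) - f x) - (s * s) *\<^sub>R Dv u) \<le> e * (s * s)"
    by (rule second_difference_bound[where f' = f', OF S _ E e]) (rule f)
  have "\<forall>\<^sub>F s in at_right (0::real). 0 < s" by (simp add: eventually_at_right_less)
  then have "\<forall>\<^sub>F s in at_right (0::real). False"
    using b1 b2
  proof eventually_elim
    case (elim s)
    let ?X = "f (x + s *\<^sub>R u + s *\<^sub>R v) - f (x + s *\<^sub>R u) - (f (x + s *\<^sub>R v) - f x)"
    have eq: "f (x + s *\<^sub>R v + s *\<^sub>R u) - f (x + s *\<^sub>R v) - (f (x + s *\<^sub>R u) - f x) = ?X"
      by (simp add: algebra_simps)
    have "norm (?X - (s * s) *\<^sub>R Dv u) \<le> e * (s * s)" using elim(3) unfolding eq .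
    then have "norm ((?X - (s * s) *\<^sub>R Dv u) - (?X - (s * s) *\<^sub>R Du v)) \<le> 2 * e * (s * s)"
      using elim(2) norm_triangle_ineq4[of "?X - (s * s) *\<^sub>R Dv u" "?X - (s * s) *\<^sub>R Du v"] by simp
    then have "norm ((s * s) *\<^sub>R (Du v - Dv u)) \<le> 2 * e * (s * s)" by (simp add: algebra_simps)
    then have "4 * e * (s * s) \<le> 2 * e * (s * s)" by (simp add: e_def mult.commute)
    then show False using e elim(1) by simp
  qed
  then show False by simp
qed

lemma smooth_on_symmetric:
  assumes "open S" "smooth_on S f" "x \<in> S"
  shows "frechet_derivative (\<lambda>z. frechet_derivative f (at z) u) (at x) v =
    frechet_derivative (\<lambda>z. frechet_derivative f (at z) v) (at x) u"
  using assms
  by (intro second_derivative_symmetric[of S x f "\<lambda>z. frechet_derivative f (at z)"])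
    (auto intro: smooth_on_has_derivative smooth_on_frechet_derivative)

section \<open>Finitely supported sequences\<close>

definition fin_seq :: "nat set \<Rightarrow> (nat \<Rightarrow> 'b::real_normed_vector) \<Rightarrow> (nat \<Rightarrow>\<^sub>C 'b)" where
  "fin_seq A x = Bcontfun (\<lambda>a. if a \<in> A then x a else 0)"

abbreviation sgl :: "nat \<Rightarrow> 'b::real_normed_vector \<Rightarrow> (nat \<Rightarrow>\<^sub>C 'b)" where
  "sgl a v \<equiv> fin_seq {a} (\<lambda>_. v)"

lemma apply_fin_seq:
  assumes "finite A"
  shows "apply_bcontfun (fin_seq A x) a = (if a \<in> A then x a else 0)"
proof -
  have "finite ((\<lambda>a. if a \<in> A then x a else 0) ` UNIV)"
    by (rule finite_subset[of _ "insert 0 (x ` A)"]) (use assms in auto)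
  then have "(\<lambda>a. if a \<in> A then x a else 0) \<in> bcontfun"
    unfolding bcontfun_def by (auto intro: finite_imp_bounded)
  then show ?thesis unfolding fin_seq_def by (simp add: Bcontfun_inverse)
qed

lemma tup_eq_fin_seq: "tup m x = fin_seq {1..m} x"
  by (simp add: tup_def fin_seq_def)

lemma bounded_linear_apply_bcontfun: "bounded_linear (\<lambda>p::'a::topological_space \<Rightarrow>\<^sub>C 'b::real_normed_vector. apply_bcontfun p a)"
  by (rule bounded_linear_intro[where K = 1]) (auto simp: norm_bounded)

lemma apply_bcontfun_sum: "apply_bcontfun (\<Sum>i\<in>I. p i) a = (\<Sum>i\<in>I. apply_bcontfun (p i) a)"
  using linear_sum[OF bounded_linear.linear[OF bounded_linear_apply_bcontfun]] .

lemma fin_seq_eq_sum: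
  assumes "finite A"
  shows "fin_seq A x = (\<Sum>a\<in>A. sgl a (x a))"
  by (rule bcontfun_eqI) (use assms in \<open>simp add: apply_bcontfun_sum apply_fin_seq\<close>)

lemma norm_fin_seq_le:
  assumes "finite A" "\<And>a. a \<in> A \<Longrightarrow> norm (x a) \<le> b" "0 \<le> b"
  shows "norm (fin_seq A x) \<le> b"
  by (rule norm_bound) (use assms in \<open>auto simp: apply_fin_seq\<close>)

lemma bounded_linear_sgl: "bounded_linear (sgl a)"
  by (rule bounded_linear_intro[where K = 1])
    (auto simp: apply_fin_seq norm_fin_seq_le intro!: bcontfun_eqI)

section \<open>Implicit functions\<close>

text \<open>Along the lines \<open>s \<mapsto> z + s *\<^sub>R e\<close> the function \<open>F\<close> is strictly increasing near \<open>z0\<close>, so that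
  \<open>F (z + s *\<^sub>R e) = c\<close> has one small solution \<open>s = \<sigma> (z, c)\<close>. With the value \<open>c\<close> as a further variable,
  \<open>(z, c) \<mapsto> (z, \<sigma> (z, c))\<close> is an inverse map, which is differentiable by the rule for inverses.\<close>

lemma implicit_function:
  fixes F :: "'a::real_normed_vector \<Rightarrow> real"
  assumes S: "open S" "z0 \<in> S" and F: "smooth_on S F" and e: "frechet_derivative F (at z0) e = 1"
  obtains N \<gamma> where "open N" "z0 \<in> N" "smooth_on N \<gamma>" "\<gamma> z0 = (0::real)"
    "\<And>z. z \<in> N \<Longrightarrow> z + \<gamma> z *\<^sub>R e \<in> S \<and> F (z + \<gamma> z *\<^sub>R e) = F z0"
proof -
  define D where "D z = frechet_derivative F (at z) e" for z
  have D: "smooth_on S D" unfolding D_def by (rule smooth_on_frechet_derivative[OF F])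
  have "isCont D z0" using smooth_on_continuous_on[OF D] S continuous_on_eq_continuous_at by blast
  then have "(D \<longlongrightarrow> D z0) (nhds z0)" by (simp add: isCont_def tendsto_at_iff_tendsto_nhds)
  then have "\<forall>\<^sub>F z in nhds z0. D z > 1/2"
    by (rule order_tendstoD(1)) (simp add: D_def e)
  then have "\<forall>\<^sub>F z in nhds z0. D z > 1/2 \<and> z \<in> S"
    using eventually_nhds_in_open[OF S] by eventually_elim simp
  then obtain \<rho> where \<rho>: "\<rho> > 0" "\<And>z. dist z z0 < \<rho> \<Longrightarrow> D z > 1/2" "\<And>z. dist z z0 < \<rho> \<Longrightarrow> z \<in> S"
    unfolding eventually_nhds_metric by blast
  define \<delta> where "\<delta> = \<rho> / (2 * (norm e + 1))"
  have ne: "norm e + 1 > 0" using norm_ge_zero[of e] by linarith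
  have \<delta>: "\<delta> > 0" "\<delta> * norm e < \<rho> / 2"
  proof -
    show "\<delta> > 0" unfolding \<delta>_def using \<rho>(1) ne by (intro divide_pos_pos) auto
    have "\<delta> * norm e < \<delta> * (norm e + 1)" using \<open>\<delta> > 0\<close> by simp
    also have "\<dots> = \<rho> / 2" using ne by (simp add: \<delta>_def field_simps)
    finally show "\<delta> * norm e < \<rho> / 2" .
  qed
  have near: "dist (z + s *\<^sub>R e) z0 < \<rho>" if "dist z z0 < \<rho>/2" "\<bar>s\<bar> \<le> \<delta>" for z s
  proof -
    have "dist (z + s *\<^sub>R e) z0 \<le> dist z z0 + \<bar>s\<bar> * norm e"
      using norm_triangle_ineq[of "z - z0" "s *\<^sub>R e"] by (simp add: dist_norm algebra_simps)
    also have "\<bar>s\<bar> * norm e \<le> \<delta> * norm e" using that by (intro mult_right_mono) auto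
    finally show ?thesis using that \<delta> by linarith
  qed
  have incr: "F (z + s' *\<^sub>R e) - F (z + s *\<^sub>R e) \<ge> (s' - s) / 2"
    if "dist z z0 < \<rho>/2" "\<bar>s\<bar> \<le> \<delta>" "\<bar>s'\<bar> \<le> \<delta>" "s \<le> s'" for z s s'
  proof (cases "s = s'")
    case False
    then have "s < s'" using that by simp
    moreover have "((\<lambda>s. F (z + s *\<^sub>R e)) has_real_derivative D (z + t *\<^sub>R e)) (at t)" if "s \<le> t" "t \<le> s'" for t
    proof -
      have "dist (z + t *\<^sub>R e) z0 < \<rho>" using near \<open>dist z z0 < \<rho>/2\<close> \<open>\<bar>s\<bar> \<le> \<delta>\<close> \<open>\<bar>s'\<bar> \<le> \<delta>\<close> that by auto
      then have d: "(F has_derivative frechet_derivative F (at (z + t *\<^sub>R e))) (at (z + t *\<^sub>R e))"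
        using \<rho>(3) smooth_on_has_derivative[OF F] by blast
      have "((\<lambda>s. z + s *\<^sub>R e) has_derivative (\<lambda>h. h *\<^sub>R e)) (at t)" by (auto intro!: derivative_eq_intros)
      from diff_chain_at[OF this d]
      show ?thesis unfolding has_field_derivative_def
        using linear_scale[OF bounded_linear.linear[OF has_derivative_bounded_linear[OF d]]]
        by (auto simp: o_def D_def fun_eq_iff mult.commute elim!: has_derivative_eq_rhs)
    qed
    ultimately obtain t where t: "s < t" "t < s'" "F (z + s' *\<^sub>R e) - F (z + s *\<^sub>R e) = (s' - s) * D (z + t *\<^sub>R e)"
      using MVT2[of s s' "\<lambda>s. F (z + s *\<^sub>R e)" "\<lambda>t. D (z + t *\<^sub>R e)"] by blast
    have "D (z + t *\<^sub>R e) > 1/2" using near[OF that(1), of t] \<rho>(2) t that by auto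
    then show ?thesis using t \<open>s < s'\<close> by (simp add: mult_left_mono less_imp_le)
  qed simp
  have lip: "\<bar>s' - s\<bar> \<le> 2 * \<bar>F (z + s' *\<^sub>R e) - F (z + s *\<^sub>R e)\<bar>"
    if "dist z z0 < \<rho>/2" "\<bar>s\<bar> \<le> \<delta>" "\<bar>s'\<bar> \<le> \<delta>" for z s s'
  proof (cases "s \<le> s'")
    case True
    then have "(s' - s) / 2 \<le> \<bar>F (z + s' *\<^sub>R e) - F (z + s *\<^sub>R e)\<bar>"
      using incr[OF that True] by linarith
    then show ?thesis using True by simp
  next
    case False
    then have "(s - s') / 2 \<le> \<bar>F (z + s' *\<^sub>R e) - F (z + s *\<^sub>R e)\<bar>"
      using incr[OF that(1,3,2)] by linarith
    then show ?thesis using False by simp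
  qed
  define M where "M = {(z, c). dist z z0 < \<rho>/2 \<and> \<bar>c - F z\<bar> < \<delta> / 2}"
  have contF: "continuous_on (ball z0 \<rho>) F"
    by (rule continuous_on_subset[OF smooth_on_continuous_on[OF F]]) (auto simp: dist_commute intro: \<rho>(3))
  have openM: "open M"
  proof -
    have "continuous_on (ball z0 (\<rho>/2) \<times> (UNIV::real set)) (\<lambda>zc. \<bar>snd zc - F (fst zc)\<bar>)"
      by (intro continuous_intros continuous_on_compose2[OF contF]) (use \<rho>(1) in auto)
    then have "open (ball z0 (\<rho>/2) \<times> (UNIV::real set) \<inter> (\<lambda>zc. \<bar>snd zc - F (fst zc)\<bar>) -` {..<\<delta> / 2})"
      by (rule continuous_open_preimage) (auto intro: open_Times)
    moreover have "M = ball z0 (\<rho>/2) \<times> (UNIV::real set) \<inter> (\<lambda>zc. \<bar>snd zc - F (fst zc)\<bar>) -` {..<\<delta> / 2}"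
      by (auto simp: M_def dist_commute)
    ultimately show ?thesis by simp
  qed
  have ex: "\<exists>s. \<bar>s\<bar> < \<delta> \<and> F (z + s *\<^sub>R e) = c" if "(z, c) \<in> M" for z c
  proof -
    have z: "dist z z0 < \<rho>/2" "\<bar>c - F z\<bar> < \<delta> / 2" using that by (auto simp: M_def)
    have "F (z + \<delta> *\<^sub>R e) - F z \<ge> \<delta> / 2" "F z - F (z + (-\<delta>) *\<^sub>R e) \<ge> \<delta> / 2"
      using incr[OF z(1), of 0 \<delta>] incr[OF z(1), of "-\<delta>" 0] \<delta> by auto
    then have c: "F (z + (-\<delta>) *\<^sub>R e) < c" "c < F (z + \<delta> *\<^sub>R e)" using z(2) by linarith+
    have "continuous_on {-\<delta>..\<delta>} (\<lambda>s. F (z + s *\<^sub>R e))"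
      by (rule continuous_on_compose2[OF contF]) (use near[OF z(1)] in \<open>auto intro!: continuous_intros simp: dist_commute\<close>)
    then obtain s where s: "-\<delta> \<le> s" "s \<le> \<delta>" "F (z + s *\<^sub>R e) = c"
      using IVT'[of "\<lambda>s. F (z + s *\<^sub>R e)" "-\<delta>" c \<delta>] c \<delta> by auto
    then have "s \<noteq> \<delta>" "s \<noteq> -\<delta>" using c by auto
    then show ?thesis using s by (intro exI[of _ s]) auto
  qed
  define \<sigma> where "\<sigma> zc = (SOME s. \<bar>s\<bar> < \<delta> \<and> F (fst zc + s *\<^sub>R e) = snd zc)" for zc
  have \<sigma>: "\<bar>\<sigma> (z, c)\<bar> < \<delta>" "F (z + \<sigma> (z, c) *\<^sub>R e) = c" if "(z, c) \<in> M" for z c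
    using someI_ex[OF ex[OF that]] by (auto simp: \<sigma>_def)
  have inS: "z + \<sigma> (z, c) *\<^sub>R e \<in> S" "D (z + \<sigma> (z, c) *\<^sub>R e) > 1/2" if "(z, c) \<in> M" for z c
    using near[of z "\<sigma> (z, c)"] \<sigma>[OF that] that \<rho> by (auto simp: M_def)
  have cont\<sigma>: "isCont \<sigma> (z, c)" if zc: "(z, c) \<in> M" for z c
  proof -
    let ?s = "\<sigma> (z, c)"
    have bnd: "\<forall>\<^sub>F zc' in at (z, c). norm (\<sigma> zc' - ?s) \<le> 2 * \<bar>snd zc' - F (fst zc' + ?s *\<^sub>R e)\<bar>"
      using eventually_at_in_open'[OF openM zc]
    proof eventually_elim
      case (elim zc')
      then show ?case using lip[of "fst zc'" ?s "\<sigma> zc'"] \<sigma>[OF zc] \<sigma>[of "fst zc'" "snd zc'"]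
        by (auto simp: M_def split_beta)
    qed
    have "isCont F (z + ?s *\<^sub>R e)"
      using smooth_on_has_derivative[OF F inS(1)[OF zc]] has_derivative_continuous by blast
    then have "isCont (\<lambda>zc'. 2 * \<bar>snd zc' - F (fst zc' + ?s *\<^sub>R e)\<bar>) (z, c)"
      by (intro continuous_intros isCont_o2[where g=F and f="\<lambda>zc'. fst zc' + ?s *\<^sub>R e"]) auto
    then have "((\<lambda>zc'. 2 * \<bar>snd zc' - F (fst zc' + ?s *\<^sub>R e)\<bar>) \<longlongrightarrow> 0) (at (z, c))"
      using \<sigma>(2)[OF zc] by (simp add: isCont_def)
    from Lim_null_comparison[OF bnd this] show ?thesis
      unfolding isCont_def by (simp add: LIM_zero_iff)
  qed
  have der: "((\<lambda>z. \<sigma> (z, c)) has_derivative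
      (\<lambda>v. - (frechet_derivative F (at (z + \<sigma> (z, c) *\<^sub>R e)) v * inverse (D (z + \<sigma> (z, c) *\<^sub>R e))))) (at z)"
    if zc: "(z, c) \<in> M" for z c
  proof -
    let ?w = "z + \<sigma> (z, c) *\<^sub>R e"
    let ?F' = "frechet_derivative F (at ?w)"
    have F': "(F has_derivative ?F') (at ?w)" using smooth_on_has_derivative[OF F inS(1)[OF zc]] .
    interpret F': bounded_linear ?F' using F' by (rule has_derivative_bounded_linear)
    have Dne: "D ?w \<noteq> 0" using inS(2)[OF zc] by auto
    have "((\<lambda>zs. fst zs + snd zs *\<^sub>R e) has_derivative (\<lambda>hk. fst hk + snd hk *\<^sub>R e)) (at (z, \<sigma> (z, c)))"
      by (auto intro!: derivative_eq_intros)
    from diff_chain_at[OF this, of F ?F'] F'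
    have 1: "((\<lambda>zs. (fst zs, F (fst zs + snd zs *\<^sub>R e))) has_derivative
        (\<lambda>hk. (fst hk, ?F' (fst hk + snd hk *\<^sub>R e)))) (at (z, \<sigma> (z, c)))"
      by (auto intro!: has_derivative_Pair has_derivative_fst[OF has_derivative_ident] simp: o_def)
    have bl: "bounded_linear (\<lambda>hk. (fst hk, (snd hk - ?F' (fst hk)) * inverse (D ?w)))"
      by (intro bounded_linear_Pair bounded_linear_fst bounded_linear_mult_left[THEN bounded_linear_compose]
        bounded_linear_sub bounded_linear_snd bounded_linear_compose[OF F'.bounded_linear_axioms])
    have "((\<lambda>zc. (fst zc, \<sigma> zc)) has_derivative
        (\<lambda>hk. (fst hk, (snd hk - ?F' (fst hk)) * inverse (D ?w)))) (at (z, c))"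
    proof (rule has_derivative_inverse_basic[where f = "\<lambda>zs. (fst zs, F (fst zs + snd zs *\<^sub>R e))"
        and f' = "\<lambda>hk. (fst hk, ?F' (fst hk + snd hk *\<^sub>R e))" and T = M])
      show "((\<lambda>zs. (fst zs, F (fst zs + snd zs *\<^sub>R e))) has_derivative
        (\<lambda>hk. (fst hk, ?F' (fst hk + snd hk *\<^sub>R e)))) (at (fst (z, c), \<sigma> (z, c)))" using 1 by simp
      show "(\<lambda>hk. (fst hk, (snd hk - ?F' (fst hk)) * inverse (D ?w))) \<circ> (\<lambda>hk. (fst hk, ?F' (fst hk + snd hk *\<^sub>R e))) = id"
        using Dne by (auto simp: fun_eq_iff F'.add F'.scaleR D_def)
      show "continuous (at (z, c)) (\<lambda>zc. (fst zc, \<sigma> zc))"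
        using cont\<sigma>[OF zc] by (intro continuous_intros) auto
      show "\<And>y. y \<in> M \<Longrightarrow> (fst (fst y, \<sigma> y), F (fst (fst y, \<sigma> y) + snd (fst y, \<sigma> y) *\<^sub>R e)) = y"
        using \<sigma>(2) by auto
    qed (use bl openM zc in auto)
    from has_derivative_snd[OF this]
    have s: "(\<sigma> has_derivative (\<lambda>hk. (snd hk - ?F' (fst hk)) * inverse (D ?w))) (at (z, c))" by simp
    have "((\<lambda>z. (z, c)) has_derivative (\<lambda>h. (h, 0))) (at z)"
      by (auto intro!: derivative_eq_intros)
    from diff_chain_at[OF this s] show ?thesis by (simp add: o_def)
  qed
  define N where "N = {z. (z, F z0) \<in> M}"
  define \<gamma> where "\<gamma> z = \<sigma> (z, F z0)" for z
  have N: "open N" unfolding N_def using openM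
    by (rule open_vimage[of M "\<lambda>z. (z, F z0)", unfolded vimage_def]) (auto intro!: continuous_intros)
  have z0M: "(z0, F z0) \<in> M" using \<rho>(1) \<delta>(1) by (simp add: M_def)
  have \<gamma>N: "z + \<gamma> z *\<^sub>R e \<in> S" if "z \<in> N" for z using inS(1) that by (auto simp: N_def \<gamma>_def)
  have "Ck_on k N \<gamma>" for k
  proof (induction k)
    case 0
    have "isCont \<gamma> z" if "z \<in> N" for z
      using der[of z "F z0"] that has_derivative_continuous unfolding N_def \<gamma>_def by blast
    then show ?case by (simp add: continuous_at_imp_continuous_on)
  next
    case (Suc k)
    have inner: "Ck_inner k N (\<lambda>z. z + \<gamma> z *\<^sub>R e)"
      by (intro Ck_inner_add N Ck_inner_linear bounded_linear_ident Ck_inner_scaleR Suc)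
    show ?case
    proof (rule Ck_on_SucI[OF _ _ N])
      show "(\<gamma> has_derivative (\<lambda>v. - (frechet_derivative F (at (z + \<gamma> z *\<^sub>R e)) v * inverse (D (z + \<gamma> z *\<^sub>R e))))) (at z)"
        if "z \<in> N" for z using der[of z "F z0"] that unfolding N_def \<gamma>_def by blast
      have 1: "Ck_on k N (\<lambda>z. D (z + \<gamma> z *\<^sub>R e))"
        by (rule Ck_on_compose[OF N _ inner \<gamma>N]) (use D in \<open>auto simp: smooth_on_def\<close>)
      have 2: "Ck_on k N (\<lambda>z. frechet_derivative F (at (z + \<gamma> z *\<^sub>R e)) v)" for v
        by (rule Ck_on_compose[OF N _ inner \<gamma>N])
          (use smooth_on_frechet_derivative[OF F] in \<open>auto simp: smooth_on_def\<close>)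
      have "D (z + \<gamma> z *\<^sub>R e) \<noteq> 0" if "z \<in> N" for z
        using inS(2)[of z "F z0"] that by (auto simp: N_def \<gamma>_def)
      from Ck_on_mult[OF N 2 Ck_on_inverse[OF N 1 this]]
      show "Ck_on k N (\<lambda>z. - (frechet_derivative F (at (z + \<gamma> z *\<^sub>R e)) v * inverse (D (z + \<gamma> z *\<^sub>R e))))" for v
        by (rule Ck_on_linear_comp[OF bounded_linear_minus[OF bounded_linear_ident] N])
    qed
  qed
  then have "smooth_on N \<gamma>" by (simp add: smooth_on_def)
  moreover have "\<gamma> z0 = 0"
    using lip[of z0 0 "\<gamma> z0"] \<sigma>[OF z0M] \<rho>(1) by (auto simp: \<gamma>_def)
  moreover have "F (z + \<gamma> z *\<^sub>R e) = F z0" if "z \<in> N" for z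
    using that \<sigma>(2) by (simp add: N_def \<gamma>_def)
  moreover have "z0 \<in> N" using z0M by (simp add: N_def)
  ultimately show ?thesis using that[OF N, of \<gamma>] \<gamma>N by blast
qed

text \<open>Several equations are solved one after the other. Solving the equation for \<open>F j\<close> along
  \<open>e j\<close> leaves the derivatives of the other equations in the other directions unchanged at \<open>z0\<close>,
  because the normalization makes the solution \<open>\<gamma>\<close> stationary in those directions.\<close>

lemma implicit_functions:
  fixes F :: "'i \<Rightarrow> 'a::real_normed_vector \<Rightarrow> real"
  assumes "finite I" "open S" "z0 \<in> S" "\<And>k. k \<in> I \<Longrightarrow> smooth_on S (F k)"
    and "\<And>i k. i \<in> I \<Longrightarrow> k \<in> I \<Longrightarrow> frechet_derivative (F k) (at z0) (e i) = (if i = k then 1 else 0)"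
  shows "\<exists>N \<gamma>. open N \<and> z0 \<in> N \<and> (\<forall>i\<in>I. smooth_on N (\<gamma> i) \<and> \<gamma> i z0 = (0::real)) \<and>
    (\<forall>z\<in>N. z + (\<Sum>i\<in>I. \<gamma> i z *\<^sub>R e i) \<in> S \<and> (\<forall>k\<in>I. F k (z + (\<Sum>i\<in>I. \<gamma> i z *\<^sub>R e i)) = F k z0))"
  using assms
proof (induction I arbitrary: S F rule: finite_induct)
  case empty
  then show ?case by (intro exI[of _ S]) auto
next
  case (insert j I)
  obtain N1 \<gamma>1 where N1: "open N1" "z0 \<in> N1" "smooth_on N1 \<gamma>1" "\<gamma>1 z0 = (0::real)"
    "\<And>z. z \<in> N1 \<Longrightarrow> z + \<gamma>1 z *\<^sub>R e j \<in> S \<and> F j (z + \<gamma>1 z *\<^sub>R e j) = F j z0"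
    using implicit_function[of S z0 "F j" "e j"] insert.prems by auto
  define h where "h z = z + \<gamma>1 z *\<^sub>R e j" for z
  have h: "smooth_inner N1 h" unfolding h_def
    by (intro smooth_inner_add N1 smooth_inner_linear bounded_linear_ident smooth_inner_scaleR)
  have hS: "h z \<in> S" if "z \<in> N1" for z using N1(5)[OF that] by (simp add: h_def)
  have h0: "h z0 = z0" by (simp add: h_def N1)
  have smF: "smooth_on N1 (\<lambda>z. F k (h z))" if "k \<in> insert j I" for k
    by (rule smooth_on_compose[OF N1(1) insert.prems(3)[OF that] h hS])
  define g where "g = frechet_derivative \<gamma>1 (at z0)"
  have hd: "(h has_derivative (\<lambda>v. v + g v *\<^sub>R e j)) (at z0)"
    unfolding h_def g_def using smooth_on_has_derivative[OF N1(3,2)]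
    by (intro has_derivative_add has_derivative_ident has_derivative_scaleR_left)
  have comp: "frechet_derivative (\<lambda>z. F k (h z)) (at z0) v =
      frechet_derivative (F k) (at z0) v + g v * frechet_derivative (F k) (at z0) (e j)"
    if "k \<in> insert j I" for k v
  proof -
    have d: "(F k has_derivative frechet_derivative (F k) (at z0)) (at (h z0))"
      using smooth_on_has_derivative[OF insert.prems(3)[OF that] insert.prems(2)] h0 by simp
    interpret l: bounded_linear "frechet_derivative (F k) (at z0)"
      using d by (rule has_derivative_bounded_linear)
    have "((\<lambda>z. F k (h z)) has_derivative (\<lambda>v. frechet_derivative (F k) (at z0) (v + g v *\<^sub>R e j))) (at z0)"
      using diff_chain_at[OF hd d] by (simp add: o_def)
    from frechet_derivative_at[OF this, symmetric] show ?thesis by (simp add: l.add l.scaleR)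
  qed
  have "frechet_derivative (\<lambda>z. F j (h z)) (at z0) = (\<lambda>v. 0)"
  proof -
    have "((\<lambda>z. F j (h z)) has_derivative (\<lambda>v. 0)) (at z0)"
      by (rule has_derivative_transform_within_open[OF has_derivative_const[of "F j z0"] N1(1,2)])
        (use N1(5) in \<open>auto simp: h_def\<close>)
    then show ?thesis using frechet_derivative_at by force
  qed
  then have g0: "g (e i) = 0" if "i \<in> I" for i
    using comp[of j "e i"] insert.prems(4)[of i j] insert.prems(4)[of j j] that insert.hyps by (cases "i = j") auto
  have "\<exists>N \<gamma>. open N \<and> z0 \<in> N \<and> (\<forall>i\<in>I. smooth_on N (\<gamma> i) \<and> \<gamma> i z0 = (0::real)) \<and>
    (\<forall>z\<in>N. z + (\<Sum>i\<in>I. \<gamma> i z *\<^sub>R e i) \<in> N1 \<and>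
       (\<forall>k\<in>I. F k (h (z + (\<Sum>i\<in>I. \<gamma> i z *\<^sub>R e i))) = F k (h z0)))"
  proof (rule insert.IH[OF N1(1,2)])
    show "frechet_derivative (\<lambda>z. F k (h z)) (at z0) (e i) = (if i = k then 1 else 0)"
      if "i \<in> I" "k \<in> I" for i k
      using comp[of k "e i"] g0[OF that(1)] insert.prems(4)[of i k] that by auto
  qed (use smF in auto)
  then obtain N \<gamma> where N: "open N" "z0 \<in> N" "\<forall>i\<in>I. smooth_on N (\<gamma> i) \<and> \<gamma> i z0 = (0::real)"
    "\<forall>z\<in>N. z + (\<Sum>i\<in>I. \<gamma> i z *\<^sub>R e i) \<in> N1 \<and>
       (\<forall>k\<in>I. F k (h (z + (\<Sum>i\<in>I. \<gamma> i z *\<^sub>R e i))) = F k (h z0))" by blast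
  define H where "H z = z + (\<Sum>i\<in>I. \<gamma> i z *\<^sub>R e i)" for z
  have H: "smooth_inner N H" unfolding H_def using N(3)
    by (intro smooth_inner_add N(1) smooth_inner_linear bounded_linear_ident smooth_inner_sum
        smooth_inner_scaleR) auto
  have H1: "H z \<in> N1" if "z \<in> N" for z using N(4) that by (simp add: H_def)
  define \<gamma>' where "\<gamma>' i z = (if i = j then \<gamma>1 (H z) else \<gamma> i z)" for i z
  have sum: "z + (\<Sum>i\<in>insert j I. \<gamma>' i z *\<^sub>R e i) = h (H z)" for z
  proof -
    have "(\<Sum>i\<in>I. \<gamma>' i z *\<^sub>R e i) = (\<Sum>i\<in>I. \<gamma> i z *\<^sub>R e i)"
      using insert.hyps by (intro sum.cong) (auto simp: \<gamma>'_def)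
    then show ?thesis using insert.hyps by (simp add: \<gamma>'_def h_def H_def)
  qed
  show ?case
  proof (intro exI[of _ N] exI[of _ \<gamma>'] conjI ballI N(1,2))
    show "smooth_on N (\<gamma>' i)" if "i \<in> insert j I" for i
    proof (cases "i = j")
      case True
      then show ?thesis unfolding \<gamma>'_def using smooth_on_compose[OF N(1) N1(3) H H1] by simp
    next
      case False
      then show ?thesis unfolding \<gamma>'_def using that N(3) by simp
    qed
    show "\<gamma>' i z0 = 0" if "i \<in> insert j I" for i
      using that N(3) N1(4) insert.hyps by (auto simp: \<gamma>'_def H_def)
    fix z assume z: "z \<in> N"
    show "z + (\<Sum>i\<in>insert j I. \<gamma>' i z *\<^sub>R e i) \<in> S" unfolding sum by (rule hS[OF H1[OF z]])
    show "F k (z + (\<Sum>i\<in>insert j I. \<gamma>' i z *\<^sub>R e i)) = F k z0" if "k \<in> insert j I" for k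
      unfolding sum using that N1(5)[OF H1[OF z]] N(4) z h0 by (auto simp: h_def H_def)
  qed
qed

section \<open>Pivots and inverse matrices\<close>

definition indep_on :: "'d set \<Rightarrow> 'i set \<Rightarrow> ('i \<Rightarrow> 'd \<Rightarrow> real) \<Rightarrow> bool" where
  "indep_on D S f \<longleftrightarrow> (\<forall>c. (\<forall>q\<in>D. (\<Sum>j\<in>S. c j * f j q) = 0) \<longrightarrow> (\<forall>j\<in>S. c j = 0))"

lemma indep_on_insert_dependent:
  assumes "finite S" "indep_on D S f" "\<not> indep_on D (insert i S) f" "i \<notin> S"
  obtains b where "\<And>q. q \<in> D \<Longrightarrow> f i q = (\<Sum>j\<in>S. b j * f j q)"
proof -
  obtain c where c: "\<And>q. q \<in> D \<Longrightarrow> (\<Sum>j\<in>insert i S. c j * f j q) = 0" "\<exists>j\<in>insert i S. c j \<noteq> 0"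
    using assms(3) unfolding indep_on_def by blast
  have ci: "c i \<noteq> 0"
  proof
    assume "c i = 0"
    then have "\<forall>q\<in>D. (\<Sum>j\<in>S. c j * f j q) = 0" using c(1) assms by simp
    then have "\<forall>j\<in>S. c j = 0" using assms(2) unfolding indep_on_def by blast
    then show False using c(2) \<open>c i = 0\<close> by auto
  qed
  have "f i q = (\<Sum>j\<in>S. (- c j / c i) * f j q)" if "q \<in> D" for q
  proof -
    have "c i * f i q = - (\<Sum>j\<in>S. c j * f j q)" using c(1)[OF that] assms by simp
    also have "\<dots> = c i * (\<Sum>j\<in>S. (- c j / c i) * f j q)"
      using ci by (simp add: sum_distrib_left sum_negf)
    finally show ?thesis using ci by simp
  qed
  then show ?thesis by (rule that)
qed

lemma sum_right_inverse:
  fixes F c :: "'i \<Rightarrow> 'i \<Rightarrow> real"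
  assumes "finite S" "k \<in> S" "\<And>j. j \<in> S \<Longrightarrow> (\<Sum>l\<in>S. F j l * c l k) = (if j = k then 1 else 0)"
  shows "(\<Sum>l\<in>S. (\<Sum>j\<in>S. \<mu> j * F j l) * c l k) = \<mu> k"
proof -
  have "(\<Sum>l\<in>S. (\<Sum>j\<in>S. \<mu> j * F j l) * c l k) = (\<Sum>j\<in>S. \<mu> j * (\<Sum>l\<in>S. F j l * c l k))"
    unfolding sum_distrib_right sum_distrib_left by (subst sum.swap) (simp add: mult.assoc)
  also have "\<dots> = (\<Sum>j\<in>S. if j = k then \<mu> j else 0)" using assms(3) by (intro sum.cong) auto
  finally show ?thesis using assms(1,2) by simp
qed

lemma indep_on_right_inverse:
  assumes "finite S" "\<And>l. l \<in> S \<Longrightarrow> q l \<in> D"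
    and "\<And>j k. j \<in> S \<Longrightarrow> k \<in> S \<Longrightarrow> (\<Sum>l\<in>S. f j (q l) * c l k) = (if j = k then 1 else 0)"
  shows "indep_on D S f"
  unfolding indep_on_def
proof (intro allI impI ballI)
  fix \<mu> k assume \<mu>: "\<forall>q\<in>D. (\<Sum>j\<in>S. \<mu> j * f j q) = 0" and k: "k \<in> S"
  have "(\<Sum>j\<in>S. \<mu> j * f j (q l)) = 0" if "l \<in> S" for l by (rule bspec[OF \<mu> assms(2)[OF that]])
  then show "\<mu> k = 0" using sum_right_inverse[where F = "\<lambda>j l. f j (q l)" and c = c and \<mu> = \<mu>, OF assms(1) k assms(3)[OF _ k]] by simp
qed

text \<open>The functions \<open>u k = (\<Sum>j\<in>S. c k j * f j)\<close> are dual to the pivots, \<open>u k (q l) = \<delta>\<close>,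
  and every \<open>f j\<close> is its own Lagrange interpolation by them. A new function is not
  interpolated by the old ones, and a point where the interpolation fails is the new pivot.\<close>

lemma pivots_exist:
  fixes f :: "'i \<Rightarrow> 'd \<Rightarrow> real"
  assumes "finite S" "indep_on D S f"
  obtains q c where "\<And>k. k \<in> S \<Longrightarrow> q k \<in> D"
    "\<And>k l. k \<in> S \<Longrightarrow> l \<in> S \<Longrightarrow> (\<Sum>j\<in>S. c k j * f j (q l)) = (if k = l then 1 else 0)"
    "\<And>j k. j \<in> S \<Longrightarrow> k \<in> S \<Longrightarrow> (\<Sum>l\<in>S. f j (q l) * c l k) = (if j = k then 1 else 0)"
proof -
  have "\<exists>q u. (\<forall>k\<in>S. q k \<in> D) \<and> (\<forall>k\<in>S. \<forall>l\<in>S. u k (q l) = (if k = l then 1 else 0)) \<and>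
     (\<forall>k\<in>S. \<exists>c. \<forall>x. u k x = (\<Sum>j\<in>S. c j * f j x)) \<and>
     (\<forall>j\<in>S. \<forall>x\<in>D. f j x = (\<Sum>l\<in>S. f j (q l) * u l x))"
    using assms
  proof (induction S rule: finite_induct)
    case (insert i S)
    have "indep_on D S f" unfolding indep_on_def
    proof (intro allI impI)
      fix c assume c: "\<forall>q\<in>D. (\<Sum>j\<in>S. c j * f j q) = 0"
      have "(\<Sum>j\<in>insert i S. (if j = i then 0 else c j) * f j q) = (\<Sum>j\<in>S. c j * f j q)" for q
      proof -
        have "(\<Sum>j\<in>S. (if j = i then 0 else c j) * f j q) = (\<Sum>j\<in>S. c j * f j q)"
          by (rule sum.cong) (use insert.hyps in auto)
        then show ?thesis using insert.hyps by simp
      qed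
      with c have "\<forall>j\<in>insert i S. (if j = i then 0 else c j) = 0"
        using insert.prems[unfolded indep_on_def, rule_format, of "\<lambda>j. if j = i then 0 else c j"] by simp
      then show "\<forall>j\<in>S. c j = 0" using insert.hyps(2) by (metis insertCI)
    qed
    then obtain q u where q: "\<forall>k\<in>S. q k \<in> D" and dual: "\<forall>k\<in>S. \<forall>l\<in>S. u k (q l) = (if k = l then 1 else (0::real))"
      and span: "\<forall>k\<in>S. \<exists>c. \<forall>x. u k x = (\<Sum>j\<in>S. c j * f j x)"
      and interp: "\<forall>j\<in>S. \<forall>x\<in>D. f j x = (\<Sum>l\<in>S. f j (q l) * u l x)"
      using insert.IH by blast
    obtain cu where cu: "\<And>k x. k \<in> S \<Longrightarrow> u k x = (\<Sum>j\<in>S. cu k j * f j x)"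
      using span by metis
    define h where "h x = f i x - (\<Sum>l\<in>S. f i (q l) * u l x)" for x
    define ch where "ch j = (if j = i then 1 else - (\<Sum>l\<in>S. f i (q l) * cu l j))" for j
    have ch: "h x = (\<Sum>j\<in>insert i S. ch j * f j x)" for x
    proof -
      have "(\<Sum>l\<in>S. f i (q l) * u l x) = (\<Sum>l\<in>S. \<Sum>j\<in>S. f i (q l) * cu l j * f j x)"
        using cu by (intro sum.cong) (auto simp: sum_distrib_left mult.assoc)
      also have "\<dots> = (\<Sum>j\<in>S. (\<Sum>l\<in>S. f i (q l) * cu l j) * f j x)"
        by (subst sum.swap) (simp add: sum_distrib_right)
      also have "\<dots> = - (\<Sum>j\<in>S. ch j * f j x)"
        using insert.hyps by (simp add: sum_negf[symmetric] ch_def) (intro sum.cong, auto)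
      finally show ?thesis using insert.hyps by (simp add: h_def ch_def)
    qed
    have "\<not> (\<forall>x\<in>D. h x = 0)"
    proof
      assume "\<forall>x\<in>D. h x = 0"
      then have "\<forall>j\<in>insert i S. ch j = 0" using insert.prems unfolding indep_on_def ch by blast
      then show False by (simp add: ch_def)
    qed
    then obtain qi where qi: "qi \<in> D" "h qi \<noteq> 0" by blast
    have hq: "h (q l) = 0" if "l \<in> S" for l
    proof -
      have "(\<Sum>k\<in>S. f i (q k) * u k (q l)) = (\<Sum>k\<in>S. if k = l then f i (q l) else 0)"
        using dual that by (intro sum.cong) auto
      then show ?thesis using that insert.hyps by (simp add: h_def)
    qed
    define q' where "q' = q(i := qi)"
    define ui where "ui x = h x / h qi" for x
    define u' where "u' k x = (if k = i then ui x else u k x - u k qi * ui x)" for k x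
    have q'S: "q' l = q l" "l \<noteq> i" if "l \<in> S" for l using that insert.hyps by (auto simp: q'_def)
    have "\<exists>c. \<forall>x. u' k x = (\<Sum>j\<in>insert i S. c j * f j x)" if k: "k \<in> insert i S" for k
    proof -
      have ui: "ui x = (\<Sum>j\<in>insert i S. (ch j / h qi) * f j x)" for x
        by (simp add: ui_def ch sum_divide_distrib)
      show ?thesis
      proof (cases "k = i")
        case True
        show ?thesis
          by (rule exI[of _ "\<lambda>j. ch j / h qi"]) (use True ui in \<open>simp add: u'_def\<close>)
      next
        case False
        then have "k \<in> S" using k by simp
        have "u k x = (\<Sum>j\<in>insert i S. (if j = i then 0 else cu k j) * f j x)" for x
        proof -
          have "(\<Sum>j\<in>S. (if j = i then 0 else cu k j) * f j x) = (\<Sum>j\<in>S. cu k j * f j x)"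
            by (rule sum.cong) (use insert.hyps in auto)
          then show ?thesis using insert.hyps cu[OF \<open>k \<in> S\<close>] by simp
        qed
        then have "u' k x = (\<Sum>j\<in>insert i S. ((if j = i then 0 else cu k j) - u k qi * (ch j / h qi)) * f j x)" for x
          using False unfolding u'_def ui left_diff_distrib sum_subtractf sum_distrib_left
          by (simp add: mult.assoc)
        then show ?thesis
          by (intro exI[of _ "\<lambda>j. (if j = i then 0 else cu k j) - u k qi * (ch j / h qi)"] allI)
      qed
    qed
    moreover have "u' k (q' l) = (if k = l then 1 else 0)" if "k \<in> insert i S" "l \<in> insert i S" for k l
    proof (cases "l = i")
      case True
      then show ?thesis using that qi by (auto simp: u'_def ui_def q'_def)
    next
      case False
      then have "l \<in> S" using that by simp
      then show ?thesis using that hq[of l] q'S[of l] dual insert.hyps by (auto simp: u'_def ui_def)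
    qed
    moreover have "f j x = (\<Sum>l\<in>insert i S. f j (q' l) * u' l x)" if j: "j \<in> insert i S" "x \<in> D" for j x
    proof -
      have "(\<Sum>l\<in>S. f j (q' l) * u' l x) = (\<Sum>l\<in>S. f j (q l) * u l x) - (\<Sum>l\<in>S. f j (q l) * u l qi) * ui x"
        unfolding sum_distrib_right sum_subtractf[symmetric]
        by (intro sum.cong) (use q'S in \<open>auto simp: u'_def algebra_simps\<close>)
      then have "(\<Sum>l\<in>insert i S. f j (q' l) * u' l x) =
          (\<Sum>l\<in>S. f j (q l) * u l x) + (f j qi - (\<Sum>l\<in>S. f j (q l) * u l qi)) * ui x"
        using insert.hyps by (simp add: q'_def u'_def algebra_simps)
      also have "\<dots> = f j x"
      proof (cases "j = i")
        case True
        then show ?thesis using qi(2) by (simp add: ui_def) (simp add: h_def)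
      next
        case False
        then show ?thesis using j interp qi(1) by simp
      qed
      finally show ?thesis by simp
    qed
    moreover have "\<forall>k\<in>insert i S. q' k \<in> D" using q qi by (auto simp: q'_def)
    ultimately show ?case by blast
  qed auto
  then obtain q u where q: "\<forall>k\<in>S. q k \<in> D" and dual: "\<forall>k\<in>S. \<forall>l\<in>S. u k (q l) = (if k = l then 1 else (0::real))"
    and span: "\<forall>k\<in>S. \<exists>c. \<forall>x. u k x = (\<Sum>j\<in>S. c j * f j x)"
    and interp: "\<forall>j\<in>S. \<forall>x\<in>D. f j x = (\<Sum>l\<in>S. f j (q l) * u l x)" by blast
  obtain c where c: "\<And>k x. k \<in> S \<Longrightarrow> u k x = (\<Sum>j\<in>S. c k j * f j x)" using span by metis
  have right: "(\<Sum>l\<in>S. f j (q l) * c l k) = (if j = k then 1 else 0)" if j: "j \<in> S" "k \<in> S" for j k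
  proof -
    define a where "a k = (if j = k then 1 else 0) - (\<Sum>l\<in>S. f j (q l) * c l k)" for k
    have "(\<Sum>k\<in>S. a k * f k x) = 0" if "x \<in> D" for x
    proof -
      have "(\<Sum>k\<in>S. (\<Sum>l\<in>S. f j (q l) * c l k) * f k x) = (\<Sum>l\<in>S. f j (q l) * u l x)"
        unfolding sum_distrib_right
        by (subst sum.swap) (intro sum.cong refl, simp add: c sum_distrib_left mult.assoc)
      moreover have "(\<Sum>k\<in>S. (if j = k then 1 else 0) * f k x) = f j x"
        using j assms(1) by (simp add: if_distrib[of "\<lambda>z. z * _"] cong: if_cong)
      ultimately show ?thesis using interp j(1) that by (simp add: a_def left_diff_distrib sum_subtractf)
    qed
    then have "a k = 0" using assms(2) j(2) unfolding indep_on_def by blast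
    then show ?thesis by (simp add: a_def)
  qed
  show ?thesis by (rule that[of q c]) (use q dual c right in auto)
qed

text \<open>A right inverse at one point extends smoothly to a neighbourhood. Its columns solve linear
  equations, to which the implicit function theorem applies in the directions given by the
  inverse at the point.\<close>

lemma smooth_right_inverse:
  fixes F :: "nat \<Rightarrow> nat \<Rightarrow> 'a::real_normed_vector \<Rightarrow> real"
  assumes S: "finite S" and O: "open O'" "z0 \<in> O'" and F: "\<And>j l. j \<in> S \<Longrightarrow> l \<in> S \<Longrightarrow> smooth_on O' (F j l)"
    and c0: "\<And>j k. j \<in> S \<Longrightarrow> k \<in> S \<Longrightarrow> (\<Sum>l\<in>S. F j l z0 * c0 l k) = (if j = k then 1 else 0)"
  obtains N c where "open N" "z0 \<in> N" "N \<subseteq> O'" "\<And>l k. l \<in> S \<Longrightarrow> k \<in> S \<Longrightarrow> smooth_on N (c l k)"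
    "\<And>z j k. z \<in> N \<Longrightarrow> j \<in> S \<Longrightarrow> k \<in> S \<Longrightarrow> (\<Sum>l\<in>S. F j l z * c l k z) = (if j = k then 1 else (0::real))"
proof -
  define P where "P k N c \<longleftrightarrow> open N \<and> z0 \<in> N \<and> N \<subseteq> O' \<and> (\<forall>l\<in>S. smooth_on N (c l)) \<and>
    (\<forall>z\<in>N. \<forall>j\<in>S. (\<Sum>l\<in>S. F j l z * c l z) = (if j = k then 1 else (0::real)))" for k N c
  have "\<exists>N c. open N \<and> z0 \<in> N \<and> N \<subseteq> O' \<and> (\<forall>l\<in>S. smooth_on N (c l)) \<and>
    (\<forall>z\<in>N. \<forall>j\<in>S. (\<Sum>l\<in>S. F j l z * c l z) = (if j = k then 1 else 0))" if k: "k \<in> S" for k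
  proof -
    let ?T = "(UNIV :: (nat \<Rightarrow>\<^sub>C real) set) \<times> O'"
    define G where "G j x = (\<Sum>l\<in>S. F j l (snd x) * apply_bcontfun (fst x) l)" for j and x :: "(nat \<Rightarrow>\<^sub>C real) \<times> 'a"
    define x0 where "x0 = (fin_seq S (\<lambda>l. c0 l k), z0)"
    define e where "e i = (fin_seq S (\<lambda>l. c0 l i), 0 :: 'a)" for i
    have T: "open ?T" "x0 \<in> ?T" using O by (auto simp: x0_def open_Times)
    have bla: "bounded_linear (\<lambda>x :: (nat \<Rightarrow>\<^sub>C real) \<times> 'a. apply_bcontfun (fst x) l)" for l
      by (rule bounded_linear_compose[OF bounded_linear_apply_bcontfun bounded_linear_fst])
    have smF: "smooth_on ?T (\<lambda>x. F j l (snd x))" if "j \<in> S" "l \<in> S" for j l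
      by (rule smooth_on_compose[OF T(1) F[OF that] smooth_inner_linear[OF bounded_linear_snd]]) auto
    have sm: "smooth_on ?T (G j)" if "j \<in> S" for j
      unfolding G_def using that
      by (intro smooth_on_sum smooth_on_mult T smF smooth_inner_imp_smooth_on[OF _ smooth_inner_linear[OF bla]])
    have fd: "frechet_derivative (G j) (at x0) (e i) = (if i = j then 1 else 0)" if "i \<in> S" "j \<in> S" for i j
    proof -
      have d: "(G j has_derivative frechet_derivative (G j) (at x0)) (at x0)"
        using smooth_on_has_derivative[OF sm[OF that(2)] T(2)] .
      have "((\<lambda>s. x0 + s *\<^sub>R e i) has_derivative (\<lambda>s. s *\<^sub>R e i)) (at (0::real))"
        by (auto intro!: derivative_eq_intros)
      then have 1: "((\<lambda>s. G j (x0 + s *\<^sub>R e i)) has_derivative (\<lambda>s. frechet_derivative (G j) (at x0) (s *\<^sub>R e i))) (at 0)"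
        using diff_chain_at[of "\<lambda>s. x0 + s *\<^sub>R e i" _ 0 "G j"] d by (simp add: o_def)
      have "G j (x0 + s *\<^sub>R e i) = G j x0 + s * (\<Sum>l\<in>S. F j l z0 * c0 l i)" for s
        using S by (simp add: G_def x0_def e_def apply_fin_seq sum.distrib algebra_simps sum_distrib_left)
      then have "((\<lambda>s. G j (x0 + s *\<^sub>R e i)) has_derivative (\<lambda>s. s * (\<Sum>l\<in>S. F j l z0 * c0 l i))) (at 0)"
        by (auto intro!: derivative_eq_intros)
      from has_derivative_unique[OF 1 this]
      have "frechet_derivative (G j) (at x0) (1 *\<^sub>R e i) = 1 * (\<Sum>l\<in>S. F j l z0 * c0 l i)" by meson
      then show ?thesis using c0[OF that(2,1)] by auto
    qed
    obtain N \<gamma> where N: "open N" "x0 \<in> N" "\<forall>i\<in>S. smooth_on N (\<gamma> i) \<and> \<gamma> i x0 = (0::real)"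
      "\<forall>x\<in>N. x + (\<Sum>i\<in>S. \<gamma> i x *\<^sub>R e i) \<in> ?T \<and> (\<forall>j\<in>S. G j (x + (\<Sum>i\<in>S. \<gamma> i x *\<^sub>R e i)) = G j x0)"
      using implicit_functions[of S ?T x0 G e, OF S T sm fd] by blast
    define N' where "N' = {z \<in> O'. (fst x0, z) \<in> N}"
    define c where "c l z = c0 l k + (\<Sum>i\<in>S. \<gamma> i (fst x0, z) * c0 l i)" for l z
    have openN': "open N'"
    proof -
      have "open ((\<lambda>z. (fst x0, z)) -` N)" by (rule open_vimage[OF N(1)]) (auto intro!: continuous_intros)
      from open_Int[OF O(1) this] show ?thesis by (simp add: N'_def Int_def vimage_def)
    qed
    have inner: "smooth_inner N' (\<lambda>z. (fst x0, z))"
      by (intro smooth_inner_Pair openN' smooth_inner_const smooth_inner_linear bounded_linear_ident)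
    have "smooth_on N' (\<lambda>z. \<gamma> i (fst x0, z))" if "i \<in> S" for i
      by (rule smooth_on_compose[OF openN' _ inner, of N]) (use N(3) that in \<open>auto simp: N'_def\<close>)
    then have "smooth_on N' (c l)" for l unfolding c_def
      by (intro smooth_on_add smooth_on_const smooth_on_sum smooth_on_mult openN')
    moreover have "(\<Sum>l\<in>S. F j l z * c l z) = (if j = k then 1 else 0)" if z: "z \<in> N'" "j \<in> S" for z j
    proof -
      let ?x = "(fst x0, z) + (\<Sum>i\<in>S. \<gamma> i (fst x0, z) *\<^sub>R e i)"
      have "apply_bcontfun (fst ?x) l = c l z" if "l \<in> S" for l
        using S that by (simp add: fst_sum apply_bcontfun_sum e_def x0_def apply_fin_seq c_def)
      moreover have "snd ?x = z" by (simp add: snd_sum e_def)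
      ultimately have "G j ?x = (\<Sum>l\<in>S. F j l z * c l z)"
        unfolding G_def by (intro sum.cong) auto
      moreover have "G j ?x = G j x0" using N(4) z by (auto simp: N'_def)
      moreover have "G j x0 = (if j = k then 1 else 0)"
        using c0[OF z(2) k] S by (simp add: G_def x0_def apply_fin_seq)
      ultimately show ?thesis by simp
    qed
    moreover have "z0 \<in> N'" using N(2) O(2) by (simp add: N'_def x0_def)
    ultimately show ?thesis using openN' by (intro exI[of _ N'] exI[of _ c]) (auto simp: N'_def)
  qed
  then have ex: "\<exists>N c. P k N c" if "k \<in> S" for k unfolding P_def using that .
  obtain N c where N: "\<And>k. k \<in> S \<Longrightarrow> P k (N k) (c k)"
    using ex by metis
  note N = N[unfolded P_def]
  show ?thesis
  proof (rule that[of "O' \<inter> (\<Inter>k\<in>S. N k)" "\<lambda>l k. c k l"])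
    show "open (O' \<inter> (\<Inter>k\<in>S. N k))" using N O S by (intro open_Int open_INT) blast+
    show "smooth_on (O' \<inter> (\<Inter>k\<in>S. N k)) (c k l)" if "l \<in> S" "k \<in> S" for l k
    proof (rule smooth_on_subset)
      show "smooth_on (N k) (c k l)" using N[OF that(2)] that(1) by blast
    qed (use that in blast)
    show "z0 \<in> O' \<inter> (\<Inter>k\<in>S. N k)" using N O by blast
    show "(\<Sum>l\<in>S. F j l z * c k l z) = (if j = k then 1 else 0)"
      if "z \<in> O' \<inter> (\<Inter>k\<in>S. N k)" "j \<in> S" "k \<in> S" for z j k
      using N[OF that(3)] that by blast
  qed blast
qed

section \<open>Ordinary differential equations\<close>

lemma vector_derivative_bound:
  fixes f :: "real \<Rightarrow> 'b::real_normed_vector"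
  assumes "\<And>s. s \<in> {a..b} \<Longrightarrow> (f has_vector_derivative f' s) (at s within {a..b})"
    and "\<And>s. s \<in> {a..b} \<Longrightarrow> norm (f' s) \<le> B" and "x \<in> {a..b}" "y \<in> {a..b}"
  shows "norm (f x - f y) \<le> B * \<bar>x - y\<bar>"
proof -
  have "norm (f x - f y) \<le> B * norm (x - y)"
  proof (rule differentiable_bound[of "{a..b}" f "\<lambda>s h. h *\<^sub>R f' s"])
    show "onorm (\<lambda>h. h *\<^sub>R f' s) \<le> B" if "s \<in> {a..b}" for s
    proof (rule onorm_bound)
      show "0 \<le> B" using order_trans[OF norm_ge_zero assms(2)[OF that]] .
      show "norm (h *\<^sub>R f' s) \<le> B * norm h" for h
        using mult_left_mono[OF assms(2)[OF that], of "\<bar>h\<bar>"] by (simp add: mult.commute)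
    qed
  qed (use assms in \<open>auto simp: has_vector_derivative_def\<close>)
  then show ?thesis by simp
qed

text \<open>The fixed point of the integral operator is sought among the bounded continuous functions on
  the whole line, with the time clamped to \<open>{-c..c}\<close>. These functions form a complete space.\<close>

lemma picard_lindelof:
  fixes F :: "real \<Rightarrow> 'b::banach \<Rightarrow> 'b"
  assumes c: "c > 0" and cont: "continuous_on ({-c..c} \<times> cball y0 \<rho>) (\<lambda>(s, y). F s y)"
    and lip: "\<And>s y y'. s \<in> {-c..c} \<Longrightarrow> y \<in> cball y0 \<rho> \<Longrightarrow> y' \<in> cball y0 \<rho> \<Longrightarrow>
      norm (F s y - F s y') \<le> L * norm (y - y')"
    and bnd: "\<And>s y. s \<in> {-c..c} \<Longrightarrow> y \<in> cball y0 \<rho> \<Longrightarrow> norm (F s y) \<le> B"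
    and \<rho>: "0 \<le> \<rho>" "c * B \<le> \<rho>" and L: "0 \<le> L" "c * L < 1"
  obtains u where "u 0 = y0" "\<And>s. s \<in> {-c..c} \<Longrightarrow> u s \<in> cball y0 \<rho>"
    "\<And>s. s \<in> {-c..c} \<Longrightarrow> (u has_vector_derivative F s (u s)) (at s within {-c..c})"
proof -
  let ?I = "{-c..c}"
  define cl where "cl s = max (-c) (min c s)" for s :: real
  have cl: "cl s \<in> ?I" "\<bar>cl s\<bar> \<le> c" for s using c by (auto simp: cl_def)
  have cl_id: "cl s = s" if "s \<in> ?I" for s using that by (auto simp: cl_def)
  define K where "K = PiC (UNIV :: real set) (\<lambda>_. cball y0 \<rho>)"
  have K: "u \<in> K \<longleftrightarrow> (\<forall>s. apply_bcontfun u s \<in> cball y0 \<rho>)" for u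
    by (auto simp: K_def mem_PiC_iff)
  define G where "G u s = integral {-c..s} (\<lambda>r. F r (apply_bcontfun u r))" for u s
  have dG: "(G u has_vector_derivative F s (apply_bcontfun u s)) (at s within ?I)"
    if "u \<in> K" "s \<in> ?I" for u s
  proof -
    have "continuous_on ?I (\<lambda>r. (\<lambda>(s, y). F s y) (r, apply_bcontfun u r))"
      by (rule continuous_on_compose2[OF cont]) (use that K in \<open>auto intro!: continuous_intros\<close>)
    then show ?thesis unfolding G_def
      using integral_has_vector_derivative[of "-c" c "\<lambda>r. F r (apply_bcontfun u r)" s] that by simp
  qed
  have I0: "0 \<in> ?I" using c by simp
  define t where "t u s = y0 + (G u (cl s) - G u 0)" for u s
  have bd: "norm (G u s - G u 0) \<le> \<rho>" if "u \<in> K" "s \<in> ?I" for u s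
  proof -
    have B: "B \<ge> 0" using order_trans[OF norm_ge_zero bnd[OF that(2), of y0]] \<rho> by simp
    have "norm (G u s - G u 0) \<le> B * \<bar>s - 0\<bar>"
      by (rule vector_derivative_bound[OF dG[OF that(1)]]) (use that I0 bnd K in auto)
    also have "\<dots> \<le> B * c" using that B by (intro mult_left_mono) auto
    finally show ?thesis using \<rho> by (simp add: mult.commute)
  qed
  have tb: "t u s \<in> cball y0 \<rho>" if "u \<in> K" for u s
    using bd[OF that cl(1)] by (simp add: t_def dist_norm norm_minus_commute)
  have tbc: "t u \<in> bcontfun" if "u \<in> K" for u
  proof -
    have "continuous_on ?I (G u)"
      using dG[OF that] has_vector_derivative_continuous continuous_on_eq_continuous_within by blast
    then have "continuous_on UNIV (\<lambda>s. G u (cl s))"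
      by (rule continuous_on_compose2) (use cl in \<open>auto simp: cl_def intro!: continuous_intros\<close>)
    moreover have "bounded (range (t u))"
      by (rule bounded_subset[OF bounded_cball]) (use tb[OF that] in blast)
    ultimately show ?thesis unfolding bcontfun_def t_def by (auto intro!: continuous_intros)
  qed
  define T where "T u = Bcontfun (t u)" for u
  have T: "apply_bcontfun (T u) s = t u s" if "u \<in> K" for u s
    using tbc[OF that] by (simp add: T_def Bcontfun_inverse)
  have "\<exists>!u\<in>K. T u = u"
  proof (rule Banach_fix)
    show "complete K" unfolding K_def by (intro closed_PiC complete_eq_closed[THEN iffD2]) auto
    have "const_bcontfun y0 \<in> K" using \<rho> by (auto simp: K const_bcontfun.rep_eq)
    then show "K \<noteq> {}" by blast
    show "T ` K \<subseteq> K" using tb T K by auto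
    show "dist (T u) (T v) \<le> (c * L) * dist u v" if "u \<in> K" "v \<in> K" for u v
    proof (rule dist_bound)
      fix s
      have "norm ((G u (cl s) - G v (cl s)) - (G u 0 - G v 0)) \<le> (L * dist u v) * \<bar>cl s - 0\<bar>"
      proof (rule vector_derivative_bound)
        show "((\<lambda>s. G u s - G v s) has_vector_derivative F s (apply_bcontfun u s) - F s (apply_bcontfun v s)) (at s within ?I)"
          if "s \<in> ?I" for s by (intro has_vector_derivative_diff dG that \<open>u \<in> K\<close> \<open>v \<in> K\<close>)
        show "norm (F s (apply_bcontfun u s) - F s (apply_bcontfun v s)) \<le> L * dist u v" if "s \<in> ?I" for s
        proof -
          have "norm (F s (apply_bcontfun u s) - F s (apply_bcontfun v s)) \<le> L * dist (apply_bcontfun u s) (apply_bcontfun v s)"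
            using lip[OF that] \<open>u \<in> K\<close> \<open>v \<in> K\<close> K by (auto simp: dist_norm)
          also have "\<dots> \<le> L * dist u v" using L dist_bounded by (intro mult_left_mono) auto
          finally show ?thesis .
        qed
      qed (use cl I0 in auto)
      also have "\<dots> \<le> (L * dist u v) * c" using cl(2)[of s] L by (intro mult_left_mono) auto
      finally show "dist (apply_bcontfun (T u) s) (apply_bcontfun (T v) s) \<le> (c * L) * dist u v"
        using that by (simp add: T t_def dist_norm algebra_simps)
    qed
  qed (use c L in auto)
  then obtain u where u: "u \<in> K" "T u = u" by blast
  have eq: "apply_bcontfun u s = y0 + (G u s - G u 0)" if "s \<in> ?I" for s
    using T[OF u(1), of s] u(2) cl_id[OF that] by (simp add: t_def)
  show ?thesis
  proof (rule that[of "apply_bcontfun u"])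
    show "apply_bcontfun u 0 = y0" using eq[OF I0] by simp
    show "apply_bcontfun u s \<in> cball y0 \<rho>" for s using u(1) K by blast
    show "(apply_bcontfun u has_vector_derivative F s (apply_bcontfun u s)) (at s within ?I)" if "s \<in> ?I" for s
    proof (rule has_vector_derivative_transform[OF that])
      show "((\<lambda>s. y0 + (G u s - G u 0)) has_vector_derivative F s (apply_bcontfun u s)) (at s within ?I)"
        using dG[OF u(1) that] by (auto intro!: derivative_eq_intros)
    qed (use eq in auto)
  qed
qed

lemma picard_lindelof_global:
  fixes F :: "real \<Rightarrow> 'b::banach \<Rightarrow> 'b"
  assumes c: "c > 0" and cont: "continuous_on ({-c..c} \<times> UNIV) (\<lambda>(s, y). F s y)"
    and lip: "\<And>s y y'. s \<in> {-c..c} \<Longrightarrow> norm (F s y - F s y') \<le> L * norm (y - y')"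
    and L: "0 \<le> L" "c * L < 1"
  obtains u where "u 0 = y0"
    "\<And>s. s \<in> {-c..c} \<Longrightarrow> (u has_vector_derivative F s (u s)) (at s within {-c..c})"
proof -
  have "continuous_on {-c..c} (\<lambda>s. (\<lambda>(s, y). F s y) (s, y0))"
    by (rule continuous_on_compose2[OF cont]) (auto intro!: continuous_intros)
  then have "continuous_on {-c..c} (\<lambda>s. F s y0)" by simp
  then have "bounded ((\<lambda>s. F s y0) ` {-c..c})"
    by (intro compact_imp_bounded compact_continuous_image) auto
  then obtain G where G: "\<And>s. s \<in> {-c..c} \<Longrightarrow> norm (F s y0) \<le> G"
    unfolding bounded_iff by blast
  have G0: "G \<ge> 0" using order_trans[OF norm_ge_zero G[of 0]] c by simp
  \<comment> \<open>A solution cannot leave the ball of radius \<open>\<rho>\<close>, on which the right-hand side is at most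
    \<open>G + L * \<rho>\<close>, since \<open>c * (G + L * \<rho>) = \<rho>\<close>.\<close>
  define \<rho> where "\<rho> = c * G / (1 - c * L)"
  have \<rho>: "\<rho> \<ge> 0" "c * (G + L * \<rho>) = \<rho>"
    using c G0 L by (auto simp: \<rho>_def field_simps)
  obtain u where "u 0 = y0"
    "\<And>s. s \<in> {-c..c} \<Longrightarrow> (u has_vector_derivative F s (u s)) (at s within {-c..c})"
  proof (rule picard_lindelof[OF c, of y0 \<rho> F L "G + L * \<rho>"])
    show "continuous_on ({-c..c} \<times> cball y0 \<rho>) (\<lambda>(s, y). F s y)"
      by (rule continuous_on_subset[OF cont]) auto
    show "norm (F s y) \<le> G + L * \<rho>" if "s \<in> {-c..c}" "y \<in> cball y0 \<rho>" for s y
    proof -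
      have "norm (F s y) \<le> norm (F s y0) + norm (F s y - F s y0)" by (metis norm_triangle_sub)
      also have "\<dots> \<le> G + L * norm (y - y0)" using G lip that by (intro add_mono) auto
      also have "\<dots> \<le> G + L * \<rho>" using that L
        by (intro add_left_mono mult_left_mono) (auto simp: dist_norm norm_minus_commute)
      finally show ?thesis .
    qed
  qed (use lip L \<rho> in auto)
  then show ?thesis by (rule that)
qed

text \<open>On an interval with \<open>c * L < 1\<close> the maximum of \<open>norm \<delta>\<close> can be absorbed on the left-hand side,
  which replaces Gronwall's inequality.\<close>

lemma ode_estimate:
  fixes \<delta> :: "real \<Rightarrow> 'b::real_normed_vector"
  assumes c: "c > 0" and L: "0 \<le> L" "c * L < 1"
    and d: "\<And>s. s \<in> {-c..c} \<Longrightarrow> (\<delta> has_vector_derivative \<delta>' s) (at s within {-c..c})"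
    and b: "\<And>s. s \<in> {-c..c} \<Longrightarrow> norm (\<delta>' s) \<le> L * norm (\<delta> s) + \<epsilon>"
    and s: "s \<in> {-c..c}"
  shows "norm (\<delta> s) \<le> (norm (\<delta> 0) + c * \<epsilon>) / (1 - c * L)"
proof -
  have "continuous_on {-c..c} \<delta>"
    using d has_vector_derivative_continuous continuous_on_eq_continuous_within by blast
  then have "continuous_on {-c..c} (\<lambda>s. norm (\<delta> s))" by (intro continuous_intros)
  then obtain m where m: "m \<in> {-c..c}" "\<And>s. s \<in> {-c..c} \<Longrightarrow> norm (\<delta> s) \<le> norm (\<delta> m)"
    using continuous_attains_sup[of "{-c..c}" "\<lambda>s. norm (\<delta> s)"] s by auto
  have bm: "norm (\<delta>' s) \<le> L * norm (\<delta> m) + \<epsilon>" if "s \<in> {-c..c}" for s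
    using b[OF that] mult_left_mono[OF m(2)[OF that] L(1)] by linarith
  have "norm (\<delta> m - \<delta> 0) \<le> (L * norm (\<delta> m) + \<epsilon>) * \<bar>m - 0\<bar>"
    by (rule vector_derivative_bound[OF d bm]) (use m c in auto)
  also have "\<dots> \<le> (L * norm (\<delta> m) + \<epsilon>) * c"
  proof (rule mult_left_mono)
    have "0 \<le> norm (\<delta>' 0)" by simp
    also have "\<dots> \<le> L * norm (\<delta> m) + \<epsilon>" using bm c by auto
    finally show "0 \<le> L * norm (\<delta> m) + \<epsilon>" .
  qed (use m in auto)
  finally have "norm (\<delta> m) \<le> norm (\<delta> 0) + (L * norm (\<delta> m) + \<epsilon>) * c"
    using norm_triangle_sub[of "\<delta> m" "\<delta> 0"] by linarith
  then have "norm (\<delta> m) * (1 - c * L) \<le> norm (\<delta> 0) + c * \<epsilon>" by (simp add: algebra_simps)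
  then have "norm (\<delta> m) \<le> (norm (\<delta> 0) + c * \<epsilon>) / (1 - c * L)" using L by (simp add: pos_le_divide_eq)
  then show ?thesis using m(2)[OF s] by linarith
qed

lemma ode_unique:
  fixes u v :: "real \<Rightarrow> 'b::real_normed_vector"
  assumes c: "c > 0" and L: "0 \<le> L" "c * L < 1"
    and u: "\<And>s. s \<in> {-c..c} \<Longrightarrow> (u has_vector_derivative F s (u s)) (at s within {-c..c})"
    and v: "\<And>s. s \<in> {-c..c} \<Longrightarrow> (v has_vector_derivative F s (v s)) (at s within {-c..c})"
    and lip: "\<And>s. s \<in> {-c..c} \<Longrightarrow> norm (F s (u s) - F s (v s)) \<le> L * norm (u s - v s)"
    and 0: "u 0 = v 0" and s: "s \<in> {-c..c}"
  shows "u s = v s"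
proof -
  have "norm (u s - v s) \<le> (norm (u 0 - v 0) + c * 0) / (1 - c * L)"
    by (rule ode_estimate[OF c L has_vector_derivative_diff[OF u v]]) (use lip s in auto)
  then show ?thesis using 0 by simp
qed

lemma uniform_linearization:
  fixes f :: "'a::euclidean_space \<Rightarrow> 'b::real_normed_vector" and f' :: "'a \<Rightarrow> 'a \<Rightarrow>\<^sub>L 'b"
  assumes Q: "open Q" and f': "\<And>q. q \<in> Q \<Longrightarrow> (f has_derivative blinfun_apply (f' q)) (at q)"
    and cont: "continuous_on Q f'" and K: "compact K" "K \<subseteq> Q" and e: "e > 0"
  obtains d where "d > 0" "\<And>q q'. q \<in> K \<Longrightarrow> norm (q' - q) < d \<Longrightarrow>
    norm (f q' - f q - f' q (q' - q)) \<le> e * norm (q' - q)"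
proof -
  obtain r where r: "r > 0" "(\<Union>x\<in>K. cball x r) \<subseteq> Q"
    using compact_subset_open_imp_cball_epsilon_subset[OF K(1) Q K(2)] by blast
  define K' where "K' = (\<Union>x\<in>K. cball x r)"
  have "K' = {x + y |x y. x \<in> K \<and> y \<in> cball 0 r}"
  proof -
    have "z \<in> K'" if "x \<in> K" "norm y \<le> r" "z = x + y" for x y z
      unfolding K'_def using that by (intro UN_I[of x]) (auto simp: dist_norm)
    moreover have "\<exists>x y. z = x + y \<and> x \<in> K \<and> norm y \<le> r" if z: "z \<in> K'" for z
    proof -
      obtain x where "x \<in> K" "dist x z \<le> r" using z by (auto simp: K'_def)
      then show ?thesis by (intro exI[of _ x] exI[of _ "z - x"]) (auto simp: dist_norm norm_minus_commute)
    qed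
    ultimately show ?thesis by auto
  qed
  then have "compact K'" using compact_sums[OF K(1) compact_cball, of 0 r] by simp
  then have "uniformly_continuous_on K' f'"
    using continuous_on_subset[OF cont] r(2) by (intro compact_uniformly_continuous) (auto simp: K'_def)
  then obtain d where d: "d > 0" "\<And>x x'. x \<in> K' \<Longrightarrow> x' \<in> K' \<Longrightarrow> dist x' x < d \<Longrightarrow> dist (f' x') (f' x) < e"
    unfolding uniformly_continuous_on_def using e by meson
  show ?thesis
  proof (rule that[of "min d r"])
    fix q q' assume q: "q \<in> K" and q': "norm (q' - q) < min d r"
    let ?S = "ball q (min d r)"
    have SK: "?S \<subseteq> K'" using q unfolding K'_def by auto
    have qK: "q \<in> K'" unfolding K'_def by (rule UN_I[OF q]) (use r in simp)
    have "norm (f q' - f q - f' q (q' - q)) \<le> norm (q' - q) * e"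
    proof (rule differentiable_bound_linearization[where S = ?S and f' = "\<lambda>x. blinfun_apply (f' x)"])
      show "q + t *\<^sub>R (q' - q) \<in> ?S" if "t \<in> {0..1}" for t
      proof -
        have "norm (t *\<^sub>R (q' - q)) \<le> 1 * norm (q' - q)"
          using that by (simp add: mult_left_le_one_le)
        then show ?thesis using q' norm_minus_cancel[of "t *\<^sub>R (q' - q)"] by (simp add: dist_norm)
      qed
      show "(f has_derivative blinfun_apply (f' x)) (at x within ?S)" if "x \<in> ?S" for x
        using f'[of x] that SK r(2) unfolding K'_def by (meson has_derivative_at_withinI subsetD)
      show "onorm (blinfun_apply (f' x) - blinfun_apply (f' q)) \<le> e" if "x \<in> ?S" for x
      proof -
        have "dist (f' x) (f' q) < e" using d(2)[OF qK, of x] SK that by (auto simp: dist_commute)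
        moreover have "blinfun_apply (f' x) - blinfun_apply (f' q) = blinfun_apply (f' x - f' q)"
          by (auto simp: blinfun.diff_left)
        ultimately show ?thesis by (simp add: dist_norm norm_blinfun.rep_eq)
      qed
    qed (use d r in auto)
    then show "norm (f q' - f q - f' q (q' - q)) \<le> e * norm (q' - q)" by (simp add: mult.commute)
  qed (use d r in auto)
qed

lemma Ck_on_blinfun_derivative:
  fixes F :: "'a::euclidean_space \<Rightarrow> 'b::real_normed_vector"
  assumes "Ck_on (Suc k) Q F"
  obtains F' :: "'a \<Rightarrow> 'a \<Rightarrow>\<^sub>L 'b" where "continuous_on Q F'"
    "\<And>q. q \<in> Q \<Longrightarrow> (F has_derivative blinfun_apply (F' q)) (at q)"
    "\<And>q v. q \<in> Q \<Longrightarrow> F' q v = frechet_derivative F (at q) v"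
proof -
  have d: "(F has_derivative frechet_derivative F (at q)) (at q)" if "q \<in> Q" for q
    using Ck_on_SucD(1)[OF assms that] .
  have app: "blinfun_apply (Blinfun (frechet_derivative F (at q))) = frechet_derivative F (at q)" if "q \<in> Q" for q
    using bounded_linear_Blinfun_apply[OF has_derivative_bounded_linear[OF d[OF that]]] .
  have "continuous_on Q (\<lambda>q. Blinfun (frechet_derivative F (at q)))"
  proof (rule continuous_on_blinfun_componentwise)
    fix i :: 'a
    have "continuous_on Q (\<lambda>q. frechet_derivative F (at q) i)"
      using Ck_on_imp_continuous_on[OF Ck_on_SucD(2)[OF assms]] .
    then show "continuous_on Q (\<lambda>q. blinfun_apply (Blinfun (frechet_derivative F (at q))) i)"
      by (rule continuous_on_eq) (simp add: app)
  qed
  then show ?thesis using that[of "\<lambda>q. Blinfun (frechet_derivative F (at q))"] app d by simp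
qed

text \<open>In the following lemmas \<open>u (s, x)\<close> is a family of solutions of \<open>u' = F (s, x, u)\<close> with
  parameter \<open>x\<close> and initial value \<open>h x\<close> on the time interval \<open>{-c<..<c}\<close>, which is so short
  that \<open>c * L < 1\<close> for a Lipschitz constant \<open>L\<close> of \<open>F\<close> in its last argument.\<close>

lemma ode_param_continuous:
  fixes F :: "real \<times> 'p::euclidean_space \<times> 'b::euclidean_space \<Rightarrow> 'b"
  assumes L: "0 \<le> L" "c * L < 1" and \<Omega>: "open \<Omega>"
    and contF: "continuous_on ({-c<..<c} \<times> \<Omega> \<times> O') F"
    and lip: "\<And>s x y y'. s \<in> {-c<..<c} \<Longrightarrow> x \<in> \<Omega> \<Longrightarrow> y \<in> O' \<Longrightarrow> y' \<in> O' \<Longrightarrow>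
      norm (F (s, x, y) - F (s, x, y')) \<le> L * norm (y - y')"
    and u: "\<And>s x. s \<in> {-c<..<c} \<Longrightarrow> x \<in> \<Omega> \<Longrightarrow> u (s, x) \<in> O' \<and>
      ((\<lambda>s. u (s, x)) has_vector_derivative F (s, x, u (s, x))) (at s)"
    and h: "\<And>x. x \<in> \<Omega> \<Longrightarrow> u (0, x) = h x" "continuous_on \<Omega> h"
  shows "continuous_on ({-c<..<c} \<times> \<Omega>) u"
proof (intro continuous_at_imp_continuous_on ballI, clarify)
  fix s0 x0 assume s0: "s0 \<in> {-c<..<c}" and x0: "x0 \<in> \<Omega>"
  define c' where "c' = (\<bar>s0\<bar> + c) / 2"
  have c': "c' > 0" "c' < c" "\<bar>s0\<bar> < c'" using s0 by (auto simp: c'_def abs_less_iff)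
  have c'L: "c' * L < 1" using c' L by (meson le_less_trans less_imp_le mult_right_mono)
  let ?I = "{-c'..c'}"
  have I: "s \<in> {-c<..<c}" if "s \<in> ?I" for s using that c' by auto
  have du: "((\<lambda>s. u (s, x)) has_vector_derivative F (s, x, u (s, x))) (at s within ?I)"
    if "s \<in> ?I" "x \<in> \<Omega>" for s x using u[OF I[OF that(1)] that(2)] has_vector_derivative_at_within by blast
  have cu: "continuous_on {-c<..<c} (\<lambda>s. u (s, x0))"
    using u[OF _ x0] by (intro continuous_at_imp_continuous_on ballI) (blast intro: has_vector_derivative_continuous)
  have g: "continuous_on (\<Omega> \<times> ?I) (\<lambda>(x, s). F (s, x, u (s, x0)))"
    unfolding split_beta
    by (intro continuous_on_compose2[OF contF] continuous_intros continuous_on_compose2[OF cu])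
       (use u[OF _ x0] I in auto)
  show "isCont u (s0, x0)" unfolding isCont_def
  proof (rule tendstoI)
    fix e' :: real assume e': "e' > 0"
    define e where "e = e' * (1 - c' * L) / (4 * (1 + c'))"
    have e: "e > 0" "(e + c' * e) / (1 - c' * L) < e' / 2"
    proof -
      show "e > 0" using e' c' c'L by (simp add: e_def)
      have "e * (4 * (1 + c')) = e' * (1 - c' * L)" using c' by (simp add: e_def)
      then have eq: "e + c' * e = (e' / 4) * (1 - c' * L)" by (simp add: algebra_simps)
      show "(e + c' * e) / (1 - c' * L) < e' / 2" 
        using e' c'L nonzero_mult_div_cancel_right[of "1 - c' * L" "e' / 4"] unfolding eq by linarith
    qed
    obtain X0 where X0: "x0 \<in> X0" "open X0"
      "\<forall>x\<in>X0 \<inter> \<Omega>. \<forall>s\<in>?I. dist ((\<lambda>(x, s). F (s, x, u (s, x0))) (x, s)) ((\<lambda>(x, s). F (s, x, u (s, x0))) (x0, s)) \<le> e"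
      using continuous_on_prod_compactE[OF g compact_Icc x0 e(1)] by blast
    have "\<forall>\<^sub>F x in nhds x0. x \<in> X0" "\<forall>\<^sub>F x in nhds x0. x \<in> \<Omega>"
      using X0 x0 \<Omega> by (auto intro: eventually_nhds_in_open)
    moreover have "\<forall>\<^sub>F x in nhds x0. dist (h x) (h x0) < e"
      using h(2) x0 \<Omega> e(1) by (intro tendstoD) (metis continuous_on_eq_continuous_at isCont_def tendsto_at_iff_tendsto_nhds)
    ultimately have 1: "\<forall>\<^sub>F x in nhds x0. \<forall>s\<in>?I. dist (u (s, x)) (u (s, x0)) < e' / 2"
    proof eventually_elim
      case (elim x)
      show ?case
      proof
        fix s assume s: "s \<in> ?I"
        have "norm (u (s, x) - u (s, x0)) \<le> (norm (u (0, x) - u (0, x0)) + c' * e) / (1 - c' * L)"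
        proof (rule ode_estimate[OF c'(1) L(1) c'L has_vector_derivative_diff[OF du du] _ s])
          fix s assume s: "s \<in> ?I"
          have "norm (F (s, x, u (s, x)) - F (s, x, u (s, x0))) \<le> L * norm (u (s, x) - u (s, x0))"
            using lip[OF I[OF s]] u[OF I[OF s]] elim x0 by blast
          moreover have "norm (F (s, x, u (s, x0)) - F (s, x0, u (s, x0))) \<le> e"
            using X0(3) elim s by (auto simp: dist_norm)
          ultimately show "norm (F (s, x, u (s, x)) - F (s, x0, u (s, x0))) \<le> L * norm (u (s, x) - u (s, x0)) + e"
            using norm_triangle_ineq[of "F (s, x, u (s, x)) - F (s, x, u (s, x0))" "F (s, x, u (s, x0)) - F (s, x0, u (s, x0))"]
            by simp
        qed (use elim x0 in auto)
        also have "\<dots> \<le> (e + c' * e) / (1 - c' * L)"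
          using elim h(1) x0 c'L by (intro divide_right_mono) (auto simp: dist_norm)
        finally show "dist (u (s, x)) (u (s, x0)) < e' / 2" using e(2) unfolding dist_norm by linarith
      qed
    qed
    have "isCont (\<lambda>s. u (s, x0)) s0"
      using u[OF s0 x0] has_vector_derivative_continuous by blast
    then have "((\<lambda>s. u (s, x0)) \<longlongrightarrow> u (s0, x0)) (nhds s0)"
      using tendsto_at_iff_tendsto_nhds[of "\<lambda>s. u (s, x0)" s0] by (simp add: isCont_def)
    from tendstoD[OF this, of "e' / 2"] have 2: "\<forall>\<^sub>F s in nhds s0. dist (u (s, x0)) (u (s0, x0)) < e' / 2"
      using e' by simp
    have 3: "\<forall>\<^sub>F s in nhds s0. s \<in> ?I"
      using c' by (intro eventually_mono[OF eventually_nhds_in_open[of "{-c'<..<c'}"]]) auto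
    have "\<forall>\<^sub>F p in nhds s0 \<times>\<^sub>F nhds x0. dist (u p) (u (s0, x0)) < e'"
      using eventually_prodI[OF eventually_conj[OF 2 3] 1]
    proof eventually_elim
      case (elim p)
      then have "dist (u p) (u (fst p, x0)) < e' / 2" "dist (u (fst p, x0)) (u (s0, x0)) < e' / 2"
        by (metis prod.collapse)+
      then show ?case using dist_triangle[of "u p" "u (s0, x0)" "u (fst p, x0)"] by linarith
    qed
    then show "\<forall>\<^sub>F p in at (s0, x0). dist (u p) (u (s0, x0)) < e'"
      by (simp add: nhds_prod eventually_at_filter eventually_mono)
  qed
qed

lemma derivative_norm_le_lipschitz:
  fixes f :: "'a::real_normed_vector \<Rightarrow> 'b::real_normed_vector"
  assumes f: "(f has_derivative f') (at y)" and O: "open O'" "y \<in> O'"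
    and lip: "\<And>z. z \<in> O' \<Longrightarrow> norm (f z - f y) \<le> L * norm (z - y)"
  shows "norm (f' w) \<le> L * norm w"
proof (rule field_le_epsilon)
  interpret f': bounded_linear f' using f by (rule has_derivative_bounded_linear)
  fix e :: real assume e: "e > 0"
  define e' where "e' = e / (norm w + 1)"
  have e': "e' > 0" "e' * norm w \<le> e"
  proof -
    have "norm w + 1 > 0" using norm_ge_zero[of w] by linarith
    then show "e' > 0" "e' * norm w \<le> e" using e by (auto simp: e'_def field_simps)
  qed
  obtain d where d: "d > 0" "\<And>z. norm (z - y) < d \<Longrightarrow> norm (f z - f y - f' (z - y)) \<le> e' * norm (z - y)"
    using f e'(1) unfolding has_derivative_at_alt by blast
  obtain d0 where d0: "d0 > 0" "ball y d0 \<subseteq> O'" using O openE by blast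
  define r where "r = min d d0 / (2 * (norm w + 1))"
  have r: "r > 0" "r * norm w < min d d0"
  proof -
    have w: "norm w + 1 > 0" using norm_ge_zero[of w] by linarith
    show "r > 0" unfolding r_def using d(1) d0(1) w by (intro divide_pos_pos) auto
    moreover have "norm w < 2 * (norm w + 1)" using w by (simp add: distrib_left add_pos_nonneg)
    ultimately have "r * norm w < r * (2 * (norm w + 1))" by (intro mult_strict_left_mono)
    also have "\<dots> = min d d0" using w by (simp add: r_def)
    finally show "r * norm w < min d d0" .
  qed
  have "y + r *\<^sub>R w \<in> O'" using d0(2) r by (auto simp: dist_norm subset_iff)
  from lip[OF this] have "norm (f (y + r *\<^sub>R w) - f y) \<le> L * (r * norm w)" using r by simp
  moreover have "norm (f (y + r *\<^sub>R w) - f y - r *\<^sub>R f' w) \<le> e' * (r * norm w)"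
    using d(2)[of "y + r *\<^sub>R w"] r by (simp add: f'.scaleR)
  ultimately have "norm (r *\<^sub>R f' w) \<le> L * (r * norm w) + e' * (r * norm w)"
    using norm_triangle_sub[of "r *\<^sub>R f' w" "f (y + r *\<^sub>R w) - f y"] by (simp add: norm_minus_commute)
  then have "r * norm (f' w) \<le> r * (L * norm w + e' * norm w)" using r by (simp add: algebra_simps)
  then have "norm (f' w) \<le> L * norm w + e' * norm w" using r by simp
  then show "norm (f' w) \<le> L * norm w + e" using e'(2) by linarith
qed

text \<open>The derivative in the parameter is found as the solution \<open>W\<close> of the variational
  equation. The error \<open>\<eta> = u (s, x) - u (s, x0) - W s (x - x0)\<close> satisfies \<open>\<bar>\<eta>'\<bar> \<le> (L + \<epsilon>) * \<bar>\<eta>\<bar> + C * \<epsilon> * \<bar>x - x0\<bar>\<close>.\<close>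

lemma ode_param_derivative:
  fixes F :: "real \<times> 'p::euclidean_space \<times> 'b::euclidean_space \<Rightarrow> 'b"
  assumes L: "0 \<le> L" "c * L < 1" and \<Omega>: "open \<Omega>" "open O'"
    and F: "Ck_on (Suc k) ({-c<..<c} \<times> \<Omega> \<times> O') F"
    and lip: "\<And>s x y y'. s \<in> {-c<..<c} \<Longrightarrow> x \<in> \<Omega> \<Longrightarrow> y \<in> O' \<Longrightarrow> y' \<in> O' \<Longrightarrow>
      norm (F (s, x, y) - F (s, x, y')) \<le> L * norm (y - y')"
    and u: "\<And>s x. s \<in> {-c<..<c} \<Longrightarrow> x \<in> \<Omega> \<Longrightarrow> u (s, x) \<in> O' \<and>
      ((\<lambda>s. u (s, x)) has_vector_derivative F (s, x, u (s, x))) (at s)"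
    and cu: "continuous_on ({-c<..<c} \<times> \<Omega>) u"
    and x0: "x0 \<in> \<Omega>" and h: "((\<lambda>x. u (0, x)) has_derivative blinfun_apply h') (at x0)"
    and c': "0 < c'" "c' < c"
  obtains W where "W 0 = h'" "\<And>s. s \<in> {-c'..c'} \<Longrightarrow> ((\<lambda>x. u (s, x)) has_derivative blinfun_apply (W s)) (at x0)"
    "\<And>s v. s \<in> {-c'..c'} \<Longrightarrow> ((\<lambda>s. W s v) has_vector_derivative
       frechet_derivative F (at (s, x0, u (s, x0))) (0, v, W s v)) (at s within {-c'..c'})"
proof -
  let ?Q = "{-c<..<c} \<times> \<Omega> \<times> O'"
  let ?I = "{-c'..c'}"
  have Q: "open ?Q" using \<Omega> by (intro open_Times) auto
  have c'L: "c' * L < 1" using c' L by (meson le_less_trans less_imp_le mult_right_mono)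
  have I: "s \<in> {-c<..<c}" if "s \<in> ?I" for s using that c' by auto
  obtain F' where F': "continuous_on ?Q F'"
    "\<And>q. q \<in> ?Q \<Longrightarrow> (F has_derivative blinfun_apply (F' q)) (at q)"
    "\<And>q v. q \<in> ?Q \<Longrightarrow> F' q v = frechet_derivative F (at q) v"
    using Ck_on_blinfun_derivative[OF F] by blast
  have F'lip: "norm (F' q (0, 0, w)) \<le> L * norm w" if q: "q \<in> ?Q" for q w
  proof -
    obtain s x y where qe: "q = (s, x, y)" "s \<in> {-c<..<c}" "x \<in> \<Omega>" "y \<in> O'" using q by auto
    have "((\<lambda>y. (s, x, y)) has_derivative (\<lambda>w. (0, 0, w))) (at y)"
      by (auto intro!: derivative_eq_intros)
    then have "((\<lambda>y. F (s, x, y)) has_derivative (\<lambda>w. F' q (0, 0, w))) (at y)"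
      using diff_chain_at[of "\<lambda>y. (s, x, y)" _ y F "F' q"] F'(2)[OF q] qe(1) by (simp add: o_def)
    then show ?thesis
      by (rule derivative_norm_le_lipschitz[OF _ \<Omega>(2) qe(4)]) (use lip[OF qe(2,3) _ qe(4)] in auto)
  qed
  define q0 where "q0 s = (s, x0, u (s, x0))" for s
  have q0: "q0 s \<in> ?Q" if "s \<in> ?I" for s using u[OF I[OF that] x0] I[OF that] x0 by (auto simp: q0_def)
  have cu0: "continuous_on ?I (\<lambda>s. u (s, x0))"
    by (rule continuous_on_compose2[OF cu]) (use I x0 in \<open>auto intro!: continuous_intros\<close>)
  have cq0: "continuous_on ?I q0" unfolding q0_def by (intro continuous_intros cu0)
  have cF'q: "continuous_on ?I (\<lambda>s. F' (q0 s))"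
    by (rule continuous_on_compose2[OF F'(1) cq0 image_subsetI[OF q0]])
  have blw: "bounded_linear (\<lambda>w::'b. (0::real, 0::'p, w))" and blv: "bounded_linear (\<lambda>v::'p. (0::real, v, 0::'b))"
    by (intro bounded_linear_Pair bounded_linear_zero bounded_linear_ident)+
  define Jw where "Jw = Blinfun (\<lambda>w::'b. (0::real, 0::'p, w))"
  define Jv where "Jv = Blinfun (\<lambda>v::'p. (0::real, v, 0::'b))"
  have Jw: "blinfun_apply Jw w = (0, 0, w)" for w unfolding Jw_def by (simp add: bounded_linear_Blinfun_apply[OF blw])
  have Jv: "blinfun_apply Jv v = (0, v, 0)" for v unfolding Jv_def by (simp add: bounded_linear_Blinfun_apply[OF blv])
  define A where "A s = F' (q0 s) o\<^sub>L Jw" for s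
  define B where "B s = F' (q0 s) o\<^sub>L Jv" for s
  have A: "A s w = F' (q0 s) (0, 0, w)" and B: "B s v = F' (q0 s) (0, v, 0)" for s w v
    by (simp_all add: A_def B_def Jw Jv)
  have AB: "F' (q0 s) (0, v, w) = A s w + B s v" for s v w
    using blinfun.add_right[of "F' (q0 s)" "(0, 0, w)" "(0, v, 0)"] by (simp add: A B)
  have nA: "norm (A s) \<le> L" if "s \<in> ?I" for s
    by (rule norm_blinfun_bound[OF L(1)]) (use F'lip[OF q0[OF that]] in \<open>simp add: A\<close>)
  have cA: "continuous_on ?I A" and cB: "continuous_on ?I B"
    unfolding A_def B_def by (intro continuous_intros cF'q)+
  define G where "G s W = (A s o\<^sub>L W) + B s" for s and W :: "'p \<Rightarrow>\<^sub>L 'b"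
  obtain W where W: "W 0 = h'" "\<And>s. s \<in> ?I \<Longrightarrow> (W has_vector_derivative G s (W s)) (at s within ?I)"
  proof (rule picard_lindelof_global[OF c'(1), of G L h'])
    show "continuous_on (?I \<times> UNIV) (\<lambda>(s, W). G s W)"
      unfolding G_def split_beta
      by (intro continuous_intros continuous_on_compose2[OF cA] continuous_on_compose2[OF cB]) auto
    show "norm (G s W - G s W') \<le> L * norm (W - W')" if "s \<in> ?I" for s W W'
    proof -
      have "G s W - G s W' = A s o\<^sub>L (W - W')"
        by (simp add: G_def bounded_bilinear.diff_right[OF bounded_bilinear_blinfun_compose])
      also have "norm \<dots> \<le> norm (A s) * norm (W - W')" by (rule norm_blinfun_compose)
      also have "\<dots> \<le> L * norm (W - W')" using nA[OF that] by (intro mult_right_mono) auto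
      finally show ?thesis .
    qed
  qed (use L c'L in auto)
  have dW: "((\<lambda>s. W s v) has_vector_derivative A s (W s v) + B s v) (at s within ?I)" if "s \<in> ?I" for s v
  proof -
    have "((\<lambda>s. blinfun_apply (W s) v) has_vector_derivative blinfun_apply (G s (W s)) v) (at s within ?I)"
      using bounded_linear.has_vector_derivative[OF bounded_bilinear.bounded_linear_left[OF bounded_bilinear_blinfun_apply, of v] W(2)[OF that]] .
    then show ?thesis by (simp add: G_def blinfun.add_left)
  qed
  have "continuous_on ?I W"
    using W(2) has_vector_derivative_continuous continuous_on_eq_continuous_within by blast
  then have "bounded (W ` ?I)" by (intro compact_imp_bounded compact_continuous_image) auto
  then obtain K where K: "\<And>s. s \<in> ?I \<Longrightarrow> norm (W s) \<le> K" unfolding bounded_iff by blast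
  have K0: "K \<ge> 0" using order_trans[OF norm_ge_zero K[of 0]] c' by simp
  have du: "((\<lambda>s. u (s, x)) has_vector_derivative F (s, x, u (s, x))) (at s within ?I)"
    if "s \<in> ?I" "x \<in> \<Omega>" for s x using u[OF I[OF that(1)] that(2)] has_vector_derivative_at_within by blast
  have small: "\<exists>d>0. \<forall>s\<in>?I. \<forall>v. norm v < d \<longrightarrow> norm (u (s, x0 + v) - u (s, x0) - W s v) \<le> e * norm v"
    if e: "e > 0" for e
  proof -
    \<comment> \<open>The estimate gives the factor \<open>\<epsilon> * (1 + c' * (1 + K)) / (1 - c' * (L + \<epsilon>))\<close>, and
      \<open>1 - c' * (L + \<epsilon>) \<ge> (1 - c' * L) / 2\<close> for small \<open>\<epsilon>\<close>.\<close>
    define a where "a = 1 - c' * L"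
    define b where "b = 1 + c' * (1 + K)"
    have a: "a > 0" using c'L by (simp add: a_def)
    have b: "b > 0" using c' K0 by (simp add: b_def add_pos_nonneg)
    define \<epsilon> where "\<epsilon> = min (a / (2 * c')) (e * a / (2 * b))"
    have \<epsilon>: "\<epsilon> > 0" "c' * \<epsilon> \<le> a / 2" "\<epsilon> * b \<le> e * (a / 2)"
    proof -
      show "\<epsilon> > 0" using a b c' e by (simp add: \<epsilon>_def)
      have "c' * \<epsilon> \<le> c' * (a / (2 * c'))" using c' by (intro mult_left_mono) (auto simp: \<epsilon>_def)
      then show "c' * \<epsilon> \<le> a / 2" using c' by simp
      have "\<epsilon> * b \<le> (e * a / (2 * b)) * b" using b by (intro mult_right_mono) (auto simp: \<epsilon>_def)
      then show "\<epsilon> * b \<le> e * (a / 2)" using b by simp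
    qed
    have a2: "1 - c' * (L + \<epsilon>) \<ge> a / 2" using \<epsilon>(2) by (simp add: a_def field_simps)
    have "compact (q0 ` ?I)" using cq0 by (intro compact_continuous_image) auto
    then obtain d1 where d1: "d1 > 0" "\<And>q q'. q \<in> q0 ` ?I \<Longrightarrow> norm (q' - q) < d1 \<Longrightarrow>
       norm (F q' - F q - F' q (q' - q)) \<le> \<epsilon> * norm (q' - q)"
      using uniform_linearization[OF Q F'(2,1) _ _ \<epsilon>(1), of "q0 ` ?I"] q0 by blast
    have "continuous_on (\<Omega> \<times> ?I) (\<lambda>(x, s). u (s, x))" unfolding split_beta
      by (intro continuous_on_compose2[OF cu] continuous_intros) (use I in auto)
    then obtain X0 where X0: "x0 \<in> X0" "open X0"
      "\<forall>x\<in>X0 \<inter> \<Omega>. \<forall>s\<in>?I. dist ((\<lambda>(x, s). u (s, x)) (x, s)) ((\<lambda>(x, s). u (s, x)) (x0, s)) \<le> d1 / 4"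
      using continuous_on_prod_compactE[of \<Omega> ?I "\<lambda>(x, s). u (s, x)" x0 "d1 / 4"] x0 d1(1) by auto
    obtain d2 where d2: "d2 > 0" "ball x0 d2 \<subseteq> X0 \<inter> \<Omega>"
      using openE[of "X0 \<inter> \<Omega>" x0] X0 \<Omega> x0 by blast
    obtain d3 where d3: "d3 > 0" "\<And>x. norm (x - x0) < d3 \<Longrightarrow>
       norm (u (0, x) - u (0, x0) - h' (x - x0)) \<le> \<epsilon> * norm (x - x0)"
      using h \<epsilon>(1) unfolding has_derivative_at_alt by blast
    define d where "d = min (d1 / 4) (min d2 d3)"
    have "norm (u (s, x0 + v) - u (s, x0) - W s v) \<le> e * norm v" if s: "s \<in> ?I" and v: "norm v < d" for s v
    proof -
      let ?x = "x0 + v"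
      have x: "?x \<in> X0" "?x \<in> \<Omega>" using v d2 by (auto simp: d_def dist_norm subset_iff)
      let ?\<eta> = "\<lambda>s. u (s, ?x) - u (s, x0) - W s v"
      have "norm (?\<eta> s) \<le> (norm (?\<eta> 0) + c' * (\<epsilon> * ((1 + K) * norm v))) / (1 - c' * (L + \<epsilon>))"
      proof (rule ode_estimate[OF c'(1) _ _ _ _ s])
        show "0 \<le> L + \<epsilon>" using L \<epsilon> by simp
        show "c' * (L + \<epsilon>) < 1" using a2 a by simp
        fix s assume s: "s \<in> ?I"
        show "(?\<eta> has_vector_derivative F (s, ?x, u (s, ?x)) - F (s, x0, u (s, x0)) - (A s (W s v) + B s v)) (at s within ?I)"
          by (intro has_vector_derivative_diff du dW s x x0)
        let ?q = "(s, ?x, u (s, ?x))"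
        let ?R = "F ?q - F (q0 s) - F' (q0 s) (?q - q0 s)"
        have qq: "?q - q0 s = (0, v, u (s, ?x) - u (s, x0))" by (simp add: q0_def)
        have du1: "norm (u (s, ?x) - u (s, x0)) \<le> d1 / 4" using X0(3) x s by (auto simp: dist_norm)
        have nq: "norm (?q - q0 s) \<le> norm v + norm (u (s, ?x) - u (s, x0))"
          unfolding qq using norm_Pair_le[of "0::real" "(v, u (s, ?x) - u (s, x0))"]
            norm_Pair_le[of v "u (s, ?x) - u (s, x0)"] by simp
        then have "norm (?q - q0 s) < d1" using du1 v d1(1) unfolding d_def by auto
        then have R: "norm ?R \<le> \<epsilon> * norm (?q - q0 s)" using d1(2) s by blast
        have "u (s, ?x) - u (s, x0) = ?\<eta> s + W s v" by simp
        then have "norm (u (s, ?x) - u (s, x0)) \<le> norm (?\<eta> s) + norm (W s v)"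
          using norm_triangle_ineq by metis
        also have "norm (W s v) \<le> K * norm v"
          using norm_blinfun[of "W s" v] mult_right_mono[OF K[OF s] norm_ge_zero[of v]] by linarith
        finally have "norm (?q - q0 s) \<le> norm (?\<eta> s) + (1 + K) * norm v"
          using nq by (simp add: algebra_simps)
        then have R': "norm ?R \<le> \<epsilon> * (norm (?\<eta> s) + (1 + K) * norm v)"
          using R mult_left_mono[of _ _ \<epsilon>] \<epsilon>(1) by (meson less_imp_le order_trans)
        have "F' (q0 s) (?q - q0 s) = A s (u (s, ?x) - u (s, x0)) + B s v" unfolding qq AB ..
        then have "F (s, ?x, u (s, ?x)) - F (s, x0, u (s, x0)) - (A s (W s v) + B s v) = A s (?\<eta> s) + ?R"
          by (simp add: q0_def blinfun.diff_right)
        then have "norm (F (s, ?x, u (s, ?x)) - F (s, x0, u (s, x0)) - (A s (W s v) + B s v)) \<le> norm (A s (?\<eta> s)) + norm ?R"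
          using norm_triangle_ineq by metis
        also have "norm (A s (?\<eta> s)) \<le> L * norm (?\<eta> s)"
          using norm_blinfun[of "A s" "?\<eta> s"] mult_right_mono[OF nA[OF s] norm_ge_zero[of "?\<eta> s"]] by linarith
        finally show "norm (F (s, ?x, u (s, ?x)) - F (s, x0, u (s, x0)) - (A s (W s v) + B s v))
            \<le> (L + \<epsilon>) * norm (?\<eta> s) + \<epsilon> * ((1 + K) * norm v)"
          using R' by (simp add: algebra_simps)
      qed
      also have "\<dots> \<le> (\<epsilon> * norm v + c' * (\<epsilon> * ((1 + K) * norm v))) / (1 - c' * (L + \<epsilon>))"
        using d3(2)[of ?x] v a2 a by (intro divide_right_mono add_right_mono) (auto simp: W(1) d_def)
      also have "\<dots> = (\<epsilon> * b) * norm v / (1 - c' * (L + \<epsilon>))" by (simp add: b_def algebra_simps)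
      also have "\<dots> \<le> (e * (a / 2)) * norm v / (a / 2)"
        using \<epsilon>(3) a2 a e by (intro frac_le mult_right_mono) (auto intro!: mult_nonneg_nonneg)
      also have "\<dots> = e * norm v" using a by simp
      finally show ?thesis .
    qed
    moreover have "d > 0" using d1 d2 d3 by (simp add: d_def)
    ultimately show ?thesis by blast
  qed
  show ?thesis
  proof (rule that[of W])
    fix s assume s: "s \<in> ?I"
    show "((\<lambda>x. u (s, x)) has_derivative blinfun_apply (W s)) (at x0)"
      unfolding has_derivative_at_alt
    proof (intro conjI allI impI)
      show "bounded_linear (blinfun_apply (W s))" by (rule blinfun.bounded_linear_right)
      fix e :: real assume "e > 0"
      then obtain d where d: "d > 0" "\<forall>s\<in>?I. \<forall>v. norm v < d \<longrightarrow> norm (u (s, x0 + v) - u (s, x0) - W s v) \<le> e * norm v"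
        using small by blast
      show "\<exists>d>0. \<forall>y. norm (y - x0) < d \<longrightarrow> norm (u (s, y) - u (s, x0) - W s (y - x0)) \<le> e * norm (y - x0)"
        using d s by (intro exI[of _ d] conjI allI impI) (auto dest!: bspec[of _ _ s] spec[of _ "_ - x0"])
    qed
    show "((\<lambda>s. W s v) has_vector_derivative
       frechet_derivative F (at (s, x0, u (s, x0))) (0, v, W s v)) (at s within ?I)" for v
      using dW[OF s, of v] AB[of s v "W s v"] F'(3)[OF q0[OF s]] by (simp add: q0_def)
  qed (rule W(1))
qed

text \<open>The directional derivatives of \<open>u\<close> in the parameter solve the variational equation, which
  is linear with the same Lipschitz constant, and whose coefficients have one derivative less.
  So each step of the induction leads back to an equation of the same kind.\<close>

lemma ode_param_Ck:
  fixes F :: "real \<times> 'p::euclidean_space \<times> 'b::euclidean_space \<Rightarrow> 'b"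
  assumes L: "0 \<le> L" "c * L < 1" and \<Omega>: "open \<Omega>"
    and "open O'" "Ck_on k ({-c<..<c} \<times> \<Omega> \<times> O') F"
    and "\<And>s x y y'. s \<in> {-c<..<c} \<Longrightarrow> x \<in> \<Omega> \<Longrightarrow> y \<in> O' \<Longrightarrow> y' \<in> O' \<Longrightarrow>
      norm (F (s, x, y) - F (s, x, y')) \<le> L * norm (y - y')"
    and "\<And>s x. s \<in> {-c<..<c} \<Longrightarrow> x \<in> \<Omega> \<Longrightarrow> u (s, x) \<in> O' \<and>
      ((\<lambda>s. u (s, x)) has_vector_derivative F (s, x, u (s, x))) (at s)"
    and "\<And>x. x \<in> \<Omega> \<Longrightarrow> u (0, x) = h x" "Ck_on k \<Omega> h"
  shows "Ck_on k ({-c<..<c} \<times> \<Omega>) u"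
  using assms(4-)
proof (induction k arbitrary: F u h O')
  case 0
  have "continuous_on ({-c<..<c} \<times> \<Omega>) u"
    by (rule ode_param_continuous[OF L \<Omega>, of O' F u h]) (use 0 in auto)
  then show ?case by simp
next
  case (Suc k)
  let ?J = "{-c<..<c}"
  note O = Suc.prems(1) and F = Suc.prems(2) and lip = Suc.prems(3) and u = Suc.prems(4)
    and u0 = Suc.prems(5) and h = Suc.prems(6)
  have uk: "Ck_on k (?J \<times> \<Omega>) u"
    by (rule Suc.IH[OF O Ck_on_Suc_imp[OF F] lip u u0 Ck_on_Suc_imp[OF h]])
  note cu = Ck_on_imp_continuous_on[OF uk]
  have Q: "open (?J \<times> \<Omega> \<times> O')" and J\<Omega>: "open (?J \<times> \<Omega>)" and T: "open (?J \<times> \<Omega> \<times> (UNIV :: 'b set))"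
    using \<Omega> O by (auto intro!: open_Times)
  define w where "w v p = frechet_derivative (\<lambda>x. u (fst p, x)) (at (snd p)) v" for v p
  have D: "((\<lambda>x. u (s, x)) has_derivative (\<lambda>v. w v (s, x))) (at x) \<and>
      (\<forall>v. ((\<lambda>s. w v (s, x)) has_vector_derivative frechet_derivative F (at (s, x, u (s, x))) (0, v, w v (s, x))) (at s))
      \<and> (\<forall>v. w v (0, x) = frechet_derivative h (at x) v)" if s: "s \<in> ?J" and x: "x \<in> \<Omega>" for s x
  proof -
    define c' where "c' = (\<bar>s\<bar> + c) / 2"
    have c': "0 < c'" "c' < c" "\<bar>s\<bar> < c'" using s by (auto simp: c'_def abs_less_iff)
    have hd: "(h has_derivative frechet_derivative h (at x)) (at x)" by (rule Ck_on_SucD(1)[OF h x])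
    have hb: "blinfun_apply (Blinfun (frechet_derivative h (at x))) = frechet_derivative h (at x)"
      by (rule bounded_linear_Blinfun_apply[OF has_derivative_bounded_linear[OF hd]])
    have "((\<lambda>x. u (0, x)) has_derivative blinfun_apply (Blinfun (frechet_derivative h (at x)))) (at x)"
      unfolding hb by (rule has_derivative_transform_within_open[OF hd \<Omega> x]) (simp add: u0)
    then obtain W where W: "W 0 = Blinfun (frechet_derivative h (at x))"
      "\<And>s. s \<in> {-c'..c'} \<Longrightarrow> ((\<lambda>x. u (s, x)) has_derivative blinfun_apply (W s)) (at x)"
      "\<And>s v. s \<in> {-c'..c'} \<Longrightarrow> ((\<lambda>s. W s v) has_vector_derivative
         frechet_derivative F (at (s, x, u (s, x))) (0, v, W s v)) (at s within {-c'..c'})"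
      using ode_param_derivative[OF L \<Omega> O F lip u cu x _ c'(1,2)] by blast
    have wW: "w v (s, x) = W s v" if "s \<in> {-c'..c'}" for s v
      using frechet_derivative_at[OF W(2)[OF that]] by (simp add: w_def)
    have sI: "s \<in> {-c'..c'}" "s \<in> {-c'<..<c'}" using c' by auto
    have "((\<lambda>s. w v (s, x)) has_vector_derivative frechet_derivative F (at (s, x, u (s, x))) (0, v, w v (s, x))) (at s)" for v
    proof (rule has_vector_derivative_transform_within_open[OF _ open_greaterThanLessThan sI(2)])
      have "at s within {-c'..c'} = at s"
        using sI(2) by (intro at_within_interior) simp
      then show "((\<lambda>s. W s v) has_vector_derivative frechet_derivative F (at (s, x, u (s, x))) (0, v, w v (s, x))) (at s)"
        using W(3)[OF sI(1), of v] wW[OF sI(1)] by simp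
    qed (use wW in auto)
    moreover have "((\<lambda>x. u (s, x)) has_derivative (\<lambda>v. w v (s, x))) (at x)"
      using W(2)[OF sI(1)] wW[OF sI(1)] by simp
    moreover have "w v (0, x) = frechet_derivative h (at x) v" for v
      using wW[of 0 v] W(1) hb c' by simp
    ultimately show ?thesis by blast
  qed
  have inner: "Ck_inner k (?J \<times> \<Omega>) (\<lambda>p. (fst p, snd p, u p))"
    by (intro Ck_inner_Pair J\<Omega> Ck_inner_linear bounded_linear_fst bounded_linear_snd Ck_inner_euclidean uk)
  have inQ: "(fst p, snd p, u p) \<in> ?J \<times> \<Omega> \<times> O'" if "p \<in> ?J \<times> \<Omega>" for p
    using u[of "fst p" "snd p"] that by (auto simp: mem_Times_iff)
  have wk: "Ck_on k (?J \<times> \<Omega>) (w v)" for v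
  proof -
    define G where "G = (\<lambda>(s, x, \<omega>::'b). frechet_derivative F (at (s, x, u (s, x))) (0, v, \<omega>))"
    have lin: "bounded_linear (frechet_derivative F (at (s, x, u (s, x))))" if "s \<in> ?J" "x \<in> \<Omega>" for s x
      using Ck_on_SucD(1)[OF F inQ[of "(s, x)"]] that has_derivative_bounded_linear by auto
    have proj: "bounded_linear (\<lambda>q :: real \<times> 'p \<times> 'b. (fst q, fst (snd q)))"
      by (intro bounded_linear_Pair bounded_linear_fst bounded_linear_compose[OF bounded_linear_fst bounded_linear_snd])
    have d: "Ck_on k (?J \<times> \<Omega> \<times> (UNIV :: 'b set)) (\<lambda>q. frechet_derivative F (at (fst q, fst (snd q), u (fst q, fst (snd q)))) e)" for e
    proof -
      have "Ck_on k (?J \<times> \<Omega>) (\<lambda>p. frechet_derivative F (at (fst p, snd p, u p)) e)"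
        by (rule Ck_on_compose[OF J\<Omega> Ck_on_SucD(2)[OF F] inner inQ])
      from Ck_on_compose[OF T this Ck_inner_linear[OF proj]] show ?thesis by auto
    qed
    have G: "Ck_on k (?J \<times> \<Omega> \<times> (UNIV :: 'b set)) G"
    proof (rule Ck_on_cong[OF T])
      have sw: "bounded_linear (\<lambda>q :: real \<times> 'p \<times> 'b. snd (snd q) \<bullet> b)" for b
        by (rule bounded_linear_compose[OF bounded_linear_inner_left bounded_linear_compose[OF bounded_linear_snd bounded_linear_snd]])
      show "Ck_on k (?J \<times> \<Omega> \<times> (UNIV :: 'b set))
        (\<lambda>q. frechet_derivative F (at (fst q, fst (snd q), u (fst q, fst (snd q)))) (0, v, 0) +
          (\<Sum>b\<in>Basis. (snd (snd q) \<bullet> b) *\<^sub>R frechet_derivative F (at (fst q, fst (snd q), u (fst q, fst (snd q)))) (0, 0, b)))"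
        by (intro Ck_on_add T Ck_on_sum Ck_on_scaleR d Ck_on_bounded_linear[OF sw])
    next
      fix q assume q: "q \<in> ?J \<times> \<Omega> \<times> (UNIV :: 'b set)"
      obtain s x \<omega> where qe: "q = (s, x, \<omega>)" "s \<in> ?J" "x \<in> \<Omega>" using q by auto
      interpret l: bounded_linear "frechet_derivative F (at (s, x, u (s, x)))" by (rule lin[OF qe(2,3)])
      have "(0::real, v, \<omega>) = (0, v, 0) + (\<Sum>b\<in>Basis. (\<omega> \<bullet> b) *\<^sub>R (0, 0, b))"
        using euclidean_representation[of \<omega>]
        by (auto simp: prod_eq_iff fst_sum snd_sum)
      then have "G q = frechet_derivative F (at (s, x, u (s, x))) ((0, v, 0) + (\<Sum>b\<in>Basis. (\<omega> \<bullet> b) *\<^sub>R (0, 0, b)))"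
        by (simp only: G_def qe(1) prod.case)
      then show "frechet_derivative F (at (fst q, fst (snd q), u (fst q, fst (snd q)))) (0, v, 0) +
          (\<Sum>b\<in>Basis. (snd (snd q) \<bullet> b) *\<^sub>R frechet_derivative F (at (fst q, fst (snd q), u (fst q, fst (snd q)))) (0, 0, b)) = G q"
        by (simp only: l.add l.sum l.scaleR qe(1) fst_conv snd_conv)
    qed
    show ?thesis
    proof (rule Suc.IH[OF open_UNIV G, of "w v" "\<lambda>x. frechet_derivative h (at x) v"])
      show "norm (G (s, x, y) - G (s, x, y')) \<le> L * norm (y - y')" if sx: "s \<in> ?J" "x \<in> \<Omega>" for s x y y'
      proof -
        let ?f = "frechet_derivative F (at (s, x, u (s, x)))"
        have Fd: "(F has_derivative ?f) (at (s, x, u (s, x)))"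
          using Ck_on_SucD(1)[OF F inQ[of "(s, x)"]] sx by auto
        have ins: "((\<lambda>y. (s, x, y)) has_derivative (\<lambda>w. (0, 0, w))) (at (u (s, x)))"
          by (auto intro!: derivative_eq_intros)
        have d: "((\<lambda>y. F (s, x, y)) has_derivative (\<lambda>w. ?f (0, 0, w))) (at (u (s, x)))"
          using diff_chain_at[OF ins Fd] by (simp add: o_def)
        have uO: "u (s, x) \<in> O'" using u[OF sx] by simp
        have "norm (?f (0, 0, y - y')) \<le> L * norm (y - y')"
          by (rule derivative_norm_le_lipschitz[OF d O uO]) (use lip[OF sx _ uO] in auto)
        moreover have "G (s, x, y) - G (s, x, y') = ?f (0, 0, y - y')"
          using linear_diff[OF bounded_linear.linear[OF lin[OF sx]], of "(0, v, y)" "(0, v, y')"] by (simp add: G_def)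
        ultimately show ?thesis by simp
      qed
      show "w v (s, x) \<in> UNIV \<and> ((\<lambda>s. w v (s, x)) has_vector_derivative G (s, x, w v (s, x))) (at s)"
        if "s \<in> ?J" "x \<in> \<Omega>" for s x using D[OF that] by (simp add: G_def)
      show "w v (0, x) = frechet_derivative h (at x) v" if "x \<in> \<Omega>" for x
      proof (cases "0 \<in> ?J")
        case True
        then show ?thesis using D that by blast
      next
        case False
        have hd: "(h has_derivative frechet_derivative h (at x)) (at x)" by (rule Ck_on_SucD(1)[OF h that])
        have "((\<lambda>x. u (0, x)) has_derivative frechet_derivative h (at x)) (at x)"
          by (rule has_derivative_transform_within_open[OF hd \<Omega> that]) (simp add: u0)
        from frechet_derivative_at[OF this] show ?thesis by (simp add: w_def)
      qed
      show "Ck_on k \<Omega> (\<lambda>x. frechet_derivative h (at x) v)" by (rule Ck_on_SucD(2)[OF h])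
    qed
  qed
  have Fu: "Ck_on k (?J \<times> \<Omega>) (\<lambda>p. F (fst p, snd p, u p))"
    by (rule Ck_on_compose[OF J\<Omega> Ck_on_Suc_imp[OF F] inner inQ])
  show ?case
  proof (rule Ck_on_SucI[OF _ _ J\<Omega>])
    fix p assume p: "p \<in> ?J \<times> \<Omega>"
    obtain s0 x0 where pe: "p = (s0, x0)" "s0 \<in> ?J" "x0 \<in> \<Omega>" using p by auto
    have "((\<lambda>(x, s). u (s, x)) has_derivative
        (\<lambda>(tx, ts). w tx (s0, x0) + blinfun_scaleR_left (F (s0, x0, u (s0, x0))) ts)) (at (x0, s0) within \<Omega> \<times> ?J)"
    proof (rule has_derivative_partialsI[where f = "\<lambda>x s. u (s, x)" and fx = "\<lambda>v. w v (s0, x0)"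
         and fy = "\<lambda>x s. blinfun_scaleR_left (F (s, x, u (s, x)))"])
      show "((\<lambda>x. u (s0, x)) has_derivative (\<lambda>v. w v (s0, x0))) (at x0 within \<Omega>)"
        using D[OF pe(2,3)] has_derivative_at_withinI by blast
      show "((\<lambda>s. u (s, x)) has_derivative blinfun_apply (blinfun_scaleR_left (F (s, x, u (s, x))))) (at s within ?J)"
        if "x \<in> \<Omega>" "s \<in> ?J" for x s
      proof -
        have "((\<lambda>s. u (s, x)) has_derivative (\<lambda>h. h *\<^sub>R F (s, x, u (s, x)))) (at s)"
          using u[OF that(2,1)] by (simp add: has_vector_derivative_def)
        then show ?thesis by (simp add: has_derivative_at_withinI)
      qed
      have sw: "continuous_on (\<Omega> \<times> ?J) (\<lambda>q. (\<lambda>p. F (fst p, snd p, u p)) (snd q, fst q))"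
        by (rule continuous_on_compose2[OF Ck_on_imp_continuous_on[OF Fu]]) (auto intro!: continuous_intros)
      have "continuous_on (\<Omega> \<times> ?J) (\<lambda>q. blinfun_scaleR_left (F (snd q, fst q, u (snd q, fst q))))"
        by (rule bounded_linear.continuous_on[OF bounded_linear_blinfun_scaleR_left]) (use sw in simp)
      then show "continuous (at (x0, s0) within \<Omega> \<times> ?J) (\<lambda>(x, s). blinfun_scaleR_left (F (s, x, u (s, x))))"
        using pe by (simp add: continuous_on_eq_continuous_within case_prod_unfold)
    qed (use pe in auto)
    moreover have "at (x0, s0) within \<Omega> \<times> ?J = at (x0, s0)"
      using pe \<Omega> by (intro at_within_open open_Times) auto
    ultimately have d: "((\<lambda>q. u (snd q, fst q)) has_derivative
        (\<lambda>q. w (fst q) (s0, x0) + snd q *\<^sub>R F (s0, x0, u (s0, x0)))) (at (x0, s0))"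
      by (simp add: case_prod_unfold)
    have sw: "((\<lambda>q. (snd q, fst q)) has_derivative (\<lambda>q. (snd q, fst q))) (at (s0, x0))"
      by (auto intro!: derivative_eq_intros)
    have "((\<lambda>q. u (snd q, fst q)) has_derivative
        (\<lambda>q. w (fst q) (s0, x0) + snd q *\<^sub>R F (s0, x0, u (s0, x0)))) (at (snd (s0, x0), fst (s0, x0)))"
      using d by simp
    from diff_chain_at[OF sw this]
    show "(u has_derivative (\<lambda>q. w (snd q) p + fst q *\<^sub>R F (fst p, snd p, u p))) (at p)"
      by (simp add: o_def pe(1))
  next
    fix q :: "real \<times> 'p"
    show "Ck_on k (?J \<times> \<Omega>) (\<lambda>p. w (snd q) p + fst q *\<^sub>R F (fst p, snd p, u p))"
      by (intro Ck_on_add J\<Omega> wk Ck_on_scaleR Ck_on_const Fu)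
  qed
qed

text \<open>The interval of times is short enough for the contraction argument to be uniform in the initial
  value, so that \<open>ode_param_Ck\<close> gives smoothness jointly in the time and the initial value. The last
  conclusion is the group law for opposite times, by uniqueness of solutions.\<close>

theorem local_flow:
  fixes X :: "'b::euclidean_space \<Rightarrow> 'b"
  assumes O: "open O'" "z0 \<in> O'" and X: "smooth_on O' X"
  obtains c \<rho> \<phi> where "c > 0" "\<rho> > 0" "smooth_on ({-c<..<c} \<times> ball z0 \<rho>) \<phi>"
    "\<And>z. z \<in> ball z0 \<rho> \<Longrightarrow> \<phi> (0, z) = z"
    "\<And>s z. s \<in> {-c<..<c} \<Longrightarrow> z \<in> ball z0 \<rho> \<Longrightarrow> \<phi> (s, z) \<in> O'"
    "\<And>s z. s \<in> {-c<..<c} \<Longrightarrow> z \<in> ball z0 \<rho> \<Longrightarrow>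
      ((\<lambda>s. \<phi> (s, z)) has_vector_derivative X (\<phi> (s, z))) (at s)"
    "\<forall>\<^sub>F p in nhds (0, z0). \<phi> (- fst p, \<phi> p) = snd p"
proof -
  have X1: "Ck_on (Suc 0) O' X" using X by (simp add: smooth_on_def del: Ck_on.simps)
  obtain X' where X': "continuous_on O' X'"
    "\<And>q. q \<in> O' \<Longrightarrow> (X has_derivative blinfun_apply (X' q)) (at q)"
    using Ck_on_blinfun_derivative[OF X1] by metis
  obtain r where r: "r > 0" "cball z0 r \<subseteq> O'" using O open_contains_cball by blast
  define \<rho> where "\<rho> = r / 2"
  have \<rho>: "\<rho> > 0" using r by (simp add: \<rho>_def)
  have "bounded (X' ` cball z0 r)" "bounded (X ` cball z0 r)"
    using continuous_on_subset[OF X'(1) r(2)] continuous_on_subset[OF smooth_on_continuous_on[OF X] r(2)]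
    by (auto intro!: compact_imp_bounded compact_continuous_image)
  then obtain L B where L: "\<And>q. q \<in> cball z0 r \<Longrightarrow> norm (X' q) \<le> L" and B: "\<And>q. q \<in> cball z0 r \<Longrightarrow> norm (X q) \<le> B"
    unfolding bounded_iff by (metis imageI)
  have z0r: "z0 \<in> cball z0 r" using r by simp
  have L0: "L \<ge> 0" and B0: "B \<ge> 0" using order_trans[OF norm_ge_zero L[OF z0r]] order_trans[OF norm_ge_zero B[OF z0r]] by auto
  have lip: "norm (X y - X y') \<le> L * norm (y - y')" if "y \<in> cball z0 r" "y' \<in> cball z0 r" for y y'
  proof (rule differentiable_bound[OF convex_cball _ _ that])
    show "(X has_derivative blinfun_apply (X' x)) (at x within cball z0 r)" if "x \<in> cball z0 r" for x
      using X'(2) that r(2) has_derivative_at_withinI by blast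
    show "onorm (blinfun_apply (X' x)) \<le> L" if "x \<in> cball z0 r" for x
      using L[OF that] by (simp add: norm_blinfun.rep_eq)
  qed
  define c where "c = min (\<rho> / (B + 1)) (1 / (2 * (L + 1)))"
  have c: "c > 0" "c * L < 1" "c * B \<le> \<rho>"
  proof -
    show c0: "c > 0" using \<rho> L0 B0 by (simp add: c_def)
    have "c * (L + 1) \<le> (1 / (2 * (L + 1))) * (L + 1)" using L0 by (intro mult_right_mono) (auto simp: c_def)
    also have "\<dots> = 1 / 2" using L0 by simp
    finally show "c * L < 1" using c0 by (simp add: distrib_left)
    have "c * (B + 1) \<le> (\<rho> / (B + 1)) * (B + 1)" using B0 by (intro mult_right_mono) (auto simp: c_def)
    also have "\<dots> = \<rho>" using B0 by simp
    finally show "c * B \<le> \<rho>" using c0 by (simp add: distrib_left)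
  qed
  have sub: "cball z \<rho> \<subseteq> cball z0 r" "cball z \<rho> \<subseteq> ball z0 r" if "z \<in> ball z0 \<rho>" for z
  proof -
    have "dist z0 y < r" if "dist z y \<le> \<rho>" for y
      using dist_triangle[of z0 y z] that \<open>z \<in> ball z0 \<rho>\<close> by (simp add: \<rho>_def)
    then show "cball z \<rho> \<subseteq> cball z0 r" "cball z \<rho> \<subseteq> ball z0 r" by (auto simp: less_imp_le)
  qed
  have "\<exists>u. u 0 = z \<and> (\<forall>s\<in>{-c..c}. u s \<in> cball z \<rho> \<and> (u has_vector_derivative X (u s)) (at s within {-c..c}))"
    if z: "z \<in> ball z0 \<rho>" for z
  proof -
    have cX: "continuous_on (cball z \<rho>) X"
      using sub(1)[OF z] r(2) by (intro continuous_on_subset[OF smooth_on_continuous_on[OF X]]) auto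
    obtain u where "u 0 = z" "\<And>s. s \<in> {-c..c} \<Longrightarrow> u s \<in> cball z \<rho>"
      "\<And>s. s \<in> {-c..c} \<Longrightarrow> (u has_vector_derivative X (u s)) (at s within {-c..c})"
    proof (rule picard_lindelof[OF c(1), of z \<rho> "\<lambda>_. X" L B])
      show "continuous_on ({-c..c} \<times> cball z \<rho>) (\<lambda>(s, y). X y)"
        unfolding split_beta by (rule continuous_on_compose2[OF cX]) (auto intro!: continuous_intros)
      show "norm (X y) \<le> B" if "y \<in> cball z \<rho>" for y using B sub(1)[OF z] that by blast
      show "norm (X y - X y') \<le> L * norm (y - y')" if "y \<in> cball z \<rho>" "y' \<in> cball z \<rho>" for y y'
        using lip sub(1)[OF z] that by blast
    qed (use c \<rho> L0 in auto)
    then show ?thesis by blast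
  qed
  then obtain U where U: "\<And>z. z \<in> ball z0 \<rho> \<Longrightarrow> U z 0 = z \<and>
     (\<forall>s\<in>{-c..c}. U z s \<in> cball z \<rho> \<and> (U z has_vector_derivative X (U z s)) (at s within {-c..c}))"
    by metis
  define \<phi> where "\<phi> p = U (snd p) (fst p)" for p
  have \<phi>0: "\<phi> (0, z) = z" if "z \<in> ball z0 \<rho>" for z using U[OF that] by (simp add: \<phi>_def)
  have \<phi>r: "\<phi> (s, z) \<in> ball z0 r" if "s \<in> {-c<..<c}" "z \<in> ball z0 \<rho>" for s z
  proof -
    have "s \<in> {-c..c}" using that by auto
    then have "U z s \<in> cball z \<rho>" using U[OF that(2)] by blast
    then show ?thesis using sub(2)[OF that(2)] unfolding \<phi>_def by auto
  qed
  have \<phi>d: "((\<lambda>s. \<phi> (s, z)) has_vector_derivative X (\<phi> (s, z))) (at s)"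
    if "s \<in> {-c<..<c}" "z \<in> ball z0 \<rho>" for s z
  proof -
    have "at s within {-c..c} = at s" using that by (intro at_within_interior) simp
    moreover have "s \<in> {-c..c}" using that by auto
    then have "(U z has_vector_derivative X (U z s)) (at s within {-c..c})" using U[OF that(2)] by blast
    ultimately show ?thesis unfolding \<phi>_def by simp
  qed
  have sm: "smooth_on ({-c<..<c} \<times> ball z0 \<rho>) \<phi>" unfolding smooth_on_def
  proof
    fix k
    show "Ck_on k ({-c<..<c} \<times> ball z0 \<rho>) \<phi>"
    proof (rule ode_param_Ck[OF L0 c(2) open_ball open_ball[of z0 r], where F = "\<lambda>q. X (snd (snd q))" and h = "\<lambda>x. x"])
      show "Ck_on k ({-c<..<c} \<times> ball z0 \<rho> \<times> ball z0 r) (\<lambda>q. X (snd (snd q)))"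
        by (rule Ck_on_compose[of _ k O'])
          (use X r in \<open>auto simp: smooth_on_def subset_iff intro!: open_Times Ck_inner_linear
             bounded_linear_compose[OF bounded_linear_snd bounded_linear_snd]\<close>)
    qed (use lip \<phi>r \<phi>d \<phi>0 Ck_on_bounded_linear[OF bounded_linear_ident] in auto)
  qed
  have "\<forall>\<^sub>F p in nhds (0, z0). \<phi> (- fst p, \<phi> p) = snd p"
  proof -
    have opn: "open ({-c<..<c} \<times> ball z0 \<rho>)" by (intro open_Times) auto
    have "isCont \<phi> (0, z0)"
      using smooth_on_continuous_on[OF sm] opn \<rho> c by (auto simp: continuous_on_eq_continuous_at)
    then have "(\<phi> \<longlongrightarrow> z0) (nhds (0, z0))"
      using tendsto_at_iff_tendsto_nhds[of \<phi> "(0, z0)"] \<phi>0[of z0] \<rho> by (simp add: isCont_def)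
    then have "\<forall>\<^sub>F p in nhds (0, z0). \<phi> p \<in> ball z0 \<rho>"
      using \<rho> by (intro topological_tendstoD[OF _ open_ball]) auto
    moreover have "\<forall>\<^sub>F p in nhds (0, z0). p \<in> {-(c/2)<..<c/2} \<times> ball z0 \<rho>"
      using c \<rho> by (intro eventually_nhds_in_open open_Times) auto
    ultimately show ?thesis
    proof eventually_elim
      case (elim p)
      obtain s z where p: "p = (s, z)" by force
      then have sz: "\<bar>s\<bar> < c / 2" "z \<in> ball z0 \<rho>" "\<phi> (s, z) \<in> ball z0 \<rho>" using elim by auto
      have c2: "(c / 2) * L < 1" using c L0 mult_nonneg_nonneg[of c L] by simp
      have range: "s + t \<in> {-c<..<c}" "t \<in> {-c<..<c}" if "t \<in> {-(c/2)..c/2}" for t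
        using that sz(1) c by (auto simp: abs_less_iff)
      have "\<phi> (t, \<phi> (s, z)) = \<phi> (s + t, z)" if t: "t \<in> {-(c/2)..c/2}" for t
      proof (rule ode_unique[OF _ L0 c2, where F = "\<lambda>_. X" and u = "\<lambda>t. \<phi> (t, \<phi> (s, z))" and v = "\<lambda>t. \<phi> (s + t, z)"])
        show "((\<lambda>t. \<phi> (t, \<phi> (s, z))) has_vector_derivative X (\<phi> (t, \<phi> (s, z)))) (at t within {-(c/2)..c/2})"
          if "t \<in> {-(c/2)..c/2}" for t
          by (rule has_vector_derivative_at_within[OF \<phi>d[OF range(2)[OF that] sz(3)]])
        show "((\<lambda>t. \<phi> (s + t, z)) has_vector_derivative X (\<phi> (s + t, z))) (at t within {-(c/2)..c/2})"
          if "t \<in> {-(c/2)..c/2}" for t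
        proof (rule has_vector_derivative_at_within)
          have 1: "((\<lambda>t. s + t) has_vector_derivative 1) (at t)" by (auto intro!: derivative_eq_intros)
          show "((\<lambda>t. \<phi> (s + t, z)) has_vector_derivative X (\<phi> (s + t, z))) (at t)"
            using vector_diff_chain_at[OF 1 \<phi>d[OF range(1)[OF that] sz(2)]] by (simp add: o_def)
        qed
        show "norm (X (\<phi> (t, \<phi> (s, z))) - X (\<phi> (s + t, z))) \<le> L * norm (\<phi> (t, \<phi> (s, z)) - \<phi> (s + t, z))"
          if "t \<in> {-(c/2)..c/2}" for t
          using \<phi>r[OF range(2)[OF that] sz(3)] \<phi>r[OF range(1)[OF that] sz(2)] by (intro lip) auto
        show "\<phi> (0, \<phi> (s, z)) = \<phi> (s + 0, z)" using \<phi>0[OF sz(3)] by simp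
      qed (use c t in auto)
      moreover have "-s \<in> {-(c/2)..c/2}" using sz(1) by (auto simp: abs_less_iff)
      ultimately have "\<phi> (- s, \<phi> (s, z)) = \<phi> (s + - s, z)" by blast
      then show ?case using \<phi>0[OF sz(2)] by (simp add: p)
    qed
  qed
  moreover have "\<phi> (s, z) \<in> O'" if "s \<in> {-c<..<c}" "z \<in> ball z0 \<rho>" for s z
    using \<phi>r[OF that] r(2) by auto
  ultimately show ?thesis using that[OF c(1) \<rho> sm \<phi>0 _ \<phi>d] by blast
qed

section \<open>Boxes near generic points\<close>

lemma near_generic_pointsI:
  assumes "\<And>O'. open O' \<Longrightarrow> O' \<noteq> {} \<Longrightarrow>
    \<exists>I U t x. open I \<and> is_interval I \<and> open U \<and> t \<in> I \<and> x \<in> U \<and> (t, x) \<in> O' \<and> P I U"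
  shows "near_generic_points P"
proof -
  define G where "G = \<Union>{I \<times> U | I U. open I \<and> is_interval I \<and> open U \<and> P I U}"
  have "open G" unfolding G_def by (intro open_Union) (auto intro: open_Times)
  moreover have "closure G = UNIV"
  proof (rule ccontr)
    assume "closure G \<noteq> UNIV"
    then have "- closure G \<noteq> {}" by auto
    then obtain I U t x where "open I" "is_interval I" "open U" "t \<in> I" "x \<in> U" "(t, x) \<in> - closure G" "P I U"
      using assms[of "- closure G"] by (auto simp: open_Compl)
    then have "(t, x) \<in> G" unfolding G_def by blast
    then show False using \<open>(t, x) \<in> - closure G\<close> closure_subset by auto
  qed
  moreover have "\<exists>I U. open I \<and> is_interval I \<and> t0 \<in> I \<and> open U \<and> x0 \<in> U \<and> P I U" if "(t0, x0) \<in> G" for t0 x0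
    using that unfolding G_def by blast
  ultimately show ?thesis unfolding near_generic_points_def by blast
qed

lemma near_generic_points_box:
  assumes "near_generic_points P" "open O'" "O' \<noteq> {}"
  obtains I U I1 U1 t x where "P I U" "open I1" "is_interval I1" "open U1" "t \<in> I1" "x \<in> U1"
    "I1 \<subseteq> I" "U1 \<subseteq> U" "I1 \<times> U1 \<subseteq> O'"
proof -
  obtain G where G: "open G" "closure G = UNIV"
    "\<forall>(t0, x0)\<in>G. \<exists>I U. open I \<and> is_interval I \<and> t0 \<in> I \<and> open U \<and> x0 \<in> U \<and> P I U"
    using assms(1) unfolding near_generic_points_def by blast
  have "O' \<inter> G \<noteq> {}" using open_Int_closure_eq_empty[OF assms(2), of G] G(2) assms(3) by auto
  then obtain t x where tx: "(t, x) \<in> O'" "(t, x) \<in> G" by auto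
  then obtain I U where IU: "open I" "is_interval I" "t \<in> I" "open U" "x \<in> U" "P I U" using G(3) by auto
  have "open (O' \<inter> I \<times> U)" using assms(2) IU by (intro open_Int open_Times)
  then obtain A B where AB: "open A" "open B" "(t, x) \<in> A \<times> B" "A \<times> B \<subseteq> O' \<inter> I \<times> U"
    using open_prod_elim[of "O' \<inter> I \<times> U" "(t, x)"] tx IU by blast
  obtain e where e: "e > 0" "ball t e \<subseteq> A" using AB openE by blast
  show ?thesis
  proof (rule that[of I U "ball t e" B t x])
    show "ball t e \<subseteq> I" "B \<subseteq> U" "ball t e \<times> B \<subseteq> O'" using AB e(2) by auto
  qed (use e AB IU in \<open>auto simp: is_interval_ball_real\<close>)
qed

section \<open>Autonomous fields and local solutions\<close>

lemma smooth_on_autonomization: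
  assumes "open S" "smooth_on S (\<lambda>(t, x). X t x)"
  shows "smooth_on S (autonomization X)"
  using smooth_on_Pair[OF assms(1) smooth_on_const assms(2), of 1]
  by (simp add: autonomization_def case_prod_unfold)

lemma fst_autonomization [simp]: "fst (autonomization X z) = 1"
  by (simp add: autonomization_def case_prod_unfold)

lemma frechet_derivative_eq_sum_Basis:
  fixes f :: "'a::euclidean_space \<Rightarrow> 'b::real_normed_vector"
  assumes "(f has_derivative frechet_derivative f (at z)) (at z)"
  shows "frechet_derivative f (at z) v = (\<Sum>b\<in>Basis. (v \<bullet> b) *\<^sub>R frechet_derivative f (at z) b)"
proof -
  interpret l: bounded_linear "frechet_derivative f (at z)" using assms by (rule has_derivative_bounded_linear)
  have "frechet_derivative f (at z) (\<Sum>b\<in>Basis. (v \<bullet> b) *\<^sub>R b) = (\<Sum>b\<in>Basis. (v \<bullet> b) *\<^sub>R frechet_derivative f (at z) b)"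
    by (simp only: l.sum l.scaleR)
  then show ?thesis by (simp only: euclidean_representation)
qed

lemma smooth_on_lie_bracket:
  fixes A B :: "'a::euclidean_space \<Rightarrow> 'a"
  assumes S: "open S" and AB: "smooth_on S A" "smooth_on S B"
  shows "smooth_on S (lie_bracket A B)"
proof -
  have 1: "smooth_on S (\<lambda>z. frechet_derivative B (at z) (A z))" if "smooth_on S A" "smooth_on S B" for A B :: "'a \<Rightarrow> 'a"
  proof (rule smooth_on_cong[OF S])
    show "smooth_on S (\<lambda>z. \<Sum>b\<in>Basis. (A z \<bullet> b) *\<^sub>R frechet_derivative B (at z) b)"
      by (intro smooth_on_sum smooth_on_scaleR S smooth_on_linear_comp[OF bounded_linear_inner_left S that(1)]
          smooth_on_frechet_derivative that(2))
  qed (simp add: frechet_derivative_eq_sum_Basis[OF smooth_on_has_derivative[OF that(2)]])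
  show ?thesis unfolding lie_bracket_def[abs_def] by (intro smooth_on_diff S 1 AB)
qed

lemma fst_frechet_derivative_eq_0:
  fixes A :: "'a::real_normed_vector \<Rightarrow> real \<times> 'b::real_normed_vector"
  assumes S: "open S" "z \<in> S" and A: "(A has_derivative A') (at z)" "\<And>z. z \<in> S \<Longrightarrow> fst (A z) = c"
  shows "fst (A' v) = 0"
proof -
  have "((\<lambda>z. fst (A z)) has_derivative (\<lambda>v. 0)) (at z)"
    by (rule has_derivative_transform_within_open[OF has_derivative_const[of c] S]) (simp add: A(2))
  from has_derivative_unique[OF this has_derivative_fst[OF A(1)]] show ?thesis by (simp add: fun_eq_iff)
qed

lemma fst_lie_bracket_eq_0:
  assumes "open S" "z \<in> S" "smooth_on S A" "smooth_on S B"
    "\<And>z. z \<in> S \<Longrightarrow> fst (A z) = (1::real)" "\<And>z. z \<in> S \<Longrightarrow> fst (B z) = 1"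
  shows "fst (lie_bracket A B z) = 0"
  using fst_frechet_derivative_eq_0[OF assms(1,2) smooth_on_has_derivative[OF assms(3,2)] assms(5)]
    fst_frechet_derivative_eq_0[OF assms(1,2) smooth_on_has_derivative[OF assms(4,2)] assms(6)]
  by (simp add: lie_bracket_def)

lemma fst_integral_curve:
  fixes u :: "real \<Rightarrow> real \<times> 'b::real_normed_vector"
  assumes u: "\<And>s. s \<in> {-c<..<c} \<Longrightarrow> (u has_vector_derivative X (u s)) (at s)"
    and X: "\<And>s. s \<in> {-c<..<c} \<Longrightarrow> fst (X (u s)) = 1" and s: "s \<in> {-c<..<c}"
  shows "fst (u s) = fst (u 0) + s"
proof -
  have d: "((\<lambda>s. fst (u s) - s) has_vector_derivative 0) (at s within {-c<..<c})" if s: "s \<in> {-c<..<c}" for s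
  proof (rule has_vector_derivative_at_within)
    have "((\<lambda>s. fst (u s)) has_vector_derivative fst (X (u s))) (at s)"
      using u[OF s] by (rule bounded_linear.has_vector_derivative[OF bounded_linear_fst])
    then show "((\<lambda>s. fst (u s) - s) has_vector_derivative 0) (at s)"
      using X[OF s] by (auto intro!: derivative_eq_intros)
  qed
  obtain k where "\<And>s. s \<in> {-c<..<c} \<Longrightarrow> fst (u s) - s = k"
    using has_vector_derivative_zero_constant[OF convex_real_interval(8)[of "-c" c] d] by blast
  from this[OF s] this[of 0] show ?thesis using s by auto
qed

lemma local_solution:
  fixes Y :: "real \<Rightarrow> real ^ 'n \<Rightarrow> real ^ 'n"
  assumes "smooth_on UNIV (\<lambda>(t, x). Y t x)"
  obtains e x where "e > 0" "x t0 = x0" "is_solution Y (ball t0 e) x"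
proof -
  obtain c \<rho> \<phi> where \<phi>: "c > 0" "\<rho> > 0" "\<And>z. z \<in> ball (t0, x0) \<rho> \<Longrightarrow> \<phi> (0, z) = z"
    "\<And>s z. s \<in> {-c<..<c} \<Longrightarrow> z \<in> ball (t0, x0) \<rho> \<Longrightarrow>
      ((\<lambda>s. \<phi> (s, z)) has_vector_derivative autonomization Y (\<phi> (s, z))) (at s)"
    by (rule local_flow[OF open_UNIV UNIV_I smooth_on_autonomization[OF open_UNIV assms], of "(t0, x0)"])
      (rule that, assumption+)
  define u where "u s = \<phi> (s, (t0, x0))" for s
  have du: "(u has_vector_derivative autonomization Y (u s)) (at s)" if "s \<in> {-c<..<c}" for s
    unfolding u_def using \<phi>(4)[OF that, of "(t0, x0)"] \<phi>(2) by simp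
  have u0: "u 0 = (t0, x0)" using \<phi>(2,3) by (simp add: u_def)
  have fu: "fst (u s) = t0 + s" if "s \<in> {-c<..<c}" for s
    using fst_integral_curve[OF du _ that] u0 by simp
  show ?thesis
  proof (rule that[of c "\<lambda>s. snd (u (s - t0))"])
    show "is_solution Y (ball t0 c) (\<lambda>s. snd (u (s - t0)))" unfolding is_solution_def
    proof (intro conjI ballI)
      fix s assume s: "s \<in> ball t0 c"
      then have s': "s - t0 \<in> {-c<..<c}" by (auto simp: dist_real_def)
      have "((\<lambda>s. s - t0) has_vector_derivative 1) (at s)" by (auto intro!: derivative_eq_intros)
      from vector_diff_chain_at[OF this du[OF s']]
      have "((\<lambda>s. u (s - t0)) has_vector_derivative autonomization Y (u (s - t0))) (at s)" by (simp add: o_def)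
      from bounded_linear.has_vector_derivative[OF bounded_linear_snd this]
      show "((\<lambda>s. snd (u (s - t0))) has_vector_derivative Y s (snd (u (s - t0)))) (at s)"
        using fu[OF s'] by (simp add: autonomization_def case_prod_unfold)
    qed (auto simp: is_interval_ball_real)
  qed (use \<phi>(1) u0 in auto)
qed

lemma is_solution_subset:
  "is_solution Y J x \<Longrightarrow> open K \<Longrightarrow> is_interval K \<Longrightarrow> K \<subseteq> J \<Longrightarrow> is_solution Y K x"
  unfolding is_solution_def by blast

lemma local_solutions:
  fixes Y :: "real \<Rightarrow> real ^ 'n \<Rightarrow> real ^ 'n"
  assumes "smooth_on UNIV (\<lambda>(t, x). Y t x)" "finite A"
  shows "\<exists>e>0. \<exists>xs. \<forall>a\<in>A. xs a t0 = x0 a \<and> is_solution Y (ball t0 e) (xs a)"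
  using assms(2)
proof (induction A rule: finite_induct)
  case empty
  show ?case by (intro exI[of _ 1]) auto
next
  case (insert b A)
  obtain e xs where e: "e > 0" "\<forall>a\<in>A. xs a t0 = x0 a \<and> is_solution Y (ball t0 e) (xs a)" using insert.IH by blast
  obtain e' x where e': "e' > 0" "x t0 = x0 b" "is_solution Y (ball t0 e') x" using local_solution[OF assms(1)] by metis
  have sub: "is_solution Y (ball t0 (min e e')) y" if "is_solution Y (ball t0 e) y \<or> is_solution Y (ball t0 e') y" for y
    using that is_solution_subset[of Y _ y "ball t0 (min e e')"] by (auto simp: is_interval_ball_real subset_ball)
  show ?case
    by (rule exI[of _ "min e e'"], rule conjI, use e(1) e'(1) in simp, rule exI[of _ "xs(b := x)"])
      (use e e' sub insert.hyps in auto)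
qed

section \<open>From a superposition rule to a finite-dimensional module\<close>

text \<open>The fields that are generated from the autonomizations by brackets, with the bracket added
  to one of its arguments, so that the coefficient of \<open>\<partial>/\<partial>t\<close> remains \<open>1\<close>.\<close>

inductive_set bracket_closure :: "('v::real_normed_vector \<Rightarrow> 'v) set \<Rightarrow> ('v \<Rightarrow> 'v) set" for B where
  base: "A \<in> B \<Longrightarrow> A \<in> bracket_closure B"
| step: "A \<in> bracket_closure B \<Longrightarrow> A' \<in> bracket_closure B \<Longrightarrow> (\<lambda>z. A z + lie_bracket A A' z) \<in> bracket_closure B"

lemma bracket_closure_smooth:
  fixes B :: "(real \<times> 'b::euclidean_space \<Rightarrow> real \<times> 'b) set"
  assumes "\<And>A. A \<in> B \<Longrightarrow> smooth_on UNIV A \<and> (\<forall>z. fst (A z) = 1)" "A \<in> bracket_closure B"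
  shows "smooth_on UNIV A \<and> (\<forall>z. fst (A z) = 1)"
  using assms(2)
proof induction
  case (step A A')
  then show ?case
    using smooth_on_add[OF open_UNIV _ smooth_on_lie_bracket[OF open_UNIV], of A A A']
      fst_lie_bracket_eq_0[OF open_UNIV UNIV_I, of A A'] by auto
qed (use assms(1) in auto)

text \<open>The field \<open>C z = e0 + (\<Sum>i\<in>F. \<beta> i z *\<^sub>R e i)\<close> is mapped to \<open>B\<close> by \<open>G\<close>, and this relation is
  differentiated in the direction \<open>v\<close>. It is only required along the line through \<open>w\<close>, because the
  relations for a superposition rule hold on a subspace that is not open.\<close>

lemma related_derivative:
  fixes G :: "'e::real_normed_vector \<Rightarrow> 'f::real_normed_vector"
  assumes W: "open W" "w \<in> W" and G: "smooth_on W G" and F: "finite F"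
    and \<beta>: "\<And>i. i \<in> F \<Longrightarrow> ((\<beta> i) has_derivative \<beta>' i) (at w)"
    and B: "(B has_derivative B') (at (G w))"
    and rel: "\<And>s. w + s *\<^sub>R v \<in> W \<Longrightarrow>
      frechet_derivative G (at (w + s *\<^sub>R v)) (e0 + (\<Sum>i\<in>F. \<beta> i (w + s *\<^sub>R v) *\<^sub>R e i)) = B (G (w + s *\<^sub>R v))"
  shows "B' (frechet_derivative G (at w) v) = frechet_derivative G (at w) (\<Sum>i\<in>F. \<beta>' i v *\<^sub>R e i)
    + frechet_derivative (\<lambda>z. frechet_derivative G (at z) v) (at w) (e0 + (\<Sum>i\<in>F. \<beta> i w *\<^sub>R e i))"
proof -
  let ?D = "\<lambda>u z. frechet_derivative G (at z) u"
  have lin: "bounded_linear (frechet_derivative G (at z))" if "z \<in> W" for z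
    using smooth_on_has_derivative[OF G that] by (rule has_derivative_bounded_linear)
  have D: "((?D u) has_derivative frechet_derivative (?D u) (at w)) (at w)" for u
    by (rule smooth_on_has_derivative[OF smooth_on_frechet_derivative[OF G] W(2)])
  have line: "((\<lambda>s. w + s *\<^sub>R v) has_derivative (\<lambda>s. s *\<^sub>R v)) (at (0::real))"
    by (auto intro!: derivative_eq_intros)
  have comp: "((\<lambda>s. f (w + s *\<^sub>R v)) has_vector_derivative f' v) (at 0)"
    if "(f has_derivative f') (at w)" for f :: "'e \<Rightarrow> 'g::real_normed_vector" and f'
  proof -
    have "(f has_derivative f') (at (w + 0 *\<^sub>R v))" using that by simp
    from diff_chain_at[OF line this] show ?thesis
      unfolding has_vector_derivative_def o_def
      by (simp add: linear_scale[OF bounded_linear.linear[OF has_derivative_bounded_linear[OF that]]])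
  qed
  define f where "f s = ?D e0 (w + s *\<^sub>R v) + (\<Sum>i\<in>F. \<beta> i (w + s *\<^sub>R v) *\<^sub>R ?D (e i) (w + s *\<^sub>R v))" for s
  have 1: "(f has_vector_derivative frechet_derivative (?D e0) (at w) v +
      (\<Sum>i\<in>F. \<beta> i w *\<^sub>R frechet_derivative (?D (e i)) (at w) v + \<beta>' i v *\<^sub>R ?D (e i) w)) (at 0)"
  proof -
    have "((\<lambda>s. \<beta> i (w + s *\<^sub>R v) *\<^sub>R ?D (e i) (w + s *\<^sub>R v)) has_vector_derivative
      (\<beta> i w *\<^sub>R frechet_derivative (?D (e i)) (at w) v + \<beta>' i v *\<^sub>R ?D (e i) w)) (at 0)" if "i \<in> F" for i
    proof -
      have "((\<lambda>s. \<beta> i (w + s *\<^sub>R v)) has_real_derivative \<beta>' i v) (at 0)"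
        using comp[OF \<beta>[OF that]] by (simp add: has_real_derivative_iff_has_vector_derivative)
      from has_vector_derivative_scaleR[OF this comp[OF D]] show ?thesis by simp
    qed
    then show ?thesis unfolding f_def
      by (intro has_vector_derivative_add has_vector_derivative_sum comp[OF D])
  qed
  have "((\<lambda>s. G (w + s *\<^sub>R v)) has_vector_derivative ?D v w) (at 0)"
    by (rule comp[OF smooth_on_has_derivative[OF G W(2)]])
  note dG = this[unfolded has_vector_derivative_def]
  have "(B has_derivative B') (at (G (w + 0 *\<^sub>R v)))" using B by simp
  from diff_chain_at[OF dG this]
  have 2: "((\<lambda>s. B (G (w + s *\<^sub>R v))) has_vector_derivative B' (?D v w)) (at 0)"
    using linear_scale[OF bounded_linear.linear[OF has_derivative_bounded_linear[OF B]]]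
    by (simp add: has_vector_derivative_def o_def)
  have "(f has_vector_derivative B' (?D v w)) (at 0)"
  proof -
    have op: "open ((\<lambda>s. w + s *\<^sub>R v) -` W)" by (intro open_vimage W continuous_intros)
    have eq: "B (G (w + s *\<^sub>R v)) = f s" if "s \<in> (\<lambda>s. w + s *\<^sub>R v) -` W" for s
    proof -
      have s: "w + s *\<^sub>R v \<in> W" using that by simp
      interpret l: bounded_linear "frechet_derivative G (at (w + s *\<^sub>R v))" by (rule lin[OF s])
      show ?thesis using rel[OF s] by (simp add: f_def l.add l.sum l.scaleR)
    qed
    show ?thesis
      by (rule has_vector_derivative_transform_within_open[OF 2 op _ eq]) (use W in auto)
  qed
  from vector_derivative_unique_at[OF this 1]
  have *: "B' (?D v w) = frechet_derivative (?D e0) (at w) v +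
      (\<Sum>i\<in>F. \<beta> i w *\<^sub>R frechet_derivative (?D (e i)) (at w) v + \<beta>' i v *\<^sub>R ?D (e i) w)" .
  interpret l: bounded_linear "frechet_derivative G (at w)" by (rule lin[OF W(2)])
  interpret S: bounded_linear "frechet_derivative (?D v) (at w)" using D by (rule has_derivative_bounded_linear)
  have sym: "frechet_derivative (?D u) (at w) v = frechet_derivative (?D v) (at w) u" for u
    by (rule smooth_on_symmetric[OF W(1) G W(2)])
  show ?thesis unfolding * sym by (simp add: S.add S.sum S.scaleR l.sum l.scaleR sum.distrib)
qed

text \<open>The points of the tuple \<open>p\<close> move along \<open>A\<close> and the constants \<open>k\<close> are at rest. The coefficient of
  \<open>\<partial>/\<partial>t\<close> is taken at an arbitrary point, since it is always \<open>1\<close> below.\<close>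

definition prolong :: "nat \<Rightarrow> (real \<times> 'b::euclidean_space \<Rightarrow> real \<times> 'b) \<Rightarrow>
    real \<times> (nat \<Rightarrow>\<^sub>C 'b) \<times> 'b \<Rightarrow> real \<times> (nat \<Rightarrow>\<^sub>C 'b) \<times> 'b" where
  "prolong m A w = (fst (A (fst w, 0)), fin_seq {1..m} (\<lambda>a. snd (A (fst w, apply_bcontfun (fst (snd w)) a))), 0)"

definition graph_map :: "(real \<Rightarrow> (nat \<Rightarrow>\<^sub>C 'b) \<Rightarrow> 'b \<Rightarrow> 'b) \<Rightarrow> real \<times> (nat \<Rightarrow>\<^sub>C 'b::euclidean_space) \<times> 'b \<Rightarrow> real \<times> 'b" where
  "graph_map \<Phi> w = (fst w, \<Phi> (fst w) (fst (snd w)) (snd (snd w)))"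

text \<open>This is the infinitesimal form of the statement that \<open>\<Phi>\<close> maps solutions to solutions. A
  superposition rule is only applied to sequences that vanish outside of \<open>{1..m}\<close>, so that the relation
  is restricted to them.\<close>

definition compatible :: "nat \<Rightarrow> (real \<times> (nat \<Rightarrow>\<^sub>C 'b::euclidean_space) \<times> 'b) set \<Rightarrow>
    (real \<Rightarrow> (nat \<Rightarrow>\<^sub>C 'b) \<Rightarrow> 'b \<Rightarrow> 'b) \<Rightarrow> (real \<times> 'b \<Rightarrow> real \<times> 'b) \<Rightarrow> bool" where
  "compatible m W \<Phi> A \<longleftrightarrow> (\<forall>w\<in>W. fst (snd w) \<in> range (fin_seq {1..m}) \<longrightarrow>
     frechet_derivative (graph_map \<Phi>) (at w) (prolong m A w) = A (graph_map \<Phi> w))"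

lemma smooth_on_graph_map:
  assumes "open W" "smooth_on W (\<lambda>(t, p, k). \<Phi> t p k)"
  shows "smooth_on W (graph_map \<Phi>)"
  using smooth_on_Pair[OF assms(1) smooth_inner_imp_smooth_on[OF assms(1) smooth_inner_linear[OF bounded_linear_fst]] assms(2)]
  by (simp add: graph_map_def[abs_def] case_prod_unfold)

text \<open>The prolongation varies only in finitely many directions, which is the form of fields that
  \<open>related_derivative\<close> asks for.\<close>

lemma prolong_derivative:
  fixes A :: "real \<times> 'b::euclidean_space \<Rightarrow> real \<times> 'b" and m :: nat
  assumes A: "smooth_on UNIV A" "\<And>z. fst (A z) = 1"
  defines "F \<equiv> {1..m} \<times> (Basis :: 'b set)"
  defines "e \<equiv> \<lambda>(a, b::'b). (0::real, sgl a b, 0::'b)"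
  defines "\<beta> \<equiv> \<lambda>(a, b) w. snd (A (fst w, apply_bcontfun (fst (snd w)) a)) \<bullet> b"
  defines "\<beta>' \<equiv> \<lambda>w (a, b) v. snd (frechet_derivative A (at (fst w, apply_bcontfun (fst (snd w)) a))
        (fst v, apply_bcontfun (fst (snd v)) a)) \<bullet> b"
  shows "prolong m A w = (1, 0, 0) + (\<Sum>i\<in>F. \<beta> i w *\<^sub>R e i)"
    and "((\<beta> i) has_derivative \<beta>' w i) (at w)"
    and "(\<Sum>i\<in>F. \<beta>' w i v *\<^sub>R e i) = (0, fin_seq {1..m} (\<lambda>a. snd (frechet_derivative A (at (fst w, apply_bcontfun (fst (snd w)) a))
        (fst v, apply_bcontfun (fst (snd v)) a))), 0)"
proof -
  have exp: "(\<Sum>(a, b)\<in>F. (g a \<bullet> b) *\<^sub>R e (a, b)) = (0, fin_seq {1..m} g, 0)" for g :: "nat \<Rightarrow> 'b"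
  proof -
    have "(\<Sum>(a, b)\<in>F. (g a \<bullet> b) *\<^sub>R e (a, b)) = (\<Sum>a\<in>{1..m}. \<Sum>b\<in>Basis. (0, sgl a ((g a \<bullet> b) *\<^sub>R b), 0))"
      unfolding F_def sum.cartesian_product[symmetric] e_def
      by (simp add: linear_scale[OF bounded_linear.linear[OF bounded_linear_sgl]])
    also have "\<dots> = (\<Sum>a\<in>{1..m}. (0, \<Sum>b\<in>Basis. sgl a ((g a \<bullet> b) *\<^sub>R b), 0))"
      by (intro sum.cong refl) (auto simp: prod_eq_iff fst_sum snd_sum)
    also have "\<dots> = (\<Sum>a\<in>{1..m}. (0, sgl a (g a), 0))"
    proof (intro sum.cong refl)
      fix a
      have "(\<Sum>b\<in>Basis. sgl a ((g a \<bullet> b) *\<^sub>R b)) = sgl a (\<Sum>b\<in>Basis. (g a \<bullet> b) *\<^sub>R b)"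
        by (rule linear_sum[OF bounded_linear.linear[OF bounded_linear_sgl], symmetric])
      then show "(0, \<Sum>b\<in>Basis. sgl a ((g a \<bullet> b) *\<^sub>R b), 0) = (0, sgl a (g a), 0)"
        by (simp only: euclidean_representation)
    qed
    also have "\<dots> = (0, fin_seq {1..m} g, 0)"
      by (simp add: prod_eq_iff fst_sum snd_sum fin_seq_eq_sum[of "{Suc 0..m}" g])
    finally show ?thesis .
  qed
  show "prolong m A w = (1, 0, 0) + (\<Sum>i\<in>F. \<beta> i w *\<^sub>R e i)"
    using exp[of "\<lambda>a. snd (A (fst w, apply_bcontfun (fst (snd w)) a))"]
    by (simp add: prolong_def A(2) \<beta>_def case_prod_unfold)
  show "(\<Sum>i\<in>F. \<beta>' w i v *\<^sub>R e i) = (0, fin_seq {1..m} (\<lambda>a. snd (frechet_derivative A (at (fst w, apply_bcontfun (fst (snd w)) a))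
        (fst v, apply_bcontfun (fst (snd v)) a))), 0)"
    using exp[of "\<lambda>a. snd (frechet_derivative A (at (fst w, apply_bcontfun (fst (snd w)) a))
        (fst v, apply_bcontfun (fst (snd v)) a))"]
    by (simp add: \<beta>'_def case_prod_unfold)
  obtain a b where i: "i = (a, b)" by force
  have bl: "bounded_linear (\<lambda>v :: real \<times> (nat \<Rightarrow>\<^sub>C 'b) \<times> 'b. (fst v, apply_bcontfun (fst (snd v)) a))"
    by (intro bounded_linear_Pair bounded_linear_fst
        bounded_linear_compose[OF bounded_linear_apply_bcontfun] bounded_linear_compose[OF bounded_linear_fst bounded_linear_snd])
  have "((\<lambda>w. A (fst w, apply_bcontfun (fst (snd w)) a)) has_derivative
     (\<lambda>v. frechet_derivative A (at (fst w, apply_bcontfun (fst (snd w)) a)) (fst v, apply_bcontfun (fst (snd v)) a))) (at w)"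
    using diff_chain_at[OF bounded_linear_imp_has_derivative[OF bl] smooth_on_has_derivative[OF A(1) UNIV_I]]
    by (simp add: o_def)
  from has_derivative_inner_left[OF has_derivative_snd[OF this], of b]
  show "((\<beta> i) has_derivative \<beta>' w i) (at w)" by (simp add: i \<beta>_def \<beta>'_def)
qed

lemma fin_seq_range_line:
  assumes "p \<in> range (fin_seq S)" "finite S"
  shows "p + s *\<^sub>R fin_seq S x \<in> range (fin_seq S)"
proof -
  obtain y where "p = fin_seq S y" using assms(1) by blast
  then have "p + s *\<^sub>R fin_seq S x = fin_seq S (\<lambda>a. y a + s *\<^sub>R x a)"
    by (intro bcontfun_eqI) (simp add: apply_fin_seq assms(2))
  then show ?thesis by blast
qed

text \<open>The relation for \<open>B\<close> is differentiated along the prolongation of \<open>A\<close>, and conversely. The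
  second derivatives of \<open>\<Phi>\<close> cancel in the difference, by symmetry.\<close>

lemma compatible_bracket:
  fixes A B :: "real \<times> 'b::euclidean_space \<Rightarrow> real \<times> 'b"
  assumes W: "open W" and \<Phi>: "smooth_on W (\<lambda>(t, p, k). \<Phi> t p k)"
    and A: "smooth_on UNIV A" "\<And>z. fst (A z) = 1" "compatible m W \<Phi> A"
    and B: "smooth_on UNIV B" "\<And>z. fst (B z) = 1" "compatible m W \<Phi> B"
  shows "compatible m W \<Phi> (\<lambda>z. A z + lie_bracket A B z)"
  unfolding compatible_def
proof (intro ballI impI)
  fix w assume w: "w \<in> W" and R: "fst (snd w) \<in> range (fin_seq {1..m})"
  let ?G = "graph_map \<Phi>"
  let ?p = "\<lambda>a. (fst w, apply_bcontfun (fst (snd w)) a)"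
  note G = smooth_on_graph_map[OF W \<Phi>]
  interpret l: bounded_linear "frechet_derivative ?G (at w)"
    using smooth_on_has_derivative[OF G w] by (rule has_derivative_bounded_linear)
  have half: "frechet_derivative B (at (?G w)) (A (?G w)) =
      frechet_derivative ?G (at w) (0, fin_seq {1..m} (\<lambda>a. snd (frechet_derivative B (at (?p a)) (A (?p a)))), 0)
      + frechet_derivative (\<lambda>z. frechet_derivative ?G (at z) (prolong m A w)) (at w) (prolong m B w)"
    if A: "smooth_on UNIV A" "\<And>z. fst (A z) = 1" "compatible m W \<Phi> A"
    and B: "smooth_on UNIV B" "\<And>z. fst (B z) = 1" "compatible m W \<Phi> B"
    for A B :: "real \<times> 'b \<Rightarrow> real \<times> 'b"
  proof -
    let ?v = "prolong m A w"
    note P1 = prolong_derivative(1)[where m = m, OF B(1,2)]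
      and P2 = prolong_derivative(2)[OF B(1,2)] and P3 = prolong_derivative(3)[where m = m, OF B(1,2)]
    have rel: "frechet_derivative ?G (at (w + s *\<^sub>R ?v)) (prolong m B (w + s *\<^sub>R ?v)) = B (?G (w + s *\<^sub>R ?v))"
      if "w + s *\<^sub>R ?v \<in> W" for s
    proof -
      have "fst (snd (w + s *\<^sub>R ?v)) \<in> range (fin_seq {1..m})"
        using fin_seq_range_line[OF R] by (simp add: prolong_def)
      then show ?thesis using B(3) that unfolding compatible_def by blast
    qed
    have Bd: "(B has_derivative frechet_derivative B (at (?G w))) (at (?G w))"
      by (rule smooth_on_has_derivative[OF B(1) UNIV_I])
    have "frechet_derivative B (at (?G w)) (frechet_derivative ?G (at w) ?v) =
       frechet_derivative ?G (at w) (0, fin_seq {1..m} (\<lambda>a. snd (frechet_derivative B (at (?p a)) (fst ?v, apply_bcontfun (fst (snd ?v)) a))), 0)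
      + frechet_derivative (\<lambda>z. frechet_derivative ?G (at z) ?v) (at w) (prolong m B w)"
      unfolding P3[symmetric] P1[of w]
      by (rule related_derivative[OF W w G _ P2 Bd]) (use rel P1 in auto)
    moreover have "frechet_derivative ?G (at w) ?v = A (?G w)"
      using A(3) w R unfolding compatible_def by blast
    moreover have "fin_seq {1..m} (\<lambda>a. snd (frechet_derivative B (at (?p a)) (fst ?v, apply_bcontfun (fst (snd ?v)) a))) =
        fin_seq {1..m} (\<lambda>a. snd (frechet_derivative B (at (?p a)) (A (?p a))))"
    proof (rule bcontfun_eqI)
      fix a
      have "(fst ?v, apply_bcontfun (fst (snd ?v)) a) = A (?p a)" if "a \<in> {1..m}"
        using that A(2) by (simp add: prolong_def apply_fin_seq prod_eq_iff)
      then show "apply_bcontfun (fin_seq {1..m} (\<lambda>a. snd (frechet_derivative B (at (?p a)) (fst ?v, apply_bcontfun (fst (snd ?v)) a)))) a =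
        apply_bcontfun (fin_seq {1..m} (\<lambda>a. snd (frechet_derivative B (at (?p a)) (A (?p a))))) a"
        by (simp add: apply_fin_seq)
    qed
    ultimately show ?thesis by simp
  qed
  have sym: "frechet_derivative (\<lambda>z. frechet_derivative ?G (at z) (prolong m A w)) (at w) (prolong m B w) =
      frechet_derivative (\<lambda>z. frechet_derivative ?G (at z) (prolong m B w)) (at w) (prolong m A w)"
    by (rule smooth_on_symmetric[OF W G w])
  let ?X = "\<lambda>A B. (0::real, fin_seq {1..m} (\<lambda>a. snd (frechet_derivative B (at (?p a)) (A (?p a)))), 0::'b)"
  have "prolong m (\<lambda>z. A z + lie_bracket A B z) w = prolong m A w + (?X A B - ?X B A)"
  proof -
    have "fst (lie_bracket A B z) = 0" for z
      by (rule fst_lie_bracket_eq_0[OF open_UNIV UNIV_I A(1) B(1)]) (use A B in auto)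
    moreover have "fin_seq {1..m} (\<lambda>a. snd (A (?p a)) + snd (lie_bracket A B (?p a))) =
       fin_seq {1..m} (\<lambda>a. snd (A (?p a))) + (fst (snd (?X A B)) - fst (snd (?X B A)))"
      by (rule bcontfun_eqI) (simp add: apply_fin_seq lie_bracket_def)
    ultimately show ?thesis by (simp add: prolong_def prod_eq_iff A(2))
  qed
  then have "frechet_derivative ?G (at w) (prolong m (\<lambda>z. A z + lie_bracket A B z) w) =
     frechet_derivative ?G (at w) (prolong m A w) + (frechet_derivative ?G (at w) (?X A B) - frechet_derivative ?G (at w) (?X B A))"
    by (simp only: l.add l.diff)
  also have "frechet_derivative ?G (at w) (prolong m A w) = A (?G w)"
    using A(3) w R unfolding compatible_def by blast
  also have "frechet_derivative ?G (at w) (?X A B) - frechet_derivative ?G (at w) (?X B A) = lie_bracket A B (?G w)"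
    using half[OF A B] half[OF B A] sym by (simp add: lie_bracket_def)
  finally show "frechet_derivative ?G (at w) (prolong m (\<lambda>z. A z + lie_bracket A B z) w) = A (?G w) + lie_bracket A B (?G w)" .
qed

text \<open>For the given systems compatibility holds because \<open>\<Phi>\<close> maps solutions to solutions, and
  solutions exist through all points.\<close>

lemma compatible_autonomization:
  fixes Y :: "'a \<Rightarrow> real \<Rightarrow> real ^ 'n \<Rightarrow> real ^ 'n"
  assumes sr: "superposition_rule_on \<Lambda> Y m I U W \<Phi>" and \<alpha>: "\<alpha> \<in> \<Lambda>"
    and Y: "smooth_on UNIV (\<lambda>(t, x). Y \<alpha> t x)"
  shows "compatible m W \<Phi> (autonomization (Y \<alpha>))"
  unfolding compatible_def
proof (intro ballI impI)
  fix w assume w: "w \<in> W" and "fst (snd w) \<in> range (fin_seq {1..m})"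
  then obtain x where x: "fst (snd w) = fin_seq {1..m} x" by blast
  have W: "open W" and \<Phi>: "smooth_on W (\<lambda>(t, p, k). \<Phi> t p k)"
    and sol: "\<And>J xs k. is_interval J \<Longrightarrow> open J \<Longrightarrow> (\<forall>a\<in>{1..m}. is_solution (Y \<alpha>) J (xs a)) \<Longrightarrow>
        (\<forall>t\<in>J. (t, tup m (\<lambda>a. xs a t), k) \<in> W) \<Longrightarrow> is_solution (Y \<alpha>) J (\<lambda>t. \<Phi> t (tup m (\<lambda>a. xs a t)) k)"
    using sr \<alpha> unfolding superposition_rule_on_def by blast+
  define t0 k where "t0 = fst w" and "k = snd (snd w)"
  obtain e xs where e: "e > 0" and xs: "\<And>a. a \<in> {1..m} \<Longrightarrow> xs a t0 = x a \<and> is_solution (Y \<alpha>) (ball t0 e) (xs a)"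
    using local_solutions[OF Y, of "{1..m}" t0 x] by blast
  define c where "c s = (s, fin_seq {1..m} (\<lambda>a. xs a s), k)" for s
  have c0: "c t0 = w"
  proof -
    have "fin_seq {1..m} (\<lambda>a. xs a t0) = fin_seq {1..m} x"
      by (rule bcontfun_eqI) (use xs in \<open>simp add: apply_fin_seq\<close>)
    then show ?thesis unfolding c_def x[symmetric] by (simp add: t0_def k_def)
  qed
  have dxs: "(xs a has_vector_derivative Y \<alpha> s (xs a s)) (at s)" if "a \<in> {1..m}" "s \<in> ball t0 e" for a s
    using xs[OF that(1)] that(2) unfolding is_solution_def by blast
  have dc: "(c has_vector_derivative (1, fin_seq {1..m} (\<lambda>a. Y \<alpha> s (xs a s)), 0)) (at s)" if "s \<in> ball t0 e" for s
  proof -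
    have "((\<lambda>s. \<Sum>a\<in>{1..m}. sgl a (xs a s)) has_vector_derivative (\<Sum>a\<in>{1..m}. sgl a (Y \<alpha> s (xs a s)))) (at s)"
      by (intro has_vector_derivative_sum bounded_linear.has_vector_derivative[OF bounded_linear_sgl] dxs that)
    then show ?thesis unfolding c_def fin_seq_eq_sum[OF finite_atLeastAtMost]
      by (intro has_vector_derivative_Pair has_vector_derivative_const) auto
  qed
  have "isCont c t0" using dc[of t0] e has_vector_derivative_continuous by fastforce
  then have "(c \<longlongrightarrow> w) (nhds t0)" using tendsto_at_iff_tendsto_nhds[of c t0] c0 by (simp add: isCont_def)
  then have "\<forall>\<^sub>F s in nhds t0. c s \<in> W" by (rule topological_tendstoD[OF _ W w])
  then obtain d where d: "d > 0" "\<And>s. dist s t0 < d \<Longrightarrow> c s \<in> W" unfolding eventually_nhds_metric by blast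
  define J where "J = ball t0 (min d e)"
  have J: "is_interval J" "open J" "t0 \<in> J" "J \<subseteq> ball t0 e" using d e by (auto simp: J_def is_interval_ball_real)
  have "is_solution (Y \<alpha>) J (\<lambda>t. \<Phi> t (tup m (\<lambda>a. xs a t)) k)"
  proof (rule sol[OF J(1,2)])
    show "\<forall>a\<in>{1..m}. is_solution (Y \<alpha>) J (xs a)" using xs J is_solution_subset by blast
    show "\<forall>t\<in>J. (t, tup m (\<lambda>a. xs a t), k) \<in> W"
      using d by (auto simp: J_def c_def tup_eq_fin_seq dist_commute)
  qed
  then have "((\<lambda>t. \<Phi> t (fin_seq {1..m} (\<lambda>a. xs a t)) k) has_vector_derivative
      Y \<alpha> t0 (\<Phi> t0 (fin_seq {1..m} (\<lambda>a. xs a t0)) k)) (at t0)"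
    using J(3) unfolding is_solution_def tup_eq_fin_seq by blast
  then have 1: "((\<lambda>t. graph_map \<Phi> (c t)) has_vector_derivative (1, Y \<alpha> t0 (\<Phi> t0 (fin_seq {1..m} (\<lambda>a. xs a t0)) k))) (at t0)"
    unfolding graph_map_def c_def fst_conv snd_conv
    by (intro has_vector_derivative_Pair has_vector_derivative_id)
  have "(1, Y \<alpha> t0 (\<Phi> t0 (fin_seq {1..m} (\<lambda>a. xs a t0)) k)) = autonomization (Y \<alpha>) (graph_map \<Phi> w)"
    unfolding c0[symmetric] by (simp add: autonomization_def graph_map_def c_def)
  note 1 = 1[unfolded this]
  have G: "(graph_map \<Phi> has_derivative frechet_derivative (graph_map \<Phi>) (at w)) (at (c t0))"
    unfolding c0 by (rule smooth_on_has_derivative[OF smooth_on_graph_map[OF W \<Phi>] w])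
  have pr: "(1, fin_seq {1..m} (\<lambda>a. Y \<alpha> t0 (xs a t0)), 0) = prolong m (autonomization (Y \<alpha>)) w"
  proof -
    have "fin_seq {1..m} (\<lambda>a. Y \<alpha> t0 (xs a t0)) = fin_seq {1..m} (\<lambda>a. Y \<alpha> t0 (apply_bcontfun (fin_seq {1..m} x) a))"
      by (rule bcontfun_eqI) (use xs in \<open>simp add: apply_fin_seq\<close>)
    then show ?thesis by (simp add: prolong_def autonomization_def t0_def[symmetric] x)
  qed
  have "(c has_vector_derivative prolong m (autonomization (Y \<alpha>)) w) (at t0)"
    using dc[of t0] e unfolding pr by simp
  from diff_chain_at[OF this[unfolded has_vector_derivative_def] G]
  have "((\<lambda>t. graph_map \<Phi> (c t)) has_vector_derivative
      frechet_derivative (graph_map \<Phi>) (at w) (prolong m (autonomization (Y \<alpha>)) w)) (at t0)"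
    using linear_scale[OF bounded_linear.linear[OF has_derivative_bounded_linear[OF G]]]
    by (simp add: has_vector_derivative_def o_def)
  from vector_derivative_unique_at[OF this 1]
  show "frechet_derivative (graph_map \<Phi>) (at w) (prolong m (autonomization (Y \<alpha>)) w) = autonomization (Y \<alpha>) (graph_map \<Phi> w)" .
qed

lemma indep_on_card_le:
  assumes "finite S" "finite D" "indep_on D S f"
  shows "card S \<le> card D"
proof -
  obtain q c where q: "\<And>k. k \<in> S \<Longrightarrow> q k \<in> D"
    "\<And>k l. k \<in> S \<Longrightarrow> l \<in> S \<Longrightarrow> (\<Sum>j\<in>S. c k j * f j (q l)) = (if k = l then 1 else 0)"
    by (rule pivots_exist[OF assms(1,3)]) (rule that, assumption+)
  have "inj_on q S"
  proof (rule inj_onI, rule ccontr)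
    fix k l assume kl: "k \<in> S" "l \<in> S" "q k = q l" "k \<noteq> l"
    have "(\<Sum>j\<in>S. c k j * f j (q l)) = 0" "(\<Sum>j\<in>S. c k j * f j (q k)) = 1"
      using q(2)[OF kl(1,2)] q(2)[OF kl(1,1)] kl(4) by simp_all
    then show False using kl(3) by simp
  qed
  then show ?thesis using card_inj_on_le[of q S D] q(1) assms(2) by auto
qed

text \<open>The derivative of the graph map is linear, and the prolongations at \<open>(t, p, k)\<close> only depend on
  the values of the fields at the points of \<open>p\<close>. So a relation between compatible fields at these
  points extends to all points \<open>\<Phi> t p k\<close>. Entry \<open>0\<close> of \<open>p\<close> is always \<open>0\<close>; it is included such that
  there is a point, which forces \<open>(\<Sum>j\<in>S. b j) = 1\<close>, also for \<open>m = 0\<close>.\<close>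

lemma compatible_linear_relation:
  fixes A :: "real \<times> 'b::euclidean_space \<Rightarrow> real \<times> 'b"
  assumes W: "open W" and \<Phi>: "smooth_on W (\<lambda>(t, p, k). \<Phi> t p k)"
    and w: "(t, p, k) \<in> W" "p \<in> range (fin_seq {1..m})"
    and A: "compatible m W \<Phi> A" "\<And>z. fst (A z) = 1"
    and Z: "\<And>j. j \<in> S \<Longrightarrow> compatible m W \<Phi> (Z j)" "\<And>j z. j \<in> S \<Longrightarrow> fst (Z j z) = 1"
    and rel: "\<And>a. a \<in> {0..m} \<Longrightarrow> A (t, apply_bcontfun p a) = (\<Sum>j\<in>S. b j *\<^sub>R Z j (t, apply_bcontfun p a))"
  shows "A (t, \<Phi> t p k) = (\<Sum>j\<in>S. b j *\<^sub>R Z j (t, \<Phi> t p k))"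
proof (cases "finite S")
  case True
  let ?w = "(t, p, k)"
  let ?G = "graph_map \<Phi>"
  have d: "(?G has_derivative frechet_derivative ?G (at ?w)) (at ?w)"
    by (rule smooth_on_has_derivative[OF smooth_on_graph_map[OF W \<Phi>] w(1)])
  interpret l: bounded_linear "frechet_derivative ?G (at ?w)" using d by (rule has_derivative_bounded_linear)
  have c: "frechet_derivative ?G (at ?w) (prolong m X ?w) = X (t, \<Phi> t p k)" if "compatible m W \<Phi> X" for X
    using that w unfolding compatible_def by (auto simp: graph_map_def)
  have "prolong m A ?w = (\<Sum>j\<in>S. b j *\<^sub>R prolong m (Z j) ?w)"
  proof -
    have "1 = (\<Sum>j\<in>S. b j)"
    proof -
      have "fst (A (t, apply_bcontfun p 0)) = fst (\<Sum>j\<in>S. b j *\<^sub>R Z j (t, apply_bcontfun p 0))"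
        using rel[of 0] by simp
      also have "\<dots> = (\<Sum>j\<in>S. b j)" by (simp add: fst_sum Z(2))
      finally show ?thesis using A(2) by simp
    qed
    moreover have "fin_seq {1..m} (\<lambda>a. snd (A (t, apply_bcontfun p a))) =
        (\<Sum>j\<in>S. b j *\<^sub>R fin_seq {1..m} (\<lambda>a. snd (Z j (t, apply_bcontfun p a))))"
      by (rule bcontfun_eqI) (use rel in \<open>auto simp: apply_fin_seq apply_bcontfun_sum snd_sum\<close>)
    ultimately show ?thesis
      by (simp add: prolong_def prod_eq_iff fst_sum snd_sum A(2) Z(2))
  qed
  then have "frechet_derivative ?G (at ?w) (prolong m A ?w) =
      (\<Sum>j\<in>S. b j *\<^sub>R frechet_derivative ?G (at ?w) (prolong m (Z j) ?w))"
    by (simp only: l.sum l.scaleR)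
  then show ?thesis using c A(1) Z(1) by simp
next
  case False
  then show ?thesis using rel[of 0] A(2)[of "(t, apply_bcontfun p 0)"] by simp
qed

text \<open>At a fixed time, the fields of the bracket closure are determined on \<open>U\<close> by their values at the
  points of one generic tuple \<open>p\<close>, because every \<open>x \<in> U\<close> is of the form \<open>\<Phi> t p k\<close>. So at most
  \<open>(m + 1) * (n + 1)\<close> of them are independent. Near a time where the largest number is independent, the
  coefficients with respect to these fields are given by an inverse matrix and hence smooth.\<close>

lemma superposition_rule_imp_module:
  fixes Y :: "'a \<Rightarrow> real \<Rightarrow> real ^ 'n \<Rightarrow> real ^ 'n"
  assumes Y: "\<And>\<alpha>. \<alpha> \<in> \<Lambda> \<Longrightarrow> smooth_on UNIV (\<lambda>(t, x). Y \<alpha> t x)" and \<Lambda>: "\<Lambda> \<noteq> {}"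
    and sr: "superposition_rule_on \<Lambda> Y m I U W \<Phi>"
    and I1: "open I1" "I1 \<noteq> {}" "I1 \<subseteq> I"
  defines "LL \<equiv> bracket_closure ((\<lambda>\<alpha>. autonomization (Y \<alpha>)) ` \<Lambda>)"
  obtains d Z \<beta> t1 e where "1 \<le> d" "d \<le> card ({0..m} \<times> (Basis :: (real \<times> (real ^ 'n)) set))"
    "\<And>j. j \<in> {1..d} \<Longrightarrow> Z j \<in> LL" "e > 0" "ball t1 e \<subseteq> I1"
    "\<And>A j. A \<in> LL \<Longrightarrow> j \<in> {1..d} \<Longrightarrow> smooth_on (ball t1 e) (\<beta> A j)"
    "\<And>A t x. A \<in> LL \<Longrightarrow> t \<in> ball t1 e \<Longrightarrow> x \<in> U \<Longrightarrow> A (t, x) = (\<Sum>j\<in>{1..d}. \<beta> A j t *\<^sub>R Z j (t, x))"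
proof -
  let ?D = "{0..m} \<times> (Basis :: (real \<times> (real ^ 'n)) set)"
  have finD: "finite ?D" by simp
  have W: "open W" and \<Phi>: "smooth_on W (\<lambda>(t, p, k). \<Phi> t p k)"
    and exV: "\<exists>V. open V \<and> V \<inter> range (tup m) \<noteq> {} \<and>
        (\<forall>\<alpha>\<in>\<Lambda>. \<forall>J x xs s.
           is_solution (Y \<alpha>) J x \<and> (\<forall>a\<in>{1..m}. is_solution (Y \<alpha>) J (xs a)) \<and>
           s \<in> J \<and> s \<in> I \<and> x s \<in> U \<and> tup m (\<lambda>a. xs a s) \<in> V \<longrightarrow>
           (\<exists>k. \<forall>\<^sub>F t in nhds s.
              (t, tup m (\<lambda>a. xs a t), k) \<in> W \<and> x t = \<Phi> t (tup m (\<lambda>a. xs a t)) k))"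
    using sr unfolding superposition_rule_on_def by blast+
  obtain V where V: "V \<inter> range (tup m) \<noteq> {}"
      "\<forall>\<alpha>\<in>\<Lambda>. \<forall>J x xs s.
           is_solution (Y \<alpha>) J x \<and> (\<forall>a\<in>{1..m}. is_solution (Y \<alpha>) J (xs a)) \<and>
           s \<in> J \<and> s \<in> I \<and> x s \<in> U \<and> tup m (\<lambda>a. xs a s) \<in> V \<longrightarrow>
           (\<exists>k. \<forall>\<^sub>F t in nhds s.
              (t, tup m (\<lambda>a. xs a t), k) \<in> W \<and> x t = \<Phi> t (tup m (\<lambda>a. xs a t)) k)"
    by (rule exE[OF exV], elim conjE) (rule that, assumption+)
  obtain p0 where p0: "fin_seq {1..m} p0 \<in> V" using V(1) by (auto simp: tup_eq_fin_seq)
  define p where "p = fin_seq {1..m} p0"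
  obtain \<alpha>0 where \<alpha>0: "\<alpha>0 \<in> \<Lambda>" using \<Lambda> by blast
  have onto: "\<exists>k. (t, p, k) \<in> W \<and> \<Phi> t p k = x" if t: "t \<in> I" and x: "x \<in> U" for t x
  proof -
    obtain e xs where e: "e > 0" and xs: "\<And>a. a \<in> {0..m} \<Longrightarrow>
        xs a t = (if a = 0 then x else p0 a) \<and> is_solution (Y \<alpha>0) (ball t e) (xs a)"
      using local_solutions[OF Y[OF \<alpha>0], of "{0..m}" t "\<lambda>a. if a = 0 then x else p0 a"] by blast
    have tp: "tup m (\<lambda>a. xs a t) = p" unfolding p_def tup_eq_fin_seq
      by (rule bcontfun_eqI) (use xs in \<open>auto simp: apply_fin_seq\<close>)
    have "\<exists>k. \<forall>\<^sub>F s in nhds t. (s, tup m (\<lambda>a. xs a s), k) \<in> W \<and> xs 0 s = \<Phi> s (tup m (\<lambda>a. xs a s)) k"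
    proof (rule V(2)[rule_format, OF \<alpha>0, of "ball t e"], intro conjI)
      show "tup m (\<lambda>a. xs a t) \<in> V" unfolding tp p_def by (rule p0)
      show "xs 0 t \<in> U" using xs[of 0] x by simp
      show "is_solution (Y \<alpha>0) (ball t e) (xs 0)" using xs by simp
      show "\<forall>a\<in>{1..m}. is_solution (Y \<alpha>0) (ball t e) (xs a)" using xs by simp
    qed (use e t in auto)
    then obtain k where "(t, tup m (\<lambda>a. xs a t), k) \<in> W \<and> xs 0 t = \<Phi> t (tup m (\<lambda>a. xs a t)) k"
      using eventually_nhds_x_imp_x by blast
    then show ?thesis using tp xs[of 0] by auto
  qed
  have gen: "smooth_on UNIV A \<and> (\<forall>z. fst (A z) = 1)" if "A \<in> (\<lambda>\<alpha>. autonomization (Y \<alpha>)) ` \<Lambda>" for A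
    using that Y smooth_on_autonomization[OF open_UNIV] by (auto simp del: split_paired_All)
  have sm: "smooth_on UNIV A" and f1: "fst (A z) = 1" if "A \<in> LL" for A z
    using bracket_closure_smooth[OF gen that[unfolded LL_def]] by (auto simp del: split_paired_All)
  have comp: "compatible m W \<Phi> A" if "A \<in> LL" for A
    using that unfolding LL_def
  proof induction
    case (base A)
    then show ?case using compatible_autonomization[OF sr _ Y] by blast
  next
    case (step A A')
    then show ?case using sm f1 unfolding LL_def[symmetric]
      by (intro compatible_bracket[OF W \<Phi>]) auto
  qed
  \<comment> \<open>The coordinates of the fields at the points of \<open>p\<close>.\<close>
  define f where "f A t = (\<lambda>(a, b). A (t, apply_bcontfun p a) \<bullet> b)" for A :: "real \<times> (real ^ 'n) \<Rightarrow> real \<times> (real ^ 'n)" and t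
  have smf: "smooth_on UNIV (\<lambda>t. f A t q)" if A: "A \<in> LL" for A q
  proof -
    obtain a b where q: "q = (a, b)" by (cases q)
    have "smooth_on UNIV (\<lambda>t. A (t, apply_bcontfun p a))"
      by (rule smooth_on_compose[OF open_UNIV sm[OF A]
            smooth_inner_Pair[OF open_UNIV smooth_inner_linear[OF bounded_linear_ident] smooth_inner_const]]) simp
    from smooth_on_linear_comp[OF bounded_linear_inner_left open_UNIV this, of b]
    show ?thesis by (simp add: f_def q)
  qed
  define good where "good d \<longleftrightarrow> (\<exists>t\<in>I1. \<exists>Z. (\<forall>j\<in>{1..d}. Z j \<in> LL) \<and> indep_on ?D {1..d} (\<lambda>j. f (Z j) t))" for d :: nat
  have "good 0" using I1(2) by (auto simp: good_def indep_on_def)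
  moreover have bnd: "d \<le> card ?D" if "good d" for d
    using that indep_on_card_le[OF _ finD, of "{1..d}"] unfolding good_def by auto
  ultimately have gm: "good (GREATEST d. good d)" "\<And>d. good d \<Longrightarrow> d \<le> (GREATEST d. good d)"
    using GreatestI_nat[of good 0 "card ?D"] Greatest_le_nat[of good _ "card ?D"] by auto
  define d where "d = (GREATEST d. good d)"
  let ?S = "{1..d}"
  obtain t1 Z where t1: "t1 \<in> I1" and Z: "\<And>j. j \<in> ?S \<Longrightarrow> Z j \<in> LL" and ind: "indep_on ?D ?S (\<lambda>j. f (Z j) t1)"
    using gm(1) unfolding d_def[symmetric] unfolding good_def by blast
  obtain q c0 where q: "\<And>k. k \<in> ?S \<Longrightarrow> q k \<in> ?D"
    and c0: "\<And>j k. j \<in> ?S \<Longrightarrow> k \<in> ?S \<Longrightarrow> (\<Sum>l\<in>?S. f (Z j) t1 (q l) * c0 l k) = (if j = k then 1 else 0)"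
    by (rule pivots_exist[OF finite_atLeastAtMost ind]) (rule that, assumption+)
  have smF: "smooth_on UNIV (\<lambda>t. f (Z j) t (q l))" if "j \<in> ?S" "l \<in> ?S" for j l by (rule smf[OF Z[OF that(1)]])
  obtain N cc where N: "open N" "t1 \<in> N" and cc: "\<And>l k. l \<in> ?S \<Longrightarrow> k \<in> ?S \<Longrightarrow> smooth_on N (cc l k)"
    "\<And>t j k. t \<in> N \<Longrightarrow> j \<in> ?S \<Longrightarrow> k \<in> ?S \<Longrightarrow> (\<Sum>l\<in>?S. f (Z j) t (q l) * cc l k t) = (if j = k then 1 else (0::real))"
    by (rule smooth_right_inverse[OF finite_atLeastAtMost open_UNIV UNIV_I smF c0]) (assumption | rule that)+
  obtain e where e: "e > 0" "ball t1 e \<subseteq> N \<inter> I1"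
    using openE[of "N \<inter> I1" t1] N I1 t1 by blast
  define \<beta> where "\<beta> A k t = (\<Sum>l\<in>?S. f A t (q l) * cc l k t)" for A k t
  have sm\<beta>: "smooth_on (ball t1 e) (\<beta> A k)" if "A \<in> LL" "k \<in> ?S" for A k
  proof -
    have "smooth_on N (\<beta> A k)" unfolding \<beta>_def
      by (intro smooth_on_sum smooth_on_mult N cc(1) that smooth_on_subset[OF smf[OF that(1)]] subset_UNIV)
    then show ?thesis by (rule smooth_on_subset) (use e in auto)
  qed
  have main: "A (t, x) = (\<Sum>j\<in>?S. \<beta> A j t *\<^sub>R Z j (t, x))" if A: "A \<in> LL" and t: "t \<in> ball t1 e" and x: "x \<in> U" for A t x
  proof -
    have tN: "t \<in> N" "t \<in> I1" "t \<in> I" using t e I1 by auto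
    have indt: "indep_on ?D ?S (\<lambda>j. f (Z j) t)"
      by (rule indep_on_right_inverse[where q = q and c = "\<lambda>l k. cc l k t", OF finite_atLeastAtMost q cc(2)[OF tN(1)]])
    define Z' where "Z' = Z(Suc d := A)"
    have ins: "insert (Suc d) ?S = {1..Suc d}" by auto
    have Z'S: "Z' j = Z j" if "j \<in> ?S" for j using that by (auto simp: Z'_def)
    have "\<not> indep_on ?D {1..Suc d} (\<lambda>j. f (Z' j) t)"
    proof
      assume ind': "indep_on ?D {1..Suc d} (\<lambda>j. f (Z' j) t)"
      have "\<forall>j\<in>{1..Suc d}. Z' j \<in> LL" using Z A by (auto simp: Z'_def)
      then have "good (Suc d)" unfolding good_def using tN(2) ind' by blast
      then show False using gm(2) unfolding d_def[symmetric] by fastforce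
    qed
    then have ndep: "\<not> indep_on ?D (insert (Suc d) ?S) (\<lambda>j. f (Z' j) t)" unfolding ins .
    have ind'': "indep_on ?D ?S (\<lambda>j. f (Z' j) t)"
      using indt Z'S unfolding indep_on_def by simp
    obtain b where b: "\<And>q. q \<in> ?D \<Longrightarrow> f (Z' (Suc d)) t q = (\<Sum>j\<in>?S. b j * f (Z' j) t q)"
      by (rule indep_on_insert_dependent[OF finite_atLeastAtMost ind'' ndep]) (simp, rule that)
    have b': "f A t q = (\<Sum>j\<in>?S. b j * f (Z j) t q)" if "q \<in> ?D" for q
      using b[OF that] Z'S by (simp add: Z'_def)
    have bk: "b k = \<beta> A k t" if k: "k \<in> ?S" for k
    proof -
      have "\<beta> A k t = (\<Sum>l\<in>?S. (\<Sum>j\<in>?S. b j * f (Z j) t (q l)) * cc l k t)"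
        unfolding \<beta>_def using b' q by (intro sum.cong) auto
      also have "\<dots> = b k" by (rule sum_right_inverse[where F = "\<lambda>j l. f (Z j) t (q l)" and c = "\<lambda>l k. cc l k t",
          OF finite_atLeastAtMost k cc(2)[OF tN(1) _ k]])
      finally show ?thesis by simp
    qed
    have rel: "A (t, apply_bcontfun p a) = (\<Sum>j\<in>?S. \<beta> A j t *\<^sub>R Z j (t, apply_bcontfun p a))" if a: "a \<in> {0..m}" for a
    proof (rule euclidean_eqI)
      fix i :: "real \<times> (real ^ 'n)" assume i: "i \<in> Basis"
      have "A (t, apply_bcontfun p a) \<bullet> i = (\<Sum>j\<in>?S. b j * (Z j (t, apply_bcontfun p a) \<bullet> i))"
        using b'[of "(a, i)"] a i by (simp add: f_def)
      also have "\<dots> = (\<Sum>j\<in>?S. \<beta> A j t * (Z j (t, apply_bcontfun p a) \<bullet> i))"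
        using bk by (intro sum.cong) auto
      finally show "A (t, apply_bcontfun p a) \<bullet> i = (\<Sum>j\<in>?S. \<beta> A j t *\<^sub>R Z j (t, apply_bcontfun p a)) \<bullet> i"
        by (simp add: inner_sum_left)
    qed
    obtain k where k: "(t, p, k) \<in> W" "\<Phi> t p k = x" using onto[OF tN(3) x] by blast
    have "A (t, \<Phi> t p k) = (\<Sum>j\<in>?S. \<beta> A j t *\<^sub>R Z j (t, \<Phi> t p k))"
    proof (rule compatible_linear_relation[OF W \<Phi> k(1)])
      show "p \<in> range (fin_seq {1..m})" by (simp add: p_def)
    qed (use comp A Z f1 rel in auto)
    then show ?thesis using k by simp
  qed
  have "d \<noteq> 0"
  proof
    assume "d = 0"
    have A: "autonomization (Y \<alpha>0) \<in> LL" unfolding LL_def using \<alpha>0 by (intro bracket_closure.base) auto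
    have "indep_on ?D {1..Suc 0} (\<lambda>j. f (autonomization (Y \<alpha>0)) t1)"
      unfolding indep_on_def
    proof (intro allI impI ballI)
      fix c :: "nat \<Rightarrow> real" and j assume c: "\<forall>q\<in>?D. (\<Sum>j\<in>{1..Suc 0}. c j * f (autonomization (Y \<alpha>0)) t1 q) = 0" and j: "j \<in> {1..Suc 0}"
      have "(1::real, 0 :: real ^ 'n) \<in> Basis" by (simp add: Basis_prod_def)
      then have "c 1 * f (autonomization (Y \<alpha>0)) t1 (0, (1, 0)) = 0" using c by auto
      then show "c j = 0" using j by (simp add: f_def autonomization_def inner_prod_def)
    qed
    then have "good (Suc 0)" unfolding good_def using t1 A by (intro bexI[of _ t1] exI[of _ "\<lambda>_. autonomization (Y \<alpha>0)"]) auto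
    then show False using gm(2)[of "Suc 0"] \<open>d = 0\<close> by (simp add: d_def)
  qed
  then show ?thesis
    using that[of d Z e t1 \<beta>] bnd[OF gm(1)] Z e sm\<beta> main unfolding d_def[symmetric] by auto
qed

definition finite_module_on ::
  "'a set \<Rightarrow> ('a \<Rightarrow> real \<Rightarrow> real ^ 'n \<Rightarrow> real ^ 'n) \<Rightarrow> nat \<Rightarrow> real set \<Rightarrow> (real ^ 'n) set \<Rightarrow> bool" where
  "finite_module_on \<Lambda> Y r I U \<longleftrightarrow>
     (\<exists>(b :: 'a \<Rightarrow> nat \<Rightarrow> real \<Rightarrow> real)
         (X :: nat \<Rightarrow> real \<Rightarrow> real ^ 'n \<Rightarrow> real ^ 'n)
         (f :: nat \<Rightarrow> nat \<Rightarrow> nat \<Rightarrow> real \<Rightarrow> real).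
          (\<forall>\<alpha>\<in>\<Lambda>. \<forall>j\<in>{1..r}. smooth_on I (b \<alpha> j)) \<and>
          (\<forall>j\<in>{1..r}. smooth_on (I \<times> U) (\<lambda>(t, x). X j t x)) \<and>
          (\<forall>j\<in>{1..r}. \<forall>k\<in>{1..r}. \<forall>l\<in>{1..r}. smooth_on I (f j k l)) \<and>
          (\<forall>\<alpha>\<in>\<Lambda>. \<forall>t\<in>I. (\<Sum>j=1..r. b \<alpha> j t) = 1) \<and>
          (\<forall>\<alpha>\<in>\<Lambda>. \<forall>t\<in>I. \<forall>x\<in>U.
             autonomization (Y \<alpha>) (t, x) =
               (\<Sum>j=1..r. b \<alpha> j t *\<^sub>R autonomization (X j) (t, x))) \<and>
          (\<forall>j\<in>{1..r}. \<forall>k\<in>{1..r}. \<forall>t\<in>I. \<forall>x\<in>U.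
             lie_bracket (autonomization (X j)) (autonomization (X k)) (t, x) =
               (\<Sum>l=1..r. f j k l t *\<^sub>R autonomization (X l) (t, x))))"

text \<open>The basis fields are repeated to obtain the same number \<open>r\<close> of fields in all boxes; the
  repeated fields get the coefficient \<open>0\<close>.\<close>

lemma superposition_rule_imp_finite_module:
  fixes Y :: "'a \<Rightarrow> real \<Rightarrow> real ^ 'n \<Rightarrow> real ^ 'n"
  assumes Y: "\<And>\<alpha>. \<alpha> \<in> \<Lambda> \<Longrightarrow> smooth_on UNIV (\<lambda>(t, x). Y \<alpha> t x)" and \<Lambda>: "\<Lambda> \<noteq> {}"
    and sr: "superposition_rule_on \<Lambda> Y m I U W \<Phi>"
    and I1: "open I1" "t0 \<in> I1" "I1 \<subseteq> I" and U1: "U1 \<subseteq> U" "x0 \<in> U1"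
  shows "\<exists>t1. \<exists>e>0. ball t1 e \<subseteq> I1 \<and>
    finite_module_on \<Lambda> Y (card ({0..m} \<times> (Basis :: (real \<times> (real ^ 'n)) set))) (ball t1 e) U1"
proof -
  define r where "r = card ({0..m} \<times> (Basis :: (real \<times> (real ^ 'n)) set))"
  define LL where "LL = bracket_closure ((\<lambda>\<alpha>. autonomization (Y \<alpha>)) ` \<Lambda>)"
  have ne: "I1 \<noteq> {}" using I1 by blast
  obtain d Z \<beta> t1 e where d: "1 \<le> d" "d \<le> r"
    and Z: "\<And>j. j \<in> {1..d} \<Longrightarrow> Z j \<in> LL" and e: "e > 0" "ball t1 e \<subseteq> I1"
    and \<beta>: "\<And>A j. A \<in> LL \<Longrightarrow> j \<in> {1..d} \<Longrightarrow> smooth_on (ball t1 e) (\<beta> A j)"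
    and exp: "\<And>A t x. A \<in> LL \<Longrightarrow> t \<in> ball t1 e \<Longrightarrow> x \<in> U \<Longrightarrow> A (t, x) = (\<Sum>j\<in>{1..d}. \<beta> A j t *\<^sub>R Z j (t, x))"
    by (rule superposition_rule_imp_module[OF Y \<Lambda> sr I1(1) ne I1(3), folded r_def LL_def])
      (assumption | rule that)+
  have gen: "smooth_on UNIV A \<and> (\<forall>z. fst (A z) = 1)" if "A \<in> (\<lambda>\<alpha>. autonomization (Y \<alpha>)) ` \<Lambda>" for A
    using that Y smooth_on_autonomization[OF open_UNIV] by (auto simp del: split_paired_All)
  have sm: "smooth_on UNIV A" and f1: "fst (A z) = 1" if "A \<in> LL" for A z
    using bracket_closure_smooth[OF gen that[unfolded LL_def]] by (auto simp del: split_paired_All)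
  have YL: "autonomization (Y \<alpha>) \<in> LL" if "\<alpha> \<in> \<Lambda>" for \<alpha>
    unfolding LL_def using that by (intro bracket_closure.base imageI)
  define \<sigma> where "\<sigma> j = (if j \<in> {1..d} then j else 1)" for j
  have \<sigma>: "Z (\<sigma> j) \<in> LL" for j using d Z by (simp add: \<sigma>_def)
  define X where "X j t x = snd (Z (\<sigma> j) (t, x))" for j t x
  have aX: "autonomization (X j) = Z (\<sigma> j)" for j
    using f1[OF \<sigma>] by (auto simp: fun_eq_iff autonomization_def X_def prod_eq_iff)
  define pad where "pad A j t = (if j \<in> {1..d} then \<beta> A j t else 0)" for A j t
  have sm_pad: "smooth_on (ball t1 e) (pad A j)" if "A \<in> LL" for A j
  proof (cases "j \<in> {1..d}")
    case True
    then show ?thesis using \<beta>[OF that True] by (simp add: pad_def[abs_def])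
  next
    case False
    then have "pad A j = (\<lambda>_. 0)" unfolding pad_def[abs_def] by (simp only: if_False)
    then show ?thesis by (simp add: smooth_on_const)
  qed
  have pad: "A (t, x) = (\<Sum>j=1..r. pad A j t *\<^sub>R autonomization (X j) (t, x))"
    if "A \<in> LL" "t \<in> ball t1 e" "x \<in> U1" for A t x
  proof -
    have "x \<in> U" using that(3) U1 by blast
    have "(\<Sum>j\<in>{1..d}. \<beta> A j t *\<^sub>R Z j (t, x)) = (\<Sum>j=1..r. pad A j t *\<^sub>R Z (\<sigma> j) (t, x))"
      using d by (intro sum.mono_neutral_cong_left) (auto simp: pad_def \<sigma>_def)
    then show ?thesis using exp[OF that(1,2) \<open>x \<in> U\<close>] by (simp add: aX)
  qed
  define C where "C j k = (\<lambda>z. Z (\<sigma> j) z + lie_bracket (Z (\<sigma> j)) (Z (\<sigma> k)) z)" for j k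
  have C: "C j k \<in> LL" for j k unfolding C_def using \<sigma> unfolding LL_def by (intro bracket_closure.step)
  have "finite_module_on \<Lambda> Y r (ball t1 e) U1"
    unfolding finite_module_on_def
  proof (intro exI[of _ "\<lambda>\<alpha>. pad (autonomization (Y \<alpha>))"] exI[of _ X] exI[of _ "\<lambda>j k l t. pad (C j k) l t - pad (Z (\<sigma> j)) l t"] conjI ballI)
    show "smooth_on (ball t1 e) (pad (autonomization (Y \<alpha>)) j)" if "\<alpha> \<in> \<Lambda>" for \<alpha> j by (rule sm_pad[OF YL[OF that]])
    show "smooth_on (ball t1 e \<times> U1) (\<lambda>(t, x). X j t x)" for j
    proof -
      have "smooth_on UNIV (\<lambda>z. snd (Z (\<sigma> j) z))"
        by (rule smooth_on_linear_comp[OF bounded_linear_snd open_UNIV sm[OF \<sigma>]])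
      from smooth_on_subset[OF this subset_UNIV] show ?thesis by (simp add: X_def case_prod_unfold)
    qed
    show "smooth_on (ball t1 e) (\<lambda>t. pad (C j k) l t - pad (Z (\<sigma> j)) l t)" for j k l
      by (intro smooth_on_diff open_ball sm_pad C \<sigma>)
    show "(\<Sum>j=1..r. pad (autonomization (Y \<alpha>)) j t) = 1" if "\<alpha> \<in> \<Lambda>" "t \<in> ball t1 e" for \<alpha> t
      using arg_cong[OF pad[OF YL[OF that(1)] that(2) U1(2)], of fst] by (simp add: fst_sum)
    show "autonomization (Y \<alpha>) (t, x) = (\<Sum>j=1..r. pad (autonomization (Y \<alpha>)) j t *\<^sub>R autonomization (X j) (t, x))"
      if "\<alpha> \<in> \<Lambda>" "t \<in> ball t1 e" "x \<in> U1" for \<alpha> t x by (rule pad[OF YL[OF that(1)] that(2,3)])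
    show "lie_bracket (autonomization (X j)) (autonomization (X k)) (t, x) =
        (\<Sum>l=1..r. (pad (C j k) l t - pad (Z (\<sigma> j)) l t) *\<^sub>R autonomization (X l) (t, x))"
      if "t \<in> ball t1 e" "x \<in> U1" for j k t x
    proof -
      have "lie_bracket (Z (\<sigma> j)) (Z (\<sigma> k)) (t, x) = C j k (t, x) - Z (\<sigma> j) (t, x)" by (simp add: C_def)
      also have "\<dots> = (\<Sum>l=1..r. pad (C j k) l t *\<^sub>R autonomization (X l) (t, x)) -
          (\<Sum>l=1..r. pad (Z (\<sigma> j)) l t *\<^sub>R autonomization (X l) (t, x))"
        by (simp only: pad[OF C that, symmetric] pad[OF \<sigma> that, symmetric])
      finally show ?thesis by (simp add: aX scaleR_left_diff_distrib sum_subtractf)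
    qed
  qed
  then show ?thesis using e unfolding r_def by blast
qed

text \<open>The passage from the rule to the module moves along the solutions of a system. An empty family
  has none, and any single field will do.\<close>

lemma finite_module_on_empty: "finite_module_on {} Y r I U"
proof -
  have z: "lie_bracket (autonomization (\<lambda>_ _. 0)) (autonomization (\<lambda>_ _. 0)) z = 0" for z :: "real \<times> (real ^ 'n)"
  proof -
    have "autonomization (\<lambda>_ _. 0) = (\<lambda>z::real \<times> (real ^ 'n). (1, 0))"
      by (auto simp: autonomization_def)
    then show ?thesis by (simp add: lie_bracket_def)
  qed
  show ?thesis unfolding finite_module_on_def
    by (rule exI[of _ "\<lambda>_ _ _. 0"], rule exI[of _ "\<lambda>_ _ _. 0"], rule exI[of _ "\<lambda>_ _ _ _. 0"])
      (simp add: z smooth_on_const case_prod_unfold)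
qed

theorem common_superposition_rule_imp_finite_module:
  fixes Y :: "'a \<Rightarrow> real \<Rightarrow> real ^ 'n \<Rightarrow> real ^ 'n"
  assumes Y: "\<And>\<alpha>. \<alpha> \<in> \<Lambda> \<Longrightarrow> smooth_on UNIV (\<lambda>(t, x). Y \<alpha> t x)"
    and rule: "admits_common_superposition_rule \<Lambda> Y"
  shows "\<exists>r>0. near_generic_points (finite_module_on \<Lambda> Y r)"
proof (cases "\<Lambda> = {}")
  case True
  have "near_generic_points (finite_module_on \<Lambda> Y 1)"
  proof (rule near_generic_pointsI)
    fix O' :: "(real \<times> (real ^ 'n)) set" assume "O' \<noteq> {}"
    then obtain t x where "(t, x) \<in> O'" by force
    then show "\<exists>I U t x. open I \<and> is_interval I \<and> open U \<and> t \<in> I \<and> x \<in> U \<and> (t, x) \<in> O' \<and> finite_module_on \<Lambda> Y 1 I U"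
      unfolding True using finite_module_on_empty
      by (intro exI[of _ UNIV] exI[of _ t] exI[of _ x]) auto
  qed
  then show ?thesis by (intro exI[of _ 1]) auto
next
  case False
  obtain m where m: "near_generic_points (\<lambda>I U. \<exists>W \<Phi>. superposition_rule_on \<Lambda> Y m I U W \<Phi>)"
    using rule unfolding admits_common_superposition_rule_def by blast
  let ?r = "card ({0..m} \<times> (Basis :: (real \<times> (real ^ 'n)) set))"
  have "near_generic_points (finite_module_on \<Lambda> Y ?r)"
  proof (rule near_generic_pointsI)
    fix O' :: "(real \<times> (real ^ 'n)) set" assume O': "open O'" "O' \<noteq> {}"
    obtain I U I1 U1 t x where box: "\<exists>W \<Phi>. superposition_rule_on \<Lambda> Y m I U W \<Phi>" "open I1" "is_interval I1" "open U1" "t \<in> I1" "x \<in> U1"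
      "I1 \<subseteq> I" "U1 \<subseteq> U" "I1 \<times> U1 \<subseteq> O'"
      by (rule near_generic_points_box[OF m O']) (rule that)
    obtain W \<Phi> where sr: "superposition_rule_on \<Lambda> Y m I U W \<Phi>" using box(1) by blast
    have "\<exists>t1. \<exists>e>0. ball t1 e \<subseteq> I1 \<and> finite_module_on \<Lambda> Y ?r (ball t1 e) U1"
      by (rule superposition_rule_imp_finite_module[OF _ False sr box(2,5,7,8,6)]) (rule Y)
    then obtain t1 e where e: "e > 0" "ball t1 e \<subseteq> I1" "finite_module_on \<Lambda> Y ?r (ball t1 e) U1" by blast
    then have "t1 \<in> I1" using centre_in_ball by blast
    then have "(t1, x) \<in> O'" using box by blast
    with e show "\<exists>I U t x. open I \<and> is_interval I \<and> open U \<and> t \<in> I \<and> x \<in> U \<and> (t, x) \<in> O' \<and> finite_module_on \<Lambda> Y ?r I U"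
      using box by (intro exI[of _ "ball t1 e"] exI[of _ U1] exI[of _ t1] exI[of _ x]) (auto simp: is_interval_ball_real)
  qed
  moreover have "?r > 0" by (simp add: card_gt_0_iff)
  ultimately show ?thesis by blast
qed

section \<open>Smoothness near a point\<close>

text \<open>Maps into the space of tuples can be used as inner maps if they satisfy \<open>inner_near\<close>; for maps
  into Euclidean spaces the two notions agree.\<close>

definition smooth_near :: "'a::real_normed_vector \<Rightarrow> ('a \<Rightarrow> 'b::real_normed_vector) \<Rightarrow> bool" where
  "smooth_near p f \<longleftrightarrow> (\<exists>N. open N \<and> p \<in> N \<and> smooth_on N f)"

definition inner_near :: "'a::real_normed_vector \<Rightarrow> ('a \<Rightarrow> 'b::real_normed_vector) \<Rightarrow> bool" where
  "inner_near p f \<longleftrightarrow> (\<exists>N. open N \<and> p \<in> N \<and> smooth_inner N f)"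

lemma inner_near_imp_smooth_near: "inner_near p f \<Longrightarrow> smooth_near p f"
  unfolding inner_near_def smooth_near_def using smooth_inner_imp_smooth_on by blast

lemma smooth_near_imp_inner_near:
  fixes f :: "'a::real_normed_vector \<Rightarrow> 'b::euclidean_space"
  shows "smooth_near p f \<Longrightarrow> inner_near p f"
  unfolding inner_near_def smooth_near_def using smooth_inner_euclidean by blast

lemma smooth_near_has_derivative:
  assumes "smooth_near p f"
  shows "\<forall>\<^sub>F q in nhds p. (f has_derivative frechet_derivative f (at q)) (at q)"
proof -
  obtain N where N: "open N" "p \<in> N" "smooth_on N f" using assms unfolding smooth_near_def by blast
  show ?thesis using eventually_nhds_in_open[OF N(1,2)]
    by eventually_elim (rule smooth_on_has_derivative[OF N(3)])
qed

lemma smooth_near_tendsto: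
  assumes "smooth_near p f"
  shows "(f \<longlongrightarrow> f p) (nhds p)"
proof -
  have "isCont f p"
    using eventually_nhds_x_imp_x[OF smooth_near_has_derivative[OF assms]] has_derivative_continuous by blast
  then show ?thesis using tendsto_at_iff_tendsto_nhds[of f p] by (simp add: isCont_def)
qed

lemma smooth_near_compose:
  assumes f: "smooth_near (h p) f" and h: "inner_near p h"
  shows "smooth_near p (\<lambda>x. f (h x))"
proof -
  obtain Nf where Nf: "open Nf" "h p \<in> Nf" "smooth_on Nf f" using f unfolding smooth_near_def by blast
  obtain Nh where Nh: "open Nh" "p \<in> Nh" "smooth_inner Nh h" using h unfolding inner_near_def by blast
  have c: "continuous_on Nh h" by (rule smooth_on_continuous_on[OF smooth_inner_imp_smooth_on[OF Nh(1,3)]])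
  define N where "N = Nh \<inter> h -` Nf"
  have N: "open N" unfolding N_def by (rule continuous_open_preimage[OF c Nh(1) Nf(1)])
  have "smooth_on N (\<lambda>x. f (h x))"
    by (rule smooth_on_compose[OF N Nf(3) smooth_inner_subset[OF Nh(3)]]) (auto simp: N_def)
  then show ?thesis unfolding smooth_near_def using N Nh(2) Nf(2) by (intro exI[of _ N]) (auto simp: N_def)
qed

lemma inner_near_compose:
  assumes f: "inner_near (h p) f" and h: "inner_near p h"
  shows "inner_near p (\<lambda>x. f (h x))"
proof -
  obtain Nf where Nf: "open Nf" "h p \<in> Nf" "smooth_inner Nf f" using f unfolding inner_near_def by blast
  obtain Nh where Nh: "open Nh" "p \<in> Nh" "smooth_inner Nh h" using h unfolding inner_near_def by blast
  have c: "continuous_on Nh h" by (rule smooth_on_continuous_on[OF smooth_inner_imp_smooth_on[OF Nh(1,3)]])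
  define N where "N = Nh \<inter> h -` Nf"
  have N: "open N" unfolding N_def by (rule continuous_open_preimage[OF c Nh(1) Nf(1)])
  have h': "smooth_inner N h" by (rule smooth_inner_subset[OF Nh(3)]) (simp add: N_def)
  have "smooth_inner N (\<lambda>x. f (h x))" unfolding smooth_inner_def
  proof
    fix k
    show "Ck_inner k N (\<lambda>x. f (h x))"
      by (rule Ck_inner_compose[OF N Nf(3)[unfolded smooth_inner_def, rule_format] h'[unfolded smooth_inner_def, rule_format]])
        (simp add: N_def)
  qed
  then show ?thesis unfolding inner_near_def using N Nh(2) Nf(2) by (intro exI[of _ N]) (simp add: N_def)
qed

lemma inner_near_linear: "bounded_linear h \<Longrightarrow> inner_near p h"
  unfolding inner_near_def using smooth_inner_linear by blast

lemma inner_near_const: "inner_near p (\<lambda>_. c)"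
  unfolding inner_near_def using smooth_inner_const by blast

lemma inner_near_2:
  assumes "inner_near p f" "inner_near p g"
    "\<And>N. open N \<Longrightarrow> smooth_inner N f \<Longrightarrow> smooth_inner N g \<Longrightarrow> smooth_inner N h"
  shows "inner_near p h"
proof -
  obtain N where N: "open N" "p \<in> N" "smooth_inner N f" using assms(1) unfolding inner_near_def by blast
  obtain M where M: "open M" "p \<in> M" "smooth_inner M g" using assms(2) unfolding inner_near_def by blast
  have "smooth_inner (N \<inter> M) h"
    using assms(3)[OF open_Int[OF N(1) M(1)]] smooth_inner_subset[OF N(3)] smooth_inner_subset[OF M(3)] by blast
  then show ?thesis unfolding inner_near_def using N M by (intro exI[of _ "N \<inter> M"]) auto
qed

lemma inner_near_Pair: "inner_near p f \<Longrightarrow> inner_near p g \<Longrightarrow> inner_near p (\<lambda>x. (f x, g x))"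
  by (rule inner_near_2[of p f g]) (auto intro: smooth_inner_Pair)

lemma inner_near_add: "inner_near p f \<Longrightarrow> inner_near p g \<Longrightarrow> inner_near p (\<lambda>x. f x + g x)"
  by (rule inner_near_2[of p f g]) (auto intro: smooth_inner_add)

lemma inner_near_scaleR:
  fixes g :: "'a::real_normed_vector \<Rightarrow> real"
  shows "smooth_near p g \<Longrightarrow> inner_near p (\<lambda>x. g x *\<^sub>R e)"
  unfolding inner_near_def smooth_near_def using smooth_inner_scaleR by blast

lemma inner_near_sum: "(\<And>i. i \<in> F \<Longrightarrow> inner_near p (f i)) \<Longrightarrow> inner_near p (\<lambda>x. \<Sum>i\<in>F. f i x)"
  by (induction F rule: infinite_finite_induct) (auto intro: inner_near_add inner_near_const)

lemma tendsto_near: "inner_near p h \<Longrightarrow> filterlim h (nhds (h p)) (nhds p)"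
  using smooth_near_tendsto inner_near_imp_smooth_near by blast

lemma eventually_near_compose:
  "\<forall>\<^sub>F q in nhds (h p). P q \<Longrightarrow> inner_near p h \<Longrightarrow> \<forall>\<^sub>F x in nhds p. P (h x)"
  using tendsto_near[of p h] by (simp add: filterlim_iff)

section \<open>Flows of the fields of a module\<close>

text \<open>The second part is the variational equation, for which the two derivatives of \<open>\<phi>\<close> are interchanged.\<close>

lemma flow_derivative:
  fixes X :: "'v::euclidean_space \<Rightarrow> 'v" and \<phi> :: "real \<times> 'v \<Rightarrow> 'v" and z v :: 'v
  assumes N: "open N" "N = {-c<..<c} \<times> B" and \<phi>: "smooth_on N \<phi>"
    and ode: "\<And>s z. (s, z) \<in> N \<Longrightarrow> ((\<lambda>s. \<phi> (s, z)) has_vector_derivative X (\<phi> (s, z))) (at s)"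
    and X: "smooth_on O' X" "\<And>s z. (s, z) \<in> N \<Longrightarrow> \<phi> (s, z) \<in> O'" and sz: "(s, z) \<in> N"
  shows "frechet_derivative \<phi> (at (s, z)) (1, 0) = X (\<phi> (s, z))"
    and "((\<lambda>s. frechet_derivative \<phi> (at (s, z)) (0, v)) has_vector_derivative
      frechet_derivative X (at (\<phi> (s, z))) (frechet_derivative \<phi> (at (s, z)) (0, v))) (at s)"
proof -
  have ins: "((\<lambda>s. (s, z)) has_vector_derivative (1, 0)) (at s)" for s :: real
    by (auto intro!: derivative_eq_intros)
  have along: "((\<lambda>s. f (s, z)) has_vector_derivative f' (1, 0)) (at s)"
    if "(f has_derivative f') (at (s, z))" for f :: "real \<times> 'v \<Rightarrow> 'v" and f' s
  proof -
    from diff_chain_at[OF ins[unfolded has_vector_derivative_def] that]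
    have "((\<lambda>s. f (s, z)) has_derivative (\<lambda>x. f' (x *\<^sub>R (1, 0)))) (at s)" by (simp add: o_def)
    then show ?thesis unfolding has_vector_derivative_def
      by (simp only: linear_scale[OF bounded_linear.linear[OF has_derivative_bounded_linear[OF that]]])
  qed
  have d: "(\<phi> has_derivative frechet_derivative \<phi> (at q)) (at q)" if "q \<in> N" for q
    by (rule smooth_on_has_derivative[OF \<phi> that])
  have eq: "frechet_derivative \<phi> (at q) (1, 0) = X (\<phi> q)" if q: "q \<in> N" for q
  proof -
    obtain s z where qe: "q = (s, z)" by (cases q)
    have ins: "((\<lambda>s. (s, z)) has_vector_derivative (1, 0)) (at s)" by (auto intro!: derivative_eq_intros)
    from diff_chain_at[OF ins[unfolded has_vector_derivative_def] d[OF q, unfolded qe]]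
    have "((\<lambda>s. \<phi> (s, z)) has_derivative (\<lambda>x. frechet_derivative \<phi> (at (s, z)) (x *\<^sub>R (1, 0)))) (at s)" by (simp add: o_def)
    then have "((\<lambda>s. \<phi> (s, z)) has_vector_derivative frechet_derivative \<phi> (at (s, z)) (1, 0)) (at s)"
      unfolding has_vector_derivative_def
      by (simp only: linear_scale[OF bounded_linear.linear[OF has_derivative_bounded_linear[OF d[OF q, unfolded qe]]]])
    from vector_derivative_unique_at[OF this ode[OF q[unfolded qe]]] show ?thesis by (simp add: qe)
  qed
  show "frechet_derivative \<phi> (at (s, z)) (1, 0) = X (\<phi> (s, z))" by (rule eq[OF sz])
  have D2: "((\<lambda>q. frechet_derivative \<phi> (at q) (0, v)) has_derivative
      frechet_derivative (\<lambda>q. frechet_derivative \<phi> (at q) (0, v)) (at (s, z))) (at (s, z))"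
    by (rule smooth_on_has_derivative[OF smooth_on_frechet_derivative[OF \<phi>] sz])
  have Xd: "(X has_derivative frechet_derivative X (at (\<phi> (s, z)))) (at (\<phi> (s, z)))"
    by (rule smooth_on_has_derivative[OF X(1) X(2)[OF sz]])
  have "((\<lambda>q. X (\<phi> q)) has_derivative (\<lambda>w. frechet_derivative X (at (\<phi> (s, z))) (frechet_derivative \<phi> (at (s, z)) w))) (at (s, z))"
    using diff_chain_at[OF d[OF sz] Xd] by (simp add: o_def)
  then have "((\<lambda>q. frechet_derivative \<phi> (at q) (1, 0)) has_derivative
      (\<lambda>w. frechet_derivative X (at (\<phi> (s, z))) (frechet_derivative \<phi> (at (s, z)) w))) (at (s, z))"
    by (rule has_derivative_transform_within_open[OF _ N(1) sz]) (simp add: eq)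
  from frechet_derivative_at[OF this]
  have "frechet_derivative (\<lambda>q. frechet_derivative \<phi> (at q) (0, v)) (at (s, z)) (1, 0) =
     frechet_derivative X (at (\<phi> (s, z))) (frechet_derivative \<phi> (at (s, z)) (0, v))"
    using smooth_on_symmetric[OF N(1) \<phi> sz, of "(0, v)" "(1, 0)"] by (simp add: fun_eq_iff)
  with along[OF D2] show "((\<lambda>s. frechet_derivative \<phi> (at (s, z)) (0, v)) has_vector_derivative
      frechet_derivative X (at (\<phi> (s, z))) (frechet_derivative \<phi> (at (s, z)) (0, v))) (at s)" by simp
qed

instance bcontfun :: (metric_space, banach) banach ..

text \<open>The combinations of the tent functions embed the tuples of \<open>r\<close> real numbers into a Banach space,
  with the entries recovered by evaluation at the integers. A linear system for \<open>r\<close> unknown functions,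
  where \<open>r\<close> is a variable, becomes a single equation there.\<close>

definition tent :: "nat \<Rightarrow> real \<Rightarrow>\<^sub>C real" where
  "tent k = Bcontfun (\<lambda>x. max 0 (1 - \<bar>x - real k\<bar>))"

lemma apply_tent: "apply_bcontfun (tent k) x = max 0 (1 - \<bar>x - real k\<bar>)"
proof -
  have "bounded (range (\<lambda>x. max 0 (1 - \<bar>x - real k\<bar>)))"
    by (rule bounded_subset[of "{0..1}"]) auto
  then have "(\<lambda>x. max 0 (1 - \<bar>x - real k\<bar>)) \<in> bcontfun"
    unfolding bcontfun_def by (auto intro!: continuous_intros)
  then show ?thesis by (simp add: tent_def Bcontfun_inverse)
qed

lemma apply_tent_nat: "apply_bcontfun (tent k) (real l) = (if k = l then 1 else 0)"
proof (cases "k = l")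
  case False
  then have "1 \<le> \<bar>real l - real k\<bar>" by linarith
  then show ?thesis using False by (simp add: apply_tent)
qed (simp add: apply_tent)

lemma norm_tent_le: "norm (tent k) \<le> 1"
  by (rule norm_bound) (simp add: apply_tent)

text \<open>The fields \<open>A j\<close> take the place of the autonomizations \<open>autonomization (X j)\<close>.\<close>

locale bracket_module =
  fixes r :: nat and A :: "nat \<Rightarrow> real \<times> 'b::euclidean_space \<Rightarrow> real \<times> 'b"
    and I1 :: "real set" and U1 :: "'b set" and f :: "nat \<Rightarrow> nat \<Rightarrow> nat \<Rightarrow> real \<Rightarrow> real"
  assumes open_I1: "open I1" and open_U1: "open U1"
    and smooth_A: "j \<in> {1..r} \<Longrightarrow> smooth_on (I1 \<times> U1) (A j)"
    and fst_A: "fst (A j z) = 1"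
    and continuous_f: "j \<in> {1..r} \<Longrightarrow> k \<in> {1..r} \<Longrightarrow> l \<in> {1..r} \<Longrightarrow> continuous_on I1 (f j k l)"
    and bracket: "j \<in> {1..r} \<Longrightarrow> k \<in> {1..r} \<Longrightarrow> z \<in> I1 \<times> U1 \<Longrightarrow>
      lie_bracket (A j) (A k) z = (\<Sum>l=1..r. f j k l (fst z) *\<^sub>R A l z)"
begin

abbreviation "O1 \<equiv> I1 \<times> U1"

lemma open_O1: "open O1" by (intro open_Times open_I1 open_U1)

text \<open>The coefficients, with respect to the fields \<open>A k\<close>, of a vector that is transported by the flow
  of \<open>A i\<close> along an integral curve solve this linear equation. It involves only the initial time \<open>t\<close> of
  the curve and not its initial point, because the \<open>f i l k\<close> are functions of the time.\<close>

definition transport_coeffs :: "nat \<Rightarrow> real \<Rightarrow> real \<Rightarrow> (real \<Rightarrow> nat \<Rightarrow> real) \<Rightarrow> bool" where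
  "transport_coeffs i c t \<alpha> \<longleftrightarrow> (\<forall>s\<in>{-c<..<c}. \<forall>k\<in>{1..r}.
     ((\<lambda>s. \<alpha> s k) has_real_derivative - (\<Sum>l=1..r. f i l k (t + s) * \<alpha> s l)) (at s))"

lemma transport_coeffs_exist:
  assumes i: "i \<in> {1..r}" and t1: "t1 \<in> I1"
  obtains c where "c > 0" "\<And>t \<beta>. \<bar>t - t1\<bar> < c \<Longrightarrow> \<exists>\<alpha>. transport_coeffs i c t \<alpha> \<and> (\<forall>k\<in>{1..r}. \<alpha> 0 k = \<beta> k)"
proof -
  let ?R = "{1..r}"
  obtain e where e: "e > 0" "cball t1 e \<subseteq> I1" using open_I1 t1 open_contains_cball by blast
  have "\<exists>M. \<forall>t\<in>cball t1 e. \<bar>f i l k t\<bar> \<le> M" if "l \<in> ?R" "k \<in> ?R" for l k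
  proof -
    have "bounded (f i l k ` cball t1 e)"
      using continuous_on_subset[OF continuous_f[OF i that] e(2)]
      by (intro compact_imp_bounded compact_continuous_image) auto
    then show ?thesis unfolding bounded_iff by auto
  qed
  then have bounded: "\<exists>M. \<forall>t\<in>cball t1 e. \<bar>f i l k t\<bar> \<le> M" if "l \<in> ?R" "k \<in> ?R" for l k using that .
  obtain m where m: "\<And>l k t. l \<in> ?R \<Longrightarrow> k \<in> ?R \<Longrightarrow> t \<in> cball t1 e \<Longrightarrow> \<bar>f i l k t\<bar> \<le> m l k"
    using bounded by metis
  define M where "M = (\<Sum>l\<in>?R. \<Sum>k\<in>?R. \<bar>m l k\<bar>)"
  have M: "\<bar>f i l k t\<bar> \<le> M" if "l \<in> ?R" "k \<in> ?R" "t \<in> cball t1 e" for l k t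
  proof -
    have "\<bar>f i l k t\<bar> \<le> \<bar>m l k\<bar>" using m[OF that] by linarith
    also have "\<dots> \<le> (\<Sum>k\<in>?R. \<bar>m l k\<bar>)" using that by (intro member_le_sum) auto
    also have "\<dots> \<le> M" unfolding M_def using that(1) by (intro member_le_sum[of l ?R "\<lambda>l. \<Sum>k\<in>?R. \<bar>m l k\<bar>"]) (auto intro: sum_nonneg)
    finally show ?thesis .
  qed
  have M0: "M \<ge> 0" unfolding M_def by (intro sum_nonneg) auto
  define L where "L = real r * (real r * M)"
  have L0: "L \<ge> 0" using M0 by (simp add: L_def)
  define c where "c = min (e / 2) (1 / (2 * (L + 1)))"
  have c: "c > 0" "c * L < 1" "c \<le> e / 2"
  proof -
    show c0: "c > 0" using e(1) L0 by (simp add: c_def)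
    have "c * (L + 1) \<le> (1 / (2 * (L + 1))) * (L + 1)" using L0 by (intro mult_right_mono) (auto simp: c_def)
    also have "\<dots> = 1 / 2" using L0 by simp
    finally show "c * L < 1" using c0 by (simp add: distrib_left)
  qed (simp add: c_def)
  have "\<exists>\<alpha>. transport_coeffs i c t \<alpha> \<and> (\<forall>k\<in>?R. \<alpha> 0 k = \<beta> k)" if t: "\<bar>t - t1\<bar> < c" for t \<beta>
  proof -
    have ts: "t + s \<in> cball t1 e" if "s \<in> {-c..c}" for s
    proof -
      have "\<bar>s\<bar> \<le> c" using that by (auto simp: abs_le_iff)
      then have "\<bar>t1 - (t + s)\<bar> \<le> e" using t c(3) by linarith
      then show ?thesis by (simp add: dist_real_def)
    qed
    define G where "G s u k = - (\<Sum>l\<in>?R. f i l k (t + s) * apply_bcontfun u (real l))"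
      for s k and u :: "real \<Rightarrow>\<^sub>C real"
    define F where "F s u = (\<Sum>k\<in>?R. G s u k *\<^sub>R tent k)" for s u
    have app: "apply_bcontfun (\<Sum>k\<in>?R. g k *\<^sub>R tent k) (real k) = g k" if "k \<in> ?R" for g k
    proof -
      have "apply_bcontfun (\<Sum>k\<in>?R. g k *\<^sub>R tent k) (real k) = (\<Sum>j\<in>?R. if j = k then g j else 0)"
        unfolding apply_bcontfun_sum by (intro sum.cong refl) (simp add: apply_tent_nat)
      then show ?thesis using that by simp
    qed
    have cf: "continuous_on ({-c..c} \<times> UNIV) (\<lambda>(s, u). F s u)"
    proof -
      have 1: "continuous_on ({-c..c} \<times> UNIV) (\<lambda>q :: real \<times> (real \<Rightarrow>\<^sub>C real). apply_bcontfun (snd q) l)" for l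
        by (intro bounded_linear.continuous_on[OF bounded_linear_apply_bcontfun] continuous_intros)
      have 2: "continuous_on ({-c..c} \<times> UNIV) (\<lambda>q. f i l k (t + fst q))" if "l \<in> ?R" "k \<in> ?R" for l k
        by (rule continuous_on_compose2[OF continuous_f[OF i that]])
          (use ts e(2) in \<open>auto intro!: continuous_intros\<close>)
      show ?thesis unfolding case_prod_unfold F_def G_def
        by (intro continuous_on_sum continuous_on_scaleR continuous_on_minus continuous_on_mult 1 2 continuous_on_const)
    qed
    have lip: "norm (F s u - F s v) \<le> L * norm (u - v)" if s: "s \<in> {-c..c}" for s u v
    proof -
      have G: "\<bar>G s u k - G s v k\<bar> \<le> real r * (M * norm (u - v))" if k: "k \<in> ?R" for k
      proof -
        have "G s u k - G s v k = - (\<Sum>l\<in>?R. f i l k (t + s) * apply_bcontfun (u - v) (real l))"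
          by (simp add: G_def right_diff_distrib sum_subtractf)
        then have "\<bar>G s u k - G s v k\<bar> \<le> (\<Sum>l\<in>?R. \<bar>f i l k (t + s) * apply_bcontfun (u - v) (real l)\<bar>)"
          by (simp only: abs_minus_cancel sum_abs)
        also have "\<dots> \<le> (\<Sum>l\<in>?R. M * norm (u - v))"
        proof (rule sum_mono)
          fix l assume l: "l \<in> ?R"
          have "\<bar>f i l k (t + s)\<bar> * norm (apply_bcontfun (u - v) (real l)) \<le> M * norm (u - v)"
            using M[OF l k ts[OF s]] norm_bounded[of "u - v" "real l"] M0 by (intro mult_mono) auto
          then show "\<bar>f i l k (t + s) * apply_bcontfun (u - v) (real l)\<bar> \<le> M * norm (u - v)" by (simp add: abs_mult)
        qed
        finally show ?thesis by simp
      qed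
      have "F s u - F s v = (\<Sum>k\<in>?R. (G s u k - G s v k) *\<^sub>R tent k)"
        by (simp add: F_def scaleR_left_diff_distrib sum_subtractf)
      also have "norm \<dots> \<le> (\<Sum>k\<in>?R. norm ((G s u k - G s v k) *\<^sub>R tent k))" by (rule norm_sum)
      also have "\<dots> \<le> (\<Sum>k\<in>?R. (real r * (M * norm (u - v))) * 1)"
        unfolding norm_scaleR by (intro sum_mono mult_mono norm_tent_le) (use G M0 in auto)
      also have "\<dots> = L * norm (u - v)" by (simp add: L_def)
      finally show ?thesis .
    qed
    obtain u where u: "u 0 = (\<Sum>k\<in>?R. \<beta> k *\<^sub>R tent k)"
      "\<And>s. s \<in> {-c..c} \<Longrightarrow> (u has_vector_derivative F s (u s)) (at s within {-c..c})"
    proof (rule picard_lindelof_global[OF c(1) cf _ L0 c(2), where ?y0.0 = "\<Sum>k\<in>?R. \<beta> k *\<^sub>R tent k"])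
      show "norm (F s u - F s v) \<le> L * norm (u - v)" if "s \<in> {-c..c}" for s u v by (rule lip[OF that])
    qed (rule that)
    have "transport_coeffs i c t (\<lambda>s k. apply_bcontfun (u s) (real k))" unfolding transport_coeffs_def
    proof (intro ballI)
      fix s k assume s: "s \<in> {-c<..<c}" and k: "k \<in> ?R"
      have "at s within {-c..c} = at s" using s by (intro at_within_interior) simp
      then have "(u has_vector_derivative F s (u s)) (at s)" using u(2)[of s] s by auto
      from bounded_linear.has_vector_derivative[OF bounded_linear_apply_bcontfun this, of "real k"]
      show "((\<lambda>s. apply_bcontfun (u s) (real k)) has_real_derivative - (\<Sum>l=1..r. f i l k (t + s) * apply_bcontfun (u s) (real l))) (at s)"
      proof -
        have "apply_bcontfun (F s (u s)) (real k) = G s (u s) k" unfolding F_def by (rule app[OF k])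
        with \<open>((\<lambda>s. apply_bcontfun (u s) (real k)) has_vector_derivative apply_bcontfun (F s (u s)) (real k)) (at s)\<close>
        show ?thesis by (simp add: has_real_derivative_iff_has_vector_derivative G_def)
      qed
    qed
    moreover have "\<forall>k\<in>?R. apply_bcontfun (u 0) (real k) = \<beta> k" using u(1) app by simp
    ultimately show ?thesis by (intro exI[of _ "\<lambda>s k. apply_bcontfun (u s) (real k)"]) auto
  qed
  then show ?thesis using that c(1) by blast
qed

text \<open>In the last conclusion, both sides solve the variational equation of the flow: the left-hand
  side because it is a derivative of the flow, the right-hand side by the bracket relations.\<close>

lemma flow_transports:
  assumes i: "i \<in> {1..r}" and z0: "z0 \<in> O1" and e: "e > 0"
  obtains c \<phi> where "c > 0" "c \<le> e" "smooth_on ({-c<..<c} \<times> ball z0 c) \<phi>"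
    "\<And>z. z \<in> ball z0 c \<Longrightarrow> \<phi> (0, z) = z"
    "\<And>s z. s \<in> {-c<..<c} \<Longrightarrow> z \<in> ball z0 c \<Longrightarrow> \<phi> (s, z) \<in> O1 \<and> fst (\<phi> (s, z)) = fst z + s \<and>
      frechet_derivative \<phi> (at (s, z)) (1, 0) = A i (\<phi> (s, z))"
    "\<And>z v. z \<in> ball z0 c \<Longrightarrow> frechet_derivative \<phi> (at (0, z)) (0, v) = v"
    "\<forall>\<^sub>F p in nhds (0, z0). \<phi> (- fst p, \<phi> p) = snd p"
    "\<And>s z \<alpha>. s \<in> {-c<..<c} \<Longrightarrow> z \<in> ball z0 c \<Longrightarrow> transport_coeffs i c (fst z) \<alpha> \<Longrightarrow>
      frechet_derivative \<phi> (at (s, z)) (0, \<Sum>l=1..r. \<alpha> 0 l *\<^sub>R A l z) = (\<Sum>l=1..r. \<alpha> s l *\<^sub>R A l (\<phi> (s, z)))"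
proof -
  let ?R = "{1..r}"
  obtain c0 \<rho> \<phi> where c0: "c0 > 0" "\<rho> > 0" and sm0: "smooth_on ({-c0<..<c0} \<times> ball z0 \<rho>) \<phi>"
    and \<phi>0: "\<And>z. z \<in> ball z0 \<rho> \<Longrightarrow> \<phi> (0, z) = z"
    and \<phi>O: "\<And>s z. s \<in> {-c0<..<c0} \<Longrightarrow> z \<in> ball z0 \<rho> \<Longrightarrow> \<phi> (s, z) \<in> O1"
    and ode: "\<And>s z. s \<in> {-c0<..<c0} \<Longrightarrow> z \<in> ball z0 \<rho> \<Longrightarrow>
      ((\<lambda>s. \<phi> (s, z)) has_vector_derivative A i (\<phi> (s, z))) (at s)"
    and inv: "\<forall>\<^sub>F p in nhds (0, z0). \<phi> (- fst p, \<phi> p) = snd p"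
    by (rule local_flow[OF open_O1 z0 smooth_A[OF i]]) (rule that)
  define N0 where "N0 = {-c0<..<c0} \<times> ball z0 \<rho>"
  have N0: "open N0" "(0, z0) \<in> N0" unfolding N0_def using c0 by (auto intro: open_Times)
  have "Ck_on (Suc 0) O1 (A i)" using smooth_A[OF i] unfolding smooth_on_def by blast
  then obtain A' where A': "continuous_on O1 A'"
    "\<And>q. q \<in> O1 \<Longrightarrow> (A i has_derivative blinfun_apply (A' q)) (at q)"
    "\<And>q v. q \<in> O1 \<Longrightarrow> A' q v = frechet_derivative (A i) (at q) v"
    using Ck_on_blinfun_derivative by metis
  define L where "L = norm (A' z0) + 1"
  have L: "L > 0" by (simp add: L_def add_nonneg_pos)
  have "isCont A' z0" using A'(1) z0 continuous_on_eq_continuous_at[OF open_O1, of A'] by blast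
  then have "((\<lambda>q. norm (A' q)) \<longlongrightarrow> norm (A' z0)) (nhds z0)"
    using tendsto_at_iff_tendsto_nhds[of A' z0] by (intro tendsto_norm) (simp add: isCont_def)
  then have 1: "\<forall>\<^sub>F q in nhds z0. norm (A' q) < L" by (rule order_tendstoD(2)) (simp add: L_def)
  have smn: "smooth_near (0, z0) \<phi>" unfolding smooth_near_def using N0 sm0 N0_def by blast
  have \<phi>z0: "\<phi> (0, z0) = z0" using \<phi>0 c0 by simp
  have "\<forall>\<^sub>F p in nhds (0, z0). norm (A' (\<phi> p)) < L \<and> p \<in> N0"
  proof (rule eventually_conj)
    show "\<forall>\<^sub>F p in nhds (0, z0). norm (A' (\<phi> p)) < L"
      using eventually_near_compose[where h = \<phi> and p = "(0, z0)" and P = "\<lambda>q. norm (A' q) < L"] 1 \<phi>z0 smooth_near_imp_inner_near[OF smn] by simp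
    show "\<forall>\<^sub>F p in nhds (0, z0). p \<in> N0" by (rule eventually_nhds_in_open[OF N0])
  qed
  then obtain S' where S': "open S'" "(0, z0) \<in> S'" "\<And>p. p \<in> S' \<Longrightarrow> norm (A' (\<phi> p)) < L \<and> p \<in> N0"
    unfolding eventually_nhds by blast
  obtain S1 S2 where S12: "open S1" "open S2" "(0, z0) \<in> S1 \<times> S2" "S1 \<times> S2 \<subseteq> S'"
    using open_prod_elim[OF S'(1,2)] by blast
  have S: "open S1" "open S2" "0 \<in> S1" "z0 \<in> S2"
    "\<And>s z. s \<in> S1 \<Longrightarrow> z \<in> S2 \<Longrightarrow> norm (A' (\<phi> (s, z))) < L \<and> (s, z) \<in> N0"
    using S12 S'(3) by blast+
  obtain d1 where d1: "d1 > 0" "ball 0 d1 \<subseteq> S1" using S openE by blast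
  obtain d2 where d2: "d2 > 0" "ball z0 d2 \<subseteq> S2" using S openE by blast
  define c where "c = min (min d1 d2) (min e (1 / (2 * L)))"
  have c: "c > 0" "c \<le> d1" "c \<le> d2" "c \<le> e" using d1 d2 L e by (auto simp: c_def)
  have cL: "c * L < 1"
  proof -
    have "c * L \<le> (1 / (2 * L)) * L" using L by (intro mult_right_mono) (auto simp: c_def)
    then show ?thesis using L by simp
  qed
  define N where "N = {-c<..<c} \<times> ball z0 c"
  have NS: "norm (A' (\<phi> (s, z))) < L \<and> (s, z) \<in> N0" if "(s, z) \<in> N" for s z
  proof -
    have "s \<in> ball 0 d1" "z \<in> ball z0 d2" using that c by (auto simp: N_def dist_real_def)
    then have "s \<in> S1" "z \<in> S2" using d1(2) d2(2) by blast+
    then show ?thesis by (rule S(5))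
  qed
  have N: "open N" unfolding N_def by (intro open_Times) auto
  have NN0: "N \<subseteq> N0" using NS by auto
  have sm: "smooth_on N \<phi>" using sm0 NN0 unfolding N0_def by (rule smooth_on_subset)
  have O: "\<phi> (s, z) \<in> O1" and od: "((\<lambda>s. \<phi> (s, z)) has_vector_derivative A i (\<phi> (s, z))) (at s)"
    if "(s, z) \<in> N" for s z using \<phi>O ode NN0 that unfolding N0_def by blast+
  have fd1: "frechet_derivative \<phi> (at (s, z)) (1, 0) = A i (\<phi> (s, z))" if "(s, z) \<in> N" for s z
    by (rule flow_derivative(1)[OF N N_def sm od smooth_A[OF i] O that])
  have fd2: "((\<lambda>s. frechet_derivative \<phi> (at (s, z)) (0, v)) has_vector_derivative
      frechet_derivative (A i) (at (\<phi> (s, z))) (frechet_derivative \<phi> (at (s, z)) (0, v))) (at s)"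
    if "(s, z) \<in> N" for s z v
    by (rule flow_derivative(2)[OF N N_def sm od smooth_A[OF i] O that])
  have fst: "fst (\<phi> (s, z)) = fst z + s" if "s \<in> {-c<..<c}" "z \<in> ball z0 c" for s z
  proof -
    have "fst (\<phi> (s, z)) = fst (\<phi> (0, z)) + s"
      by (rule fst_integral_curve[of c "\<lambda>s. \<phi> (s, z)" "A i"]) (use od that fst_A in \<open>auto simp: N_def\<close>)
    moreover have "(0, z) \<in> N" using that c by (simp add: N_def)
    then have "z \<in> ball z0 \<rho>" using NN0 by (auto simp: N0_def)
    ultimately show ?thesis using \<phi>0 by simp
  qed
  have \<phi>0': "\<phi> (0, z) = z" if "z \<in> ball z0 c" for z
  proof -
    have "(0, z) \<in> N" using that c by (simp add: N_def)
    then have "z \<in> ball z0 \<rho>" using NN0 by (auto simp: N0_def)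
    then show ?thesis by (rule \<phi>0)
  qed
  have D0: "frechet_derivative \<phi> (at (0, z)) (0, v) = v" if z: "z \<in> ball z0 c" for z v
  proof -
    have "(0, z) \<in> N" using that c by (simp add: N_def)
    note d = smooth_on_has_derivative[OF sm this]
    have "((\<lambda>z. (0, z)) has_derivative (\<lambda>v. (0, v))) (at z)" by (auto intro!: derivative_eq_intros)
    from diff_chain_at[OF this d]
    have 1: "((\<lambda>z. \<phi> (0, z)) has_derivative (\<lambda>v. frechet_derivative \<phi> (at (0, z)) (0, v))) (at z)" by (simp add: o_def)
    have "((\<lambda>z. \<phi> (0, z)) has_derivative (\<lambda>v. v)) (at z)"
      by (rule has_derivative_transform_within_open[OF has_derivative_ident open_ball z]) (simp add: \<phi>0')
    from fun_cong[OF has_derivative_unique[OF 1 this], of v] show ?thesis .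
  qed
  have main: "frechet_derivative \<phi> (at (s0, z)) (0, \<Sum>l=1..r. \<alpha> 0 l *\<^sub>R A l z) = (\<Sum>l=1..r. \<alpha> s0 l *\<^sub>R A l (\<phi> (s0, z)))"
    if s0: "s0 \<in> {-c<..<c}" and z: "z \<in> ball z0 c" and \<alpha>: "transport_coeffs i c (fst z) \<alpha>" for s0 z \<alpha>
  proof -
    define c' where "c' = (\<bar>s0\<bar> + c) / 2"
    have c': "0 < c'" "c' < c" "\<bar>s0\<bar> < c'" using s0 by (auto simp: c'_def abs_less_iff)
    then have c's: "s0 \<in> {-c'..c'}" by (auto simp: abs_less_iff)
    have c'L: "c' * L < 1" using c' cL L by (meson le_less_trans less_imp_le mult_right_mono)
    have sN: "(s, z) \<in> N" "s \<in> {-c<..<c}" if "s \<in> {-c'..c'}" for s using that c' z by (auto simp: N_def)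
    let ?F = "\<lambda>s v. blinfun_apply (A' (\<phi> (s, z))) v"
    show ?thesis
    proof (rule ode_unique[OF c'(1) less_imp_le[OF L] c'L, where F = ?F
          and u = "\<lambda>s. frechet_derivative \<phi> (at (s, z)) (0, \<Sum>l=1..r. \<alpha> 0 l *\<^sub>R A l z)"
          and v = "\<lambda>s. \<Sum>l=1..r. \<alpha> s l *\<^sub>R A l (\<phi> (s, z))"])
      fix s assume s: "s \<in> {-c'..c'}"
      show "((\<lambda>s. frechet_derivative \<phi> (at (s, z)) (0, \<Sum>l=1..r. \<alpha> 0 l *\<^sub>R A l z)) has_vector_derivative
         ?F s (frechet_derivative \<phi> (at (s, z)) (0, \<Sum>l=1..r. \<alpha> 0 l *\<^sub>R A l z))) (at s within {-c'..c'})"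
        using has_vector_derivative_at_within[OF fd2[OF sN(1)[OF s]]] A'(3)[OF O[OF sN(1)[OF s]]] by simp
      show "norm (?F s a - ?F s b) \<le> L * norm (a - b)" for a b
      proof -
        have "norm (?F s (a - b)) \<le> norm (A' (\<phi> (s, z))) * norm (a - b)" by (rule norm_blinfun)
        also have "\<dots> \<le> L * norm (a - b)" using NS[OF sN(1)[OF s]] by (intro mult_right_mono) auto
        finally show ?thesis by (simp add: blinfun.diff_right)
      qed
      let ?w = "\<phi> (s, z)"
      have wO: "?w \<in> O1" by (rule O[OF sN(1)[OF s]])
      have dA: "((\<lambda>s. A l (\<phi> (s, z))) has_vector_derivative
          frechet_derivative (A l) (at ?w) (A i ?w)) (at s)" if "l \<in> ?R" for l
      proof -
        note d = smooth_on_has_derivative[OF smooth_A[OF that] wO]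
        from diff_chain_at[OF od[OF sN(1)[OF s], unfolded has_vector_derivative_def] d]
        show ?thesis unfolding has_vector_derivative_def o_def
          by (simp only: linear_scale[OF bounded_linear.linear[OF has_derivative_bounded_linear[OF d]]])
      qed
      have "((\<lambda>s. \<Sum>l\<in>?R. \<alpha> s l *\<^sub>R A l (\<phi> (s, z))) has_vector_derivative
          (\<Sum>l\<in>?R. \<alpha> s l *\<^sub>R frechet_derivative (A l) (at ?w) (A i ?w) +
             (- (\<Sum>m\<in>?R. f i m l (fst z + s) * \<alpha> s m)) *\<^sub>R A l ?w)) (at s)"
        using \<alpha> sN(2)[OF s] unfolding transport_coeffs_def
        by (intro has_vector_derivative_sum has_vector_derivative_scaleR dA) auto
      moreover have "(\<Sum>l\<in>?R. \<alpha> s l *\<^sub>R frechet_derivative (A l) (at ?w) (A i ?w) +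
             (- (\<Sum>m\<in>?R. f i m l (fst z + s) * \<alpha> s m)) *\<^sub>R A l ?w) = ?F s (\<Sum>l\<in>?R. \<alpha> s l *\<^sub>R A l ?w)"
      proof -
        have br: "frechet_derivative (A l) (at ?w) (A i ?w) = (\<Sum>k\<in>?R. f i l k (fst z + s) *\<^sub>R A k ?w) + ?F s (A l ?w)"
          if l: "l \<in> ?R" for l
          using bracket[OF i l wO] fst[OF sN(2)[OF s] z] A'(3)[OF wO] by (simp add: lie_bracket_def algebra_simps)
        have "(\<Sum>l\<in>?R. \<alpha> s l *\<^sub>R frechet_derivative (A l) (at ?w) (A i ?w)) =
           (\<Sum>l\<in>?R. \<Sum>k\<in>?R. (f i l k (fst z + s) * \<alpha> s l) *\<^sub>R A k ?w) + ?F s (\<Sum>l\<in>?R. \<alpha> s l *\<^sub>R A l ?w)"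
          by (simp add: br scaleR_add_right sum.distrib scaleR_sum_right blinfun.sum_right blinfun.scaleR_right mult.commute)
        also have "(\<Sum>l\<in>?R. \<Sum>k\<in>?R. (f i l k (fst z + s) * \<alpha> s l) *\<^sub>R A k ?w) =
            (\<Sum>l\<in>?R. (\<Sum>m\<in>?R. f i m l (fst z + s) * \<alpha> s m) *\<^sub>R A l ?w)"
          by (subst sum.swap) (simp add: scaleR_sum_left)
        finally have e: "(\<Sum>l\<in>?R. \<alpha> s l *\<^sub>R frechet_derivative (A l) (at ?w) (A i ?w)) =
            (\<Sum>l\<in>?R. (\<Sum>m\<in>?R. f i m l (fst z + s) * \<alpha> s m) *\<^sub>R A l ?w) + ?F s (\<Sum>l\<in>?R. \<alpha> s l *\<^sub>R A l ?w)" .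
        show ?thesis unfolding sum.distrib e scaleR_minus_left sum_negf by simp
      qed
      ultimately show "((\<lambda>s. \<Sum>l\<in>?R. \<alpha> s l *\<^sub>R A l (\<phi> (s, z))) has_vector_derivative
          ?F s (\<Sum>l\<in>?R. \<alpha> s l *\<^sub>R A l ?w)) (at s within {-c'..c'})"
        using has_vector_derivative_at_within by auto
    qed (use c's D0[OF z] \<phi>0'[OF z] in auto)
  qed
  show ?thesis
  proof (rule that[OF c(1,4) sm[unfolded N_def] \<phi>0' _ D0 inv main])
    show "\<phi> (s, z) \<in> O1 \<and> fst (\<phi> (s, z)) = fst z + s \<and> frechet_derivative \<phi> (at (s, z)) (1, 0) = A i (\<phi> (s, z))"
      if "s \<in> {-c<..<c}" "z \<in> ball z0 c" for s z
      using fst[OF that] O[of s z] fd1[of s z] that by (simp add: N_def)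
  qed
qed

end

section \<open>Compositions of flows\<close>

text \<open>The entry \<open>i\<close> of the first argument is the time for which the flow of the field \<open>A i\<close> is followed.\<close>

primrec flow_comp :: "(nat \<Rightarrow> real \<times> 'v \<Rightarrow> 'v) \<Rightarrow> nat list \<Rightarrow> (nat \<Rightarrow>\<^sub>C real) \<times> 'v \<Rightarrow> 'v" where
  "flow_comp \<phi> [] p = snd p"
| "flow_comp \<phi> (i # is) p = \<phi> i (apply_bcontfun (fst p) i, flow_comp \<phi> is p)"

primrec flow_comp_inv :: "(nat \<Rightarrow> real \<times> 'v \<Rightarrow> 'v) \<Rightarrow> nat list \<Rightarrow> (nat \<Rightarrow>\<^sub>C real) \<times> 'v \<Rightarrow> 'v" where
  "flow_comp_inv \<phi> [] p = snd p"
| "flow_comp_inv \<phi> (i # is) p = flow_comp_inv \<phi> is (fst p, \<phi> i (- apply_bcontfun (fst p) i, snd p))"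

lemma bounded_linear_apply_fst:
  "bounded_linear (\<lambda>p :: (nat \<Rightarrow>\<^sub>C real) \<times> 'v::real_normed_vector. apply_bcontfun (fst p) i)"
  by (rule bounded_linear_compose[OF bounded_linear_apply_bcontfun bounded_linear_fst])

lemma eventually_common_radius:
  fixes P :: "nat \<Rightarrow> 'b::real_normed_vector"
  assumes "finite K" "\<And>a. a \<in> K \<Longrightarrow> \<forall>\<^sub>F p in nhds (0 :: nat \<Rightarrow>\<^sub>C real, t1 :: real, P a). Q a p"
  obtains \<delta> where "\<delta> > 0" "\<And>a g t y. a \<in> K \<Longrightarrow> norm g < \<delta> \<Longrightarrow> \<bar>t - t1\<bar> < \<delta> \<Longrightarrow> dist y (P a) < \<delta> \<Longrightarrow> Q a (g, t, y)"
proof -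
  have "\<exists>d>0. \<forall>p. dist p (0, t1, P a) < d \<longrightarrow> Q a p" if "a \<in> K" for a
    using assms(2)[OF that] unfolding eventually_nhds_metric .
  then obtain d where d: "\<And>a. a \<in> K \<Longrightarrow> d a > 0" "\<And>a p. a \<in> K \<Longrightarrow> dist p (0, t1, P a) < d a \<Longrightarrow> Q a p"
    by metis
  define \<delta> where "\<delta> = Min (insert 1 (d ` K)) / 3"
  have \<delta>: "\<delta> > 0" "3 * \<delta> \<le> d a" if "a \<in> K" for a
  proof -
    show "\<delta> > 0" unfolding \<delta>_def using assms(1) d(1) by (auto simp: Min_gr_iff)
    show "3 * \<delta> \<le> d a" unfolding \<delta>_def using assms(1) that by (auto intro!: Min_le)
  qed
  have \<delta>0: "\<delta> > 0" unfolding \<delta>_def using assms(1) d(1) by (auto simp: Min_gr_iff)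
  show ?thesis
  proof (rule that[OF \<delta>0])
    fix a t y and g :: "nat \<Rightarrow>\<^sub>C real" assume a: "a \<in> K" and h: "norm g < \<delta>" "\<bar>t - t1\<bar> < \<delta>" "dist y (P a) < \<delta>"
    have "dist (g, t, y) (0, t1, P a) \<le> norm g + (\<bar>t - t1\<bar> + dist y (P a))"
      using norm_Pair_le[of g "(t - t1, y - P a)"] norm_Pair_le[of "t - t1" "y - P a"]
      by (simp add: dist_norm)
    also have "\<dots> < 3 * \<delta>" using h by linarith
    finally show "Q a (g, t, y)" using \<delta>(2)[OF a] d(2)[OF a] by force
  qed
qed

context bracket_module
begin

text \<open>Properties near one point suffice, since the domains shrink with every composition.\<close>

definition flow_germ :: "nat \<Rightarrow> real \<times> 'b \<Rightarrow> (real \<times> real \<times> 'b \<Rightarrow> real \<times> 'b) \<Rightarrow> bool" where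
  "flow_germ i z0 \<phi> \<longleftrightarrow> smooth_near (0, z0) \<phi> \<and> \<phi> (0, z0) = z0 \<and>
     (\<forall>\<^sub>F p in nhds (0, z0). \<phi> p \<in> O1 \<and> fst (\<phi> p) = fst (snd p) + fst p \<and>
        frechet_derivative \<phi> (at p) (1, 0) = A i (\<phi> p)) \<and>
     (\<forall>v. frechet_derivative \<phi> (at (0, z0)) (0, v) = v) \<and>
     (\<forall>\<^sub>F p in nhds (0, z0). \<phi> (- fst p, \<phi> p) = snd p)"

text \<open>Near every point \<open>P a\<close> there is a flow \<open>\<phi> a\<close> of the same field. The coefficients \<open>\<mu>\<close> of the image
  of a combination of the fields are chosen before the point: they depend only on \<open>\<beta>\<close> and on the times.\<close>

definition common_transport :: "real \<Rightarrow> (nat \<Rightarrow> 'b) \<Rightarrow> nat set \<Rightarrow> (nat \<Rightarrow> real \<times> real \<times> 'b \<Rightarrow> real \<times> 'b) \<Rightarrow> bool" where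
  "common_transport t1 P K \<phi> \<longleftrightarrow> (\<exists>\<delta>>0. \<forall>s t \<beta>. \<bar>s\<bar> < \<delta> \<longrightarrow> \<bar>t - t1\<bar> < \<delta> \<longrightarrow> (\<exists>\<mu>. \<forall>a\<in>K. \<forall>y. dist y (P a) < \<delta> \<longrightarrow>
     frechet_derivative (\<phi> a) (at (s, t, y)) (0, \<Sum>l=1..r. \<beta> l *\<^sub>R A l (t, y)) = (\<Sum>l=1..r. \<mu> l *\<^sub>R A l (\<phi> a (s, t, y)))))"

lemma flow_germs_exist:
  assumes i: "i \<in> {1..r}" and K: "finite K" and P: "\<And>a. a \<in> K \<Longrightarrow> (t1, P a) \<in> O1" and t1: "t1 \<in> I1"
  shows "\<exists>\<phi>. (\<forall>a\<in>K. flow_germ i (t1, P a) (\<phi> a)) \<and> common_transport t1 P K \<phi>"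
proof -
  obtain c' where c': "c' > 0"
    "\<And>t \<beta>. \<bar>t - t1\<bar> < c' \<Longrightarrow> \<exists>\<alpha>. transport_coeffs i c' t \<alpha> \<and> (\<forall>k\<in>{1..r}. \<alpha> 0 k = \<beta> k)"
    using transport_coeffs_exist[OF i t1] by metis
  define T where "T a c \<phi> \<longleftrightarrow> 0 < c \<and> c \<le> c' \<and> flow_germ i (t1, P a) \<phi> \<and>
    (\<forall>s z \<alpha>. s \<in> {-c<..<c} \<longrightarrow> z \<in> ball (t1, P a) c \<longrightarrow> transport_coeffs i c (fst z) \<alpha> \<longrightarrow>
      frechet_derivative \<phi> (at (s, z)) (0, \<Sum>l=1..r. \<alpha> 0 l *\<^sub>R A l z) = (\<Sum>l=1..r. \<alpha> s l *\<^sub>R A l (\<phi> (s, z))))" for a c \<phi>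
  have "\<exists>c \<phi>. T a c \<phi>" if a: "a \<in> K" for a
  proof -
    let ?z0 = "(t1, P a)"
    obtain c \<phi> where c: "c > 0" "c \<le> c'" and sm: "smooth_on ({-c<..<c} \<times> ball ?z0 c) \<phi>"
      and \<phi>0: "\<And>z. z \<in> ball ?z0 c \<Longrightarrow> \<phi> (0, z) = z"
      and \<phi>: "\<And>s z. s \<in> {-c<..<c} \<Longrightarrow> z \<in> ball ?z0 c \<Longrightarrow> \<phi> (s, z) \<in> O1 \<and> fst (\<phi> (s, z)) = fst z + s \<and>
        frechet_derivative \<phi> (at (s, z)) (1, 0) = A i (\<phi> (s, z))"
      and D0: "\<And>z v. z \<in> ball ?z0 c \<Longrightarrow> frechet_derivative \<phi> (at (0, z)) (0, v) = v"
      and inv: "\<forall>\<^sub>F p in nhds (0, ?z0). \<phi> (- fst p, \<phi> p) = snd p"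
      and tr: "\<And>s z \<alpha>. s \<in> {-c<..<c} \<Longrightarrow> z \<in> ball ?z0 c \<Longrightarrow> transport_coeffs i c (fst z) \<alpha> \<Longrightarrow>
        frechet_derivative \<phi> (at (s, z)) (0, \<Sum>l=1..r. \<alpha> 0 l *\<^sub>R A l z) = (\<Sum>l=1..r. \<alpha> s l *\<^sub>R A l (\<phi> (s, z)))"
      by (rule flow_transports[OF i P[OF a] c'(1)]) (rule that)
    let ?N = "{-c<..<c} \<times> ball ?z0 c"
    have N: "open ?N" "(0, ?z0) \<in> ?N" using c by (auto intro!: open_Times)
    have "smooth_near (0, ?z0) \<phi>" unfolding smooth_near_def using N sm by blast
    moreover have "\<forall>\<^sub>F p in nhds (0, ?z0). \<phi> p \<in> O1 \<and> fst (\<phi> p) = fst (snd p) + fst p \<and>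
        frechet_derivative \<phi> (at p) (1, 0) = A i (\<phi> p)"
      using eventually_nhds_in_open[OF N]
    proof eventually_elim
      case (elim p)
      then have "fst p \<in> {-c<..<c}" "snd p \<in> ball ?z0 c" unfolding mem_Times_iff by blast+
      from \<phi>[OF this] show ?case unfolding prod.collapse .
    qed
    moreover have "?z0 \<in> ball ?z0 c" using c by simp
    ultimately have "flow_germ i ?z0 \<phi>" unfolding flow_germ_def using \<phi>0 D0 inv by blast
    then have "T a c \<phi>" unfolding T_def using c tr by blast
    then show ?thesis by blast
  qed
  then obtain c \<phi> where T: "\<And>a. a \<in> K \<Longrightarrow> T a (c a) (\<phi> a)" by metis
  define \<delta> where "\<delta> = Min (insert c' (c ` K)) / 2"
  have cp: "c a > 0" if "a \<in> K" for a using T[OF that] by (simp add: T_def)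
  have \<delta>: "\<delta> > 0" "\<delta> < c'" unfolding \<delta>_def using K cp c'(1)
    by (auto simp: Min_gr_iff intro: order.strict_trans1[OF Min_le[of _ c']])
  have \<delta>c: "2 * \<delta> \<le> c a" if "a \<in> K" for a unfolding \<delta>_def using K that by (auto intro!: Min_le)
  have "common_transport t1 P K \<phi>" unfolding common_transport_def
  proof (intro exI[of _ \<delta>] conjI allI impI \<delta>(1))
    fix s t :: real and \<beta> :: "nat \<Rightarrow> real" assume s: "\<bar>s\<bar> < \<delta>" and t: "\<bar>t - t1\<bar> < \<delta>"
    obtain \<alpha> where \<alpha>: "transport_coeffs i c' t \<alpha>" "\<forall>k\<in>{1..r}. \<alpha> 0 k = \<beta> k" using c'(2)[of t \<beta>] t \<delta> by auto
    show "\<exists>\<mu>. \<forall>a\<in>K. \<forall>y. dist y (P a) < \<delta> \<longrightarrow>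
       frechet_derivative (\<phi> a) (at (s, t, y)) (0, \<Sum>l=1..r. \<beta> l *\<^sub>R A l (t, y)) = (\<Sum>l=1..r. \<mu> l *\<^sub>R A l (\<phi> a (s, t, y)))"
    proof (intro exI[of _ "\<alpha> s"] ballI allI impI)
      fix a y assume a: "a \<in> K" and y: "dist y (P a) < \<delta>"
      have "dist (t, y) (t1, P a) \<le> \<bar>t - t1\<bar> + dist y (P a)"
        using norm_Pair_le[of "t - t1" "y - P a"] by (simp add: dist_norm)
      then have z: "(t, y) \<in> ball (t1, P a) (c a)" using t y \<delta>c[OF a] by (simp add: dist_commute)
      have sc: "s \<in> {-c a<..<c a}" using s \<delta>c[OF a] \<delta>(1) by (auto simp: abs_less_iff)
      have tc: "transport_coeffs i (c a) (fst (t, y)) \<alpha>"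
        using \<alpha>(1) T[OF a] unfolding T_def transport_coeffs_def by auto
      have "frechet_derivative (\<phi> a) (at (s, t, y)) (0, \<Sum>l=1..r. \<alpha> 0 l *\<^sub>R A l (t, y)) = (\<Sum>l=1..r. \<alpha> s l *\<^sub>R A l (\<phi> a (s, t, y)))"
        using T[OF a] sc z tc unfolding T_def by blast
      moreover have "(\<Sum>l=1..r. \<alpha> 0 l *\<^sub>R A l (t, y)) = (\<Sum>l=1..r. \<beta> l *\<^sub>R A l (t, y))"
        using \<alpha>(2) by (intro sum.cong) auto
      ultimately show "frechet_derivative (\<phi> a) (at (s, t, y)) (0, \<Sum>l=1..r. \<beta> l *\<^sub>R A l (t, y)) = (\<Sum>l=1..r. \<alpha> s l *\<^sub>R A l (\<phi> a (s, t, y)))"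
        by simp
    qed
  qed
  then show ?thesis using T unfolding T_def by blast
qed

lemma inner_near_flow_step:
  assumes "smooth_near (0, z0) E"
  shows "inner_near (0, z0) (\<lambda>p :: (nat \<Rightarrow>\<^sub>C real) \<times> real \<times> 'b. (apply_bcontfun (fst p) i :: real, E p :: real \<times> 'b))"
  by (intro inner_near_Pair inner_near_linear bounded_linear_apply_fst smooth_near_imp_inner_near assms)

lemma flow_step_derivative:
  fixes E :: "(nat \<Rightarrow>\<^sub>C real) \<times> real \<times> 'b \<Rightarrow> real \<times> 'b"
  assumes E: "(E has_derivative E') (at p)"
    and \<phi>: "(\<phi> has_derivative \<phi>') (at (apply_bcontfun (fst p) i, E p))"
  shows "((\<lambda>p. \<phi> (apply_bcontfun (fst p) i, E p)) has_derivative
     (\<lambda>w. apply_bcontfun (fst w) i *\<^sub>R \<phi>' (1, 0) + \<phi>' (0, E' w))) (at p)"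
proof -
  have "((\<lambda>p. (apply_bcontfun (fst p) i, E p)) has_derivative (\<lambda>w. (apply_bcontfun (fst w) i, E' w))) (at p)"
    by (intro has_derivative_Pair bounded_linear_imp_has_derivative bounded_linear_apply_fst E)
  from diff_chain_at[OF this \<phi>]
  have 1: "((\<lambda>p. \<phi> (apply_bcontfun (fst p) i, E p)) has_derivative (\<lambda>w. \<phi>' (apply_bcontfun (fst w) i, E' w))) (at p)"
    by (simp add: o_def)
  interpret l: bounded_linear \<phi>' using \<phi> by (rule has_derivative_bounded_linear)
  have split: "\<phi>' (s, v) = s *\<^sub>R \<phi>' (1, 0) + \<phi>' (0, v)" for s v
    using l.add[of "s *\<^sub>R (1, 0)" "(0, v)"] l.scaleR[of s "(1, 0)"] by simp
  show ?thesis by (rule has_derivative_eq_rhs[OF 1 ext]) (rule split)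
qed

lemma flow_comp_germ:
  assumes "\<And>i. i \<in> set is \<Longrightarrow> flow_germ i z0 (\<phi> i)" and z0: "z0 \<in> O1"
  shows "smooth_near (0, z0) (flow_comp \<phi> is) \<and> flow_comp \<phi> is (0, z0) = z0 \<and>
    (\<forall>\<^sub>F p in nhds (0, z0). flow_comp \<phi> is p \<in> O1 \<and>
       fst (flow_comp \<phi> is p) = fst (snd p) + (\<Sum>i\<leftarrow>is. apply_bcontfun (fst p) i)) \<and>
    (flow_comp \<phi> is has_derivative (\<lambda>w. snd w + (\<Sum>i\<leftarrow>is. apply_bcontfun (fst w) i *\<^sub>R A i z0))) (at (0, z0))"
  using assms(1)
proof (induction "is")
  case Nil
  have "smooth_near (0, z0) (snd :: (nat \<Rightarrow>\<^sub>C real) \<times> real \<times> 'b \<Rightarrow> real \<times> 'b)"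
    by (intro inner_near_imp_smooth_near inner_near_linear bounded_linear_snd)
  moreover have "\<forall>\<^sub>F p :: (nat \<Rightarrow>\<^sub>C real) \<times> real \<times> 'b in nhds (0, z0). snd p \<in> O1"
    by (rule eventually_near_compose[where h = snd])
      (use z0 open_O1 in \<open>auto intro: eventually_nhds_in_open inner_near_linear bounded_linear_snd\<close>)
  moreover have "flow_comp \<phi> [] = snd" by (auto simp: fun_eq_iff)
  ultimately show ?case by (auto intro!: derivative_eq_intros)
next
  case (Cons i "is")
  let ?E = "flow_comp \<phi> is"
  have IH: "smooth_near (0, z0) ?E" "?E (0, z0) = z0"
    "\<forall>\<^sub>F p in nhds (0, z0). ?E p \<in> O1 \<and> fst (?E p) = fst (snd p) + (\<Sum>i\<leftarrow>is. apply_bcontfun (fst p) i)"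
    "(?E has_derivative (\<lambda>w. snd w + (\<Sum>i\<leftarrow>is. apply_bcontfun (fst w) i *\<^sub>R A i z0))) (at (0, z0))"
    using Cons by auto
  have g: "smooth_near (0, z0) (\<phi> i)" "\<phi> i (0, z0) = z0"
    "\<forall>\<^sub>F p in nhds (0, z0). \<phi> i p \<in> O1 \<and> fst (\<phi> i p) = fst (snd p) + fst p \<and> frechet_derivative (\<phi> i) (at p) (1, 0) = A i (\<phi> i p)"
    "\<And>v. frechet_derivative (\<phi> i) (at (0, z0)) (0, v) = v"
    using Cons.prems[of i] unfolding flow_germ_def by auto
  let ?h = "\<lambda>p. (apply_bcontfun (fst p) i, ?E p)"
  have h0: "?h (0, z0) = (0, z0)" by (simp add: IH(2))
  have inner: "inner_near (0, z0) ?h" by (rule inner_near_flow_step[OF IH(1)])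
  have eq: "flow_comp \<phi> (i # is) = (\<lambda>p. \<phi> i (?h p))" by (simp add: fun_eq_iff)
  have 1: "smooth_near (0, z0) (\<lambda>p. \<phi> i (?h p))"
    by (rule smooth_near_compose[OF _ inner]) (simp only: h0 g(1))
  have 2: "\<forall>\<^sub>F p in nhds (0, z0). \<phi> i (?h p) \<in> O1 \<and>
       fst (\<phi> i (?h p)) = fst (snd p) + (\<Sum>i\<leftarrow>i # is. apply_bcontfun (fst p) i)"
    using IH(3) eventually_near_compose[OF _ inner, unfolded h0, OF g(3)]
    by eventually_elim auto
  have d: "(\<phi> i has_derivative frechet_derivative (\<phi> i) (at (0, z0))) (at (?h (0, z0)))"
    unfolding h0 using eventually_nhds_x_imp_x[OF smooth_near_has_derivative[OF g(1)]] .
  have "A i (\<phi> i (0, z0)) = A i z0" using g(2) by simp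
  then have "frechet_derivative (\<phi> i) (at (0, z0)) (1, 0) = A i z0"
    using eventually_nhds_x_imp_x[OF g(3)] by simp
  then have 3: "((\<lambda>p. \<phi> i (?h p)) has_derivative (\<lambda>w. snd w + (\<Sum>i\<leftarrow>i # is. apply_bcontfun (fst w) i *\<^sub>R A i z0))) (at (0, z0))"
    using flow_step_derivative[OF IH(4) d] by (simp add: g(4) algebra_simps)
  show ?case unfolding eq using 1 2 3 g(2) IH(2) by auto
qed

lemma flow_comp_inv_germ:
  assumes "\<And>i. i \<in> set is \<Longrightarrow> flow_germ i z0 (\<phi> i)" and z0: "z0 \<in> O1"
  shows "smooth_near (0, z0) (flow_comp_inv \<phi> is) \<and> flow_comp_inv \<phi> is (0, z0) = z0 \<and>
    (\<forall>\<^sub>F p in nhds (0, z0). fst (flow_comp_inv \<phi> is p) = fst (snd p) - (\<Sum>i\<leftarrow>is. apply_bcontfun (fst p) i) \<and>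
       flow_comp_inv \<phi> is (fst p, flow_comp \<phi> is p) = snd p \<and>
       flow_comp \<phi> is (fst p, flow_comp_inv \<phi> is p) = snd p)"
  using assms(1)
proof (induction "is")
  case Nil
  have "smooth_near (0, z0) (snd :: (nat \<Rightarrow>\<^sub>C real) \<times> real \<times> 'b \<Rightarrow> real \<times> 'b)"
    by (intro inner_near_imp_smooth_near inner_near_linear bounded_linear_snd)
  moreover have "flow_comp_inv \<phi> [] = snd" by (auto simp: fun_eq_iff)
  ultimately show ?case by simp
next
  case (Cons i "is")
  let ?F = "flow_comp_inv \<phi> is"
  let ?E = "flow_comp \<phi> is"
  have IH: "smooth_near (0, z0) ?F" "?F (0, z0) = z0"
    "\<forall>\<^sub>F p in nhds (0, z0). fst (?F p) = fst (snd p) - (\<Sum>i\<leftarrow>is. apply_bcontfun (fst p) i) \<and>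
       ?F (fst p, ?E p) = snd p \<and> ?E (fst p, ?F p) = snd p"
    using Cons by auto
  have E: "smooth_near (0, z0) ?E" "?E (0, z0) = z0" using flow_comp_germ[of "is" z0 \<phi>] Cons.prems z0 by auto
  have g: "smooth_near (0, z0) (\<phi> i)" "\<phi> i (0, z0) = z0"
    "\<forall>\<^sub>F p in nhds (0, z0). \<phi> i p \<in> O1 \<and> fst (\<phi> i p) = fst (snd p) + fst p \<and> frechet_derivative (\<phi> i) (at p) (1, 0) = A i (\<phi> i p)"
    "\<forall>\<^sub>F p in nhds (0, z0). \<phi> i (- fst p, \<phi> i p) = snd p"
    using Cons.prems[of i] unfolding flow_germ_def by auto
  let ?m = "\<lambda>p :: (nat \<Rightarrow>\<^sub>C real) \<times> real \<times> 'b. (- apply_bcontfun (fst p) i, snd p)"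
  let ?k = "\<lambda>p :: (nat \<Rightarrow>\<^sub>C real) \<times> real \<times> 'b. (fst p, \<phi> i (?m p))"
  let ?h = "\<lambda>p. (apply_bcontfun (fst p) i, ?E p)"
  have m: "inner_near (0, z0) ?m"
    by (intro inner_near_linear bounded_linear_Pair bounded_linear_minus bounded_linear_apply_fst bounded_linear_snd)
  have m0: "?m (0, z0) = (0, z0)" by simp
  have sm: "smooth_near (0, z0) (\<lambda>p. \<phi> i (?m p))" by (rule smooth_near_compose[OF _ m]) (simp only: m0 g(1))
  have k: "inner_near (0, z0) ?k"
    by (intro inner_near_Pair inner_near_linear bounded_linear_fst smooth_near_imp_inner_near sm)
  have k0: "?k (0, z0) = (0, z0)" using g(2) by simp
  have h0: "?h (0, z0) = (0, z0)" by (simp add: E(2))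
  have h: "inner_near (0, z0) ?h" by (rule inner_near_flow_step[OF E(1)])
  have eqF: "flow_comp_inv \<phi> (i # is) = (\<lambda>p. ?F (?k p))" by (simp add: fun_eq_iff)
  have 1: "smooth_near (0, z0) (\<lambda>p. ?F (?k p))" by (rule smooth_near_compose[OF _ k]) (simp only: k0 IH(1))
  have 2: "\<forall>\<^sub>F p in nhds (0, z0). fst (?F (?k p)) = fst (snd p) - (\<Sum>i\<leftarrow>i # is. apply_bcontfun (fst p) i) \<and>
      flow_comp \<phi> (i # is) (fst p, ?F (?k p)) = snd p"
    using eventually_near_compose[OF _ k, unfolded k0, OF IH(3)] eventually_near_compose[OF _ m, unfolded m0, OF g(3)]
      eventually_near_compose[OF _ m, unfolded m0, OF g(4)]
    by eventually_elim auto
  have 3: "\<forall>\<^sub>F p in nhds (0, z0). ?F (?k (fst p, flow_comp \<phi> (i # is) p)) = snd p"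
    using IH(3) eventually_near_compose[OF _ h, unfolded h0, OF g(4)]
    by eventually_elim auto
  have 23: "\<forall>\<^sub>F p in nhds (0, z0). fst (?F (?k p)) = fst (snd p) - (\<Sum>i\<leftarrow>i # is. apply_bcontfun (fst p) i) \<and>
       ?F (?k (fst p, flow_comp \<phi> (i # is) p)) = snd p \<and>
       flow_comp \<phi> (i # is) (fst p, ?F (?k p)) = snd p"
    using 2 3 by eventually_elim blast
  show ?case unfolding eqF using 1 23 k0 IH(2) by simp
qed

text \<open>The transport is common to all points for every single flow, and a flow adds to the time the same
  amount at all points, so that the next flow again starts at a common time. A variation \<open>g'\<close> of the
  times contributes a multiple of \<open>A i\<close> in each step.\<close>

lemma flow_comp_transport:
  assumes K: "finite K" and P: "\<And>a. a \<in> K \<Longrightarrow> (t1, P a) \<in> O1"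
    and "\<And>i a. i \<in> set is \<Longrightarrow> a \<in> K \<Longrightarrow> flow_germ i (t1, P a) (\<phi> i a)"
    and "\<And>i. i \<in> set is \<Longrightarrow> common_transport t1 P K (\<phi> i)" and "set is \<subseteq> {1..r}"
  shows "\<exists>\<delta>>0. \<forall>g t. norm g < \<delta> \<longrightarrow> \<bar>t - t1\<bar> < \<delta> \<longrightarrow> (\<forall>g' \<beta>. \<exists>\<mu>. \<forall>a\<in>K. \<forall>y. dist y (P a) < \<delta> \<longrightarrow>
     frechet_derivative (flow_comp (\<lambda>i. \<phi> i a) is) (at (g, t, y)) (g', \<Sum>l=1..r. \<beta> l *\<^sub>R A l (t, y)) =
       (\<Sum>l=1..r. \<mu> l *\<^sub>R A l (flow_comp (\<lambda>i. \<phi> i a) is (g, t, y))))"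
  using assms(3-5)
proof (induction "is")
  case Nil
  have "flow_comp \<phi> [] = snd" for \<phi> :: "nat \<Rightarrow> real \<times> real \<times> 'b \<Rightarrow> real \<times> 'b" by (auto simp: fun_eq_iff)
  moreover have "frechet_derivative (snd :: (nat \<Rightarrow>\<^sub>C real) \<times> real \<times> 'b \<Rightarrow> real \<times> 'b) (at p) = snd" for p
    using frechet_derivative_at[OF bounded_linear_imp_has_derivative[OF bounded_linear_snd]] by metis
  ultimately show ?case by (intro exI[of _ 1]) auto
next
  case (Cons i "is")
  let ?E = "\<lambda>a. flow_comp (\<lambda>i. \<phi> i a) is"
  have "\<exists>\<delta>>0. \<forall>g t. norm g < \<delta> \<longrightarrow> \<bar>t - t1\<bar> < \<delta> \<longrightarrow> (\<forall>g' \<beta>. \<exists>\<mu>. \<forall>a\<in>K. \<forall>y. dist y (P a) < \<delta> \<longrightarrow>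
     frechet_derivative (?E a) (at (g, t, y)) (g', \<Sum>l=1..r. \<beta> l *\<^sub>R A l (t, y)) = (\<Sum>l=1..r. \<mu> l *\<^sub>R A l (?E a (g, t, y))))"
    by (rule Cons.IH) (use Cons.prems in simp_all)
  then obtain \<delta>1 where \<delta>1: "\<delta>1 > 0" "\<forall>g t. norm g < \<delta>1 \<longrightarrow> \<bar>t - t1\<bar> < \<delta>1 \<longrightarrow> (\<forall>g' \<beta>. \<exists>\<mu>. \<forall>a\<in>K. \<forall>y. dist y (P a) < \<delta>1 \<longrightarrow>
     frechet_derivative (?E a) (at (g, t, y)) (g', \<Sum>l=1..r. \<beta> l *\<^sub>R A l (t, y)) = (\<Sum>l=1..r. \<mu> l *\<^sub>R A l (?E a (g, t, y))))"
    by (elim exE conjE) (rule that)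
  have "common_transport t1 P K (\<phi> i)" using Cons.prems(2)[of i] by simp
  then obtain \<delta>2 where \<delta>2: "\<delta>2 > 0" "\<forall>s t \<beta>. \<bar>s\<bar> < \<delta>2 \<longrightarrow> \<bar>t - t1\<bar> < \<delta>2 \<longrightarrow> (\<exists>\<mu>. \<forall>a\<in>K. \<forall>y. dist y (P a) < \<delta>2 \<longrightarrow>
     frechet_derivative (\<phi> i a) (at (s, t, y)) (0, \<Sum>l=1..r. \<beta> l *\<^sub>R A l (t, y)) = (\<Sum>l=1..r. \<mu> l *\<^sub>R A l (\<phi> i a (s, t, y))))"
    unfolding common_transport_def by (elim exE conjE) (rule that)
  define Q where "Q a p \<longleftrightarrow> (?E a has_derivative frechet_derivative (?E a) (at p)) (at p) \<and>
     (\<phi> i a has_derivative frechet_derivative (\<phi> i a) (at (apply_bcontfun (fst p) i, ?E a p))) (at (apply_bcontfun (fst p) i, ?E a p)) \<and>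
     frechet_derivative (\<phi> i a) (at (apply_bcontfun (fst p) i, ?E a p)) (1, 0) = A i (\<phi> i a (apply_bcontfun (fst p) i, ?E a p)) \<and>
     fst (?E a p) = fst (snd p) + (\<Sum>i\<leftarrow>is. apply_bcontfun (fst p) i) \<and>
     \<bar>apply_bcontfun (fst p) i\<bar> < \<delta>2 \<and> \<bar>fst (?E a p) - t1\<bar> < \<delta>2 \<and> dist (snd (?E a p)) (P a) < \<delta>2" for a p
  have Qe: "\<forall>\<^sub>F p in nhds (0, t1, P a). Q a p" if a: "a \<in> K" for a
  proof -
    let ?z0 = "(t1, P a)"
    have E: "smooth_near (0, ?z0) (?E a)" "?E a (0, ?z0) = ?z0"
      "\<forall>\<^sub>F p in nhds (0, ?z0). ?E a p \<in> O1 \<and> fst (?E a p) = fst (snd p) + (\<Sum>i\<leftarrow>is. apply_bcontfun (fst p) i)"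
      using flow_comp_germ[of "is" ?z0 "\<lambda>i. \<phi> i a"] Cons.prems(1) P a by auto
    have g: "smooth_near (0, ?z0) (\<phi> i a)"
      "\<forall>\<^sub>F p in nhds (0, ?z0). \<phi> i a p \<in> O1 \<and> fst (\<phi> i a p) = fst (snd p) + fst p \<and> frechet_derivative (\<phi> i a) (at p) (1, 0) = A i (\<phi> i a p)"
      using Cons.prems(1)[of i a] a unfolding flow_germ_def by auto
    let ?h = "\<lambda>p. (apply_bcontfun (fst p) i, ?E a p)"
    have h0: "?h (0, ?z0) = (0, ?z0)" by (simp add: E(2))
    have h: "inner_near (0, ?z0) ?h" by (rule inner_near_flow_step[OF E(1)])
    have o: "open ({-\<delta>2<..<\<delta>2} \<times> {t1-\<delta>2<..<t1+\<delta>2} \<times> ball (P a) \<delta>2)" by (intro open_Times) auto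
    have box: "\<forall>\<^sub>F q in nhds (0, ?z0). q \<in> {-\<delta>2<..<\<delta>2} \<times> {t1-\<delta>2<..<t1+\<delta>2} \<times> ball (P a) \<delta>2"
      using \<delta>2(1) by (intro eventually_nhds_in_open[OF o]) auto
    show ?thesis
      using smooth_near_has_derivative[OF E(1)] E(3)
        eventually_near_compose[OF _ h, unfolded h0, OF smooth_near_has_derivative[OF g(1)]]
        eventually_near_compose[OF _ h, unfolded h0, OF g(2)] eventually_near_compose[OF _ h, unfolded h0, OF box]
      unfolding Q_def
      by eventually_elim (auto simp: abs_less_iff dist_commute mem_Times_iff)
  qed
  obtain \<delta>3 where \<delta>3: "\<delta>3 > 0" "\<And>a g t y. a \<in> K \<Longrightarrow> norm g < \<delta>3 \<Longrightarrow> \<bar>t - t1\<bar> < \<delta>3 \<Longrightarrow> dist y (P a) < \<delta>3 \<Longrightarrow> Q a (g, t, y)"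
    by (rule eventually_common_radius[where P = P and Q = Q, OF K]) (rule Qe, assumption, rule that)
  define \<delta> where "\<delta> = min \<delta>1 \<delta>3"
  show ?case
  proof (rule exI[of _ \<delta>], intro conjI allI impI)
    show "\<delta> > 0" using \<delta>1 \<delta>3 by (simp add: \<delta>_def)
    fix g :: "nat \<Rightarrow>\<^sub>C real" and t :: real and g' :: "nat \<Rightarrow>\<^sub>C real" and \<beta> :: "nat \<Rightarrow> real"
    assume g: "norm g < \<delta>" and t: "\<bar>t - t1\<bar> < \<delta>"
    have gt1: "norm g < \<delta>1" "\<bar>t - t1\<bar> < \<delta>1" using g t by (auto simp: \<delta>_def)
    obtain \<mu>1 where \<mu>1: "\<forall>a\<in>K. \<forall>y. dist y (P a) < \<delta>1 \<longrightarrow>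
       frechet_derivative (?E a) (at (g, t, y)) (g', \<Sum>l=1..r. \<beta> l *\<^sub>R A l (t, y)) = (\<Sum>l=1..r. \<mu>1 l *\<^sub>R A l (?E a (g, t, y)))"
      by (rule exE[OF \<delta>1(2)[rule_format, OF gt1, of g' \<beta>]]) (rule that)
    \<comment> \<open>The time after the inner flows is the same at all points.\<close>
    define \<tau> where "\<tau> = t + (\<Sum>i\<leftarrow>is. apply_bcontfun g i)"
    show "\<exists>\<mu>. \<forall>a\<in>K. \<forall>y. dist y (P a) < \<delta> \<longrightarrow>
       frechet_derivative (flow_comp (\<lambda>i. \<phi> i a) (i # is)) (at (g, t, y)) (g', \<Sum>l=1..r. \<beta> l *\<^sub>R A l (t, y)) =
         (\<Sum>l=1..r. \<mu> l *\<^sub>R A l (flow_comp (\<lambda>i. \<phi> i a) (i # is) (g, t, y)))"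
    proof (cases "\<bar>apply_bcontfun g i\<bar> < \<delta>2 \<and> \<bar>\<tau> - t1\<bar> < \<delta>2")
      case True
      then have s\<tau>: "\<bar>apply_bcontfun g i\<bar> < \<delta>2" "\<bar>\<tau> - t1\<bar> < \<delta>2" by blast+
      obtain \<mu>2 where \<mu>2: "\<forall>a\<in>K. \<forall>y. dist y (P a) < \<delta>2 \<longrightarrow>
         frechet_derivative (\<phi> i a) (at (apply_bcontfun g i, \<tau>, y)) (0, \<Sum>l=1..r. \<mu>1 l *\<^sub>R A l (\<tau>, y)) =
           (\<Sum>l=1..r. \<mu>2 l *\<^sub>R A l (\<phi> i a (apply_bcontfun g i, \<tau>, y)))"
        by (rule exE[OF \<delta>2(2)[rule_format, OF s\<tau>, of \<mu>1]]) (rule that)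
      define \<mu> where "\<mu> l = (if l = i then apply_bcontfun g' i else 0) + \<mu>2 l" for l
      show ?thesis
      proof (intro exI[of _ \<mu>] ballI allI impI)
        fix a y assume a: "a \<in> K" and y: "dist y (P a) < \<delta>"
        let ?p = "(g, t, y)"
        have q: "Q a ?p" using \<delta>3(2)[OF a, of g t y] g t y by (simp add: \<delta>_def)
        let ?w = "flow_comp (\<lambda>i. \<phi> i a) (i # is) ?p"
        obtain y' where Ep: "?E a ?p = (\<tau>, y')" using q by (cases "?E a ?p") (auto simp: Q_def \<tau>_def)
        have y': "dist y' (P a) < \<delta>2" using q Ep by (simp add: Q_def)
        have dE: "(?E a has_derivative frechet_derivative (?E a) (at ?p)) (at ?p)" using q by (simp add: Q_def)
        let ?q = "(apply_bcontfun (fst ?p) i, ?E a ?p)"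
        have q12: "(\<phi> i a has_derivative frechet_derivative (\<phi> i a) (at ?q)) (at ?q)"
          "frechet_derivative (\<phi> i a) (at ?q) (1, 0) = A i (\<phi> i a ?q)"
          using q unfolding Q_def by blast+
        have d\<phi>: "(\<phi> i a has_derivative frechet_derivative (\<phi> i a) (at (apply_bcontfun g i, \<tau>, y'))) (at (apply_bcontfun (fst ?p) i, ?E a ?p))"
          "frechet_derivative (\<phi> i a) (at (apply_bcontfun g i, \<tau>, y')) (1, 0) = A i ?w"
          using q12 by (simp_all add: Ep)
        have eq: "flow_comp (\<lambda>i. \<phi> i a) (i # is) = (\<lambda>p. \<phi> i a (apply_bcontfun (fst p) i, ?E a p))"
          by (simp add: fun_eq_iff)
        have "frechet_derivative (flow_comp (\<lambda>i. \<phi> i a) (i # is)) (at ?p) (g', \<Sum>l=1..r. \<beta> l *\<^sub>R A l (t, y)) =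
           apply_bcontfun g' i *\<^sub>R A i ?w + frechet_derivative (\<phi> i a) (at (apply_bcontfun g i, \<tau>, y'))
             (0, frechet_derivative (?E a) (at ?p) (g', \<Sum>l=1..r. \<beta> l *\<^sub>R A l (t, y)))"
          unfolding eq using frechet_derivative_at[OF flow_step_derivative[OF dE d\<phi>(1)], symmetric] d\<phi>(2) by simp
        also have "frechet_derivative (?E a) (at ?p) (g', \<Sum>l=1..r. \<beta> l *\<^sub>R A l (t, y)) = (\<Sum>l=1..r. \<mu>1 l *\<^sub>R A l (\<tau>, y'))"
          using \<mu>1[rule_format, OF a, of y] y Ep by (simp add: \<delta>_def)
        also have "frechet_derivative (\<phi> i a) (at (apply_bcontfun g i, \<tau>, y')) (0, \<Sum>l=1..r. \<mu>1 l *\<^sub>R A l (\<tau>, y')) =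
            (\<Sum>l=1..r. \<mu>2 l *\<^sub>R A l ?w)"
          using \<mu>2[rule_format, OF a y'] Ep by simp
        also have "apply_bcontfun g' i *\<^sub>R A i ?w + (\<Sum>l=1..r. \<mu>2 l *\<^sub>R A l ?w) = (\<Sum>l=1..r. \<mu> l *\<^sub>R A l ?w)"
        proof -
          have "(\<Sum>l=1..r. (if l = i then apply_bcontfun g' i else 0) *\<^sub>R A l ?w) = (\<Sum>l=1..r. if l = i then apply_bcontfun g' i *\<^sub>R A l ?w else 0)"
            by (intro sum.cong) auto
          also have "\<dots> = apply_bcontfun g' i *\<^sub>R A i ?w" using Cons.prems(3) by simp
          finally show ?thesis by (simp add: \<mu>_def scaleR_left_distrib sum.distrib)
        qed
        finally show "frechet_derivative (flow_comp (\<lambda>i. \<phi> i a) (i # is)) (at ?p) (g', \<Sum>l=1..r. \<beta> l *\<^sub>R A l (t, y)) =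
           (\<Sum>l=1..r. \<mu> l *\<^sub>R A l ?w)" .
      qed
    next
      case False
      have "\<not> dist y (P a) < \<delta>" if "a \<in> K" for a y
      proof
        assume "dist y (P a) < \<delta>"
        then have "Q a (g, t, y)" using \<delta>3(2)[OF that, of g t y] g t by (simp add: \<delta>_def)
        then show False using False by (auto simp: Q_def \<tau>_def)
      qed
      then show ?thesis by blast
    qed
  qed
qed

end

section \<open>Coordinates in which solutions are at rest\<close>

context bracket_module
begin

text \<open>The time is chosen such that the largest number of fields \<open>A j\<close> is independent, as fields on \<open>U1\<close>.
  These fields remain independent nearby and span the others. The pivots \<open>q k\<close> consist of a point and
  a direction, along which the coordinate is taken.\<close>

lemma independent_fields_exist:
  assumes I1: "I1 \<noteq> {}"
  obtains t1 S e q c where "t1 \<in> I1" "S \<subseteq> {1..r}" "e > 0" "ball t1 e \<subseteq> I1"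
    "\<And>k. k \<in> S \<Longrightarrow> fst (q k) \<in> U1"
    "\<And>k l. k \<in> S \<Longrightarrow> l \<in> S \<Longrightarrow> (\<Sum>j\<in>S. c k j * (A j (t1, fst (q l)) \<bullet> snd (q l))) = (if k = l then 1 else 0)"
    "\<And>j k. j \<in> S \<Longrightarrow> k \<in> S \<Longrightarrow> (\<Sum>l\<in>S. (A j (t1, fst (q l)) \<bullet> snd (q l)) * c l k) = (if j = k then 1 else 0)"
    "\<And>t j. t \<in> ball t1 e \<Longrightarrow> j \<in> {1..r} \<Longrightarrow> \<exists>a. \<forall>x\<in>U1. A j (t, x) = (\<Sum>l\<in>S. a l *\<^sub>R A l (t, x))"
proof -
  let ?D = "U1 \<times> (UNIV :: (real \<times> 'b) set)"
  define ev where "ev j t q = A j (t, fst q) \<bullet> snd q" for j t and q :: "'b \<times> real \<times> 'b"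
  define good where "good d \<longleftrightarrow> (\<exists>t\<in>I1. \<exists>S\<subseteq>{1..r}. card S = d \<and> indep_on ?D S (\<lambda>j. ev j t))" for d
  have "good 0"
  proof -
    obtain t where "t \<in> I1" using I1 by blast
    then show ?thesis unfolding good_def by (intro bexI[of _ t] exI[of _ "{}"]) (auto simp: indep_on_def)
  qed
  moreover have bnd: "d \<le> r" if gd: "good d" for d
  proof -
    obtain S where "S \<subseteq> {1..r}" "card S = d" using gd unfolding good_def by (elim bexE exE conjE) (rule that)
    then show ?thesis using card_mono[of "{1..r}" S] by simp
  qed
  ultimately have gm: "good (GREATEST d. good d)" "\<And>d. good d \<Longrightarrow> d \<le> (GREATEST d. good d)"
    using GreatestI_nat[of good 0 r] Greatest_le_nat[of good _ r] by auto
  obtain t1 S where t1: "t1 \<in> I1" and S: "S \<subseteq> {1..r}" "card S = (GREATEST d. good d)"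
    and ind: "indep_on ?D S (\<lambda>j. ev j t1)"
    using gm(1)[unfolded good_def[of "GREATEST d. good d"]] by (elim bexE exE conjE) (rule that)
  have finS: "finite S" using S finite_subset by blast
  obtain q c where q: "\<And>k. k \<in> S \<Longrightarrow> q k \<in> ?D"
    and c1: "\<And>k l. k \<in> S \<Longrightarrow> l \<in> S \<Longrightarrow> (\<Sum>j\<in>S. c k j * ev j t1 (q l)) = (if k = l then 1 else 0)"
    and c2: "\<And>j k. j \<in> S \<Longrightarrow> k \<in> S \<Longrightarrow> (\<Sum>l\<in>S. ev j t1 (q l) * c l k) = (if j = k then 1 else 0)"
    by (rule pivots_exist[OF finS ind]) (rule that)
  have qU: "fst (q k) \<in> U1" if "k \<in> S" for k using q[OF that] by auto
  have smF: "smooth_on I1 (\<lambda>t. ev j t (q l))" if j: "j \<in> S" and l: "l \<in> S" for j l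
  proof -
    have "smooth_on I1 (\<lambda>t. A j (t, fst (q l)))"
    proof (rule smooth_on_compose[OF open_I1 smooth_A])
      show "j \<in> {1..r}" using j S by blast
      show "smooth_inner I1 (\<lambda>t. (t, fst (q l)))"
        by (rule smooth_inner_Pair[OF open_I1 smooth_inner_linear[OF bounded_linear_ident] smooth_inner_const])
    qed (use qU[OF l] in auto)
    from smooth_on_linear_comp[OF bounded_linear_inner_left open_I1 this] show ?thesis by (simp add: ev_def)
  qed
  obtain N cc where N: "open N" "t1 \<in> N" "N \<subseteq> I1"
    and cc: "\<And>t j k. t \<in> N \<Longrightarrow> j \<in> S \<Longrightarrow> k \<in> S \<Longrightarrow> (\<Sum>l\<in>S. ev j t (q l) * cc l k t) = (if j = k then 1 else (0::real))"
    by (rule smooth_right_inverse[OF finS open_I1 t1 smF c2]) (assumption | rule that)+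
  obtain e where e: "e > 0" "ball t1 e \<subseteq> N" using N openE by blast
  have span: "\<exists>a. \<forall>x\<in>U1. A j (t, x) = (\<Sum>l\<in>S. a l *\<^sub>R A l (t, x))" if t: "t \<in> ball t1 e" and j: "j \<in> {1..r}" for t j
  proof (cases "j \<in> S")
    case True
    have "(\<Sum>l\<in>S. (if l = j then 1 else 0) *\<^sub>R A l (t, x)) = A j (t, x)" for x
    proof -
      have "(\<Sum>l\<in>S. (if l = j then 1 else 0) *\<^sub>R A l (t, x)) = (\<Sum>l\<in>S. if l = j then A l (t, x) else 0)"
        by (intro sum.cong) auto
      then show ?thesis using True finS by simp
    qed
    then show ?thesis by (intro exI[of _ "\<lambda>l. if l = j then 1 else 0"]) simp
  next
    case False
    have tN: "t \<in> N" "t \<in> I1" using t e N by auto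
    have indt: "indep_on ?D S (\<lambda>j. ev j t)"
      by (rule indep_on_right_inverse[where q = q and c = "\<lambda>l k. cc l k t", OF finS q cc[OF tN(1)]])
    have "\<not> indep_on ?D (insert j S) (\<lambda>j. ev j t)"
    proof
      assume "indep_on ?D (insert j S) (\<lambda>j. ev j t)"
      moreover have "insert j S \<subseteq> {1..r}" using S j by blast
      ultimately have "good (card (insert j S))" unfolding good_def using tN(2) by blast
      then show False using gm(2) S(2) False finS by fastforce
    qed
    then obtain b where b: "\<And>q. q \<in> ?D \<Longrightarrow> ev j t q = (\<Sum>l\<in>S. b l * ev l t q)"
      by (rule indep_on_insert_dependent[OF finS indt _ False]) (rule that)
    have "A j (t, x) = (\<Sum>l\<in>S. b l *\<^sub>R A l (t, x))" if "x \<in> U1" for x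
    proof (rule euclidean_eqI)
      fix i :: "real \<times> 'b"
      show "A j (t, x) \<bullet> i = (\<Sum>l\<in>S. b l *\<^sub>R A l (t, x)) \<bullet> i"
        using b[of "(x, i)"] that by (simp add: ev_def inner_sum_left)
    qed
    then show ?thesis by blast
  qed
  show ?thesis
    by (rule that[OF t1 S(1) e(1) subset_trans[OF e(2) N(3)] qU c1[unfolded ev_def] c2[unfolded ev_def] span])
qed

text \<open>The map \<open>E\<close> is a composition of flows for the times in its first argument. The times \<open>\<Gamma> (t, p)\<close>
  are chosen by the implicit function theorem such that, for each of the chosen independent fields, one
  coordinate of a transported point of \<open>p\<close> is constant. The tuple has one point for each of these
  fields, where the matrix of their coordinates is invertible.

  If \<open>t\<close>, \<open>p\<close> and \<open>y\<close> move along \<open>\<Sum>l. \<beta> l *\<^sub>R A l\<close>, then the transported points move along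
  \<open>\<Sum>l. \<mu> l *\<^sub>R A l\<close> with common coefficients \<open>\<mu>\<close>. The constant coordinates and the invertible matrix show
  that this combination is \<open>0\<close> as a field. So the point transported from \<open>y\<close> does not move, which is
  the last conclusion.\<close>

lemma transport_coordinates:
  assumes x1: "x1 \<in> U1" and I1: "I1 \<noteq> {}"
  obtains t1 p0 and E E' :: "(nat \<Rightarrow>\<^sub>C real) \<times> real \<times> 'b \<Rightarrow> real \<times> 'b" and \<Gamma> \<sigma>
  where "t1 \<in> I1" "p0 \<in> range (fin_seq {1..r})"
    "inner_near (t1, p0) \<Gamma>" "\<Gamma> (t1, p0) = 0" "bounded_linear \<sigma>"
    "smooth_near (0, t1, x1) E" "E (0, t1, x1) = (t1, x1)"
    "smooth_near (0, t1, x1) E'" "E' (0, t1, x1) = (t1, x1)"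
    "\<forall>\<^sub>F w in nhds (0, t1, x1). fst (E w) = fst (snd w) + \<sigma> (fst w) \<and> fst (E' w) = fst (snd w) - \<sigma> (fst w) \<and>
       E' (fst w, E w) = snd w \<and> E (fst w, E' w) = snd w"
    "\<forall>\<^sub>F w in nhds (t1, p0, x1). fst w \<in> I1 \<and> snd (snd w) \<in> U1 \<and> (\<forall>k\<in>{1..r}. apply_bcontfun (fst (snd w)) k \<in> U1) \<and>
       (\<forall>\<beta> v. (\<Sum>l=1..r. \<beta> l) = 1 \<longrightarrow>
          (\<forall>k\<in>{1..r}. apply_bcontfun v k = snd (\<Sum>l=1..r. \<beta> l *\<^sub>R A l (fst w, apply_bcontfun (fst (snd w)) k))) \<longrightarrow>
          frechet_derivative E (at (\<Gamma> (fst w, fst (snd w)), fst w, snd (snd w)))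
            (frechet_derivative \<Gamma> (at (fst w, fst (snd w))) (1, v), \<Sum>l=1..r. \<beta> l *\<^sub>R A l (fst w, snd (snd w))) = 0)"
proof -
  obtain t1 S e q c where t1: "t1 \<in> I1" and S: "S \<subseteq> {1..r}" and e: "e > 0" "ball t1 e \<subseteq> I1"
    and q: "\<And>k. k \<in> S \<Longrightarrow> fst (q k) \<in> U1"
    and c1: "\<And>k l. k \<in> S \<Longrightarrow> l \<in> S \<Longrightarrow> (\<Sum>j\<in>S. c k j * (A j (t1, fst (q l)) \<bullet> snd (q l))) = (if k = l then 1 else 0)"
    and c2: "\<And>j k. j \<in> S \<Longrightarrow> k \<in> S \<Longrightarrow> (\<Sum>l\<in>S. (A j (t1, fst (q l)) \<bullet> snd (q l)) * c l k) = (if j = k then 1 else 0)"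
    and span: "\<And>t j. t \<in> ball t1 e \<Longrightarrow> j \<in> {1..r} \<Longrightarrow> \<exists>a. \<forall>x\<in>U1. A j (t, x) = (\<Sum>l\<in>S. a l *\<^sub>R A l (t, x))"
    by (rule independent_fields_exist[OF I1]) (rule that)
  have finS: "finite S" using S finite_subset by blast
  have 0: "0 \<notin> S" using S by auto
  \<comment> \<open>The index \<open>0\<close>, which is not the index of a field, stands for the further point \<open>x1\<close>.\<close>
  define P where "P k = (if k \<in> S then fst (q k) else x1)" for k
  define B where "B k = snd (q k)" for k
  have PU: "P k \<in> U1" for k using q x1 by (simp add: P_def)
  have P0: "P 0 = x1" using 0 by (simp add: P_def)
  define K where "K = insert 0 S"
  have K: "finite K" using finS by (simp add: K_def)
  have PO: "(t1, P a) \<in> O1" for a using t1 PU by simp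
  have "\<exists>\<phi>. (\<forall>a\<in>K. flow_germ i (t1, P a) (\<phi> a)) \<and> common_transport t1 P K \<phi>" if "i \<in> {1..r}" for i
    by (rule flow_germs_exist[OF that K PO t1])
  then obtain \<phi> where \<phi>: "\<And>i a. i \<in> {1..r} \<Longrightarrow> a \<in> K \<Longrightarrow> flow_germ i (t1, P a) (\<phi> i a)"
    "\<And>i. i \<in> {1..r} \<Longrightarrow> common_transport t1 P K (\<phi> i)" by metis
  define ls where "ls = sorted_list_of_set S"
  have ls: "set ls = S" "distinct ls" using finS by (simp_all add: ls_def)
  have lsum: "(\<Sum>i\<leftarrow>ls. h i) = (\<Sum>i\<in>S. h i)" for h :: "nat \<Rightarrow> 'x::comm_monoid_add"
    using sum_list_distinct_conv_sum_set[OF ls(2)] ls(1) by simp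
  define E where "E a = flow_comp (\<lambda>i. \<phi> i a) ls" for a
  define E' where "E' = flow_comp_inv (\<lambda>i. \<phi> i 0) ls"
  define \<sigma> where "\<sigma> g = (\<Sum>i\<in>S. apply_bcontfun g i)" for g :: "nat \<Rightarrow>\<^sub>C real"
  have \<sigma>: "bounded_linear \<sigma>" unfolding \<sigma>_def by (intro bounded_linear_sum bounded_linear_apply_bcontfun)
  have germ: "flow_germ i (t1, P a) (\<phi> i a)" if "i \<in> set ls" "a \<in> K" for i a
    using \<phi>(1) that ls S by blast
  have Ea: "smooth_near (0, t1, P a) (E a) \<and> E a (0, t1, P a) = (t1, P a) \<and>
    (\<forall>\<^sub>F p in nhds (0, t1, P a). E a p \<in> O1 \<and> fst (E a p) = fst (snd p) + \<sigma> (fst p)) \<and>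
    (E a has_derivative (\<lambda>w. snd w + (\<Sum>i\<in>S. apply_bcontfun (fst w) i *\<^sub>R A i (t1, P a)))) (at (0, t1, P a))"
    if a: "a \<in> K" for a
    unfolding E_def \<sigma>_def lsum[symmetric]
    by (rule flow_comp_germ[where \<phi> = "\<lambda>i. \<phi> i a", OF _ PO]) (rule germ[OF _ a])
  note E = Ea[THEN conjunct1] Ea[THEN conjunct2, THEN conjunct1]
    Ea[THEN conjunct2, THEN conjunct2, THEN conjunct1] Ea[THEN conjunct2, THEN conjunct2, THEN conjunct2]
  have "0 \<in> K" by (simp add: K_def)
  note E0 = E[OF this, unfolded P0]
  have Ei: "smooth_near (0, t1, P 0) E' \<and> E' (0, t1, P 0) = (t1, P 0) \<and>
    (\<forall>\<^sub>F p in nhds (0, t1, P 0). fst (E' p) = fst (snd p) - \<sigma> (fst p) \<and> E' (fst p, E 0 p) = snd p \<and> E 0 (fst p, E' p) = snd p)"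
    unfolding E'_def E_def \<sigma>_def lsum[symmetric]
    by (rule flow_comp_inv_germ[where \<phi> = "\<lambda>i. \<phi> i 0", OF _ PO]) (rule germ[OF _ \<open>0 \<in> K\<close>])
  note E' = Ei[THEN conjunct1, unfolded P0] Ei[THEN conjunct2, THEN conjunct1, unfolded P0]
    Ei[THEN conjunct2, THEN conjunct2, unfolded P0]
  have "\<exists>\<delta>>0. \<forall>g t. norm g < \<delta> \<longrightarrow> \<bar>t - t1\<bar> < \<delta> \<longrightarrow> (\<forall>g' \<beta>. \<exists>\<mu>. \<forall>a\<in>K. \<forall>y. dist y (P a) < \<delta> \<longrightarrow>
     frechet_derivative (E a) (at (g, t, y)) (g', \<Sum>l=1..r. \<beta> l *\<^sub>R A l (t, y)) =
       (\<Sum>l=1..r. \<mu> l *\<^sub>R A l (E a (g, t, y))))"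
    unfolding E_def
    by (rule flow_comp_transport[OF K PO germ]) (use \<phi>(2) ls S in auto)
  then obtain \<delta> where \<delta>: "\<delta> > 0" and tr: "\<forall>g t. norm g < \<delta> \<longrightarrow> \<bar>t - t1\<bar> < \<delta> \<longrightarrow> (\<forall>g' \<beta>. \<exists>\<mu>. \<forall>a\<in>K. \<forall>y. dist y (P a) < \<delta> \<longrightarrow>
     frechet_derivative (E a) (at (g, t, y)) (g', \<Sum>l=1..r. \<beta> l *\<^sub>R A l (t, y)) =
       (\<Sum>l=1..r. \<mu> l *\<^sub>R A l (E a (g, t, y))))"
    by (elim exE conjE) (rule that)
  define p0 where "p0 = fin_seq {1..r} P"
  have p0: "apply_bcontfun p0 k = P k" if "k \<in> {1..r}" for k using that by (simp add: p0_def apply_fin_seq)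
  have p0S: "apply_bcontfun p0 k = P k" if "k \<in> S" for k using p0 that S by blast
  \<comment> \<open>The equations \<open>F k (g, t, p) = F k (0, t1, p0)\<close> determine the times \<open>g\<close>.\<close>
  define h where "h k \<zeta> = (fst \<zeta>, fst (snd \<zeta>), apply_bcontfun (snd (snd \<zeta>)) k)"
    for k and \<zeta> :: "(nat \<Rightarrow>\<^sub>C real) \<times> real \<times> (nat \<Rightarrow>\<^sub>C 'b)"
  define F where "F k \<zeta> = E k (h k \<zeta>) \<bullet> B k" for k \<zeta>
  define \<zeta>0 where "\<zeta>0 = (0 :: nat \<Rightarrow>\<^sub>C real, t1, p0)"
  have blh: "bounded_linear (h k)" for k unfolding h_def
    by (intro bounded_linear_Pair bounded_linear_fst bounded_linear_compose[OF bounded_linear_fst bounded_linear_snd]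
        bounded_linear_compose[OF bounded_linear_apply_bcontfun] bounded_linear_compose[OF bounded_linear_snd bounded_linear_snd])
  have h0: "h k \<zeta>0 = (0, t1, P k)" if "k \<in> S" for k using p0S[OF that] by (simp add: h_def \<zeta>0_def)
  have smF: "smooth_near \<zeta>0 (F k)" if k: "k \<in> S" for k
  proof -
    have "smooth_near \<zeta>0 (\<lambda>\<zeta>. E k (h k \<zeta>))"
      by (rule smooth_near_compose[OF _ inner_near_linear[OF blh]]) (use E(1)[of k] k h0[OF k] in \<open>simp add: K_def\<close>)
    then show ?thesis unfolding smooth_near_def F_def
      using smooth_on_linear_comp[OF bounded_linear_inner_left] by blast
  qed
  then have "\<forall>k\<in>S. \<exists>N. open N \<and> \<zeta>0 \<in> N \<and> smooth_on N (F k)" unfolding smooth_near_def by blast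
  then obtain NF where NF: "\<And>k. k \<in> S \<Longrightarrow> open (NF k) \<and> \<zeta>0 \<in> NF k \<and> smooth_on (NF k) (F k)" by metis
  define O' where "O' = (\<Inter>k\<in>S. NF k)"
  have O': "open O'" "\<zeta>0 \<in> O'" unfolding O'_def using NF finS by (auto intro!: open_INT)
  have smFO: "smooth_on O' (F k)" if "k \<in> S" for k
    by (rule smooth_on_subset[of "NF k"]) (use NF that in \<open>auto simp: O'_def\<close>)
  define d where "d i = (fin_seq S (c i), 0 :: real, 0 :: nat \<Rightarrow>\<^sub>C 'b)" for i
  have fd: "frechet_derivative (F k) (at \<zeta>0) (d i) = (if i = k then 1 else 0)" if i: "i \<in> S" and k: "k \<in> S" for i k
  proof -
    have "(E k has_derivative (\<lambda>w. snd w + (\<Sum>i\<in>S. apply_bcontfun (fst w) i *\<^sub>R A i (t1, P k)))) (at (h k \<zeta>0))"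
      unfolding h0[OF k] using E(4)[of k] k by (simp add: K_def)
    from has_derivative_inner_left[OF diff_chain_at[OF bounded_linear_imp_has_derivative[OF blh] this], of "B k"]
    have "(F k has_derivative (\<lambda>w. (snd (h k w) + (\<Sum>i\<in>S. apply_bcontfun (fst (h k w)) i *\<^sub>R A i (t1, P k))) \<bullet> B k)) (at \<zeta>0)"
      by (simp add: F_def[abs_def] o_def)
    from frechet_derivative_at[OF this, symmetric]
    have "frechet_derivative (F k) (at \<zeta>0) (d i) = (\<Sum>j\<in>S. c i j * (A j (t1, P k) \<bullet> B k))"
      using finS by (simp add: h_def d_def apply_fin_seq inner_add_left inner_sum_left inner_zero_left zero_prod_def[symmetric])
    also have "\<dots> = (if i = k then 1 else 0)" using c1[OF i k] k by (simp add: P_def B_def)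
    finally show ?thesis .
  qed
  have "\<exists>N \<gamma>. open N \<and> \<zeta>0 \<in> N \<and> (\<forall>i\<in>S. smooth_on N (\<gamma> i) \<and> \<gamma> i \<zeta>0 = (0::real)) \<and>
    (\<forall>z\<in>N. z + (\<Sum>i\<in>S. \<gamma> i z *\<^sub>R d i) \<in> O' \<and> (\<forall>k\<in>S. F k (z + (\<Sum>i\<in>S. \<gamma> i z *\<^sub>R d i)) = F k \<zeta>0))"
    by (rule implicit_functions[OF finS O' smFO fd])
  then obtain N \<gamma> where N: "open N" "\<zeta>0 \<in> N" and \<gamma>: "\<And>i. i \<in> S \<Longrightarrow> smooth_on N (\<gamma> i)" "\<And>i. i \<in> S \<Longrightarrow> \<gamma> i \<zeta>0 = (0::real)"
    and sol: "\<And>z k. z \<in> N \<Longrightarrow> k \<in> S \<Longrightarrow> F k (z + (\<Sum>i\<in>S. \<gamma> i z *\<^sub>R d i)) = F k \<zeta>0" by blast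
  define \<Gamma> where "\<Gamma> u = (\<Sum>i\<in>S. \<gamma> i (0, u) *\<^sub>R fin_seq S (c i))" for u :: "real \<times> (nat \<Rightarrow>\<^sub>C 'b)"
  let ?u0 = "(t1, p0)"
  have bl0: "bounded_linear (\<lambda>u :: real \<times> (nat \<Rightarrow>\<^sub>C 'b). (0 :: nat \<Rightarrow>\<^sub>C real, u))"
    by (intro bounded_linear_Pair bounded_linear_zero bounded_linear_ident)
  have \<Gamma>: "inner_near ?u0 \<Gamma>" unfolding \<Gamma>_def
  proof (intro inner_near_sum inner_near_scaleR)
    fix i assume i: "i \<in> S"
    have "smooth_near \<zeta>0 (\<gamma> i)" unfolding smooth_near_def using N \<gamma>(1)[OF i] by blast
    then show "smooth_near ?u0 (\<lambda>u. \<gamma> i (0, u))"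
      by (intro smooth_near_compose[OF _ inner_near_linear[OF bl0]]) (simp add: \<zeta>0_def)
  qed
  have \<Gamma>0: "\<Gamma> ?u0 = 0" using \<gamma>(2) by (simp add: \<Gamma>_def \<zeta>0_def)
  have eqF: "\<forall>\<^sub>F u in nhds ?u0. \<forall>k\<in>S. F k (\<Gamma> u, u) = F k \<zeta>0"
  proof -
    have "\<forall>\<^sub>F \<zeta> in nhds (0, ?u0). \<zeta> \<in> N" using N by (intro eventually_nhds_in_open) (auto simp: \<zeta>0_def)
    from eventually_near_compose[where h = "\<lambda>u. (0, u)", OF this inner_near_linear[OF bl0]]
    show ?thesis
    proof eventually_elim
      case (elim u)
      have "(0, u) + (\<Sum>i\<in>S. \<gamma> i (0, u) *\<^sub>R d i) = (\<Gamma> u, u)"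
        by (simp add: prod_eq_iff fst_sum snd_sum d_def \<Gamma>_def)
      then show ?case using sol[OF elim] by simp
    qed
  qed
  define G where "G k u = h k (\<Gamma> u, u)" for k and u :: "real \<times> (nat \<Rightarrow>\<^sub>C 'b)"
  have blid: "bounded_linear (\<lambda>u :: real \<times> (nat \<Rightarrow>\<^sub>C 'b). u)" by (rule bounded_linear_ident)
  have inG: "inner_near ?u0 (G k)" for k
  proof -
    have "inner_near ?u0 (\<lambda>u. (\<Gamma> u, fst u, apply_bcontfun (snd u) k))"
      by (intro inner_near_Pair \<Gamma> inner_near_linear bounded_linear_fst
          bounded_linear_compose[OF bounded_linear_apply_bcontfun bounded_linear_snd])
    then show ?thesis by (simp add: G_def[abs_def] h_def)
  qed
  have G0: "G k ?u0 = (0, t1, P k)" if "k \<in> S" for k using h0[OF that] by (simp add: G_def \<Gamma>0 \<zeta>0_def)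
  have kK: "k \<in> K" if "k \<in> S" for k using that by (simp add: K_def)
  \<comment> \<open>The pivot matrix stays invertible along the transported points.\<close>
  define H where "H j k u = A j (E k (G k u)) \<bullet> B k" for j k u
  have smH: "smooth_near ?u0 (H j k)" if j: "j \<in> S" and k: "k \<in> S" for j k
  proof -
    have 1: "smooth_near ?u0 (\<lambda>u. E k (G k u))"
      by (rule smooth_near_compose[OF _ inG]) (simp add: G0[OF k] E(1)[OF kK[OF k]])
    have EG0: "E k (G k ?u0) = (t1, P k)" by (simp add: G0[OF k] E(2)[OF kK[OF k]])
    have "smooth_near (E k (G k ?u0)) (A j)"
      unfolding smooth_near_def EG0 using open_O1 PO smooth_A j S by blast
    then have "smooth_near ?u0 (\<lambda>u. A j (E k (G k u)))"
      by (rule smooth_near_compose[OF _ smooth_near_imp_inner_near[OF 1]])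
    then show ?thesis unfolding smooth_near_def H_def
      using smooth_on_linear_comp[OF bounded_linear_inner_left] by blast
  qed
  then have "\<forall>j\<in>S. \<forall>k\<in>S. \<exists>N. open N \<and> ?u0 \<in> N \<and> smooth_on N (H j k)" unfolding smooth_near_def by blast
  then obtain NH where NH: "\<And>j k. j \<in> S \<Longrightarrow> k \<in> S \<Longrightarrow> open (NH j k) \<and> ?u0 \<in> NH j k \<and> smooth_on (NH j k) (H j k)" by metis
  define OH where "OH = (\<Inter>j\<in>S. \<Inter>k\<in>S. NH j k)"
  have OH: "open OH" "?u0 \<in> OH" unfolding OH_def using NH finS by (auto intro!: open_INT)
  have smHO: "smooth_on OH (H j k)" if "j \<in> S" "k \<in> S" for j k
    by (rule smooth_on_subset[of "NH j k"]) (use NH that in \<open>auto simp: OH_def\<close>)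
  have H0: "(\<Sum>l\<in>S. H j l ?u0 * c l k) = (if j = k then 1 else 0)" if "j \<in> S" "k \<in> S" for j k
  proof -
    have "H j l ?u0 = A j (t1, fst (q l)) \<bullet> snd (q l)" if "l \<in> S" for l
      using G0[OF that] E(2)[OF kK[OF that]] that by (simp add: H_def P_def B_def)
    then show ?thesis using c2[OF that] by simp
  qed
  obtain NC cc where NC: "open NC" "?u0 \<in> NC"
    and cc: "\<And>u j k. u \<in> NC \<Longrightarrow> j \<in> S \<Longrightarrow> k \<in> S \<Longrightarrow> (\<Sum>l\<in>S. H j l u * cc l k u) = (if j = k then 1 else (0::real))"
    by (rule smooth_right_inverse[OF finS OH smHO H0]) (assumption | rule that)+
  have sm\<Gamma>: "smooth_near ?u0 \<Gamma>" by (rule inner_near_imp_smooth_near[OF \<Gamma>])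
  define R where "R u \<longleftrightarrow> fst u \<in> I1 \<and> (\<forall>k\<in>{1..r}. apply_bcontfun (snd u) k \<in> U1) \<and> norm (\<Gamma> u) < \<delta> \<and> \<bar>fst u - t1\<bar> < \<delta> \<and>
     fst u + \<sigma> (\<Gamma> u) \<in> ball t1 e \<and> u \<in> NC \<and> (\<Gamma> has_derivative frechet_derivative \<Gamma> (at u)) (at u) \<and>
     (\<forall>\<^sub>F u' in nhds u. \<forall>k\<in>S. F k (\<Gamma> u', u') = F k \<zeta>0) \<and>
     (\<forall>k\<in>S. dist (apply_bcontfun (snd u) k) (P k) < \<delta> \<and>
        (E k has_derivative frechet_derivative (E k) (at (G k u))) (at (G k u)) \<and>
        E k (G k u) \<in> O1 \<and> fst (E k (G k u)) = fst u + \<sigma> (\<Gamma> u))" for u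
  have R: "\<forall>\<^sub>F u in nhds ?u0. R u"
  proof -
    have t1': "\<forall>\<^sub>F u in nhds ?u0. fst u \<in> I1 \<inter> ball t1 \<delta>"
      by (rule eventually_near_compose[where h = fst, OF _ inner_near_linear[OF bounded_linear_fst]])
        (rule eventually_nhds_in_open; use open_I1 t1 \<delta> in auto)
    have pU: "\<forall>\<^sub>F u in nhds ?u0. apply_bcontfun (snd u) k \<in> U1 \<inter> ball (P k) \<delta>" if "k \<in> {1..r}" for k
    proof (rule eventually_near_compose[where h = "\<lambda>u :: real \<times> (nat \<Rightarrow>\<^sub>C 'b). apply_bcontfun (snd u) k"])
      show "\<forall>\<^sub>F x in nhds (apply_bcontfun (snd ?u0) k). x \<in> U1 \<inter> ball (P k) \<delta>"
        using open_U1 PU \<delta> p0[OF that] by (intro eventually_nhds_in_open) auto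
    qed (intro inner_near_linear bounded_linear_compose[OF bounded_linear_apply_bcontfun bounded_linear_snd])
    then have pU': "\<forall>\<^sub>F u in nhds ?u0. \<forall>k\<in>{1..r}. apply_bcontfun (snd u) k \<in> U1 \<inter> ball (P k) \<delta>"
      by (intro eventually_ball_finite) auto
    have G1: "\<forall>\<^sub>F u in nhds ?u0. \<Gamma> u \<in> ball 0 \<delta>"
      by (rule eventually_near_compose[OF _ \<Gamma>]) (rule eventually_nhds_in_open; use \<delta> \<Gamma>0 in auto)
    have \<tau>: "\<forall>\<^sub>F u in nhds ?u0. fst u + \<sigma> (\<Gamma> u) \<in> ball t1 e"
    proof -
      have \<tau>: "bounded_linear (\<lambda>w :: (nat \<Rightarrow>\<^sub>C real) \<times> real. snd w + \<sigma> (fst w))"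
        by (intro bounded_linear_add bounded_linear_snd bounded_linear_compose[OF \<sigma> bounded_linear_fst])
      have 1: "\<forall>\<^sub>F w in nhds (\<Gamma> ?u0, fst ?u0). snd w + \<sigma> (fst w) \<in> ball t1 e"
        by (rule eventually_near_compose[where h = "\<lambda>w. snd w + \<sigma> (fst w)", OF _ inner_near_linear[OF \<tau>]])
          (rule eventually_nhds_in_open; use e \<Gamma>0 linear_0[OF bounded_linear.linear[OF \<sigma>]] in auto)
      from eventually_near_compose[where h = "\<lambda>u. (\<Gamma> u, fst u)", OF 1 inner_near_Pair[OF \<Gamma> inner_near_linear[OF bounded_linear_fst]]]
      show ?thesis by simp
    qed
    have Ek: "\<forall>\<^sub>F u in nhds ?u0. (E k has_derivative frechet_derivative (E k) (at (G k u))) (at (G k u)) \<and>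
        E k (G k u) \<in> O1 \<and> fst (E k (G k u)) = fst u + \<sigma> (\<Gamma> u)" if k: "k \<in> S" for k
    proof -
      have 1: "\<forall>\<^sub>F p in nhds (G k ?u0). (E k has_derivative frechet_derivative (E k) (at p)) (at p) \<and>
          E k p \<in> O1 \<and> fst (E k p) = fst (snd p) + \<sigma> (fst p)"
        unfolding G0[OF k] by (rule eventually_conj[OF smooth_near_has_derivative[OF E(1)[OF kK[OF k]]] E(3)[OF kK[OF k]]])
      show ?thesis using eventually_near_compose[where h = "G k", OF 1 inG]
        by eventually_elim (simp add: G_def h_def)
    qed
    then have Ek': "\<forall>\<^sub>F u in nhds ?u0. \<forall>k\<in>S. (E k has_derivative frechet_derivative (E k) (at (G k u))) (at (G k u)) \<and>
        E k (G k u) \<in> O1 \<and> fst (E k (G k u)) = fst u + \<sigma> (\<Gamma> u)"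
      using finS by (intro eventually_ball_finite) auto
    have nc: "\<forall>\<^sub>F u in nhds ?u0. u \<in> NC" by (rule eventually_nhds_in_open[OF NC])
    have ee: "\<forall>\<^sub>F u in nhds ?u0. \<forall>\<^sub>F u' in nhds u. \<forall>k\<in>S. F k (\<Gamma> u', u') = F k \<zeta>0"
      using eqF unfolding eventually_eventually .
    show ?thesis
      using t1' pU' G1 \<tau> smooth_near_has_derivative[OF sm\<Gamma>] Ek' nc ee
    proof eventually_elim
      case (elim u)
      have "\<bar>fst u - t1\<bar> < \<delta>" using elim(1) by (auto simp: dist_real_def)
      moreover have "dist (apply_bcontfun (snd u) k) (P k) < \<delta>" if "k \<in> S" for k
        using elim(2) that S by (auto simp: dist_commute)
      moreover have "norm (\<Gamma> u) < \<delta>" using elim(3) by simp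
      ultimately show ?case unfolding R_def using elim(1,2,4-8) by blast
    qed
  qed
  have main: "frechet_derivative (E 0) (at (\<Gamma> u, fst u, y)) (frechet_derivative \<Gamma> (at u) (1, v), \<Sum>l=1..r. \<beta> l *\<^sub>R A l (fst u, y)) = 0"
    if u: "R u" and y: "dist y x1 < \<delta>" "E 0 (\<Gamma> u, fst u, y) \<in> O1" "fst (E 0 (\<Gamma> u, fst u, y)) = fst u + \<sigma> (\<Gamma> u)"
    and \<beta>: "(\<Sum>l=1..r. \<beta> l) = 1"
    and v: "\<forall>k\<in>{1..r}. apply_bcontfun v k = snd (\<Sum>l=1..r. \<beta> l *\<^sub>R A l (fst u, apply_bcontfun (snd u) k))"
    for u y v \<beta>
  proof -
    let ?\<tau> = "fst u + \<sigma> (\<Gamma> u)"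
    let ?g' = "frechet_derivative \<Gamma> (at u) (1, v)"
    have u1: "norm (\<Gamma> u) < \<delta>" "\<bar>fst u - t1\<bar> < \<delta>" and \<tau>: "?\<tau> \<in> ball t1 e" and uNC: "u \<in> NC"
      and d\<Gamma>: "(\<Gamma> has_derivative frechet_derivative \<Gamma> (at u)) (at u)"
      and const: "\<forall>\<^sub>F u' in nhds u. \<forall>k\<in>S. F k (\<Gamma> u', u') = F k \<zeta>0"
      and uk: "\<And>k. k \<in> S \<Longrightarrow> dist (apply_bcontfun (snd u) k) (P k) < \<delta>"
        "\<And>k. k \<in> S \<Longrightarrow> (E k has_derivative frechet_derivative (E k) (at (G k u))) (at (G k u))"
        "\<And>k. k \<in> S \<Longrightarrow> E k (G k u) \<in> O1" "\<And>k. k \<in> S \<Longrightarrow> fst (E k (G k u)) = ?\<tau>"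
      using u unfolding R_def by blast+
    obtain \<mu> where \<mu>: "\<forall>a\<in>K. \<forall>y. dist y (P a) < \<delta> \<longrightarrow>
       frechet_derivative (E a) (at (\<Gamma> u, fst u, y)) (?g', \<Sum>l=1..r. \<beta> l *\<^sub>R A l (fst u, y)) =
         (\<Sum>l=1..r. \<mu> l *\<^sub>R A l (E a (\<Gamma> u, fst u, y)))"
      by (rule exE[OF tr[rule_format, OF u1, of ?g' \<beta>]]) (rule that)
    have "\<forall>l\<in>{1..r}. \<exists>a. \<forall>x\<in>U1. A l (?\<tau>, x) = (\<Sum>j\<in>S. a j *\<^sub>R A j (?\<tau>, x))" using span[OF \<tau>] by blast
    then obtain a where a: "\<And>l x. l \<in> {1..r} \<Longrightarrow> x \<in> U1 \<Longrightarrow> A l (?\<tau>, x) = (\<Sum>j\<in>S. a l j *\<^sub>R A j (?\<tau>, x))" by metis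
    define \<nu> where "\<nu> j = (\<Sum>l=1..r. \<mu> l * a l j)" for j
    have red: "(\<Sum>l=1..r. \<mu> l *\<^sub>R A l z) = (\<Sum>j\<in>S. \<nu> j *\<^sub>R A j z)" if z: "z \<in> O1" "fst z = ?\<tau>" for z
    proof -
      have ze: "z = (?\<tau>, snd z)" "snd z \<in> U1" using z by (auto simp: prod_eq_iff)
      have "(\<Sum>l=1..r. \<mu> l *\<^sub>R A l z) = (\<Sum>l=1..r. \<mu> l *\<^sub>R (\<Sum>j\<in>S. a l j *\<^sub>R A j z))"
        using a[OF _ ze(2)] ze(1) by (intro sum.cong) auto
      also have "\<dots> = (\<Sum>j\<in>S. \<Sum>l=1..r. (\<mu> l * a l j) *\<^sub>R A j z)"
        unfolding scaleR_sum_right scaleR_scaleR by (rule sum.swap)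
      finally show ?thesis by (simp add: \<nu>_def scaleR_sum_left)
    qed
    have zero: "(\<Sum>j\<in>S. \<nu> j * H j k u) = 0" if k: "k \<in> S" for k
    proof -
      have Gu: "G k u = (\<Gamma> u, fst u, apply_bcontfun (snd u) k)" by (simp add: G_def h_def)
      have kr: "k \<in> {1..r}" using k S by blast
      have dG: "(G k has_derivative (\<lambda>w. (frechet_derivative \<Gamma> (at u) w, fst w, apply_bcontfun (snd w) k))) (at u)"
      proof -
        have "((\<lambda>u. (\<Gamma> u, fst u, apply_bcontfun (snd u) k)) has_derivative
            (\<lambda>w. (frechet_derivative \<Gamma> (at u) w, fst w, apply_bcontfun (snd w) k))) (at u)"
          by (intro has_derivative_Pair d\<Gamma> bounded_linear_imp_has_derivative bounded_linear_fst
              bounded_linear_compose[OF bounded_linear_apply_bcontfun bounded_linear_snd])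
        then show ?thesis by (simp add: G_def[abs_def] h_def)
      qed
      from has_derivative_inner_left[OF diff_chain_at[OF dG uk(2)[OF k]], of "B k"]
      have 1: "((\<lambda>u. F k (\<Gamma> u, u)) has_derivative (\<lambda>w. frechet_derivative (E k) (at (G k u))
          (frechet_derivative \<Gamma> (at u) w, fst w, apply_bcontfun (snd w) k) \<bullet> B k)) (at u)"
        by (simp add: F_def G_def o_def)
      have "((\<lambda>u. F k (\<Gamma> u, u)) has_derivative (\<lambda>w. 0)) (at u)"
      proof -
        obtain T where T: "open T" "u \<in> T" "\<forall>u'\<in>T. \<forall>k\<in>S. F k (\<Gamma> u', u') = F k \<zeta>0"
          using const unfolding eventually_nhds by blast
        show ?thesis
          by (rule has_derivative_transform_within_open[OF has_derivative_const[of "F k \<zeta>0"] T(1,2)]) (use T(3) k in auto)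
      qed
      from fun_cong[OF has_derivative_unique[OF 1 this], of "(1, v)"]
      have "frechet_derivative (E k) (at (G k u)) (?g', 1, apply_bcontfun v k) \<bullet> B k = 0" by simp
      moreover have "(1, apply_bcontfun v k) = (\<Sum>l=1..r. \<beta> l *\<^sub>R A l (fst u, apply_bcontfun (snd u) k))"
        using v kr \<beta> by (simp add: prod_eq_iff fst_sum fst_A)
      ultimately have "(\<Sum>l=1..r. \<mu> l *\<^sub>R A l (E k (G k u))) \<bullet> B k = 0"
        using \<mu>[rule_format, OF kK[OF k] uk(1)[OF k]] unfolding Gu by simp
      then show ?thesis unfolding red[OF uk(3)[OF k] uk(4)[OF k]] by (simp add: H_def inner_sum_left)
    qed
    have "\<nu> k = 0" if k: "k \<in> S" for k
      using sum_right_inverse[where F = "\<lambda>j l. H j l u" and c = "\<lambda>l k. cc l k u" and \<mu> = \<nu>, OF finS k cc[OF uNC _ k]] zero by simp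
    then have "(\<Sum>l=1..r. \<mu> l *\<^sub>R A l (E 0 (\<Gamma> u, fst u, y))) = 0" using red[OF y(2,3)] by simp
    then show ?thesis using \<mu>[rule_format, OF \<open>0 \<in> K\<close>, of y] y(1) by (simp add: P0)
  qed
  have "\<forall>\<^sub>F w in nhds (t1, p0, x1). R (fst w, fst (snd w)) \<and> dist (snd (snd w)) x1 < \<delta> \<and> snd (snd w) \<in> U1 \<and>
     E 0 (\<Gamma> (fst w, fst (snd w)), fst w, snd (snd w)) \<in> O1 \<and>
     fst (E 0 (\<Gamma> (fst w, fst (snd w)), fst w, snd (snd w))) = fst w + \<sigma> (\<Gamma> (fst w, fst (snd w)))"
  proof -
    let ?pr = "\<lambda>w :: real \<times> (nat \<Rightarrow>\<^sub>C 'b) \<times> 'b. (fst w, fst (snd w))"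
    have pr: "bounded_linear ?pr"
      by (intro bounded_linear_Pair bounded_linear_fst bounded_linear_compose[OF bounded_linear_fst bounded_linear_snd])
    have ss: "bounded_linear (\<lambda>w :: real \<times> (nat \<Rightarrow>\<^sub>C 'b) \<times> 'b. snd (snd w))"
      by (intro bounded_linear_compose[OF bounded_linear_snd bounded_linear_snd])
    have 1: "\<forall>\<^sub>F w in nhds (t1, p0, x1). R (?pr w)"
      by (rule eventually_near_compose[where h = ?pr, OF _ inner_near_linear[OF pr]]) (use R in simp)
    have 2: "\<forall>\<^sub>F w in nhds (t1, p0, x1). snd (snd w) \<in> ball x1 \<delta> \<inter> U1"
      by (rule eventually_near_compose[where h = "\<lambda>w. snd (snd w)", OF _ inner_near_linear[OF ss]])
        (rule eventually_nhds_in_open; use \<delta> x1 open_U1 in auto)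
    have i\<Gamma>: "inner_near (t1, p0, x1) (\<lambda>w. \<Gamma> (?pr w))"
      by (rule inner_near_compose[where h = ?pr, OF _ inner_near_linear[OF pr]]) (use \<Gamma> in simp)
    have i3: "inner_near (t1, p0, x1) (\<lambda>w. (\<Gamma> (?pr w), fst w, snd (snd w)))"
      by (intro inner_near_Pair i\<Gamma> inner_near_linear bounded_linear_fst ss)
    have 3: "\<forall>\<^sub>F w in nhds (t1, p0, x1). E 0 (\<Gamma> (?pr w), fst w, snd (snd w)) \<in> O1 \<and>
       fst (E 0 (\<Gamma> (?pr w), fst w, snd (snd w))) = fst w + \<sigma> (\<Gamma> (?pr w))"
    proof -
      have "\<forall>\<^sub>F p in nhds (\<Gamma> (?pr (t1, p0, x1)), fst (t1, p0, x1), snd (snd (t1, p0, x1))). E 0 p \<in> O1 \<and> fst (E 0 p) = fst (snd p) + \<sigma> (fst p)"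
        using E0(3) \<Gamma>0 by simp
      from eventually_near_compose[where h = "\<lambda>w. (\<Gamma> (?pr w), fst w, snd (snd w))", OF this i3]
      show ?thesis by simp
    qed
    show ?thesis using 1 2 3 by eventually_elim (auto simp: dist_commute)
  qed
  then have near: "\<forall>\<^sub>F w in nhds (t1, p0, x1). fst w \<in> I1 \<and> snd (snd w) \<in> U1 \<and> (\<forall>k\<in>{1..r}. apply_bcontfun (fst (snd w)) k \<in> U1) \<and>
       (\<forall>\<beta> v. (\<Sum>l=1..r. \<beta> l) = 1 \<longrightarrow>
          (\<forall>k\<in>{1..r}. apply_bcontfun v k = snd (\<Sum>l=1..r. \<beta> l *\<^sub>R A l (fst w, apply_bcontfun (fst (snd w)) k))) \<longrightarrow>
          frechet_derivative (E 0) (at (\<Gamma> (fst w, fst (snd w)), fst w, snd (snd w)))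
            (frechet_derivative \<Gamma> (at (fst w, fst (snd w))) (1, v), \<Sum>l=1..r. \<beta> l *\<^sub>R A l (fst w, snd (snd w))) = 0)"
  proof eventually_elim
    case (elim w)
    have "fst w \<in> I1" "\<forall>k\<in>{1..r}. apply_bcontfun (fst (snd w)) k \<in> U1" using elim unfolding R_def by auto
    moreover have "frechet_derivative (E 0) (at (\<Gamma> (fst w, fst (snd w)), fst w, snd (snd w)))
            (frechet_derivative \<Gamma> (at (fst w, fst (snd w))) (1, v), \<Sum>l=1..r. \<beta> l *\<^sub>R A l (fst w, snd (snd w))) = 0"
      if "(\<Sum>l=1..r. \<beta> l) = 1" "\<forall>k\<in>{1..r}. apply_bcontfun v k = snd (\<Sum>l=1..r. \<beta> l *\<^sub>R A l (fst w, apply_bcontfun (fst (snd w)) k))" for \<beta> v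
      using main[of "(fst w, fst (snd w))" "snd (snd w)" \<beta> v] elim that by simp
    ultimately show ?case using elim by blast
  qed
  have inv: "\<forall>\<^sub>F w in nhds (0, t1, x1). fst (E 0 w) = fst (snd w) + \<sigma> (fst w) \<and> fst (E' w) = fst (snd w) - \<sigma> (fst w) \<and>
       E' (fst w, E 0 w) = snd w \<and> E 0 (fst w, E' w) = snd w"
    using E0(3) E'(3) by eventually_elim blast
  have "p0 \<in> range (fin_seq {1..r})" by (simp add: p0_def)
  note 1 = that[where E = "E 0" and E' = E' and \<Gamma> = \<Gamma> and \<sigma> = \<sigma> and ?t1.0 = t1 and ?p0.0 = p0]
  from 1[OF t1 \<open>p0 \<in> _\<close> \<Gamma> \<Gamma>0 \<sigma> E0(1,2) E'(1,2) inv near] show ?thesis .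
qed

end

section \<open>The superposition rule of a finite module\<close>

lemma has_vector_derivative_compose_at:
  assumes "(c has_vector_derivative c') (at t)" "(g has_derivative g') (at (c t))"
  shows "((\<lambda>s. g (c s)) has_vector_derivative g' c') (at t)"
  using vector_derivative_diff_chain_within[OF assms(1) has_derivative_at_withinI[OF assms(2)]] by (simp add: o_def)

lemma derivative_left_inverse:
  assumes "(f has_derivative f') (at x)" "(g has_derivative g') (at (f x))" "\<forall>\<^sub>F x' in nhds x. g (f x') = x'"
  shows "g' (f' v) = v"
proof -
  obtain T where T: "open T" "x \<in> T" "\<forall>x'\<in>T. g (f x') = x'" using assms(3) unfolding eventually_nhds by blast
  have "((\<lambda>x. g (f x)) has_derivative (\<lambda>v. v)) (at x)"
    by (rule has_derivative_transform_within_open[OF has_derivative_ident T(1,2)]) (use T(3) in simp)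
  moreover have "((\<lambda>x. g (f x)) has_derivative (\<lambda>v. g' (f' v))) (at x)"
    using diff_chain_at[OF assms(1,2)] by (simp add: o_def)
  ultimately have "(\<lambda>v. g' (f' v)) = (\<lambda>v. v)" by (rule has_derivative_unique[symmetric])
  then show ?thesis by (rule fun_cong)
qed

lemma eventually_in_slice:
  assumes "open N" "(t, p, y) \<in> N"
  shows "\<forall>\<^sub>F y' in nhds y. (t, p, y') \<in> N"
proof -
  have "((\<lambda>y'. (t, p, y')) \<longlongrightarrow> (t, p, y)) (nhds y)" by (intro tendsto_Pair tendsto_const filterlim_ident)
  from topological_tendstoD[OF this assms] show ?thesis .
qed

text \<open>In the coordinates of \<open>transport_coordinates\<close>, and for solutions \<open>p\<close> of a system, a differentiable curve \<open>y\<close>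
  is a solution of the same system if and only if \<open>\<Psi> (t, p, y) = snd (E (\<Gamma> (t, p), t, y))\<close> is constant along it. The
  superposition rule is the inverse of \<open>\<Psi>\<close> with respect to \<open>y\<close>.\<close>

lemma superposition_rule_near:
  fixes Y :: "'a \<Rightarrow> real \<Rightarrow> real ^ 'n \<Rightarrow> real ^ 'n"
  assumes module: "bracket_module r (\<lambda>j. autonomization (X j)) I1 U1 f" and I1: "I1 \<noteq> {}" and x1: "x1 \<in> U1"
    and b: "\<And>\<alpha> t. \<alpha> \<in> \<Lambda> \<Longrightarrow> t \<in> I1 \<Longrightarrow> (\<Sum>j=1..r. b \<alpha> j t) = 1"
    and Yb: "\<And>\<alpha> t x. \<alpha> \<in> \<Lambda> \<Longrightarrow> t \<in> I1 \<Longrightarrow> x \<in> U1 \<Longrightarrow>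
      autonomization (Y \<alpha>) (t, x) = (\<Sum>j=1..r. b \<alpha> j t *\<^sub>R autonomization (X j) (t, x))"
  shows "\<exists>t1 I U W \<Phi>. t1 \<in> I1 \<and> open I \<and> is_interval I \<and> t1 \<in> I \<and> open U \<and> x1 \<in> U \<and> superposition_rule_on \<Lambda> Y r I U W \<Phi>"
proof -
  interpret bracket_module r "\<lambda>j. autonomization (X j)" I1 U1 f by (rule module)
  obtain t1 p0 and E E' :: "(nat \<Rightarrow>\<^sub>C real) \<times> real \<times> (real ^ 'n) \<Rightarrow> real \<times> (real ^ 'n)" and \<Gamma> \<sigma>
    where t1: "t1 \<in> I1" and p0: "p0 \<in> range (fin_seq {1..r})"
    and \<Gamma>: "inner_near (t1, p0) \<Gamma>" "\<Gamma> (t1, p0) = 0" and \<sigma>: "bounded_linear \<sigma>"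
    and E: "smooth_near (0, t1, x1) E" "E (0, t1, x1) = (t1, x1)"
    and E': "smooth_near (0, t1, x1) E'" "E' (0, t1, x1) = (t1, x1)"
    and inv: "\<forall>\<^sub>F w in nhds (0, t1, x1). fst (E w) = fst (snd w) + \<sigma> (fst w) \<and> fst (E' w) = fst (snd w) - \<sigma> (fst w) \<and>
       E' (fst w, E w) = snd w \<and> E (fst w, E' w) = snd w"
    and tr: "\<forall>\<^sub>F w in nhds (t1, p0, x1). fst w \<in> I1 \<and> snd (snd w) \<in> U1 \<and> (\<forall>k\<in>{1..r}. apply_bcontfun (fst (snd w)) k \<in> U1) \<and>
       (\<forall>\<beta> v. (\<Sum>l=1..r. \<beta> l) = 1 \<longrightarrow>
          (\<forall>k\<in>{1..r}. apply_bcontfun v k = snd (\<Sum>l=1..r. \<beta> l *\<^sub>R autonomization (X l) (fst w, apply_bcontfun (fst (snd w)) k))) \<longrightarrow>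
          frechet_derivative E (at (\<Gamma> (fst w, fst (snd w)), fst w, snd (snd w)))
            (frechet_derivative \<Gamma> (at (fst w, fst (snd w))) (1, v), \<Sum>l=1..r. \<beta> l *\<^sub>R autonomization (X l) (fst w, snd (snd w))) = 0)"
    by (rule transport_coordinates[OF x1 I1]) (rule that)
  define w0 where "w0 = (t1, p0, x1)"
  define e1 where "e1 w = (\<Gamma> (fst w, fst (snd w)), fst w, snd (snd w))" for w :: "real \<times> (nat \<Rightarrow>\<^sub>C (real ^ 'n)) \<times> (real ^ 'n)"
  define e2 where "e2 w = (\<Gamma> (fst w, fst (snd w)), fst w + \<sigma> (\<Gamma> (fst w, fst (snd w))), snd (snd w))"
    for w :: "real \<times> (nat \<Rightarrow>\<^sub>C (real ^ 'n)) \<times> (real ^ 'n)"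
  define \<Psi> where "\<Psi> w = snd (E (e1 w))" for w
  define \<Phi> where "\<Phi> w = snd (E' (e2 w))" for w
  have pr: "bounded_linear (\<lambda>w :: real \<times> (nat \<Rightarrow>\<^sub>C (real ^ 'n)) \<times> (real ^ 'n). (fst w, fst (snd w)))"
    by (intro bounded_linear_Pair bounded_linear_fst bounded_linear_compose[OF bounded_linear_fst bounded_linear_snd])
  have ss: "bounded_linear (\<lambda>w :: real \<times> (nat \<Rightarrow>\<^sub>C (real ^ 'n)) \<times> (real ^ 'n). snd (snd w))"
    by (intro bounded_linear_compose[OF bounded_linear_snd bounded_linear_snd])
  have n\<Gamma>: "inner_near w0 (\<lambda>w. \<Gamma> (fst w, fst (snd w)))"
    by (rule inner_near_compose[where h = "\<lambda>w. (fst w, fst (snd w))", OF _ inner_near_linear[OF pr]]) (simp add: w0_def \<Gamma>)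
  have ne1: "inner_near w0 e1" unfolding e1_def[abs_def]
    by (intro inner_near_Pair n\<Gamma> inner_near_linear bounded_linear_fst ss)
  have n\<sigma>: "inner_near w0 (\<lambda>w. \<sigma> (\<Gamma> (fst w, fst (snd w))))"
    by (rule inner_near_compose[where f = \<sigma>, OF inner_near_linear[OF \<sigma>] n\<Gamma>])
  have ne2: "inner_near w0 e2" unfolding e2_def[abs_def]
    by (intro inner_near_Pair inner_near_add n\<Gamma> n\<sigma> inner_near_linear bounded_linear_fst ss)
  have e0: "e1 w0 = (0, t1, x1)" "e2 w0 = (0, t1, x1)"
    using \<Gamma>(2) linear_0[OF bounded_linear.linear[OF \<sigma>]] by (simp_all add: e1_def e2_def w0_def)
  have \<Phi>\<Psi>0: "\<Psi> w0 = x1" "\<Phi> w0 = x1" by (simp_all add: \<Psi>_def \<Phi>_def e0 E(2) E'(2))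
  have sm: "smooth_near w0 \<Psi>" "smooth_near w0 \<Phi>"
  proof -
    have 1: "smooth_near w0 (\<lambda>w. E (e1 w))"
      by (rule smooth_near_compose[OF _ ne1]) (simp add: e0 E(1))
    have 2: "smooth_near w0 (\<lambda>w. E' (e2 w))"
      by (rule smooth_near_compose[OF _ ne2]) (simp add: e0 E'(1))
    note snd = inner_near_compose[where f = snd, OF inner_near_linear[OF bounded_linear_snd] smooth_near_imp_inner_near,
        THEN inner_near_imp_smooth_near]
    show "smooth_near w0 \<Psi>" using snd[OF 1] by (simp add: \<Psi>_def[abs_def])
    show "smooth_near w0 \<Phi>" using snd[OF 2] by (simp add: \<Phi>_def[abs_def])
  qed
  have A1: "\<forall>\<^sub>F w in nhds w0. \<Phi> (fst w, fst (snd w), \<Psi> w) = snd (snd w)"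
  proof -
    from eventually_near_compose[where h = e1, OF _ ne1, unfolded e0, OF inv]
    show ?thesis
    proof eventually_elim
      case (elim w)
      then have "e2 (fst w, fst (snd w), \<Psi> w) = (fst (e1 w), E (e1 w))"
        by (simp add: e1_def e2_def \<Psi>_def prod_eq_iff)
      with elim show ?case by (simp add: \<Phi>_def) (simp add: e1_def)
    qed
  qed
  have A2: "\<forall>\<^sub>F w in nhds w0. \<Psi> (fst w, fst (snd w), \<Phi> w) = snd (snd w)"
  proof -
    from eventually_near_compose[where h = e2, OF _ ne2, unfolded e0, OF inv]
    show ?thesis
    proof eventually_elim
      case (elim w)
      then have "e1 (fst w, fst (snd w), \<Phi> w) = (fst (e2 w), E' (e2 w))"
        by (simp add: e1_def e2_def \<Phi>_def prod_eq_iff)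
      with elim show ?case by (simp add: \<Psi>_def) (simp add: e2_def)
    qed
  qed
  have dE: "\<forall>\<^sub>F w in nhds w0. (E has_derivative frechet_derivative E (at (e1 w))) (at (e1 w))"
    by (rule eventually_near_compose[where h = e1, OF _ ne1, unfolded e0, OF smooth_near_has_derivative[OF E(1)]])
  have d\<Gamma>: "\<forall>\<^sub>F w in nhds w0. (\<Gamma> has_derivative frechet_derivative \<Gamma> (at (fst w, fst (snd w)))) (at (fst w, fst (snd w)))"
    by (rule eventually_near_compose[where h = "\<lambda>w. (fst w, fst (snd w))", OF _ inner_near_linear[OF pr]])
      (use smooth_near_has_derivative[OF inner_near_imp_smooth_near[OF \<Gamma>(1)]] in \<open>simp add: w0_def\<close>)
  define good1 where "good1 w \<longleftrightarrow> (\<Phi> (fst w, fst (snd w), \<Psi> w) = snd (snd w) \<and>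
      (E has_derivative frechet_derivative E (at (e1 w))) (at (e1 w)) \<and>
      (\<Gamma> has_derivative frechet_derivative \<Gamma> (at (fst w, fst (snd w)))) (at (fst w, fst (snd w)))) \<and>
      fst w \<in> I1 \<and> snd (snd w) \<in> U1 \<and> (\<forall>k\<in>{1..r}. apply_bcontfun (fst (snd w)) k \<in> U1) \<and>
       (\<forall>\<beta> v. (\<Sum>l=1..r. \<beta> l) = 1 \<longrightarrow>
          (\<forall>k\<in>{1..r}. apply_bcontfun v k = snd (\<Sum>l=1..r. \<beta> l *\<^sub>R autonomization (X l) (fst w, apply_bcontfun (fst (snd w)) k))) \<longrightarrow>
          frechet_derivative E (at (e1 w))
            (frechet_derivative \<Gamma> (at (fst w, fst (snd w))) (1, v), \<Sum>l=1..r. \<beta> l *\<^sub>R autonomization (X l) (fst w, snd (snd w))) = 0)" for w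
  have "\<forall>\<^sub>F w in nhds w0. good1 w" unfolding good1_def
    by (rule eventually_conj[OF eventually_conj[OF A1 eventually_conj[OF dE d\<Gamma>]] tr[folded w0_def e1_def]])
  then obtain G1 where G1: "open G1" "w0 \<in> G1" "\<And>w. w \<in> G1 \<Longrightarrow> good1 w" unfolding eventually_nhds by blast
  obtain S1 where S1: "open S1" "w0 \<in> S1" "smooth_on S1 \<Psi>" using sm(1) unfolding smooth_near_def by blast
  define N1 where "N1 = G1 \<inter> S1"
  have N1: "open N1" "w0 \<in> N1" "smooth_on N1 \<Psi>" and g1: "\<And>w. w \<in> N1 \<Longrightarrow> good1 w"
    using G1 S1 smooth_on_subset[OF S1(3), of N1] by (auto simp: N1_def)
  obtain G2 where G2: "open G2" "w0 \<in> G2" "\<And>w. w \<in> G2 \<Longrightarrow> \<Psi> (fst w, fst (snd w), \<Phi> w) = snd (snd w)"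
    using A2 unfolding eventually_nhds by blast
  obtain S2 where S2: "open S2" "w0 \<in> S2" "smooth_on S2 \<Phi>" using sm(2) unfolding smooth_near_def by blast
  define N2 where "N2 = G2 \<inter> S2"
  have N2: "open N2" "w0 \<in> N2" "smooth_on N2 \<Phi>" and g2: "\<And>w. w \<in> N2 \<Longrightarrow> \<Psi> (fst w, fst (snd w), \<Phi> w) = snd (snd w)"
    using G2 S2 smooth_on_subset[OF S2(3), of N2] by (auto simp: N2_def)
  define W where "W = N2 \<inter> (\<lambda>w. (fst w, fst (snd w), \<Phi> w)) -` N1"
  have W: "open W" unfolding W_def
    by (rule continuous_open_preimage[OF _ N2(1) N1(1)])
      (intro continuous_on_Pair continuous_on_fst continuous_on_snd continuous_on_id smooth_on_continuous_on[OF N2(3)])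
  have WN: "(t, p, k) \<in> N2" "(t, p, \<Phi> (t, p, k)) \<in> N1" if "(t, p, k) \<in> W" for t p k using that by (simp_all add: W_def)
  define N3 where "N3 = N1 \<inter> (\<lambda>w. (fst w, fst (snd w), \<Psi> w)) -` N2"
  have N3: "open N3" unfolding N3_def
    by (rule continuous_open_preimage[OF _ N1(1) N2(1)])
      (intro continuous_on_Pair continuous_on_fst continuous_on_snd continuous_on_id smooth_on_continuous_on[OF N1(3)])
  have "w0 \<in> N3" using N1(2) N2(2) \<Phi>\<Psi>0(1) by (simp add: N3_def w0_def)
  then obtain I0 V0 where IV: "open I0" "open V0" "t1 \<in> I0" "(p0, x1) \<in> V0" "I0 \<times> V0 \<subseteq> N3"
    using open_prod_elim[OF N3] unfolding w0_def by (metis mem_Sigma_iff)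
  obtain V U where VU: "open V" "open U" "p0 \<in> V" "x1 \<in> U" "V \<times> U \<subseteq> V0"
    using open_prod_elim[OF IV(2,4)] by (metis mem_Sigma_iff)
  obtain d where d: "d > 0" "ball t1 d \<subseteq> I0" using IV(1,3) openE by blast
  have in3: "(t, p, y) \<in> N3" if "t \<in> ball t1 d" "p \<in> V" "y \<in> U" for t p y using that d IV(5) VU(5) by blast

  \<comment> \<open>The derivatives of \<open>\<Psi>\<close> and \<open>\<Phi>\<close> in the last variable are inverse to each other.\<close>
  have d\<Psi>: "((\<lambda>y. \<Psi> (t, p, y)) has_derivative (\<lambda>v. snd (frechet_derivative E (at (e1 (t, p, y))) (0, 0, v)))) (at y)"
    if "(t, p, y) \<in> N1" for t p y
  proof -
    have 1: "((\<lambda>y. (\<Gamma> (t, p), t, y)) has_derivative (\<lambda>v. (0, 0, v))) (at y)"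
      by (intro has_derivative_Pair has_derivative_const has_derivative_ident)
    have "(E has_derivative frechet_derivative E (at (e1 (t, p, y)))) (at (\<Gamma> (t, p), t, y))"
      using g1[OF that] by (simp add: good1_def e1_def)
    from has_derivative_snd[OF diff_chain_at[OF 1 this]] show ?thesis by (simp add: \<Psi>_def e1_def o_def)
  qed
  have d\<Phi>: "((\<lambda>k. \<Phi> (t, p, k)) has_derivative frechet_derivative (\<lambda>k. \<Phi> (t, p, k)) (at k)) (at k)"
    if "(t, p, k) \<in> N2" for t p k
  proof -
    have 1: "((\<lambda>k. (t, p, k)) has_derivative (\<lambda>v. (0, 0, v))) (at k)"
      by (intro has_derivative_Pair has_derivative_const has_derivative_ident)
    from diff_chain_at[OF 1 smooth_on_has_derivative[OF N2(3) that]]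
    have "(\<lambda>k. \<Phi> (t, p, k)) differentiable (at k)" unfolding differentiable_def by (auto simp: o_def)
    then show ?thesis by (simp add: frechet_derivative_works)
  qed
  have inv12: "snd (frechet_derivative E (at (e1 (t, p, \<Phi> (t, p, k)))) (0, 0, frechet_derivative (\<lambda>k. \<Phi> (t, p, k)) (at k) v)) = v"
    "frechet_derivative (\<lambda>k. \<Phi> (t, p, k)) (at k) (snd (frechet_derivative E (at (e1 (t, p, \<Phi> (t, p, k)))) (0, 0, v))) = v"
    if w: "(t, p, k) \<in> W" for t p k v
  proof -
    have i2: "\<forall>\<^sub>F k' in nhds k. \<Psi> (t, p, \<Phi> (t, p, k')) = k'"
      using eventually_in_slice[OF N2(1) WN(1)[OF w]] by eventually_elim (use g2 in fastforce)
    show "snd (frechet_derivative E (at (e1 (t, p, \<Phi> (t, p, k)))) (0, 0, frechet_derivative (\<lambda>k. \<Phi> (t, p, k)) (at k) v)) = v"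
      by (rule derivative_left_inverse[OF d\<Phi>[OF WN(1)[OF w]] d\<Psi>[OF WN(2)[OF w]] i2])
    have i1: "\<forall>\<^sub>F y' in nhds (\<Phi> (t, p, k)). \<Phi> (t, p, \<Psi> (t, p, y')) = y'"
      using eventually_in_slice[OF N1(1) WN(2)[OF w]]
    proof eventually_elim
      case (elim y')
      then show ?case using g1[OF elim] by (simp add: good1_def)
    qed
    have k: "\<Psi> (t, p, \<Phi> (t, p, k)) = k" using g2[OF WN(1)[OF w]] by simp
    show "frechet_derivative (\<lambda>k. \<Phi> (t, p, k)) (at k) (snd (frechet_derivative E (at (e1 (t, p, \<Phi> (t, p, k)))) (0, 0, v))) = v"
      by (rule derivative_left_inverse[OF d\<Psi>[OF WN(2)[OF w]] _ i1]) (simp add: k d\<Phi>[OF WN(1)[OF w]])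
  qed

  have dp: "((\<lambda>t. fin_seq {1..r} (\<lambda>a. xs a t)) has_vector_derivative fin_seq {1..r} (\<lambda>a. Y \<alpha> t (xs a t))) (at t)"
    if "\<forall>a\<in>{1..r}. is_solution (Y \<alpha>) J (xs a)" "t \<in> J" for \<alpha> J xs t
  proof -
    have "(xs a has_vector_derivative Y \<alpha> t (xs a t)) (at t)" if "a \<in> {1..r}" for a
      using \<open>\<forall>a\<in>_. _\<close> \<open>t \<in> J\<close> that unfolding is_solution_def by blast
    then have "((\<lambda>t. \<Sum>a\<in>{1..r}. sgl a (xs a t)) has_vector_derivative (\<Sum>a\<in>{1..r}. sgl a (Y \<alpha> t (xs a t)))) (at t)"
      by (intro has_vector_derivative_sum bounded_linear.has_vector_derivative[OF bounded_linear_sgl])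
    then show ?thesis unfolding fin_seq_eq_sum[OF finite_atLeastAtMost] .
  qed
  have d\<Psi>c: "((\<lambda>t. \<Psi> (t, p t, z t)) has_vector_derivative
      snd (frechet_derivative E (at (e1 (t, p t, z t))) (frechet_derivative \<Gamma> (at (t, p t)) (1, p'), 1, z'))) (at t)"
    if w: "(t, p t, z t) \<in> N1" and p: "(p has_vector_derivative p') (at t)" and z: "(z has_vector_derivative z') (at t)"
    for t p z p' z'
  proof -
    have dG: "(\<Gamma> has_derivative frechet_derivative \<Gamma> (at (t, p t))) (at (t, p t))"
      and dE: "(E has_derivative frechet_derivative E (at (e1 (t, p t, z t)))) (at (\<Gamma> (t, p t), t, z t))"
      using g1[OF w] by (simp_all add: good1_def e1_def)
    have 1: "((\<lambda>t. (t, p t)) has_vector_derivative (1, p')) (at t)"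
      by (intro has_vector_derivative_Pair has_vector_derivative_id p)
    have "((\<lambda>t. (\<Gamma> (t, p t), t, z t)) has_vector_derivative (frechet_derivative \<Gamma> (at (t, p t)) (1, p'), 1, z')) (at t)"
      by (intro has_vector_derivative_Pair has_vector_derivative_id z has_vector_derivative_compose_at[OF 1 dG])
    from bounded_linear.has_vector_derivative[OF bounded_linear_snd has_vector_derivative_compose_at[OF this dE]]
    show ?thesis by (simp add: \<Psi>_def e1_def)
  qed
  have along: "snd (frechet_derivative E (at (e1 (t, fin_seq {1..r} x, y)))
      (frechet_derivative \<Gamma> (at (t, fin_seq {1..r} x)) (1, fin_seq {1..r} (\<lambda>a. Y \<alpha> t (x a))), 1, Y \<alpha> t y)) = 0"
    if \<alpha>: "\<alpha> \<in> \<Lambda>" and w: "(t, fin_seq {1..r} x, y) \<in> N1" for \<alpha> t x y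
  proof -
    note g = g1[OF w, unfolded good1_def fst_conv snd_conv]
    have t: "t \<in> I1" and y: "y \<in> U1" and x: "\<And>k. k \<in> {1..r} \<Longrightarrow> x k \<in> U1" using g by (auto simp: apply_fin_seq)
    have "frechet_derivative E (at (e1 (t, fin_seq {1..r} x, y)))
      (frechet_derivative \<Gamma> (at (t, fin_seq {1..r} x)) (1, fin_seq {1..r} (\<lambda>a. Y \<alpha> t (x a))),
        \<Sum>l=1..r. b \<alpha> l t *\<^sub>R autonomization (X l) (t, y)) = 0"
    proof (rule g[THEN conjunct2, THEN conjunct2, THEN conjunct2, THEN conjunct2, rule_format, OF b[OF \<alpha> t]])
      fix k assume k: "k \<in> {1..r}"
      show "apply_bcontfun (fin_seq {1..r} (\<lambda>a. Y \<alpha> t (x a))) k =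
          snd (\<Sum>l=1..r. b \<alpha> l t *\<^sub>R autonomization (X l) (t, apply_bcontfun (fin_seq {1..r} x) k))"
        using k Yb[OF \<alpha> t x[OF k], symmetric] by (simp add: apply_fin_seq) (simp add: autonomization_def)
    qed
    then show ?thesis unfolding Yb[OF \<alpha> t y, symmetric] by (simp add: autonomization_def)
  qed

  \<comment> \<open>\<open>\<Psi>\<close> is constant along \<open>y = \<Phi> (t, p, k)\<close>, and its derivative would vanish if \<open>y' = Y \<alpha> t y\<close>. As the
    derivative of \<open>\<Psi>\<close> in the last variable is injective, \<open>y'\<close> is \<open>Y \<alpha> t y\<close>.\<close>
  have sol: "is_solution (Y \<alpha>) J (\<lambda>t. \<Phi> (t, fin_seq {1..r} (\<lambda>a. xs a t), k))"
    if \<alpha>: "\<alpha> \<in> \<Lambda>" and J: "is_interval J" "open J" and xs: "\<forall>a\<in>{1..r}. is_solution (Y \<alpha>) J (xs a)"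
      and inW: "\<And>t. t \<in> J \<Longrightarrow> (t, fin_seq {1..r} (\<lambda>a. xs a t), k) \<in> W" for \<alpha> J xs k
    unfolding is_solution_def
  proof (intro conjI ballI J)
    fix t assume t: "t \<in> J"
    let ?p = "\<lambda>t. fin_seq {1..r} (\<lambda>a. xs a t)" and ?z = "\<lambda>t. \<Phi> (t, fin_seq {1..r} (\<lambda>a. xs a t), k)"
    let ?p' = "fin_seq {1..r} (\<lambda>a. Y \<alpha> t (xs a t))"
    let ?DE = "frechet_derivative E (at (e1 (t, ?p t, ?z t)))" and ?g = "frechet_derivative \<Gamma> (at (t, ?p t)) (1, ?p')"
    let ?z' = "frechet_derivative \<Phi> (at (t, ?p t, k)) (1, ?p', 0)"
    note w = WN[OF inW[OF t]]
    have "((\<lambda>t. (t, ?p t, k)) has_vector_derivative (1, ?p', 0)) (at t)"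
      by (intro has_vector_derivative_Pair has_vector_derivative_id has_vector_derivative_const dp[OF xs t])
    from has_vector_derivative_compose_at[OF this smooth_on_has_derivative[OF N2(3) w(1)]]
    have z: "(?z has_vector_derivative ?z') (at t)" .
    have 1: "((\<lambda>t. \<Psi> (t, ?p t, ?z t)) has_vector_derivative snd (?DE (?g, 1, ?z'))) (at t)"
      by (rule d\<Psi>c[OF w(2) dp[OF xs t] z])
    have "((\<lambda>t. \<Psi> (t, ?p t, ?z t)) has_vector_derivative 0) (at t)"
    proof (rule has_vector_derivative_transform_within_open[OF has_vector_derivative_const[of k] J(2) t])
      show "k = \<Psi> (s, ?p s, ?z s)" if "s \<in> J" for s using g2[OF WN(1)[OF inW[OF that]]] by simp
    qed
    from vector_derivative_unique_at[OF 1 this] have 2: "snd (?DE (?g, 1, ?z')) = 0" .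
    have "linear ?DE"
      using g1[OF w(2)] has_derivative_bounded_linear bounded_linear.linear unfolding good1_def by blast
    from linear_diff[OF this, of "(?g, 1, ?z')" "(?g, 1, Y \<alpha> t (?z t))"]
    have "snd (?DE (0, 0, ?z' - Y \<alpha> t (?z t))) = 0"
      using 2 along[OF \<alpha> w(2)] by simp
    then have "?z' - Y \<alpha> t (?z t) = frechet_derivative (\<lambda>k. \<Phi> (t, ?p t, k)) (at k) 0"
      using inv12(2)[OF inW[OF t], of "?z' - Y \<alpha> t (?z t)"] by simp
    also have "\<dots> = 0"
      by (rule linear_0[OF bounded_linear.linear[OF has_derivative_bounded_linear[OF d\<Phi>[OF w(1)]]]])
    finally show "(?z has_vector_derivative Y \<alpha> t (?z t)) (at t)" using z by simp
  qed

  have gen: "\<exists>k. \<forall>\<^sub>F t in nhds s. (t, fin_seq {1..r} (\<lambda>a. xs a t), k) \<in> W \<and> x t = \<Phi> (t, fin_seq {1..r} (\<lambda>a. xs a t), k)"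
    if \<alpha>: "\<alpha> \<in> \<Lambda>" and x: "is_solution (Y \<alpha>) J x" and xs: "\<forall>a\<in>{1..r}. is_solution (Y \<alpha>) J (xs a)"
      and s: "s \<in> J" "s \<in> ball t1 d" "x s \<in> U" "fin_seq {1..r} (\<lambda>a. xs a s) \<in> V" for \<alpha> J x xs s
  proof -
    let ?p = "\<lambda>t. fin_seq {1..r} (\<lambda>a. xs a t)"
    have J: "open J" and dx: "\<And>t. t \<in> J \<Longrightarrow> (x has_vector_derivative Y \<alpha> t (x t)) (at t)"
      using x unfolding is_solution_def by auto
    have c: "continuous_on J (\<lambda>t. (t, ?p t, x t))"
    proof (rule continuous_at_imp_continuous_on, rule ballI)
      fix t assume t: "t \<in> J"
      have "((\<lambda>t. (t, ?p t, x t)) has_vector_derivative (1, fin_seq {1..r} (\<lambda>a. Y \<alpha> t (xs a t)), Y \<alpha> t (x t))) (at t)"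
        by (intro has_vector_derivative_Pair has_vector_derivative_id dx dp[OF xs] t)
      then show "isCont (\<lambda>t. (t, ?p t, x t)) t" by (rule has_vector_derivative_continuous)
    qed
    have "open (J \<inter> (\<lambda>t. (t, ?p t, x t)) -` N3)" by (rule continuous_open_preimage[OF c J N3])
    moreover have "s \<in> J \<inter> (\<lambda>t. (t, ?p t, x t)) -` N3" using s in3 by simp
    ultimately obtain e where e: "e > 0" "ball s e \<subseteq> J \<inter> (\<lambda>t. (t, ?p t, x t)) -` N3" by (rule openE)
    have in3e: "t \<in> J" "(t, ?p t, x t) \<in> N3" if "t \<in> ball s e" for t using e(2) that by auto
    have in1: "(t, ?p t, x t) \<in> N1" if "t \<in> ball s e" for t using in3e(2)[OF that] by (simp add: N3_def)
    have "((\<lambda>t. \<Psi> (t, ?p t, x t)) has_vector_derivative 0) (at t within ball s e)" if t: "t \<in> ball s e" for t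
      using d\<Psi>c[where p = ?p and z = x, OF in1[OF t] dp[OF xs in3e(1)[OF t]] dx[OF in3e(1)[OF t]]] along[OF \<alpha> in1[OF t]]
      by (auto intro: has_vector_derivative_at_within)
    then obtain k where k: "\<And>t. t \<in> ball s e \<Longrightarrow> \<Psi> (t, ?p t, x t) = k"
      using has_vector_derivative_zero_constant[OF convex_ball, of s e "\<lambda>t. \<Psi> (t, ?p t, x t)"] by blast
    have "(t, ?p t, k) \<in> W \<and> x t = \<Phi> (t, ?p t, k)" if t: "t \<in> ball s e" for t
    proof -
      have eq: "\<Phi> (t, ?p t, k) = x t" using g1[OF in1[OF t]] k[OF t] by (simp add: good1_def)
      have "(t, ?p t, k) \<in> N2" using in3e(2)[OF t] k[OF t] by (simp add: N3_def)
      then show ?thesis using eq in1[OF t] by (simp add: W_def)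
    qed
    moreover have "\<forall>\<^sub>F t in nhds s. t \<in> ball s e" using e by (intro eventually_nhds_in_open) auto
    ultimately show ?thesis by (intro exI[of _ k]) (auto elim: eventually_mono)
  qed

  have "superposition_rule_on \<Lambda> Y r (ball t1 d) U W (\<lambda>t p k. \<Phi> (t, p, k))"
    unfolding superposition_rule_on_def tup_eq_fin_seq
  proof (intro conjI)
    show "smooth_on W (\<lambda>(t, p, k). \<Phi> (t, p, k))"
      using smooth_on_subset[OF N2(3), of W] by (simp add: W_def)
    show "\<forall>(t, p, k)\<in>W. bij (frechet_derivative (\<lambda>k. \<Phi> (t, p, k)) (at k))"
    proof clarify
      fix t p k assume w: "(t, p, k) \<in> W"
      show "bij (frechet_derivative (\<lambda>k. \<Phi> (t, p, k)) (at k))"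
        by (rule o_bij[where g = "\<lambda>v. snd (frechet_derivative E (at (e1 (t, p, \<Phi> (t, p, k)))) (0, 0, v))"])
          (simp_all add: fun_eq_iff inv12[OF w])
    qed
    show "\<forall>\<alpha>\<in>\<Lambda>. \<forall>J xs k. is_interval J \<and> open J \<and> (\<forall>a\<in>{1..r}. is_solution (Y \<alpha>) J (xs a)) \<and>
        (\<forall>t\<in>J. (t, fin_seq {1..r} (\<lambda>a. xs a t), k) \<in> W) \<longrightarrow>
        is_solution (Y \<alpha>) J (\<lambda>t. \<Phi> (t, fin_seq {1..r} (\<lambda>a. xs a t), k))"
      using sol by blast
    have "V \<inter> range (fin_seq {1..r}) \<noteq> {}" using VU(3) p0 by blast
    moreover have "\<forall>\<alpha>\<in>\<Lambda>. \<forall>J x xs s. is_solution (Y \<alpha>) J x \<and> (\<forall>a\<in>{1..r}. is_solution (Y \<alpha>) J (xs a)) \<and>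
        s \<in> J \<and> s \<in> ball t1 d \<and> x s \<in> U \<and> fin_seq {1..r} (\<lambda>a. xs a s) \<in> V \<longrightarrow>
        (\<exists>k. \<forall>\<^sub>F t in nhds s. (t, fin_seq {1..r} (\<lambda>a. xs a t), k) \<in> W \<and> x t = \<Phi> (t, fin_seq {1..r} (\<lambda>a. xs a t), k))"
    proof (intro ballI allI impI, elim conjE)
      fix \<alpha> J x xs s assume "\<alpha> \<in> \<Lambda>" "is_solution (Y \<alpha>) J x" "\<forall>a\<in>{1..r}. is_solution (Y \<alpha>) J (xs a)"
        "s \<in> J" "s \<in> ball t1 d" "x s \<in> U" "fin_seq {1..r} (\<lambda>a. xs a s) \<in> V"
      then show "\<exists>k. \<forall>\<^sub>F t in nhds s. (t, fin_seq {1..r} (\<lambda>a. xs a t), k) \<in> W \<and> x t = \<Phi> (t, fin_seq {1..r} (\<lambda>a. xs a t), k)"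
        by (rule gen)
    qed
    ultimately show "\<exists>V. open V \<and> V \<inter> range (fin_seq {1..r}) \<noteq> {} \<and> (\<forall>\<alpha>\<in>\<Lambda>. \<forall>J x xs s.
        is_solution (Y \<alpha>) J x \<and> (\<forall>a\<in>{1..r}. is_solution (Y \<alpha>) J (xs a)) \<and>
        s \<in> J \<and> s \<in> ball t1 d \<and> x s \<in> U \<and> fin_seq {1..r} (\<lambda>a. xs a s) \<in> V \<longrightarrow>
        (\<exists>k. \<forall>\<^sub>F t in nhds s. (t, fin_seq {1..r} (\<lambda>a. xs a t), k) \<in> W \<and> x t = \<Phi> (t, fin_seq {1..r} (\<lambda>a. xs a t), k)))"
      using VU(1) by (intro exI[of _ V] conjI)
  qed (rule W)
  moreover have "t1 \<in> ball t1 d" using d by simp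
  ultimately show ?thesis using t1 VU(2,4) open_ball is_interval_ball_real by blast
qed

theorem finite_module_imp_common_superposition_rule:
  fixes Y :: "'a \<Rightarrow> real \<Rightarrow> real ^ 'n \<Rightarrow> real ^ 'n"
  assumes module: "near_generic_points (finite_module_on \<Lambda> Y r)"
  shows "admits_common_superposition_rule \<Lambda> Y"
  unfolding admits_common_superposition_rule_def
proof (intro exI[of _ r] near_generic_pointsI)
  fix O' :: "(real \<times> (real ^ 'n)) set" assume O': "open O'" "O' \<noteq> {}"
  obtain I U I1 U1 t x where box: "finite_module_on \<Lambda> Y r I U" "open I1" "is_interval I1" "open U1" "t \<in> I1" "x \<in> U1"
    "I1 \<subseteq> I" "U1 \<subseteq> U" "I1 \<times> U1 \<subseteq> O'"
    by (rule near_generic_points_box[OF module O']) (rule that)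
  obtain b :: "'a \<Rightarrow> nat \<Rightarrow> real \<Rightarrow> real" and X :: "nat \<Rightarrow> real \<Rightarrow> real ^ 'n \<Rightarrow> real ^ 'n" and f :: "nat \<Rightarrow> nat \<Rightarrow> nat \<Rightarrow> real \<Rightarrow> real"
    where X: "\<forall>j\<in>{1..r}. smooth_on (I \<times> U) (\<lambda>(t, x). X j t x)"
    and f: "\<forall>j\<in>{1..r}. \<forall>k\<in>{1..r}. \<forall>l\<in>{1..r}. smooth_on I (f j k l)"
    and b: "\<forall>\<alpha>\<in>\<Lambda>. \<forall>t\<in>I. (\<Sum>j=1..r. b \<alpha> j t) = 1"
    and Yb: "\<forall>\<alpha>\<in>\<Lambda>. \<forall>t\<in>I. \<forall>x\<in>U. autonomization (Y \<alpha>) (t, x) = (\<Sum>j=1..r. b \<alpha> j t *\<^sub>R autonomization (X j) (t, x))"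
    and br: "\<forall>j\<in>{1..r}. \<forall>k\<in>{1..r}. \<forall>t\<in>I. \<forall>x\<in>U.
      lie_bracket (autonomization (X j)) (autonomization (X k)) (t, x) = (\<Sum>l=1..r. f j k l t *\<^sub>R autonomization (X l) (t, x))"
    using box(1) unfolding finite_module_on_def by (elim exE conjE) (rule that)
  have "bracket_module r (\<lambda>j. autonomization (X j)) I1 U1 f"
  proof
    show "smooth_on (I1 \<times> U1) (autonomization (X j))" if "j \<in> {1..r}" for j
      by (rule smooth_on_autonomization[OF open_Times[OF box(2,4)] smooth_on_subset[OF bspec[OF X that]]]) (use box(7,8) in auto)
    show "continuous_on I1 (f j k l)" if "j \<in> {1..r}" "k \<in> {1..r}" "l \<in> {1..r}" for j k l
      by (rule continuous_on_subset[OF smooth_on_continuous_on[OF f[rule_format, OF that]] box(7)])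
    show "lie_bracket (autonomization (X j)) (autonomization (X k)) z = (\<Sum>l=1..r. f j k l (fst z) *\<^sub>R autonomization (X l) z)"
      if "j \<in> {1..r}" "k \<in> {1..r}" "z \<in> I1 \<times> U1" for j k z
    proof -
      have "fst z \<in> I" "snd z \<in> U" using that(3) box(7,8) by auto
      from br[rule_format, OF that(1,2) this] show ?thesis by simp
    qed
  qed (use box(2,4) in simp_all)
  moreover have "I1 \<noteq> {}" using box(5) by blast
  ultimately have "\<exists>t1 I U W \<Phi>. t1 \<in> I1 \<and> open I \<and> is_interval I \<and> t1 \<in> I \<and> open U \<and> x \<in> U \<and> superposition_rule_on \<Lambda> Y r I U W \<Phi>"
  proof (rule superposition_rule_near[OF _ _ box(6), where b = b])
    show "(\<Sum>j=1..r. b \<alpha> j t) = 1" if "\<alpha> \<in> \<Lambda>" "t \<in> I1" for \<alpha> t using b that box(7) by blast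
    show "autonomization (Y \<alpha>) (t, x) = (\<Sum>j=1..r. b \<alpha> j t *\<^sub>R autonomization (X j) (t, x))"
      if "\<alpha> \<in> \<Lambda>" "t \<in> I1" "x \<in> U1" for \<alpha> t x using Yb that box(7,8) by blast
  qed
  then obtain t1 I' U' W \<Phi> where 1: "t1 \<in> I1" "open I'" "is_interval I'" "t1 \<in> I'" "open U'" "x \<in> U'"
    "superposition_rule_on \<Lambda> Y r I' U' W \<Phi>" by (elim exE conjE) (rule that)
  moreover have "(t1, x) \<in> O'" using 1(1) box(6,9) by blast
  ultimately show "\<exists>I U t x. open I \<and> is_interval I \<and> open U \<and> t \<in> I \<and> x \<in> U \<and> (t, x) \<in> O' \<and>
      (\<exists>W \<Phi>. superposition_rule_on \<Lambda> Y r I U W \<Phi>)"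
    by blast
qed

theorem theorem10:
  fixes \<Lambda> :: "'a set"
    and Y :: "'a \<Rightarrow> real \<Rightarrow> real ^ 'n \<Rightarrow> real ^ 'n"
  assumes "\<And>\<alpha>. \<alpha> \<in> \<Lambda> \<Longrightarrow> smooth_on UNIV (\<lambda>(t, x). Y \<alpha> t x)"
  shows "admits_common_superposition_rule \<Lambda> Y \<longleftrightarrow>
    (\<exists>r::nat. r > 0 \<and>
      near_generic_points (\<lambda>I U.
        \<exists>(b :: 'a \<Rightarrow> nat \<Rightarrow> real \<Rightarrow> real)
         (X :: nat \<Rightarrow> real \<Rightarrow> real ^ 'n \<Rightarrow> real ^ 'n)
         (f :: nat \<Rightarrow> nat \<Rightarrow> nat \<Rightarrow> real \<Rightarrow> real).
          (\<forall>\<alpha>\<in>\<Lambda>. \<forall>j\<in>{1..r}. smooth_on I (b \<alpha> j)) \<and>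
          (\<forall>j\<in>{1..r}. smooth_on (I \<times> U) (\<lambda>(t, x). X j t x)) \<and>
          (\<forall>j\<in>{1..r}. \<forall>k\<in>{1..r}. \<forall>l\<in>{1..r}. smooth_on I (f j k l)) \<and>
          (\<forall>\<alpha>\<in>\<Lambda>. \<forall>t\<in>I. (\<Sum>j=1..r. b \<alpha> j t) = 1) \<and>
          (\<forall>\<alpha>\<in>\<Lambda>. \<forall>t\<in>I. \<forall>x\<in>U.
             autonomization (Y \<alpha>) (t, x) =
               (\<Sum>j=1..r. b \<alpha> j t *\<^sub>R autonomization (X j) (t, x))) \<and>
          (\<forall>j\<in>{1..r}. \<forall>k\<in>{1..r}. \<forall>t\<in>I. \<forall>x\<in>U.
             lie_bracket (autonomization (X j)) (autonomization (X k)) (t, x) =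
               (\<Sum>l=1..r. f j k l t *\<^sub>R autonomization (X l) (t, x)))))"
  unfolding finite_module_on_def[symmetric]
proof
  assume "admits_common_superposition_rule \<Lambda> Y"
  then show "\<exists>r>0. near_generic_points (finite_module_on \<Lambda> Y r)"
    by (rule common_superposition_rule_imp_finite_module[rotated]) (rule assms)
next
  assume "\<exists>r>0. near_generic_points (finite_module_on \<Lambda> Y r)"
  then show "admits_common_superposition_rule \<Lambda> Y"
    using finite_module_imp_common_superposition_rule by blast
qed

end
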